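(* Assume (H1), (H2), that $\sup_{i\ge1}|x_i(0)|\le M_0$ for a constant $M_0$, and that (MF) has a unique solution. Then there is a constant $C$ independent of $N$ such that for every $N\ge1$ and every $1\le i\le N$, the strategies $(\hat u_1,\dots,\hat u_N)$ satisfy $J_i^{\rm wo}(\hat u_i,\hat u_{-i})-\varepsilon_N\le\inf_{u_i\in\mathcal U}J_i^{\rm wo}(u_i,\hat u_{-i})\le J_i^{\rm wo}(\hat u_i,\hat u_{-i})$ with $0\le\varepsilon_N=C\big(1/\sqrt N+|x^{(N)}(0)-m_0|\big)$, where $x^{(N)}(0)=\frac1N\sum_{j=1}^Nx_j(0)$; i.e. $(\hat u_1,\dots,\hat u_N)$ is a robust $\varepsilon_N$-Nash equilibrium.
   Context: Fix integers $n,n_1,n_2\ge1$, $T>0$, constant matrices $A,G,\Gamma\in\mathbb R^{n\times n}$, $B\in\mathbb R^{n\times n_1}$, $D\in\mathbb R^{n\times n_2}$, $\eta,m_0\in\mathbb R^n$, $\gamma>0$, symmetric $Q\ge0$, $H\ge0$ ($n\times n$), $R>0$ ($n_1\times n_1$). Write $|z|_M^2=z^TMz$, $\widehat Q=(I-\Gamma)^TQ(I-\Gamma)$, $\|h\|_{L^2}=(\int_0^T|h|^2dt)^{1/2}$. $W_1,W_2,\dots$ are independent $n_2$-dimensional standard Brownian motions, $x_1(0),x_2(0),\dots\in\mathbb R^n$ deterministic. For the $N$-player game, $\{\mathcal F_t\}$ is the natural filtration of $(W_1,\dots,W_N)$ and $\mathcal U=L^2_{\mathcal F}(0,T;\mathbb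 R^{n_1})$ (progressively measurable square-integrable processes). For $u_j\in\mathcal U$ and $f\in L^2(0,T;\mathbb R^n)$: $dx_j=(Ax_j+Bu_j+Gx^{(N)}+f)dt+DdW_j$, $x^{(N)}=\frac1N\sum_{j=1}^Nx_j$, and $J_i(u_i,u_{-i},f)=\mathbb E\big[\int_0^T(|x_i-(\Gamma x^{(N)}+\eta)|_Q^2+u_i^TRu_i-\frac1\gamma|f|^2)dt+x_i(T)^THx_i(T)\big]$, $J_i^{\rm wo}(u_i,u_{-i})=\sup_{f\in L^2(0,T;\mathbb R^n)}J_i(u_i,u_{-i},f)$. (H1): with $\dot z=(A+G)z+g$, $z(0)=0$, $\bar J''(g)=\int_0^T\{-z^T\widehat Qz+\frac1\gamma|g|^2\}dt-z(T)^THz(T)$, there is $\epsilon_0>0$ with $\bar J''(g)\ge\epsilon_0\|g\|_{L^2}^2$ for all $g$. (H2): for $\nu\in L^2(0,T;\mathbb R^{n_1})$ let $(z_i,z,q)$ solve $\dot z_i=Az_i+B\nu+Gz+\gamma q$, $\dot z=(A+G)z+\gamma q$, $\dot q=-(A+G)^Tq-(I-\Gamma)^TQ(z_i-\Gamma z)$, $z_i(0)=z(0)=0$, $q(T)=Hz_i(T)$, $\bar J^a(\nu)=\int_0^T\{|z_i-\Gamma z|_Q^2+\nu^TR\nu-\gamma|q|^2\}dt+|z_i(T)|_H^2$; there is $\delta_0>0$ with $\bar J^a(\nu)\ge\delta_0\|\nu\|_{L^2}^2$ for all $\nu$. (MF): $\dot{\mathbf m}=(A+G)\mathbf m+BR^{-1}B^T\mathbf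 y+\gamma\mathbf p$, $\dot{\mathbf p}=-(A+G)^T\mathbf p-(I-\Gamma)^TQ[\mathbf m-(\Gamma\mathbf m+\eta)]$, $\dot{\mathbf y}=-A^T\mathbf y+Q[\mathbf m-(\Gamma\mathbf m+\eta)]$, $\mathbf m(0)=m_0$, $\mathbf p(T)=H\mathbf m(T)$, $\mathbf y(T)=-H\mathbf m(T)$; set $\bar u^*=R^{-1}B^T\mathbf y$. Strategies: for each $i$ let $(X_i,M_i,P_i,Y_i,Z_i)$ be the unique solution (in the natural filtration of $W_i$) of $dX_i=(AX_i+BR^{-1}B^TY_i+GM_i+\gamma P_i)dt+DdW_i$, $\dot M_i=(A+G)M_i+B\bar u^*+\gamma P_i$, $\dot P_i=-(A+G)^TP_i-(I-\Gamma)^TQ[\mathbb EX_i-(\Gamma M_i+\eta)]$, $dY_i=\{-A^TY_i+Q[X_i-(\Gamma M_i+\eta)]\}dt+Z_idW_i$, $X_i(0)=x_i(0)$, $M_i(0)=m_0$, $P_i(T)=H\mathbb EX_i(T)$, $Y_i(T)=-HX_i(T)$, and $\hat u_i=R^{-1}B^TY_i\in\mathcal U$. *)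

theory Defs
  imports "HOL-Probability.Probability"
begin

definition qf :: "real^'n^'n \<Rightarrow> real^'n \<Rightarrow> real" where
  "qf M z = z \<bullet> (M *v z)"

definition sym_mat :: "real^'n^'n \<Rightarrow> bool" where
  "sym_mat M \<longleftrightarrow> transpose M = M"

definition psd :: "real^'n^'n \<Rightarrow> bool" where
  "psd M \<longleftrightarrow> sym_mat M \<and> (\<forall>z. 0 \<le> qf M z)"

definition pd :: "real^'n^'n \<Rightarrow> bool" where
  "pd M \<longleftrightarrow> sym_mat M \<and> (\<forall>z. z \<noteq> 0 \<longrightarrow> 0 < qf M z)"

definition L2fun :: "real \<Rightarrow> (real \<Rightarrow> 'a::euclidean_space) set" where
  "L2fun T = {f. f \<in> borel_measurable lborel \<and>
       (\<integral>\<^sup>+ t\<in>{0..T}. ennreal ((norm (f t))\<^sup>2) \<partial>lborel) < \<infinity>}"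

definition L2sq :: "real \<Rightarrow> (real \<Rightarrow> 'a::euclidean_space) \<Rightarrow> real" where
  "L2sq T f = (\<integral>t\<in>{0..T}. (norm (f t))\<^sup>2 \<partial>lborel)"

definition mf_avg :: "nat \<Rightarrow> (nat \<Rightarrow> 'a::real_vector) \<Rightarrow> 'a" where
  "mf_avg N x = (1 / real N) *\<^sub>R (\<Sum>j\<in>{1..N}. x j)"

definition bm_cov :: "nat \<times> real \<times> 'd \<Rightarrow> nat \<times> real \<times> 'd \<Rightarrow> real" where
  "bm_cov p q = (case p of (j, t, k) \<Rightarrow> case q of (j', t', k') \<Rightarrow>
        if j = j' \<and> k = k' then min t t' else 0)"

text \<open>W 1, W 2, ... are independent standard Brownian motions in R^d (d = CARD('d)):
  continuous paths started at 0 and jointly centred Gaussian with covariance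
  Cov(W_j(s)_k, W_j'(t)_k') = [j=j'][k=k'] min s t; joint Gaussianity is expressed
  through the characteristic functions of all finite linear combinations.\<close>
definition brownian_family :: "'w measure \<Rightarrow> (nat \<Rightarrow> real \<Rightarrow> 'w \<Rightarrow> real^'d) \<Rightarrow> bool" where
  "brownian_family \<Omega> W \<longleftrightarrow>
     (\<forall>j t. 1 \<le> j \<longrightarrow> 0 \<le> t \<longrightarrow> W j t \<in> borel_measurable \<Omega>) \<and>
     (\<forall>j. 1 \<le> j \<longrightarrow> (\<forall>\<omega>\<in>space \<Omega>. W j 0 \<omega> = 0)) \<and>
     (\<forall>j. 1 \<le> j \<longrightarrow> (\<forall>\<omega>\<in>space \<Omega>. continuous_on {0..} (\<lambda>t. W j t \<omega>))) \<and>
     (\<forall>(P :: (nat \<times> real \<times> 'd) set) c. finite P \<longrightarrow> (\<forall>(j, t, k)\<in>P. 1 \<le> j \<and> 0 \<le> t) \<longrightarrow>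
        (let S = (\<lambda>\<omega>. \<Sum>(j, t, k)\<in>P. c (j, t, k) * (W j t \<omega> $ k));
             V = (\<Sum>p\<in>P. \<Sum>q\<in>P. c p * c q * bm_cov p q)
         in (\<integral>\<omega>. cos (S \<omega>) \<partial>\<Omega>) = exp (- V / 2) \<and> (\<integral>\<omega>. sin (S \<omega>) \<partial>\<Omega>) = 0))"

definition nat_filt :: "'w measure \<Rightarrow> (nat \<Rightarrow> real \<Rightarrow> 'w \<Rightarrow> real^'d) \<Rightarrow> nat set \<Rightarrow> real \<Rightarrow> 'w measure" where
  "nat_filt \<Omega> W J t = sigma (space \<Omega>)
     {W j s -` A \<inter> space \<Omega> | j s A. j \<in> J \<and> 0 \<le> s \<and> s \<le> t \<and> A \<in> sets borel}"

definition prog_meas :: "'w measure \<Rightarrow> (nat \<Rightarrow> real \<Rightarrow> 'w \<Rightarrow> real^'d) \<Rightarrow> nat set \<Rightarrow> real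
      \<Rightarrow> (real \<Rightarrow> 'w \<Rightarrow> 'b::topological_space) \<Rightarrow> bool" where
  "prog_meas \<Omega> W J T u \<longleftrightarrow> (\<forall>t\<in>{0..T}.
     (\<lambda>(s, \<omega>). u s \<omega>) \<in> borel_measurable (restrict_space lborel {0..t} \<Otimes>\<^sub>M nat_filt \<Omega> W J t))"

definition sq_integrable :: "'w measure \<Rightarrow> real \<Rightarrow> (real \<Rightarrow> 'w \<Rightarrow> 'b::real_normed_vector) \<Rightarrow> bool" where
  "sq_integrable \<Omega> T u \<longleftrightarrow>
     (\<integral>\<^sup>+ \<omega>. (\<integral>\<^sup>+ t\<in>{0..T}. ennreal ((norm (u t \<omega>))\<^sup>2) \<partial>lborel) \<partial>\<Omega>) < \<infinity>"

definition adm_controls :: "'w measure \<Rightarrow> (nat \<Rightarrow> real \<Rightarrow> 'w \<Rightarrow> real^'d) \<Rightarrow> real \<Rightarrow> nat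
      \<Rightarrow> (real \<Rightarrow> 'w \<Rightarrow> real^'k) set" where
  "adm_controls \<Omega> W T N = {u. prog_meas \<Omega> W {1..N} T u \<and> sq_integrable \<Omega> T u}"

definition game_state ::
  "real^'n^'n \<Rightarrow> real^'k^'n \<Rightarrow> real^'n^'n \<Rightarrow> real^'d^'n \<Rightarrow> real \<Rightarrow> 'w measure
   \<Rightarrow> (nat \<Rightarrow> real \<Rightarrow> 'w \<Rightarrow> real^'d) \<Rightarrow> (nat \<Rightarrow> real^'n) \<Rightarrow> nat
   \<Rightarrow> (nat \<Rightarrow> real \<Rightarrow> 'w \<Rightarrow> real^'k) \<Rightarrow> (real \<Rightarrow> real^'n) \<Rightarrow> (nat \<Rightarrow> real \<Rightarrow> 'w \<Rightarrow> real^'n) \<Rightarrow> bool" where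
  "game_state A B G D T \<Omega> W x0 N u f x \<longleftrightarrow> (\<forall>j\<in>{1..N}.
     (\<lambda>(t, \<omega>). x j t \<omega>) \<in> borel_measurable (lborel \<Otimes>\<^sub>M \<Omega>) \<and>
     (AE \<omega> in \<Omega>. \<forall>t\<in>{0..T}.
        ((\<lambda>s. A *v x j s \<omega> + B *v u j s \<omega> + G *v mf_avg N (\<lambda>l. x l s \<omega>) + f s)
           has_integral (x j t \<omega> - x0 j - D *v W j t \<omega>)) {0..t}))"

definition game_cost ::
  "real^'n^'n \<Rightarrow> real^'n \<Rightarrow> real^'n^'n \<Rightarrow> real^'k^'k \<Rightarrow> real^'n^'n \<Rightarrow> real \<Rightarrow> real \<Rightarrow> 'w measure
   \<Rightarrow> nat \<Rightarrow> nat \<Rightarrow> (nat \<Rightarrow> real \<Rightarrow> 'w \<Rightarrow> real^'k) \<Rightarrow> (real \<Rightarrow> real^'n)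
   \<Rightarrow> (nat \<Rightarrow> real \<Rightarrow> 'w \<Rightarrow> real^'n) \<Rightarrow> real" where
  "game_cost \<Gamma> \<eta> Q R H \<gamma> T \<Omega> N i u f x =
     (\<integral>\<omega>. (\<integral>t\<in>{0..T}. qf Q (x i t \<omega> - (\<Gamma> *v mf_avg N (\<lambda>l. x l t \<omega>) + \<eta>))
                          + qf R (u i t \<omega>) - (1 / \<gamma>) * (norm (f t))\<^sup>2 \<partial>lborel)
          + qf H (x i T \<omega>) \<partial>\<Omega>)"

definition J_cost ::
  "real^'n^'n \<Rightarrow> real^'k^'n \<Rightarrow> real^'n^'n \<Rightarrow> real^'d^'n \<Rightarrow> real^'n^'n \<Rightarrow> real^'n
   \<Rightarrow> real^'n^'n \<Rightarrow> real^'k^'k \<Rightarrow> real^'n^'n \<Rightarrow> real \<Rightarrow> real \<Rightarrow> 'w measure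
   \<Rightarrow> (nat \<Rightarrow> real \<Rightarrow> 'w \<Rightarrow> real^'d) \<Rightarrow> (nat \<Rightarrow> real^'n) \<Rightarrow> nat \<Rightarrow> nat
   \<Rightarrow> (nat \<Rightarrow> real \<Rightarrow> 'w \<Rightarrow> real^'k) \<Rightarrow> (real \<Rightarrow> real^'n) \<Rightarrow> real" where
  "J_cost A B G D \<Gamma> \<eta> Q R H \<gamma> T \<Omega> W x0 N i u f =
     game_cost \<Gamma> \<eta> Q R H \<gamma> T \<Omega> N i u f (SOME x. game_state A B G D T \<Omega> W x0 N u f x)"

definition J_wo ::
  "real^'n^'n \<Rightarrow> real^'k^'n \<Rightarrow> real^'n^'n \<Rightarrow> real^'d^'n \<Rightarrow> real^'n^'n \<Rightarrow> real^'n
   \<Rightarrow> real^'n^'n \<Rightarrow> real^'k^'k \<Rightarrow> real^'n^'n \<Rightarrow> real \<Rightarrow> real \<Rightarrow> 'w measure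
   \<Rightarrow> (nat \<Rightarrow> real \<Rightarrow> 'w \<Rightarrow> real^'d) \<Rightarrow> (nat \<Rightarrow> real^'n) \<Rightarrow> nat \<Rightarrow> nat
   \<Rightarrow> (nat \<Rightarrow> real \<Rightarrow> 'w \<Rightarrow> real^'k) \<Rightarrow> ereal" where
  "J_wo A B G D \<Gamma> \<eta> Q R H \<gamma> T \<Omega> W x0 N i u =
     (SUP f\<in>L2fun T. ereal (J_cost A B G D \<Gamma> \<eta> Q R H \<gamma> T \<Omega> W x0 N i u f))"

definition H1 ::
  "real^'n^'n \<Rightarrow> real^'n^'n \<Rightarrow> real^'n^'n \<Rightarrow> real^'n^'n \<Rightarrow> real^'n^'n \<Rightarrow> real \<Rightarrow> real \<Rightarrow> bool" where
  "H1 A G \<Gamma> Q H \<gamma> T \<longleftrightarrow> (\<exists>\<epsilon>0>0. \<forall>g\<in>L2fun T. \<forall>z :: real \<Rightarrow> real^'n.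
     (\<forall>t\<in>{0..T}. ((\<lambda>s. (A + G) *v z s + g s) has_integral z t) {0..t}) \<longrightarrow>
     (\<integral>t\<in>{0..T}. - qf (transpose (mat 1 - \<Gamma>) ** Q ** (mat 1 - \<Gamma>)) (z t)
                   + (1 / \<gamma>) * (norm (g t))\<^sup>2 \<partial>lborel) - qf H (z T)
       \<ge> \<epsilon>0 * L2sq T g)"

definition H2 ::
  "real^'n^'n \<Rightarrow> real^'k^'n \<Rightarrow> real^'n^'n \<Rightarrow> real^'n^'n \<Rightarrow> real^'n^'n \<Rightarrow> real^'k^'k \<Rightarrow> real^'n^'n
   \<Rightarrow> real \<Rightarrow> real \<Rightarrow> bool" where
  "H2 A B G \<Gamma> Q R H \<gamma> T \<longleftrightarrow> (\<exists>\<delta>0>0. \<forall>\<nu>\<in>L2fun T. \<forall>(zi :: real \<Rightarrow> real^'n) z q.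
     ((\<forall>t\<in>{0..T}. ((\<lambda>s. A *v zi s + B *v \<nu> s + G *v z s + \<gamma> *\<^sub>R q s) has_integral zi t) {0..t}) \<and>
      (\<forall>t\<in>{0..T}. ((\<lambda>s. (A + G) *v z s + \<gamma> *\<^sub>R q s) has_integral z t) {0..t}) \<and>
      (\<forall>t\<in>{0..T}. ((\<lambda>s. transpose (A + G) *v q s + transpose (mat 1 - \<Gamma>) *v (Q *v (zi s - \<Gamma> *v z s)))
                      has_integral (q t - H *v zi T)) {t..T})) \<longrightarrow>
     (\<integral>t\<in>{0..T}. qf Q (zi t - \<Gamma> *v z t) + qf R (\<nu> t) - \<gamma> * (norm (q t))\<^sup>2 \<partial>lborel) + qf H (zi T)
       \<ge> \<delta>0 * L2sq T \<nu>)"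

definition MF_sol ::
  "real^'n^'n \<Rightarrow> real^'k^'n \<Rightarrow> real^'n^'n \<Rightarrow> real^'n^'n \<Rightarrow> real^'n \<Rightarrow> real^'n^'n \<Rightarrow> real^'k^'k
   \<Rightarrow> real^'n^'n \<Rightarrow> real \<Rightarrow> real \<Rightarrow> real^'n
   \<Rightarrow> (real \<Rightarrow> real^'n) \<Rightarrow> (real \<Rightarrow> real^'n) \<Rightarrow> (real \<Rightarrow> real^'n) \<Rightarrow> bool" where
  "MF_sol A B G \<Gamma> \<eta> Q R H \<gamma> T m0 m p y \<longleftrightarrow>
     m 0 = m0 \<and> p T = H *v m T \<and> y T = - (H *v m T) \<and>
     (\<forall>t\<in>{0..T}.
        (m has_vector_derivative ((A + G) *v m t + B *v (matrix_inv R *v (transpose B *v y t)) + \<gamma> *\<^sub>R p t))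
           (at t within {0..T}) \<and>
        (p has_vector_derivative (- (transpose (A + G) *v p t)
             - transpose (mat 1 - \<Gamma>) *v (Q *v (m t - (\<Gamma> *v m t + \<eta>))))) (at t within {0..T}) \<and>
        (y has_vector_derivative (- (transpose A *v y t) + Q *v (m t - (\<Gamma> *v m t + \<eta>))))
           (at t within {0..T}))"

text \<open>(X_i, M_i, P_i, Y_i) solves the FBSDE system defining player i's strategy, in the
  natural filtration of W_i.  The backward equation dY = g dt + Z dW_i, Y(T) = -H X(T),
  is expressed (without the stochastic integral of Z) by: Y adapted, square integrable,
  Y(T) = -H X(T), and Y(t) - int_0^t g ds a martingale w.r.t. the filtration of W_i.\<close>
definition FBSDE_sol ::
  "real^'n^'n \<Rightarrow> real^'k^'n \<Rightarrow> real^'n^'n \<Rightarrow> real^'d^'n \<Rightarrow> real^'n^'n \<Rightarrow> real^'n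
   \<Rightarrow> real^'n^'n \<Rightarrow> real^'k^'k \<Rightarrow> real^'n^'n \<Rightarrow> real \<Rightarrow> real \<Rightarrow> 'w measure
   \<Rightarrow> (nat \<Rightarrow> real \<Rightarrow> 'w \<Rightarrow> real^'d) \<Rightarrow> (nat \<Rightarrow> real^'n) \<Rightarrow> real^'n \<Rightarrow> (real \<Rightarrow> real^'n) \<Rightarrow> nat
   \<Rightarrow> (real \<Rightarrow> 'w \<Rightarrow> real^'n) \<Rightarrow> (real \<Rightarrow> real^'n) \<Rightarrow> (real \<Rightarrow> real^'n) \<Rightarrow> (real \<Rightarrow> 'w \<Rightarrow> real^'n)
   \<Rightarrow> bool" where
  "FBSDE_sol A B G D \<Gamma> \<eta> Q R H \<gamma> T \<Omega> W x0 m0 y i X M P Y \<longleftrightarrow>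
     (let ubar = (\<lambda>t. matrix_inv R *v (transpose B *v y t));
          EXi = (\<lambda>t. \<integral>\<omega>. X t \<omega> \<partial>\<Omega>);
          g = (\<lambda>s \<omega>. - (transpose A *v Y s \<omega>) + Q *v (X s \<omega> - (\<Gamma> *v M s + \<eta>)));
          Mart = (\<lambda>t \<omega>. Y t \<omega> - (\<integral>s\<in>{0..t}. g s \<omega> \<partial>lborel))
      in prog_meas \<Omega> W {i} T X \<and> prog_meas \<Omega> W {i} T Y \<and>
         sq_integrable \<Omega> T X \<and> sq_integrable \<Omega> T Y \<and>
         M 0 = m0 \<and> P T = H *v EXi T \<and>
         (\<forall>t\<in>{0..T}.
            (M has_vector_derivative ((A + G) *v M t + B *v ubar t + \<gamma> *\<^sub>R P t)) (at t within {0..T}) \<and>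
            (P has_vector_derivative (- (transpose (A + G) *v P t)
                 - transpose (mat 1 - \<Gamma>) *v (Q *v (EXi t - (\<Gamma> *v M t + \<eta>))))) (at t within {0..T})) \<and>
         (AE \<omega> in \<Omega>. \<forall>t\<in>{0..T}.
            ((\<lambda>s. A *v X s \<omega> + B *v (matrix_inv R *v (transpose B *v Y s \<omega>)) + G *v M s + \<gamma> *\<^sub>R P s)
               has_integral (X t \<omega> - x0 i - D *v W i t \<omega>)) {0..t}) \<and>
         (AE \<omega> in \<Omega>. set_integrable lborel {0..T} (\<lambda>s. g s \<omega>)) \<and>
         (AE \<omega> in \<Omega>. Y T \<omega> = - (H *v X T \<omega>)) \<and>
         (\<forall>t\<in>{0..T}. integrable \<Omega> (Mart t)) \<and>
         (\<forall>s t. 0 \<le> s \<longrightarrow> s \<le> t \<longrightarrow> t \<le> T \<longrightarrow>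
            (\<forall>E\<in>sets (nat_filt \<Omega> W {i} s). (\<integral>\<omega>\<in>E. (Mart t \<omega> - Mart s \<omega>) \<partial>\<Omega>) = 0)))"

definition uhat :: "real^'k^'n \<Rightarrow> real^'k^'k \<Rightarrow> (nat \<Rightarrow> real \<Rightarrow> 'w \<Rightarrow> real^'n) \<Rightarrow> nat \<Rightarrow> real \<Rightarrow> 'w \<Rightarrow> real^'k" where
  "uhat B R Y i t \<omega> = matrix_inv R *v (transpose B *v Y i t \<omega>)"

end

(* The strategy of player i and the disturbance gamma P_i form a stationary pair of a limiting
   linear-quadratic max-min problem (integration by parts against the martingale part of Y_i).
   If player i deviates by nu and the disturbance by g, the N-player cost is therefore a
   constant Jlim plus a second variation quad(nu, g), up to an error of order
   1/sqrt N + |x^(N)(0) - m0|: the population average follows M_i shifted by the path driven by g,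
   because the averaged strategies have centred fluctuations of variance O(1/N) and their
   means depend linearly on x_j(0) through a uniquely solvable two-point problem.
   For nu = 0, (H1) makes quad coercively negative in g, which bounds the worst-case cost of the
   strategy from above.  For arbitrary nu, the disturbance gamma q supplied by (H2) for the mean
   of nu makes quad nonnegative by Jensen's inequality; large nu are excluded because f = 0
   already costs at least a multiple of the squared norm of the control (R > 0). *)
theory Submission
  imports Defs
begin

text \<open>No stochastic integral occurs. Since the noise is additive, almost every path of a state
  solves a linear integral equation with continuous data, and forward estimates are pathwise; the
  backward equation enters only through the orthogonality of martingale increments to the past. The
  obstacle is that this orthogonality is given for the filtration of W_i alone, whereas deviations
  are adapted to all of W_1,...,W_N. Independence is extracted from the Gaussian characteristic
  functions by Fourier uniqueness. There is no explicit (Riccati) formula for the strategies. Their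
  bounds, uniform in i, and the variance O(1/N) come from stationarity itself, tested in the
  direction of the centred control and combined with a completed square. (H1) and (H2) are used a
  second time to show that the two-point problems are uniquely solvable: on a homogeneous solution
  the corresponding functional vanishes. The rate rests on the shape of the cost error, e_N (1 +
  |nu|^2) sqrt(1 + |g|^2): it grows only linearly in |g|, so a coercive term -eps |g|^2 absorbs it
  at a price of order e_N.\<close>

lemmas bi_add = Bochner_Integration.integrable_add
  and bi_diff = Bochner_Integration.integrable_diff
  and bi_bound = Bochner_Integration.integrable_bound
  and bint_add = Bochner_Integration.integral_add
  and bint_diff = Bochner_Integration.integral_diff
  and bint_cong = Bochner_Integration.integral_cong

section \<open>Linear integral equations with constant coefficients\<close>

abbreviation prim :: "(real \<Rightarrow> 'a::euclidean_space) \<Rightarrow> real \<Rightarrow> 'a" where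
  "prim f t \<equiv> \<integral>s\<in>{0..t}. f s \<partial>lborel"

text \<open>The flow exp(tK) applied to x. K is a linear map on an arbitrary Euclidean space rather
  than a matrix because the coupled two-point systems live on product spaces.\<close>

definition eflow :: "('a::euclidean_space \<Rightarrow> 'a) \<Rightarrow> real \<Rightarrow> 'a \<Rightarrow> 'a" where
  "eflow K t x = (\<Sum>k. (t ^ k / fact k) *\<^sub>R (K ^^ k) x)"

lemma norm_funpow_le:
  fixes K :: "'a::real_normed_vector \<Rightarrow> 'a"
  assumes "\<And>x. norm (K x) \<le> k * norm x" "k \<ge> 0"
  shows "norm ((K ^^ n) x) \<le> k ^ n * norm x"
proof (induction n)
  case (Suc n)
  have "norm (K ((K ^^ n) x)) \<le> k * norm ((K ^^ n) x)" by (rule assms)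
  also have "\<dots> \<le> k * (k ^ n * norm x)" using Suc assms(2) by (intro mult_left_mono) auto
  finally show ?case by (simp add: mult_ac)
qed simp

lemma eflow_summable:
  fixes K :: "'a::euclidean_space \<Rightarrow> 'a"
  assumes "linear K"
  shows "summable (\<lambda>k. (t ^ k / fact k) *\<^sub>R (K ^^ k) x)"
proof -
  obtain k where k: "\<And>x. norm (K x) \<le> k * norm x" "k > 0"
    using linear_bounded_pos[OF assms] by blast
  have "summable (\<lambda>n. (\<bar>t\<bar> * k) ^ n / fact n * norm x)"
    using summable_exp_generic[of "\<bar>t\<bar> * k"] by (intro summable_mult2) (simp add: field_simps)
  moreover have "norm ((t ^ n / fact n) *\<^sub>R (K ^^ n) x) \<le> (\<bar>t\<bar> * k) ^ n / fact n * norm x" for n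
  proof -
    have "norm ((t ^ n / fact n) *\<^sub>R (K ^^ n) x) = \<bar>t\<bar> ^ n / fact n * norm ((K ^^ n) x)"
      by (simp add: power_abs)
    also have "\<dots> \<le> \<bar>t\<bar> ^ n / fact n * (k ^ n * norm x)"
      using k by (intro mult_left_mono norm_funpow_le) auto
    finally show ?thesis by (simp add: power_mult_distrib)
  qed
  ultimately show ?thesis by (rule summable_comparison_test'[where N = 0])
qed

lemma linear_funpow:
  fixes K :: "'a::real_vector \<Rightarrow> 'a"
  shows "linear K \<Longrightarrow> linear (K ^^ k)"
proof (induction k)
  case 0 then show ?case by (simp add: linear_iff)
next
  case (Suc k)
  then show ?case using linear_compose[of "K ^^ k" K] by (simp add: o_def)
qed

lemma eflow_linear:
  assumes "linear K"
  shows "linear (eflow K t)"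
proof (rule linearI)
  note L = linear_funpow[OF assms]
  fix x y and r :: real
  show "eflow K t (x + y) = eflow K t x + eflow K t y"
    unfolding eflow_def suminf_add[OF eflow_summable eflow_summable, OF assms assms]
    by (simp add: linear_add[OF L] scaleR_add_right)
  show "eflow K t (r *\<^sub>R x) = r *\<^sub>R eflow K t x"
    unfolding eflow_def suminf_scaleR_right[OF eflow_summable, OF assms]
    by (simp add: linear_scale[OF L] mult.commute)
qed

lemma eflow_commute:
  assumes "linear K"
  shows "eflow K t (K x) = K (eflow K t x)"
proof -
  have bl: "bounded_linear K" using assms by (rule linear_conv_bounded_linear[THEN iffD1])
  show ?thesis
    unfolding eflow_def bounded_linear.suminf[OF bl eflow_summable[OF assms]]
    by (simp add: linear_scale[OF assms] funpow_swap1)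
qed

lemma eflow_0 [simp]: "eflow K 0 x = x"
  unfolding eflow_def by (subst suminf_finite[of "{0}"]) auto

lemma eflow_derivative:
  fixes K :: "'a::euclidean_space \<Rightarrow> 'a"
  assumes "linear K"
  shows "((\<lambda>t. eflow K t x) has_vector_derivative K (eflow K t x)) (at t within S)"
  unfolding has_vector_derivative_def
proof (subst has_derivative_componentwise_within, rule ballI)
  fix b :: 'a assume "b \<in> Basis"
  define c where "c x n = ((K ^^ n) x \<bullet> b) / fact n" for x n
  have eq: "eflow K t x \<bullet> b = (\<Sum>n. c x n * t ^ n)" for t x
    unfolding eflow_def c_def
    by (subst bounded_linear.suminf[OF bounded_linear_inner_left eflow_summable[OF assms]])
       (simp add: mult_ac)
  have sm: "summable (\<lambda>n. c x n * t ^ n)" for t x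
    using bounded_linear.summable[OF bounded_linear_inner_left eflow_summable[OF assms], of t x b]
    by (simp add: c_def mult_ac)
  \<comment> \<open>Termwise differentiation shifts the coefficient sequence, and the shifted
    sequence is the one belonging to K x, so the derivative is again a value of the flow.\<close>
  have "diffs (c x) = c (K x)"
    by (rule ext) (simp add: diffs_def c_def funpow_swap1 divide_simps)
  then have "((\<lambda>t. eflow K t x \<bullet> b) has_field_derivative eflow K t (K x) \<bullet> b) (at t)"
    using termdiffs_strong_converges_everywhere[of "c x" t] sm by (simp add: eq)
  then show "((\<lambda>t. eflow K t x \<bullet> b) has_derivative (\<lambda>h. (h *\<^sub>R K (eflow K t x)) \<bullet> b)) (at t within S)"
    by (auto simp: eflow_commute[OF assms] has_field_derivative_def mult_commute_abs
             intro: has_derivative_at_withinI)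
qed

lemma eflow_expand:
  assumes K: "linear K"
  shows "eflow K s w = (\<Sum>b\<in>Basis. (w \<bullet> b) *\<^sub>R eflow K s b)"
proof -
  have "eflow K s w = eflow K s (\<Sum>b\<in>Basis. (w \<bullet> b) *\<^sub>R b)" by (simp add: euclidean_representation)
  then show ?thesis by (simp add: linear_sum[OF eflow_linear[OF K]] linear_scale[OF eflow_linear[OF K]])
qed

text \<open>A product rule without operator-valued derivatives: expanding v in the basis leaves a
  finite sum of scalar functions times the curves \<open>eflow K (\<phi> t) b\<close>, which are
  differentiated one by one.\<close>

lemma eflow_apply_derivative:
  fixes K :: "'a::euclidean_space \<Rightarrow> 'a"
  assumes K: "linear K" and \<phi>: "(\<phi> has_real_derivative \<phi>') (at t within S)"
    and v: "(v has_vector_derivative v') (at t within S)"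
  shows "((\<lambda>t. eflow K (\<phi> t) (v t)) has_vector_derivative
          \<phi>' *\<^sub>R K (eflow K (\<phi> t) (v t)) + eflow K (\<phi> t) v') (at t within S)"
proof -
  note expand = eflow_expand[OF K]
  have f: "((\<lambda>t. eflow K (\<phi> t) b) has_vector_derivative \<phi>' *\<^sub>R K (eflow K (\<phi> t) b)) (at t within S)" for b
    using vector_diff_chain_within[OF \<phi>[unfolded has_real_derivative_iff_has_vector_derivative]
        eflow_derivative[OF K, of b "\<phi> t" "\<phi> ` S"]] by (simp add: o_def)
  have g: "((\<lambda>t. v t \<bullet> b) has_real_derivative v' \<bullet> b) (at t within S)" for b
    using bounded_linear.has_vector_derivative[OF bounded_linear_inner_left v, of b]
    by (simp add: has_real_derivative_iff_has_vector_derivative)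
  have "((\<lambda>t. \<Sum>b\<in>Basis. (v t \<bullet> b) *\<^sub>R eflow K (\<phi> t) b) has_vector_derivative
      (\<Sum>b\<in>Basis. (v t \<bullet> b) *\<^sub>R (\<phi>' *\<^sub>R K (eflow K (\<phi> t) b)) + (v' \<bullet> b) *\<^sub>R eflow K (\<phi> t) b)) (at t within S)"
    by (intro has_vector_derivative_sum has_vector_derivative_scaleR f g)
  also have "(\<lambda>t. \<Sum>b\<in>Basis. (v t \<bullet> b) *\<^sub>R eflow K (\<phi> t) b) = (\<lambda>t. eflow K (\<phi> t) (v t))"
    by (simp flip: expand)
  also have "(\<Sum>b\<in>Basis. (v t \<bullet> b) *\<^sub>R (\<phi>' *\<^sub>R K (eflow K (\<phi> t) b)) + (v' \<bullet> b) *\<^sub>R eflow K (\<phi> t) b)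
      = \<phi>' *\<^sub>R K (eflow K (\<phi> t) (v t)) + eflow K (\<phi> t) v'"
    unfolding expand[of _ "v t"] expand[of _ v']
    by (simp add: sum.distrib linear_sum[OF K] linear_scale[OF K] scaleR_sum_right mult.commute)
  finally show ?thesis .
qed

text \<open>The derivative of exp(tK) exp(-tK) x in t consists of two terms that cancel because the
  flow commutes with K; the product therefore keeps its value at t = 0.\<close>

lemma eflow_inverse:
  fixes K :: "'a::euclidean_space \<Rightarrow> 'a"
  assumes "linear K"
  shows "eflow K t (eflow K (- t) x) = x"
proof -
  have 1: "((\<lambda>t. eflow K (- t) x) has_vector_derivative - K (eflow K (- t) x)) (at t)" for t
  proof -
    have "(uminus has_real_derivative - 1) (at t)" by (auto intro!: derivative_eq_intros)
    from eflow_apply_derivative[OF assms this has_vector_derivative_const[of x]]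
    show ?thesis by (simp add: linear_0[OF eflow_linear[OF assms]])
  qed
  have "((\<lambda>t. eflow K t (eflow K (- t) x)) has_vector_derivative 0) (at t)" for t
    using eflow_apply_derivative[OF assms _ 1, of "\<lambda>t. t" 1 t]
    by (auto intro!: derivative_eq_intros simp: eflow_commute[OF assms] linear_neg[OF eflow_linear[OF assms]])
  then obtain c where "\<And>t. eflow K t (eflow K (- t) x) = c"
    using has_vector_derivative_zero_constant[of UNIV] by auto
  from this[of t] this[of 0] show ?thesis by simp
qed

lemma eflow_bounded:
  fixes K :: "'a::euclidean_space \<Rightarrow> 'a"
  assumes "linear K"
  obtains C where "C > 0" "\<And>t x. \<bar>t\<bar> \<le> T \<Longrightarrow> norm (eflow K t x) \<le> C * norm x"
proof -
  obtain k where k: "\<And>x. norm (K x) \<le> k * norm x" "k > 0"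
    using linear_bounded_pos[OF assms] by blast
  have "norm (eflow K t x) \<le> exp (T * k) * norm x" if t: "\<bar>t\<bar> \<le> T" for t x
  proof -
    have le: "norm ((t ^ n / fact n) *\<^sub>R (K ^^ n) x) \<le> (T * k) ^ n /\<^sub>R fact n * norm x" for n
    proof -
      have "norm ((t ^ n / fact n) *\<^sub>R (K ^^ n) x) = \<bar>t\<bar> ^ n / fact n * norm ((K ^^ n) x)"
        by (simp add: power_abs)
      also have "\<dots> \<le> T ^ n / fact n * (k ^ n * norm x)"
        using k t by (intro mult_mono divide_right_mono power_mono norm_funpow_le) auto
      finally show ?thesis by (simp add: power_mult_distrib field_simps)
    qed
    have s: "(\<lambda>n. (T * k) ^ n /\<^sub>R fact n * norm x) sums (exp (T * k) * norm x)"
      by (intro sums_mult2 exp_converges)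
    have sn: "summable (\<lambda>n. norm ((t ^ n / fact n) *\<^sub>R (K ^^ n) x))"
      using le by (intro summable_comparison_test'[OF sums_summable[OF s], of 0]) simp
    show ?thesis unfolding eflow_def sums_unique[OF s]
      by (rule order_trans[OF summable_norm[OF sn] suminf_le[OF le sn sums_summable[OF s]]])
  qed
  then show ?thesis using that[of "exp (T * k)"] by simp
qed

lemma eflow_continuous:
  fixes K :: "'a::euclidean_space \<Rightarrow> 'a"
  assumes K: "linear K" and "continuous_on S \<phi>" "continuous_on S v"
  shows "continuous_on S (\<lambda>t. eflow K (\<phi> t) (v t))"
proof -
  note expand = eflow_expand[OF K]
  have c: "continuous_on UNIV (\<lambda>t. eflow K t b)" for b
    using has_vector_derivative_continuous[OF eflow_derivative[OF K]]
    by (simp add: continuous_on_eq_continuous_within)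
  have "continuous_on S (\<lambda>t. eflow K (\<phi> t) b)" for b
    by (rule continuous_on_compose2[OF c assms(2)]) auto
  then show ?thesis unfolding expand[of _ "v _"]
    using assms(3) by (intro continuous_intros)
qed

text \<open>The datum c need only be continuous: it collects the initial value, the Brownian path
  and the primitives of all forcings. A path of a state with additive noise is thus a solution for
  fixed omega even though c and z need not be differentiable.\<close>

definition ie_sol :: "('a::euclidean_space \<Rightarrow> 'a) \<Rightarrow> real \<Rightarrow> (real \<Rightarrow> 'a) \<Rightarrow> (real \<Rightarrow> 'a) \<Rightarrow> bool" where
  "ie_sol K T c z \<longleftrightarrow> continuous_on {0..T} c \<and>
     (\<forall>t\<in>{0..T}. ((\<lambda>s. K (z s)) has_integral (z t - c t)) {0..t})"

text \<open>Substituting \<open>w = z - c\<close> turns the integral equation into \<open>w' = K w + K c\<close> with continuous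
  right-hand side, which variation of constants solves.\<close>
definition ie_formula :: "('a::euclidean_space \<Rightarrow> 'a) \<Rightarrow> (real \<Rightarrow> 'a) \<Rightarrow> real \<Rightarrow> 'a" where
  "ie_formula K c t = c t + eflow K t (prim (\<lambda>s. eflow K (- s) (K (c s))) t)"

lemma linear_continuous_on_compose:
  fixes K :: "'a::euclidean_space \<Rightarrow> 'b::real_normed_vector"
  shows "linear K \<Longrightarrow> continuous_on S f \<Longrightarrow> continuous_on S (\<lambda>x. K (f x))"
  using linear_conv_bounded_linear bounded_linear.continuous_on by blast

lemma ie_formula_sol:
  fixes K :: "'a::euclidean_space \<Rightarrow> 'a"
  assumes K: "linear K" and c: "continuous_on {0..T} c"
  shows "ie_sol K T c (ie_formula K c)"
proof -
  define h where "h s = eflow K (- s) (K (c s))" for s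
  have hc: "continuous_on {0..T} h" unfolding h_def
    by (intro eflow_continuous[OF K] continuous_intros linear_continuous_on_compose[OF K] c)
  define v where "v t = integral {0..t} h" for t
  have v': "(v has_vector_derivative h t) (at t within {0..T})" if "t \<in> {0..T}" for t
    unfolding v_def using integral_has_vector_derivative[OF hc that] .
  define w where "w t = eflow K t (v t)" for t
  have fw: "ie_formula K c t = c t + w t" if "t \<in> {0..T}" for t
  proof -
    have "set_integrable lborel {0..t} h"
      using that by (intro borel_integrable_atLeastAtMost' continuous_on_subset[OF hc]) auto
    from set_borel_integral_eq_integral(2)[OF this] show ?thesis
      by (simp add: ie_formula_def w_def v_def h_def)
  qed
  have w': "(w has_vector_derivative K (ie_formula K c t)) (at t within {0..T})" if t: "t \<in> {0..T}" for t
  proof -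
    have "(w has_vector_derivative 1 *\<^sub>R K (eflow K t (v t)) + eflow K t (h t)) (at t within {0..T})"
      unfolding w_def by (rule eflow_apply_derivative[OF K _ v'[OF t]]) (auto intro!: derivative_eq_intros)
    then show ?thesis
      by (simp add: h_def eflow_inverse[OF K] fw[OF t] w_def linear_add[OF K] add.commute)
  qed
  have "((\<lambda>s. K (ie_formula K c s)) has_integral (ie_formula K c t - c t)) {0..t}" if t: "t \<in> {0..T}" for t
  proof -
    have "((\<lambda>s. K (ie_formula K c s)) has_integral (w t - w 0)) {0..t}"
      using t by (intro fundamental_theorem_of_calculus has_vector_derivative_within_subset[OF w']) auto
    moreover have "w 0 = 0" by (simp add: w_def v_def)
    ultimately show ?thesis using fw[OF t] by simp
  qed
  then show ?thesis using c by (auto simp: ie_sol_def)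
qed

text \<open>Since z differs from c by an indefinite integral, and the equation at t = T contains the
  integrability on all of [0,T], continuity is a consequence of the equation rather than a condition
  in it.\<close>

lemma ie_sol_continuous:
  fixes K :: "'a::euclidean_space \<Rightarrow> 'a"
  assumes "ie_sol K T c z"
  shows "continuous_on {0..T} z"
proof (cases "0 \<le> T")
  case True
  have "(\<lambda>s. K (z s)) integrable_on {0..T}"
    using assms True by (auto simp: ie_sol_def)
  then have "continuous_on {0..T} (\<lambda>t. c t + integral {0..t} (\<lambda>s. K (z s)))"
    using assms by (intro continuous_intros indefinite_integral_continuous_1) (auto simp: ie_sol_def)
  then show ?thesis
  proof (rule continuous_on_eq)
    fix t assume "t \<in> {0..T}"
    then have "((\<lambda>s. K (z s)) has_integral (z t - c t)) {0..t}" using assms by (auto simp: ie_sol_def)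
    from integral_unique[OF this] show "c t + integral {0..t} (\<lambda>s. K (z s)) = z t" by simp
  qed
qed simp

lemma ie_sol_diff:
  fixes K :: "'a::euclidean_space \<Rightarrow> 'a"
  assumes K: "linear K" and "ie_sol K T c z" "ie_sol K T c' z'"
  shows "ie_sol K T (\<lambda>t. c t - c' t) (\<lambda>t. z t - z' t)"
  unfolding ie_sol_def
proof (intro conjI ballI)
  fix t assume "t \<in> {0..T}"
  then have "((\<lambda>s. K (z s) - K (z' s)) has_integral (z t - c t) - (z' t - c' t)) {0..t}"
    using assms by (intro has_integral_diff) (auto simp: ie_sol_def)
  then show "((\<lambda>s. K (z s - z' s)) has_integral (z t - z' t - (c t - c' t))) {0..t}"
    by (simp add: linear_diff[OF K] algebra_simps)
qed (use assms in \<open>auto simp: ie_sol_def intro!: continuous_intros\<close>)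

text \<open>With zero datum z is a primitive of the continuous function K z, hence differentiable,
  and exp(-sK) z(s) has derivative zero.\<close>

lemma ie_sol_zero:
  fixes K :: "'a::euclidean_space \<Rightarrow> 'a"
  assumes K: "linear K" and z: "ie_sol K T (\<lambda>_. 0) z" and t: "t \<in> {0..T}"
  shows "z t = 0"
proof -
  have cont: "continuous_on {0..T} (\<lambda>s. K (z s))"
    by (intro linear_continuous_on_compose[OF K] ie_sol_continuous[OF z])
  have zi: "z s = integral {0..s} (\<lambda>s. K (z s))" if "s \<in> {0..T}" for s
  proof -
    have "((\<lambda>r. K (z r)) has_integral z s) {0..s}" using z that by (auto simp: ie_sol_def)
    from integral_unique[OF this] show ?thesis by simp
  qed
  have z': "(z has_vector_derivative K (z s)) (at s within {0..T})" if "s \<in> {0..T}" for s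
    by (rule has_vector_derivative_transform[OF that _ integral_has_vector_derivative[OF cont that]])
       (rule zi)
  have "((\<lambda>s. eflow K (- s) (z s)) has_vector_derivative 0) (at s within {0..T})" if "s \<in> {0..T}" for s
  proof -
    have "(uminus has_real_derivative - 1) (at s within {0..T})" by (auto intro!: derivative_eq_intros)
    from eflow_apply_derivative[OF K this z'[OF that]] show ?thesis by (simp add: eflow_commute[OF K])
  qed
  then obtain k where k: "\<And>s. s \<in> {0..T} \<Longrightarrow> eflow K (- s) (z s) = k"
    using has_vector_derivative_zero_constant[of "{0..T}"] by auto
  have "z 0 = 0" using zi[of 0] t by auto
  then have "k = 0" using k[of 0] t by auto
  then have "eflow K t (eflow K (- t) (z t)) = 0"
    using k[OF t] by (simp add: linear_0[OF eflow_linear[OF K]])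
  then show ?thesis using eflow_inverse[OF K, of "-t"] eflow_inverse[OF K, of t] 
    by simp
qed

lemma ie_sol_unique:
  fixes K :: "'a::euclidean_space \<Rightarrow> 'a"
  assumes K: "linear K" and "ie_sol K T c z" "ie_sol K T c z'" and t: "t \<in> {0..T}"
  shows "z t = z' t"
  using ie_sol_zero[OF K _ t] ie_sol_diff[OF assms(1-3)] by fastforce

text \<open>By uniqueness z is given by variation of constants. Each of the two exponentials there
  contributes a factor C and K a factor k. The value c(t) is kept apart from the integral so that
  terminal values can be estimated as well.\<close>

lemma ie_sol_bound:
  fixes K :: "'a::euclidean_space \<Rightarrow> 'a"
  assumes K: "linear K"
  obtains C where "C > 0"
    "\<And>c z t. ie_sol K T c z \<Longrightarrow> t \<in> {0..T} \<Longrightarrow>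
       norm (z t) \<le> norm (c t) + C * (prim (\<lambda>s. norm (c s)) T)"
proof -
  obtain C where C: "C > 0" "\<And>t x. \<bar>t\<bar> \<le> T \<Longrightarrow> norm (eflow K t x) \<le> C * norm x"
    using eflow_bounded[OF K] by blast
  obtain k where k: "k > 0" "\<And>x. norm (K x) \<le> k * norm x"
    using linear_bounded_pos[OF K] by blast
  have "norm (z t) \<le> norm (c t) + (C * C * k) * (prim (\<lambda>s. norm (c s)) T)"
    if z: "ie_sol K T c z" and t: "t \<in> {0..T}" for c z t
  proof -
    have c: "continuous_on {0..T} c" using z by (simp add: ie_sol_def)
    have "z t = ie_formula K c t"
      by (rule ie_sol_unique[OF K z ie_formula_sol[OF K c] t])
    define h where "h s = eflow K (- s) (K (c s))" for s
    have hc: "continuous_on {0..T} h" unfolding h_def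
      by (intro eflow_continuous[OF K] continuous_intros linear_continuous_on_compose[OF K] c)
    have hi: "set_integrable lborel {0..t} h"
      using t by (intro borel_integrable_atLeastAtMost' continuous_on_subset[OF hc]) auto
    have ci: "set_integrable lborel {0..T} (\<lambda>s. (C * k) * norm (c s))"
      by (intro borel_integrable_atLeastAtMost' continuous_intros c)
    have "norm (prim h t) \<le> (prim (\<lambda>s. (C * k) * norm (c s)) T)"
      unfolding set_lebesgue_integral_def
    proof (rule Bochner_Integration.integral_norm_bound_integral)
      show "integrable lborel (\<lambda>x. indicator {0..t} x *\<^sub>R h x)" using hi by (simp add: set_integrable_def)
      show "integrable lborel (\<lambda>x. indicator {0..T} x *\<^sub>R (C * k * norm (c x)))" using ci by (simp add: set_integrable_def)
      fix s
      show "norm (indicator {0..t} s *\<^sub>R h s) \<le> indicator {0..T} s *\<^sub>R (C * k * norm (c s))"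
      proof (cases "s \<in> {0..t}")
        case True
        have "norm (h s) \<le> C * norm (K (c s))" unfolding h_def using C(2)[of "-s"] True t by auto
        also have "\<dots> \<le> C * (k * norm (c s))" using k C by (intro mult_left_mono) auto
        finally show ?thesis using True t by (auto simp: mult.assoc)
      next
        case False
        then show ?thesis using C k by (auto simp: indicator_def)
      qed
    qed
    also have "\<dots> = C * k * (prim (\<lambda>s. norm (c s)) T)" by simp
    finally have *: "norm (prim h t) \<le> C * k * (prim (\<lambda>s. norm (c s)) T)" .
    have "norm (z t) \<le> norm (c t) + norm (eflow K t (prim h t))"
      unfolding \<open>z t = _\<close> ie_formula_def h_def by (rule norm_triangle_ineq)
    also have "norm (eflow K t (prim h t)) \<le> C * norm (prim h t)"
      using C(2)[of t] t by auto
    also have "\<dots> \<le> C * (C * k * (prim (\<lambda>s. norm (c s)) T))"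
      using * C by (intro mult_left_mono) auto
    finally show ?thesis by (simp add: mult_ac)
  qed
  then show ?thesis using that[of "C * C * k"] C k by simp
qed

subsection \<open>Two-point boundary conditions\<close>

lemma ie_sol_add_const:
  fixes K :: "'a::euclidean_space \<Rightarrow> 'a"
  assumes K: "linear K" and z: "ie_sol K T c z"
  shows "ie_sol K T (\<lambda>t. c t + w) (\<lambda>t. z t + eflow K t w)"
  unfolding ie_sol_def
proof (intro conjI ballI)
  fix t assume t: "t \<in> {0..T}"
  have "((\<lambda>s. K (eflow K s w)) has_integral (eflow K t w - eflow K 0 w)) {0..t}"
    using t by (intro fundamental_theorem_of_calculus eflow_derivative[OF K]) auto
  moreover have "((\<lambda>s. K (z s)) has_integral (z t - c t)) {0..t}" using z t by (auto simp: ie_sol_def)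
  ultimately have "((\<lambda>s. K (z s) + K (eflow K s w)) has_integral (z t - c t) + (eflow K t w - eflow K 0 w)) {0..t}"
    by (intro has_integral_add)
  then show "((\<lambda>s. K (z s + eflow K s w)) has_integral (z t + eflow K t w - (c t + w))) {0..t}"
    by (simp add: linear_add[OF K] algebra_simps)
qed (use z in \<open>auto simp: ie_sol_def intro!: continuous_intros\<close>)

text \<open>Shooting: the unknown initial value w of the second block is fixed by the boundary
  condition at T. The map from w to \<beta>(exp(TK)(0,w)) is injective by the uniqueness hypothesis,
  hence bijective in finite dimension and bounded below. This gives solvability for every datum
  together with a constant that does not depend on the datum.\<close>

lemma two_point_problem:
  fixes K :: "'a::euclidean_space \<times> 'b::euclidean_space \<Rightarrow> 'a \<times> 'b" and \<beta> :: "'a \<times> 'b \<Rightarrow> 'b"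
  assumes T: "0 \<le> T" and K: "linear K" and \<beta>: "linear \<beta>"
    and uniq: "\<And>z w. ie_sol K T (\<lambda>_. (0, w)) z \<Longrightarrow> \<beta> (z T) = 0 \<Longrightarrow> w = 0"
  obtains C where "C > 0"
    "\<And>c. continuous_on {0..T} c \<Longrightarrow> \<exists>z w. ie_sol K T (\<lambda>t. c t + (0, w)) z \<and> \<beta> (z T) = 0"
    "\<And>c z w t. ie_sol K T (\<lambda>t. c t + (0, w)) z \<Longrightarrow> \<beta> (z T) = 0 \<Longrightarrow> t \<in> {0..T} \<Longrightarrow> continuous_on {0..T} c \<Longrightarrow>
       norm (z t) \<le> norm (c t) + C * (norm (c T) + (prim (\<lambda>s. norm (c s)) T))"
proof -
  define L where "L w = \<beta> (eflow K T (0, w))" for w :: 'b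
  have lin0: "linear (\<lambda>w::'b. (0::'a, w))" by (rule linearI) auto
  have L: "linear L" unfolding L_def
    using linear_compose[OF linear_compose[OF lin0 eflow_linear[OF K]] \<beta>] by (simp add: o_def)
  have e0: "ie_sol K T (\<lambda>_. 0) (\<lambda>_. 0)" by (simp add: ie_sol_def linear_0[OF K])
  have inj: "inj L"
    unfolding linear_inj_iff_eq_0[OF L]
  proof (intro allI impI)
    fix w assume "L w = 0"
    then show "w = 0" using uniq[OF ie_sol_add_const[OF K e0, of "(0, w)", simplified]] by (simp add: L_def)
  qed
  then have surj: "surj L" by (rule linear_injective_imp_surjective[OF L _ refl])
  obtain B where B: "B > 0" "\<And>w. B * norm w \<le> norm (L w)"
    using linear_inj_bounded_below_pos[OF L inj] by blast
  obtain C1 where C1: "C1 > 0" "\<And>t x. \<bar>t\<bar> \<le> T \<Longrightarrow> norm (eflow K t x) \<le> C1 * norm x"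
    using eflow_bounded[OF K] by blast
  obtain b where b: "b > 0" "\<And>x. norm (\<beta> x) \<le> b * norm x"
    using linear_bounded_pos[OF \<beta>] by blast
  obtain C2 where C2: "C2 > 0"
    "\<And>c z t. ie_sol K T c z \<Longrightarrow> t \<in> {0..T} \<Longrightarrow>
       norm (z t) \<le> norm (c t) + C2 * (prim (\<lambda>s. norm (c s)) T)"
    using ie_sol_bound[OF K] by blast
  have ex: "\<exists>z w. ie_sol K T (\<lambda>t. c t + (0, w)) z \<and> \<beta> (z T) = 0" if c: "continuous_on {0..T} c" for c
  proof -
    obtain w where "L w = - \<beta> (ie_formula K c T)" using surj by (metis surj_def)
    then have "\<beta> (ie_formula K c T + eflow K T (0, w)) = 0" by (simp add: L_def linear_add[OF \<beta>])
    then show ?thesis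
      using ie_sol_add_const[OF K ie_formula_sol[OF K c], of "(0, w)"] by blast
  qed
  \<comment> \<open>B inverts the shooting map, so |w| is at most b/B times the bound for the
    solution started with w = 0; C1 then carries w to time t, and C2 bounds that first solution
    itself.\<close>
  define C where "C = C2 + C1 * b / B * (1 + C2)"
  have bd: "norm (z t) \<le> norm (c t) + C * (norm (c T) + (prim (\<lambda>s. norm (c s)) T))"
    if z: "ie_sol K T (\<lambda>t. c t + (0, w)) z" and \<beta>0: "\<beta> (z T) = 0" and t: "t \<in> {0..T}"
      and c: "continuous_on {0..T} c" for c z w t
  proof -
    let ?I = "\<integral>s\<in>{0..T}. norm (c s) \<partial>lborel"
    let ?z = "ie_formula K c"
    have I: "?I \<ge> 0" unfolding set_lebesgue_integral_def by (intro integral_nonneg_AE) auto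
    have zeq: "z s = ?z s + eflow K s (0, w)" if "s \<in> {0..T}" for s
      using ie_sol_unique[OF K z ie_sol_add_const[OF K ie_formula_sol[OF K c]] that] .
    have "L w = - \<beta> (?z T)" using \<beta>0 zeq[of T] T by (simp add: L_def linear_add[OF \<beta>] eq_neg_iff_add_eq_0 add.commute)
    then have "B * norm w \<le> norm (\<beta> (?z T))" using B(2)[of w] by simp
    also have "\<dots> \<le> b * norm (?z T)" by (rule b)
    also have "\<dots> \<le> b * (norm (c T) + C2 * ?I)"
      using C2(2)[OF ie_formula_sol[OF K c], of T] T b by (intro mult_left_mono) auto
    finally have w: "norm w \<le> b / B * (norm (c T) + C2 * ?I)" using B by (simp add: field_simps)
    have "norm (z t) \<le> norm (?z t) + norm (eflow K t (0, w))" unfolding zeq[OF t] by (rule norm_triangle_ineq)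
    also have "norm (?z t) \<le> norm (c t) + C2 * ?I" by (rule C2(2)[OF ie_formula_sol[OF K c] t])
    also have "norm (eflow K t (0, w)) \<le> C1 * norm w" using C1(2)[of t "(0, w)"] t by (auto simp: norm_Pair)
    also have "\<dots> \<le> C1 * (b / B * (norm (c T) + C2 * ?I))" using w C1 by (intro mult_left_mono) auto
    also have "norm (c t) + C2 * ?I + C1 * (b / B * (norm (c T) + C2 * ?I))
        \<le> norm (c t) + C * (norm (c T) + ?I)"
    proof -
      have "0 \<le> C2 * norm (c T)" "0 \<le> C1 * b / B * ?I" "0 \<le> C1 * b / B * (C2 * norm (c T))"
        using C2 C1 b B I by auto
      then show ?thesis by (simp add: C_def algebra_simps add_divide_distrib)
    qed
    finally show ?thesis by simp
  qed
  have "C > 0" unfolding C_def using C1 C2 b B by (intro add_pos_pos mult_pos_pos divide_pos_pos) auto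
  show ?thesis by (rule that[of C]) (fact, erule ex, rule bd)
qed

section \<open>Fourier uniqueness and the Brownian family\<close>

lemma integrable_mult_bounded:
  fixes h g :: "'w \<Rightarrow> real"
  assumes "integrable M h" "g \<in> borel_measurable M" "\<And>x. \<bar>g x\<bar> \<le> 1"
  shows "integrable M (\<lambda>x. h x * g x)"
  by (rule bi_bound[OF assms(1)])
     (use assms in \<open>auto simp: abs_mult intro!: AE_I2 mult_left_le\<close>)

text \<open>The positive and negative parts of h have equal mass (frequency t = 0). Normalised, they
  are densities under which U has two laws with the same characteristic function, so the laws agree
  by Levy uniqueness.\<close>

lemma integral_indicator_vimage_eq_0_if_fourier_eq_0:
  fixes h U :: "'w \<Rightarrow> real"
  assumes U[measurable]: "U \<in> borel_measurable M" and h: "integrable M h"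
    and c: "\<And>t. (\<integral>x. h x * cos (t * U x) \<partial>M) = 0" and s: "\<And>t. (\<integral>x. h x * sin (t * U x) \<partial>M) = 0"
    and A[measurable]: "A \<in> sets borel"
  shows "(\<integral>x. h x * indicator A (U x) \<partial>M) = 0"
proof -
  have [measurable]: "h \<in> borel_measurable M" using h by auto
  define hp where "hp x = max (h x) 0" for x
  define hm where "hm x = max (- h x) 0" for x
  have [measurable]: "hp \<in> borel_measurable M" "hm \<in> borel_measurable M" by (auto simp: hp_def[abs_def] hm_def[abs_def])
  have hpm: "h x = hp x - hm x" "hp x \<ge> 0" "hm x \<ge> 0" for x by (auto simp: hp_def hm_def)
  have ip: "integrable M hp" and im: "integrable M hm"
    using h by (auto simp: hp_def[abs_def] hm_def[abs_def])
  define k where "k = (\<integral>x. hp x \<partial>M)"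
  have km: "k = (\<integral>x. hm x \<partial>M)"
  proof -
    have "(\<integral>x. h x \<partial>M) = 0" using c[of 0] by simp
    then show ?thesis unfolding k_def hpm(1) using ip im by simp
  qed
  show ?thesis
  proof (cases "k = 0")
    case True
    have "AE x in M. hp x = 0" using True k_def integral_nonneg_eq_0_iff_AE[OF ip] hpm by auto
    moreover have "AE x in M. hm x = 0" using True km integral_nonneg_eq_0_iff_AE[OF im] hpm by auto
    ultimately have "AE x in M. h x * indicator A (U x) = 0" by eventually_elim (simp add: hpm(1))
    from integral_cong_AE[OF _ _ this] show ?thesis by simp
  next
    case False
    moreover have "k \<ge> 0" unfolding k_def using hpm by (intro integral_nonneg_AE) auto
    ultimately have k: "k > 0" by simp
    define D where "D g = distr (density M (\<lambda>x. ennreal (g x / k))) borel U" for g :: "'w \<Rightarrow> real"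
    have rd: "real_distribution (D g)"
      if [measurable]: "g \<in> borel_measurable M" and g: "\<And>x. g x \<ge> 0" "integrable M g" "(\<integral>x. g x \<partial>M) = k" for g
    proof -
      have "emeasure (density M (\<lambda>x. ennreal (g x / k))) (space M) = (\<integral>\<^sup>+x. ennreal (g x / k) \<partial>M)"
        by (subst emeasure_density) (auto intro!: nn_integral_cong)
      also have "\<dots> = ennreal (\<integral>x. g x / k \<partial>M)"
        using g k by (intro nn_integral_eq_integral) auto
      also have "\<dots> = 1" using g k by simp
      finally have "prob_space (density M (\<lambda>x. ennreal (g x / k)))" by (intro prob_spaceI) simp
      then interpret p: prob_space "density M (\<lambda>x. ennreal (g x / k))" .
      show ?thesis unfolding D_def by (rule p.real_distribution_distr) simp
    qed
    have chr: "char (D g) t = (\<integral>x. (g x / k) *\<^sub>R iexp (t * U x) \<partial>M)"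
      if [measurable]: "g \<in> borel_measurable M" and g: "\<And>x. g x \<ge> 0" for g t
      unfolding char_def D_def using g k
      by (subst integral_distr) (auto simp: integral_density)
    have ii: "integrable M (\<lambda>x. (g x / k) *\<^sub>R iexp (t * U x))"
      if [measurable]: "g \<in> borel_measurable M" and g: "integrable M g" for g t
    proof (rule bi_bound[of M "\<lambda>x. g x / k"])
      show "AE x in M. norm ((g x / k) *\<^sub>R iexp (t * U x)) \<le> norm (g x / k)"
        by (simp add: norm_mult)
    qed (use g in auto)
    have "char (D hp) t = char (D hm) t" for t
    proof -
      have z: "(\<integral>x. (h x / k) *\<^sub>R iexp (t * U x) \<partial>M) = 0" (is "?I = 0")
      proof (rule complex_eqI)
        have i: "integrable M (\<lambda>x. (h x / k) *\<^sub>R iexp (t * U x))" using ii[of h t] h by auto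
        have "Re ?I = (\<integral>x. Re ((h x / k) *\<^sub>R iexp (t * U x)) \<partial>M)"
          by (rule integral_Re[OF i, symmetric])
        also have "\<dots> = (\<integral>x. h x * cos (t * U x) / k \<partial>M)"
          by (intro bint_cong) (simp_all add: Re_exp)
        finally show "Re ?I = Re 0" using c by simp
        have "Im ?I = (\<integral>x. Im ((h x / k) *\<^sub>R iexp (t * U x)) \<partial>M)"
          by (rule integral_Im[OF i, symmetric])
        also have "\<dots> = (\<integral>x. h x * sin (t * U x) / k \<partial>M)"
          by (intro bint_cong) (simp_all add: Im_exp)
        finally show "Im ?I = Im 0" using s by simp
      qed
      have "char (D hp) t - char (D hm) t = (\<integral>x. (hp x / k) *\<^sub>R iexp (t * U x) - (hm x / k) *\<^sub>R iexp (t * U x) \<partial>M)"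
        unfolding chr[OF \<open>hp \<in> _\<close> hpm(2)] chr[OF \<open>hm \<in> _\<close> hpm(3)]
        using ii[of hp t] ii[of hm t] ip im by (subst bint_diff) auto
      also have "\<dots> = ?I" by (simp add: hpm(1) diff_divide_distrib scaleR_diff_left)
      finally show ?thesis using z by simp
    qed
    then have eq: "D hp = D hm"
      using ip im hpm k_def km by (intro Levy_uniqueness rd) auto
    have ms: "(\<integral>x. indicator A x \<partial>D g) = (\<integral>x. g x * indicator A (U x) \<partial>M) / k"
      if [measurable]: "g \<in> borel_measurable M" and g: "\<And>x. g x \<ge> 0" for g
      unfolding D_def using g k by (subst integral_distr) (auto simp: integral_density simp del: integral_indicator)
    have "(\<integral>x. hp x * indicator A (U x) \<partial>M) = (\<integral>x. hm x * indicator A (U x) \<partial>M)"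
      using ms[of hp] ms[of hm] eq k hpm by simp
    moreover have "integrable M (\<lambda>x. hp x * indicator A (U x))" "integrable M (\<lambda>x. hm x * indicator A (U x))"
      using ip im by (intro integrable_mult_bounded; simp)+
    moreover have "h x * indicator A (U x) = hp x * indicator A (U x) - hm x * indicator A (U x)" for x
      by (simp add: hpm(1) left_diff_distrib)
    ultimately show ?thesis by simp
  qed
qed

text \<open>The signed measure with density h has vanishing Fourier transform on every finite
  subfamily of U, written with cosine and sine to stay real. The empty family gives integral zero
  for h.\<close>

definition fourier_null :: "'w measure \<Rightarrow> 'i set \<Rightarrow> ('i \<Rightarrow> 'w \<Rightarrow> real) \<Rightarrow> ('w \<Rightarrow> real) \<Rightarrow> bool" where
  "fourier_null M I U h \<longleftrightarrow> integrable M h \<and>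
     (\<forall>P c. finite P \<longrightarrow> P \<subseteq> I \<longrightarrow>
        (\<integral>x. h x * cos (\<Sum>i\<in>P. c i * U i x) \<partial>M) = 0 \<and> (\<integral>x. h x * sin (\<Sum>i\<in>P. c i * U i x) \<partial>M) = 0)"

lemma fourier_null_cos: "fourier_null M I U h \<Longrightarrow> (\<integral>x. h x * cos 0 \<partial>M) = 0"
  unfolding fourier_null_def by (elim conjE allE[of _ "{}"]) simp

text \<open>Product formulas reduce h cos(S) and h sin(S), tested against frequencies of U i, to
  trigonometric integrals over the family enlarged by i, which vanish. The one-dimensional
  uniqueness then permits an indicator in U i, so coordinates can be localised one after the
  other.\<close>

lemma fourier_null_indicator:
  assumes U: "\<And>i. i \<in> I \<Longrightarrow> U i \<in> borel_measurable M"
    and h: "fourier_null M I U h" and i: "i \<in> I" and A[measurable]: "A \<in> sets borel"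
  shows "fourier_null M I U (\<lambda>x. h x * indicator A (U i x))"
  unfolding fourier_null_def
proof (intro conjI allI impI)
  have hi: "integrable M h" using h by (simp add: fourier_null_def)
  then have [measurable]: "h \<in> borel_measurable M" by auto
  have [measurable]: "U i \<in> borel_measurable M" by (rule U[OF i])
  show "integrable M (\<lambda>x. h x * indicator A (U i x))"
    using hi by (intro integrable_mult_bounded) auto
  fix P :: "'a set" and c :: "'a \<Rightarrow> real" assume P: "finite P" "P \<subseteq> I"
  define S where "S x = (\<Sum>i\<in>P. c i * U i x)" for x
  have [measurable]: "S \<in> borel_measurable M" unfolding S_def using U P by (auto intro!: borel_measurable_sum)
  have Si: "(\<integral>x. h x * cos (S x + t * U i x) \<partial>M) = 0 \<and> (\<integral>x. h x * sin (S x + t * U i x) \<partial>M) = 0" for t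
  proof -
    \<comment> \<open>The index i may already occur in P, so its two coefficients have to be
      merged.\<close>
    have "S x + t * U i x = (\<Sum>j\<in>insert i P. ((if j \<in> P then c j else 0) + (if j = i then t else 0)) * U j x)" for x
    proof -
      have "(\<Sum>j\<in>insert i P. ((if j \<in> P then c j else 0) + (if j = i then t else 0)) * U j x)
          = (\<Sum>j\<in>insert i P. (if j \<in> P then c j * U j x else 0)) + (\<Sum>j\<in>insert i P. (if j = i then t * U j x else 0))"
        by (subst sum.distrib[symmetric]) (auto intro!: sum.cong simp: distrib_right)
      also have "(\<Sum>j\<in>insert i P. (if j \<in> P then c j * U j x else 0)) = S x"
        unfolding S_def using P by (intro sum.mono_neutral_cong_right) auto
      also have "(\<Sum>j\<in>insert i P. (if j = i then t * U j x else 0)) = t * U i x"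
        using P by (subst sum.delta) auto
      finally show ?thesis by simp
    qed
    then show ?thesis using h P i by (simp add: fourier_null_def)
  qed
  have int: "integrable M (\<lambda>x. h x * cos (S x + t * U i x))" "integrable M (\<lambda>x. h x * sin (S x + t * U i x))" for t
    using hi by (intro integrable_mult_bounded; simp)+
  have Si': "(\<integral>x. h x * cos (S x - t * U i x) \<partial>M) = 0 \<and> (\<integral>x. h x * sin (S x - t * U i x) \<partial>M) = 0"
    and int': "integrable M (\<lambda>x. h x * cos (S x - t * U i x))" "integrable M (\<lambda>x. h x * sin (S x - t * U i x))" for t
    using Si[of "- t"] int[of "- t"] by simp_all
  have cc: "h x * cos (S x) * cos (t * U i x) = (h x * cos (S x + t * U i x) + h x * cos (S x - t * U i x)) / 2"
    and cs: "h x * cos (S x) * sin (t * U i x) = (h x * sin (S x + t * U i x) - h x * sin (S x - t * U i x)) / 2"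
    and sc: "h x * sin (S x) * cos (t * U i x) = (h x * sin (S x + t * U i x) + h x * sin (S x - t * U i x)) / 2"
    and ss: "h x * sin (S x) * sin (t * U i x) = (h x * cos (S x - t * U i x) - h x * cos (S x + t * U i x)) / 2"
    for x t by (simp_all add: cos_add sin_add cos_diff sin_diff algebra_simps)
  have "(\<integral>x. (h x * cos (S x)) * indicator A (U i x) \<partial>M) = 0"
  proof (rule integral_indicator_vimage_eq_0_if_fourier_eq_0)
    show "integrable M (\<lambda>x. h x * cos (S x))" using hi by (intro integrable_mult_bounded) auto
    show "(\<integral>x. h x * cos (S x) * cos (t * U i x) \<partial>M) = 0" for t
      unfolding cc using Si Si' int int' by simp
    show "(\<integral>x. h x * cos (S x) * sin (t * U i x) \<partial>M) = 0" for t
      unfolding cs using Si Si' int int' by simp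
  qed auto
  then show "(\<integral>x. h x * indicator A (U i x) * cos (\<Sum>i\<in>P. c i * U i x) \<partial>M) = 0"
    by (simp add: S_def mult_ac)
  have "(\<integral>x. (h x * sin (S x)) * indicator A (U i x) \<partial>M) = 0"
  proof (rule integral_indicator_vimage_eq_0_if_fourier_eq_0)
    show "integrable M (\<lambda>x. h x * sin (S x))" using hi by (intro integrable_mult_bounded) auto
    show "(\<integral>x. h x * sin (S x) * cos (t * U i x) \<partial>M) = 0" for t
      unfolding sc using Si Si' int int' by simp
    show "(\<integral>x. h x * sin (S x) * sin (t * U i x) \<partial>M) = 0" for t
      unfolding ss using Si Si' int int' by simp
  qed auto
  then show "(\<integral>x. h x * indicator A (U i x) * sin (\<Sum>i\<in>P. c i * U i x) \<partial>M) = 0"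
    by (simp add: S_def mult_ac)
qed

text \<open>Finite cylinders form an intersection-stable generator, and localising one coordinate at
  a time makes h integrate to zero over each of them; Dynkin's theorem extends this to the generated
  sigma-algebra.\<close>

lemma fourier_null_integral_eq_0:
  assumes U: "\<And>i. i \<in> I \<Longrightarrow> U i \<in> borel_measurable M" and h: "fourier_null M I U h"
    and E: "E \<in> sigma_sets (space M) {U i -` A \<inter> space M | i A. i \<in> I \<and> A \<in> sets borel}"
  shows "(\<integral>x. h x * indicator E x \<partial>M) = 0"
proof -
  have hi: "integrable M h" using h by (simp add: fourier_null_def)
  then have [measurable]: "h \<in> borel_measurable M" by auto
  \<comment> \<open>Lists serve better than sets: intersection becomes append, one coordinate is
    removed per induction step, and the empty list is the whole space, whose integral is used for
    complements.\<close>
  define cyl where "cyl L = {x \<in> space M. \<forall>(i, A)\<in>set L. U i x \<in> A}" for L :: "('a \<times> real set) list"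
  define G where "G = {cyl L | L. set L \<subseteq> I \<times> sets borel}"
  have cylE: "fourier_null M I U (\<lambda>x. h x * indicator (cyl L) x)" if "set L \<subseteq> I \<times> sets borel" for L
    using that
  proof (induction L)
    case Nil
    have "(\<integral>x. h x * indicator (cyl []) x * g x \<partial>M) = (\<integral>x. h x * g x \<partial>M)" for g
      by (intro bint_cong) (auto simp: cyl_def)
    moreover have "integrable M (\<lambda>x. h x * indicator (cyl []) x) \<longleftrightarrow> integrable M h"
      by (intro Bochner_Integration.integrable_cong) (auto simp: cyl_def)
    ultimately show ?case using h by (simp add: fourier_null_def)
  next
    case (Cons p L)
    obtain i A where p: "p = (i, A)" by force
    have "fourier_null M I U (\<lambda>x. (h x * indicator (cyl L) x) * indicator A (U i x))"
      using Cons p by (intro fourier_null_indicator U) auto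
    also have "(\<lambda>x. (h x * indicator (cyl L) x) * indicator A (U i x)) = (\<lambda>x. h x * indicator (cyl (p # L)) x)"
      by (auto simp: cyl_def p fun_eq_iff indicator_def)
    finally show ?case .
  qed
  have Gm: "G \<subseteq> sets M"
  proof
    fix E assume "E \<in> G"
    then obtain L where L: "E = cyl L" "set L \<subseteq> I \<times> sets borel" by (auto simp: G_def)
    have "{x \<in> space M. case p of (i, A) \<Rightarrow> U i x \<in> A} \<in> sets M" if "p \<in> set L" for p
    proof -
      obtain i A where p: "p = (i, A)" by force
      have "U i -` A \<inter> space M \<in> sets M" using measurable_sets[OF U, of i A] that L p by auto
      moreover have "U i -` A \<inter> space M = {x \<in> space M. case p of (i, A) \<Rightarrow> U i x \<in> A}" using p by auto
      ultimately show ?thesis by simp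
    qed
    then show "E \<in> sets M" unfolding L cyl_def
      by (intro sets.sets_Collect_finite_All) auto
  qed
  have st: "Int_stable G"
  proof (rule Int_stableI)
    fix a b assume "a \<in> G" "b \<in> G"
    then obtain L L' where "a = cyl L" "b = cyl L'" "set L \<subseteq> I \<times> sets borel" "set L' \<subseteq> I \<times> sets borel"
      by (auto simp: G_def)
    moreover have "cyl L \<inter> cyl L' = cyl (L @ L')" by (auto simp: cyl_def)
    ultimately show "a \<inter> b \<in> G" unfolding G_def by (intro CollectI exI[of _ "L @ L'"]) auto
  qed
  have GP: "G \<subseteq> Pow (space M)" by (auto simp: G_def cyl_def)
  have sub: "{U i -` A \<inter> space M | i A. i \<in> I \<and> A \<in> sets borel} \<subseteq> G"
  proof
    fix E assume "E \<in> {U i -` A \<inter> space M | i A. i \<in> I \<and> A \<in> sets borel}"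
    then obtain i A where "E = U i -` A \<inter> space M" "i \<in> I" "A \<in> sets borel" by auto
    moreover from this have "E = cyl [(i, A)]" by (auto simp: cyl_def)
    ultimately show "E \<in> G" unfolding G_def by (intro CollectI exI[of _ "[(i, A)]"]) auto
  qed
  have int: "integrable M (\<lambda>x. h x * indicator A x)" if "A \<in> sets M" for A
    using that hi by (intro integrable_mult_bounded) auto
  have SM: "sigma_sets (space M) G \<subseteq> sets M" using Gm sets.sigma_sets_subset by blast
  have "E \<in> sigma_sets (space M) G" by (rule subsetD[OF sigma_sets_mono'[OF sub] E])
  then show ?thesis
  proof (rule sigma_sets_induct_disjoint[where P = "\<lambda>E. (\<integral>x. h x * indicator E x \<partial>M) = 0", OF st GP])
    fix A assume "A \<in> G"
    then obtain L where L: "A = cyl L" "set L \<subseteq> I \<times> sets borel" by (auto simp: G_def)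
    have "(\<integral>x. h x * indicator (cyl L) x * cos (\<Sum>i\<in>{}. 0 * U i x) \<partial>M) = 0"
      using fourier_null_cos[OF cylE[OF L(2)]] by simp
    then show "(\<integral>x. h x * indicator A x \<partial>M) = 0" by (simp add: L)
  next
    show "(\<integral>x. h x * indicator {} x \<partial>M) = 0" by simp
  next
    fix A assume A: "A \<in> sigma_sets (space M) G" "(\<integral>x. h x * indicator A x \<partial>M) = 0"
    have "fourier_null M I U (\<lambda>x. h x * indicator (cyl []) x)" by (rule cylE) simp
    then have "(\<integral>x. h x * indicator (cyl []) x * cos (\<Sum>i\<in>{}. 0 * U i x) \<partial>M) = 0"
      using fourier_null_cos by simp
    then have "(\<integral>x. h x * indicator (space M) x \<partial>M) = 0" by (simp add: cyl_def)
    moreover have "h x * indicator (space M - A) x = h x * indicator (space M) x - h x * indicator A x" for x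
      using sigma_sets_into_sp[OF GP A(1)] by (auto simp: indicator_def)
    ultimately show "(\<integral>x. h x * indicator (space M - A) x \<partial>M) = 0"
      using A(2) int[of A] int[of "space M"] SM A(1) by auto
  next
    fix A :: "nat \<Rightarrow> _ set"
    assume A: "disjoint_family A" "range A \<subseteq> sigma_sets (space M) G" "\<And>i. (\<integral>x. h x * indicator (A i) x \<partial>M) = 0"
    have Am: "A i \<in> sets M" for i using A(2) SM by auto
    have eq: "(LINT x:B|M. h x) = (\<integral>x. h x * indicator B x \<partial>M)" for B
      by (simp add: set_lebesgue_integral_def mult.commute)
    have "(LINT x:(\<Union>i. A i)|M. h x) = (\<Sum>i. LINT x:A i|M. h x)"
      using int[of "\<Union>i. A i"] Am
      by (intro lebesgue_integral_countable_add[OF Am])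
         (use A(1) in \<open>auto simp: disjoint_family_on_def set_integrable_def mult.commute\<close>)
    then show "(\<integral>x. h x * indicator (\<Union>i. A i) x \<partial>M) = 0" unfolding eq using A(3) by simp
  qed
qed

text \<open>S is approximated by sin(eS)/e as e tends to 0. The mean square of that is (1 - E
  cos(2eS))/(2e^2), which the characteristic function bounds by V; Fatou then bounds the second
  moment, and dominated convergence with majorant |S| transfers the vanishing sine integrals to the
  mean.\<close>

lemma square_mean_from_characteristic_function:
  fixes S :: "'w \<Rightarrow> real"
  assumes "prob_space M" and S[measurable]: "S \<in> borel_measurable M" and V: "V \<ge> 0"
    and c: "\<And>r. (\<integral>x. cos (r * S x) \<partial>M) = exp (- (r\<^sup>2 * V) / 2)" and s: "\<And>r. (\<integral>x. sin (r * S x) \<partial>M) = 0"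
  shows "integrable M (\<lambda>x. (S x)\<^sup>2)" "(\<integral>x. (S x)\<^sup>2 \<partial>M) \<le> V" "integrable M S" "(\<integral>x. S x \<partial>M) = 0"
proof -
  interpret prob_space M by fact
  define e where "e n = inverse (real (Suc n))" for n
  have e0: "e n > 0" for n by (simp add: e_def)
  have elim: "filterlim e (at 0) sequentially"
    unfolding filterlim_at using LIMSEQ_inverse_real_of_nat by (auto simp: e_def[abs_def])
  define f where "f n a = sin (a * e n) / e n" for n a
  have flim: "(\<lambda>n. f n a) \<longlonglongrightarrow> a" for a
  proof -
    have "((\<lambda>h. sin (a * h)) has_real_derivative a) (at 0)" by (auto intro!: derivative_eq_intros)
    then have "((\<lambda>h. sin (a * h) / h) \<longlongrightarrow> a) (at 0)" by (simp add: DERIV_def)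
    from filterlim_compose[OF this elim] show ?thesis by (simp add: f_def)
  qed
  have [measurable]: "f n \<in> borel_measurable borel" for n unfolding f_def by measurable
  have sq: "(f n a)\<^sup>2 = (1 - cos ((2 * e n) * a)) / (2 * (e n)\<^sup>2)" for n a
  proof -
    have "cos (2 * (a * e n)) = 1 - 2 * (sin (a * e n))\<^sup>2" by (rule cos_double_sin)
    then have *: "1 - cos ((2 * e n) * a) = 2 * (sin (a * e n))\<^sup>2" by (simp add: mult_ac)
    show ?thesis unfolding * by (simp add: f_def power_divide)
  qed
  have isq: "integrable M (\<lambda>x. (f n (S x))\<^sup>2)" for n
    unfolding sq by (intro integrable_divide bi_diff integrable_const
        integrable_const_bound[where B = 1]) auto
  have le: "(\<integral>x. (f n (S x))\<^sup>2 \<partial>M) \<le> V" for n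
  proof -
    have i: "integrable M (\<lambda>x. cos ((2 * e n) * S x))" by (rule integrable_const_bound[where B = 1]) auto
    have "(\<integral>x. (f n (S x))\<^sup>2 \<partial>M) = (1 - exp (- ((2 * e n)\<^sup>2 * V) / 2)) / (2 * (e n)\<^sup>2)"
      unfolding sq using i c[of "2 * e n"] by (simp add: prob_space)
    also have "\<dots> \<le> (((2 * e n)\<^sup>2 * V) / 2) / (2 * (e n)\<^sup>2)"
      using exp_ge_add_one_self[of "- ((2 * e n)\<^sup>2 * V) / 2"] by (intro divide_right_mono) auto
    also have "\<dots> = V" using e0[of n] by (simp add: power2_eq_square)
    finally show ?thesis .
  qed
  have "(\<integral>\<^sup>+x. ennreal ((S x)\<^sup>2) \<partial>M) \<le> ennreal V"
  proof -
    have "(\<lambda>n. ennreal ((f n (S x))\<^sup>2)) \<longlonglongrightarrow> ennreal ((S x)\<^sup>2)" for x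
      by (intro tendsto_intros flim)
    from lim_imp_Liminf[OF _ this] have "(\<integral>\<^sup>+x. ennreal ((S x)\<^sup>2) \<partial>M) = (\<integral>\<^sup>+x. liminf (\<lambda>n. ennreal ((f n (S x))\<^sup>2)) \<partial>M)"
      by (intro nn_integral_cong) simp
    also have "\<dots> \<le> liminf (\<lambda>n. \<integral>\<^sup>+x. ennreal ((f n (S x))\<^sup>2) \<partial>M)"
      by (intro nn_integral_liminf) measurable
    also have "\<dots> \<le> ennreal V"
    proof (rule Liminf_le)
      show "\<forall>\<^sub>F n in sequentially. (\<integral>\<^sup>+x. ennreal ((f n (S x))\<^sup>2) \<partial>M) \<le> ennreal V"
        using le V by (intro always_eventually allI) (simp add: nn_integral_eq_integral[OF isq] ennreal_leI)
    qed simp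
    finally show ?thesis .
  qed
  note nn = this
  show i2: "integrable M (\<lambda>x. (S x)\<^sup>2)"
    by (rule integrableI_nonneg) (use nn in \<open>auto simp: le_less_trans\<close>)
  show "(\<integral>x. (S x)\<^sup>2 \<partial>M) \<le> V"
    using nn V by (simp add: nn_integral_eq_integral[OF i2])
  show i1: "integrable M S" by (rule square_integrable_imp_integrable[OF S i2])
  have "(\<lambda>n. \<integral>x. f n (S x) \<partial>M) \<longlonglongrightarrow> (\<integral>x. S x \<partial>M)"
  proof (rule integral_dominated_convergence[where w = "\<lambda>x. \<bar>S x\<bar>"])
    show "AE x in M. norm (f n (S x)) \<le> \<bar>S x\<bar>" for n
    proof (rule AE_I2)
      fix x
      have "\<bar>sin (S x * e n)\<bar> \<le> \<bar>S x * e n\<bar>" by (rule abs_sin_x_le_abs_x)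
      then show "norm (f n (S x)) \<le> \<bar>S x\<bar>" using e0[of n] by (simp add: f_def abs_mult field_simps)
    qed
  qed (use i1 flim in auto)
  moreover have "(\<integral>x. f n (S x) \<partial>M) = 0" for n
    using s[of "e n"] by (simp add: f_def mult.commute)
  ultimately show "(\<integral>x. S x \<partial>M) = 0" by (simp add: LIMSEQ_const_iff)
qed

text \<open>W is sampled at the last multiple of 1/(n+1) not after t. Such step processes are
  jointly measurable, the grid points remain in [0,\<infinity>) where paths are continuous, and they
  converge to t.\<close>

lemma borel_measurable_pair_continuous:
  fixes W :: "real \<Rightarrow> 'w \<Rightarrow> 'b::metric_space"
  assumes m: "\<And>t. 0 \<le> t \<Longrightarrow> W t \<in> borel_measurable M"
    and c: "\<And>x. x \<in> space M \<Longrightarrow> continuous_on {0..} (\<lambda>t. W t x)"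
  shows "(\<lambda>(t, x). W t x) \<in> borel_measurable (restrict_space lborel {0..T} \<Otimes>\<^sub>M M)"
proof (rule borel_measurable_LIMSEQ_metric)
  define g where "g n t = nat \<lfloor>real (Suc n) * t\<rfloor>" for n and t :: real
  let ?P = "restrict_space lborel {0..T} \<Otimes>\<^sub>M M"
  fix n
  have fm: "fst \<in> borel_measurable ?P"
    by (rule measurable_compose[OF measurable_fst]) (simp add: measurable_restrict_space1)
  have [measurable]: "(\<lambda>p. g n (fst p)) \<in> measurable ?P (count_space UNIV)"
    unfolding g_def using fm by measurable
  have [measurable]: "(\<lambda>p. W (real k / real (Suc n)) (snd p)) \<in> borel_measurable ?P" for k
    by (rule measurable_compose[OF measurable_snd m]) simp
  show "(\<lambda>p. W (real (g n (fst p)) / real (Suc n)) (snd p)) \<in> borel_measurable ?P"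
    by (rule measurable_compose_countable[where f = "\<lambda>k p. W (real k / real (Suc n)) (snd p)"]) fact+
next
  fix p assume p: "p \<in> space (restrict_space lborel {0..T} \<Otimes>\<^sub>M M)"
  obtain t x where tx: "p = (t, x)" "t \<in> {0..T}" "x \<in> space M"
    using p by (auto simp: space_pair_measure)
  have lim: "(\<lambda>n. real (nat \<lfloor>real (Suc n) * t\<rfloor>) / real (Suc n)) \<longlonglongrightarrow> t"
  proof (rule tendsto_sandwich[OF _ _ _ tendsto_const])
    have "real (nat \<lfloor>real (Suc n) * t\<rfloor>) \<ge> real (Suc n) * t - 1" "real (nat \<lfloor>real (Suc n) * t\<rfloor>) \<le> real (Suc n) * t" for n
      using tx by simp_all
    note fl = this
    show "\<forall>\<^sub>F n in sequentially. t - inverse (real (Suc n)) \<le> real (nat \<lfloor>real (Suc n) * t\<rfloor>) / real (Suc n)"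
    proof (intro always_eventually allI)
      fix n
      have "t - inverse (real (Suc n)) = (real (Suc n) * t - 1) / real (Suc n)" by (simp add: field_simps)
      also have "\<dots> \<le> real (nat \<lfloor>real (Suc n) * t\<rfloor>) / real (Suc n)" using fl(1) by (intro divide_right_mono) auto
      finally show "t - inverse (real (Suc n)) \<le> real (nat \<lfloor>real (Suc n) * t\<rfloor>) / real (Suc n)" .
    qed
    show "\<forall>\<^sub>F n in sequentially. real (nat \<lfloor>real (Suc n) * t\<rfloor>) / real (Suc n) \<le> t"
      using fl(2) by (intro always_eventually allI) (simp add: field_simps del: of_nat_Suc)
    show "(\<lambda>n. t - inverse (real (Suc n))) \<longlonglongrightarrow> t"
      using tendsto_diff[OF tendsto_const LIMSEQ_inverse_real_of_nat, of t] by simp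
  qed
  have "(\<lambda>n. W (real (nat \<lfloor>real (Suc n) * t\<rfloor>) / real (Suc n)) x) \<longlonglongrightarrow> W t x"
    by (rule continuous_on_tendsto_compose[OF c[OF tx(3)] lim]) (use tx in auto)
  then show "(\<lambda>n. W (real (nat \<lfloor>real (Suc n) * fst p\<rfloor>) / real (Suc n)) (snd p)) \<longlonglongrightarrow> (case p of (t, x) \<Rightarrow> W t x)"
    by (simp add: tx)
qed

section \<open>Square-integrable functions\<close>

definition L2 :: "'x measure \<Rightarrow> ('x \<Rightarrow> 'v::euclidean_space) \<Rightarrow> bool" where
  "L2 M f \<longleftrightarrow> f \<in> borel_measurable M \<and> integrable M (\<lambda>x. (norm (f x))\<^sup>2)"

text \<open>The square of the norm is kept, so that sums are handled by |a+b|^2 \<le> 2|a|^2 +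
  2|b|^2 and all later estimates stay linear in these quantities.\<close>

definition n2 :: "'x measure \<Rightarrow> ('x \<Rightarrow> 'v::euclidean_space) \<Rightarrow> real" where
  "n2 M f = (\<integral>x. (norm (f x))\<^sup>2 \<partial>M)"

lemma L2_measurable [measurable_dest]: "L2 M f \<Longrightarrow> f \<in> borel_measurable M"
  by (simp add: L2_def)

lemma n2_nonneg [simp]: "n2 M f \<ge> 0"
  unfolding n2_def by (intro integral_nonneg_AE) auto

lemma norm_add_sq_le: "(norm (a + b :: 'v::real_normed_vector))\<^sup>2 \<le> 2 * (norm a)\<^sup>2 + 2 * (norm b)\<^sup>2"
proof -
  have "(norm (a + b))\<^sup>2 \<le> (norm a + norm b)\<^sup>2"
    by (intro power_mono norm_triangle_ineq) auto
  also have "\<dots> \<le> 2 * (norm a)\<^sup>2 + 2 * (norm b)\<^sup>2"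
    using zero_le_power2[of "norm a - norm b"] by (simp add: power2_sum power2_diff)
  finally show ?thesis .
qed

lemma L2_dominated:
  assumes f: "f \<in> borel_measurable M" and g: "integrable M g" and le: "AE x in M. (norm (f x))\<^sup>2 \<le> g x"
  shows "L2 M f" "n2 M f \<le> (\<integral>x. g x \<partial>M)"
proof -
  show 1: "L2 M f" unfolding L2_def
  proof (intro conjI f bi_bound[OF g])
    show "AE x in M. norm ((norm (f x))\<^sup>2) \<le> norm (g x)" using le by eventually_elim auto
  qed (use f in measurable)
  show "n2 M f \<le> (\<integral>x. g x \<partial>M)" unfolding n2_def
    using 1 g le by (intro integral_mono_AE) (auto simp: L2_def)
qed

lemma L2_add:
  assumes "L2 M f" "L2 M g"
  shows "L2 M (\<lambda>x. f x + g x)" "n2 M (\<lambda>x. f x + g x) \<le> 2 * n2 M f + 2 * n2 M g"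
proof -
  have i: "integrable M (\<lambda>x. 2 * (norm (f x))\<^sup>2 + 2 * (norm (g x))\<^sup>2)"
    using assms by (auto simp: L2_def)
  have m: "(\<lambda>x. f x + g x) \<in> borel_measurable M" using assms by measurable
  note * = L2_dominated[OF m i AE_I2[OF norm_add_sq_le]]
  show "L2 M (\<lambda>x. f x + g x)" by (rule *)
  show "n2 M (\<lambda>x. f x + g x) \<le> 2 * n2 M f + 2 * n2 M g"
    using *(2) assms by (simp add: n2_def L2_def)
qed

lemma L2_linear:
  assumes K: "linear K" and b: "\<And>x. norm (K x) \<le> k * norm x" and f: "L2 M f"
  shows "L2 M (\<lambda>x. K (f x))" "n2 M (\<lambda>x. K (f x)) \<le> k\<^sup>2 * n2 M f"
proof -
  have [measurable]: "K \<in> borel_measurable borel"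
    using K linear_continuous_on linear_conv_bounded_linear by (blast intro: borel_measurable_continuous_onI)
  have m: "(\<lambda>x. K (f x)) \<in> borel_measurable M" using f by measurable
  have i: "integrable M (\<lambda>x. k\<^sup>2 * (norm (f x))\<^sup>2)" using f by (auto simp: L2_def)
  have le: "(norm (K (f x)))\<^sup>2 \<le> k\<^sup>2 * (norm (f x))\<^sup>2" for x
    unfolding power_mult_distrib[symmetric] by (intro power_mono b) auto
  note * = L2_dominated[OF m i AE_I2[OF le]]
  show "L2 M (\<lambda>x. K (f x))" by (rule *)
  show "n2 M (\<lambda>x. K (f x)) \<le> k\<^sup>2 * n2 M f" using *(2) by (simp add: n2_def)
qed

lemma L2_linear': "linear K \<Longrightarrow> L2 M f \<Longrightarrow> L2 M (\<lambda>x. K (f x))"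
  using linear_bounded_pos[of K] L2_linear(1)[of K] by metis

lemma L2_scaleR: "L2 M f \<Longrightarrow> L2 M (\<lambda>x. c *\<^sub>R f x)"
  by (auto simp: L2_def power_mult_distrib)

lemma n2_scaleR: "n2 M (\<lambda>x. c *\<^sub>R f x) = c\<^sup>2 * n2 M f"
  by (simp add: n2_def power_mult_distrib)

lemma L2_uminus: "L2 M f \<Longrightarrow> L2 M (\<lambda>x. - f x)"
  by (auto simp: L2_def)

lemma L2_diff:
  assumes "L2 M f" "L2 M g"
  shows "L2 M (\<lambda>x. f x - g x)" "n2 M (\<lambda>x. f x - g x) \<le> 2 * n2 M f + 2 * n2 M g"
proof -
  have "n2 M (\<lambda>x. - g x) = n2 M g" by (simp add: n2_def)
  then show "L2 M (\<lambda>x. f x - g x)" "n2 M (\<lambda>x. f x - g x) \<le> 2 * n2 M f + 2 * n2 M g"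
    using L2_add[OF assms(1) L2_uminus[OF assms(2)]] by simp_all
qed

lemma L2_0 [simp]: "L2 M (\<lambda>_. 0)" by (simp add: L2_def)

lemma L2_sum: "(\<And>i. i \<in> I \<Longrightarrow> L2 M (f i)) \<Longrightarrow> L2 M (\<lambda>x. \<Sum>i\<in>I. f i x)"
  by (induction I rule: infinite_finite_induct) (auto intro: L2_add)

lemma L2_inner:
  assumes f: "L2 M f" and g: "L2 M g"
  shows "integrable M (\<lambda>x. f x \<bullet> g x)" "\<bar>\<integral>x. f x \<bullet> g x \<partial>M\<bar> \<le> sqrt (n2 M f) * sqrt (n2 M g)"
proof -
  have [measurable]: "f \<in> borel_measurable M" "g \<in> borel_measurable M" using f g by (auto simp: L2_def)
  show i: "integrable M (\<lambda>x. f x \<bullet> g x)"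
  proof (rule bi_bound)
    show "integrable M (\<lambda>x. (norm (f x))\<^sup>2 + (norm (g x))\<^sup>2)" using f g by (auto simp: L2_def)
    show "AE x in M. norm (f x \<bullet> g x) \<le> norm ((norm (f x))\<^sup>2 + (norm (g x))\<^sup>2)"
    proof (rule AE_I2)
      fix x
      have "\<bar>f x \<bullet> g x\<bar> \<le> norm (f x) * norm (g x)" by (rule Cauchy_Schwarz_ineq2)
      also have "\<dots> \<le> (norm (f x))\<^sup>2 + (norm (g x))\<^sup>2"
      proof -
        have "0 \<le> (norm (f x) - norm (g x))\<^sup>2 + (norm (f x))\<^sup>2 + (norm (g x))\<^sup>2" by simp
        then show ?thesis by (simp add: power2_diff)
      qed
      finally show "norm (f x \<bullet> g x) \<le> norm ((norm (f x))\<^sup>2 + (norm (g x))\<^sup>2)" by simp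
    qed
  qed simp
  let ?I = "\<integral>x. f x \<bullet> g x \<partial>M"
  have q: "0 \<le> n2 M f * s\<^sup>2 - 2 * s * ?I + n2 M g" for s
  proof -
    have fi: "integrable M (\<lambda>x. (norm (f x))\<^sup>2)" and gi: "integrable M (\<lambda>x. (norm (g x))\<^sup>2)"
      using f g by (auto simp: L2_def)
    have eq: "(norm (s *\<^sub>R f x - g x))\<^sup>2 = s\<^sup>2 * (norm (f x))\<^sup>2 - 2 * s * (f x \<bullet> g x) + (norm (g x))\<^sup>2" for x
      unfolding power2_norm_eq_inner by (simp add: algebra_simps inner_commute power2_eq_square)
    have "0 \<le> (\<integral>x. (norm (s *\<^sub>R f x - g x))\<^sup>2 \<partial>M)" by simp
    also have "\<dots> = s\<^sup>2 * n2 M f - 2 * s * ?I + n2 M g"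
      unfolding eq n2_def using fi gi i by simp
    finally show ?thesis by (simp add: mult.commute)
  qed
  have "?I\<^sup>2 \<le> n2 M f * n2 M g"
  proof (cases "n2 M f = 0")
    case True
    have "?I = 0"
    proof (rule ccontr)
      assume "?I \<noteq> 0"
      \<comment> \<open>The leading coefficient vanishes, so the polynomial is affine in s and takes
        the value -1 at this point.\<close>
      then show False using q[of "(n2 M g + 1) / (2 * ?I)"] True by (simp add: field_simps)
    qed
    then show ?thesis by simp
  next
    case False
    then have p: "n2 M f > 0" using n2_nonneg[of M f] by linarith
    have "0 \<le> n2 M f * (?I / n2 M f)\<^sup>2 - 2 * (?I / n2 M f) * ?I + n2 M g" by (rule q)
    also have "\<dots> = n2 M g - ?I\<^sup>2 / n2 M f" using p by (simp add: power2_eq_square field_simps)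
    finally show ?thesis using p by (simp add: field_simps)
  qed
  from real_sqrt_le_mono[OF this] show "\<bar>?I\<bar> \<le> sqrt (n2 M f) * sqrt (n2 M g)"
    by (simp add: real_sqrt_mult)
qed

lemma (in finite_measure) L2_const: "L2 M (\<lambda>_. c)"
  by (simp add: L2_def)

lemma (in finite_measure) L2_integrable:
  fixes f :: "'a \<Rightarrow> 'v::euclidean_space"
  assumes f: "L2 M f"
  shows "integrable M f" "(norm (\<integral>x. f x \<partial>M))\<^sup>2 \<le> measure M (space M) * n2 M f"
    "(\<integral>x. norm (f x) \<partial>M)\<^sup>2 \<le> measure M (space M) * n2 M f"
proof -
  have n: "L2 M (\<lambda>x. norm (f x))" using f by (auto simp: L2_def)
  note * = L2_inner[OF n L2_const[of "1 :: real"]]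
  have ni: "integrable M (\<lambda>x. norm (f x))" using *(1) by simp
  show i: "integrable M f" using ni f by (simp add: L2_def integrable_norm_iff)
  have "(\<integral>x. norm (f x) \<partial>M) \<le> sqrt (n2 M f * measure M (space M))"
    using *(2) by (simp add: n2_def real_sqrt_mult)
  then have "(\<integral>x. norm (f x) \<partial>M)\<^sup>2 \<le> (sqrt (n2 M f * measure M (space M)))\<^sup>2"
    by (intro power_mono) auto
  then show 2: "(\<integral>x. norm (f x) \<partial>M)\<^sup>2 \<le> measure M (space M) * n2 M f"
    by (simp add: mult.commute)
  have "(norm (\<integral>x. f x \<partial>M))\<^sup>2 \<le> (\<integral>x. norm (f x) \<partial>M)\<^sup>2"
    by (intro power_mono) auto
  with 2 show "(norm (\<integral>x. f x \<partial>M))\<^sup>2 \<le> measure M (space M) * n2 M f" by linarith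
qed

section \<open>Processes on a finite horizon\<close>

abbreviation leb :: "real \<Rightarrow> real measure" where
  "leb T \<equiv> restrict_space lborel {0..T}"

lemma finite_measure_leb: "finite_measure (leb T)"
  by (intro finite_measureI) (cases "0 \<le> T"; simp add: emeasure_restrict_space)

lemma sets_leb: "0 \<le> a \<Longrightarrow> b \<le> T \<Longrightarrow> {a..b} \<in> sets (leb T)"
  by (subst sets_restrict_space_iff) auto

lemma measure_leb: "0 \<le> T \<Longrightarrow> measure (leb T) (space (leb T)) = T"
  by (simp add: measure_restrict_space)

lemma integrable_leb:
  fixes f :: "real \<Rightarrow> 'b::euclidean_space"
  shows "integrable (leb T) f \<longleftrightarrow> set_integrable lborel {0..T} f"
  by (simp add: integrable_restrict_space set_integrable_def)

lemma set_integral_leb: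
  fixes f :: "real \<Rightarrow> 'b::euclidean_space"
  assumes "0 \<le> a" "b \<le> T"
  shows "(\<integral>s\<in>{a..b}. f s \<partial>lborel) = (\<integral>s. indicator {a..b} s *\<^sub>R f s \<partial>leb T)"
proof -
  have "indicator {a..b} s *\<^sub>R f s = indicator {0..T} s *\<^sub>R (indicator {a..b} s *\<^sub>R f s)" for s
    using assms by (auto simp: indicator_def)
  note eq = this
  show ?thesis unfolding set_lebesgue_integral_def
    by (subst integral_restrict_space) (simp, simp only: eq[symmetric])
qed

lemma set_integral_leb': "(prim f T) = (\<integral>s. f s \<partial>leb T)" for f :: "real \<Rightarrow> 'b::euclidean_space"
  unfolding set_lebesgue_integral_def by (subst integral_restrict_space) auto

lemma set_integrable_leb_sub:
  fixes f :: "real \<Rightarrow> 'b::euclidean_space"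
  assumes "integrable (leb T) f" "0 \<le> a" "b \<le> T"
  shows "set_integrable lborel {a..b} f"
  using assms unfolding integrable_leb by (auto intro: set_integrable_subset)

lemma has_integral_leb:
  fixes f :: "real \<Rightarrow> 'b::euclidean_space"
  assumes "integrable (leb T) f" "0 \<le> a" "b \<le> T"
  shows "(f has_integral (\<integral>s\<in>{a..b}. f s \<partial>lborel)) {a..b}"
  using set_borel_integral_eq_integral[OF set_integrable_leb_sub[OF assms]] by (auto simp: has_integral_integral)

lemma continuous_on_int_leb:
  fixes f :: "real \<Rightarrow> 'b::euclidean_space"
  assumes f: "integrable (leb T) f"
  shows "continuous_on {0..T} (\<lambda>t. \<integral>s\<in>{0..t}. f s \<partial>lborel)"
proof -
  have "f integrable_on {0..T}" using has_integral_leb[OF f, of 0 T] by auto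
  then have "continuous_on {0..T} (\<lambda>t. integral {0..t} f)" by (rule indefinite_integral_continuous_1)
  then show ?thesis
    by (rule continuous_on_eq) (use integral_unique[OF has_integral_leb[OF f]] in auto)
qed

lemma integrable_leb_continuous:
  fixes f :: "real \<Rightarrow> 'b::euclidean_space"
  shows "continuous_on {0..T} f \<Longrightarrow> integrable (leb T) f"
  unfolding integrable_leb by (rule borel_integrable_atLeastAtMost')

lemma measurable_leb_continuous:
  fixes f :: "real \<Rightarrow> 'b::euclidean_space"
  shows "continuous_on {0..T} f \<Longrightarrow> f \<in> borel_measurable (leb T)"
  using borel_measurable_integrable[OF integrable_leb_continuous] by blast

lemma L2_leb_continuous:
  fixes f :: "real \<Rightarrow> 'b::euclidean_space"
  assumes "continuous_on {0..T} f"
  shows "L2 (leb T) f"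
  unfolding L2_def using assms
  by (auto intro!: measurable_leb_continuous integrable_leb_continuous continuous_intros)

lemma L2_leb_iff_L2fun:
  fixes f :: "real \<Rightarrow> 'b::euclidean_space"
  assumes "f \<in> borel_measurable lborel"
  shows "L2 (leb T) f \<longleftrightarrow> f \<in> L2fun T"
proof -
  have "integrable (leb T) (\<lambda>x. (norm (f x))\<^sup>2) \<longleftrightarrow> (\<integral>\<^sup>+ t\<in>{0..T}. ennreal ((norm (f t))\<^sup>2) \<partial>lborel) < \<infinity>"
    using assms by (subst integrable_iff_bounded) (auto simp: nn_integral_restrict_space measurable_restrict_space1)
  then show ?thesis using assms by (auto simp: L2_def L2fun_def measurable_restrict_space1)
qed

lemma L2sq_eq_n2: "L2sq T f = n2 (leb T) f"
  by (simp add: L2sq_def n2_def set_integral_leb')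

lemma n2_primitive:
  fixes k :: "real \<Rightarrow> 'b::euclidean_space"
  assumes k: "L2 (leb T) k" and t: "t \<in> {0..T}"
  shows "(norm (prim k t))\<^sup>2 \<le> T * n2 (leb T) k"
proof -
  interpret finite_measure "leb T" by (rule finite_measure_leb)
  have ki: "integrable (leb T) (\<lambda>s. norm (k s))" using L2_integrable(1)[OF k] by auto
  have "norm (prim k t) \<le> (\<integral>s. norm (indicator {0..t} s *\<^sub>R k s) \<partial>leb T)"
    using t integral_norm_bound[of "leb T" "\<lambda>s. indicator {0..t} s *\<^sub>R k s"]
    by (simp only: set_integral_leb[of 0 t T] atLeastAtMost_iff order_refl)
  also have "\<dots> \<le> (\<integral>s. norm (k s) \<partial>leb T)"
    using ki by (intro integral_mono_AE' AE_I2) (auto simp: indicator_def)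
  finally have "(norm (prim k t))\<^sup>2 \<le> (\<integral>s. norm (k s) \<partial>leb T)\<^sup>2"
    by (intro power_mono) auto
  also have "\<dots> \<le> T * n2 (leb T) k" using L2_integrable(3)[OF k] measure_leb[of T] t by simp
  finally show ?thesis .
qed

text \<open>Fubini on the triangle s \<le> r for the integrand \<alpha>(r) . k(s). Controls are
  merely integrable in time, so \<open>a\<close> and \<theta> are specified through their densities,
  \<open>a\<close> backward from its terminal value and \<theta> forward from 0.\<close>

lemma integral_by_parts_L1:
  fixes \<alpha> k a \<theta> :: "real \<Rightarrow> 'b::euclidean_space"
  assumes T: "0 \<le> T" and \<alpha>: "integrable (leb T) \<alpha>" and k: "integrable (leb T) k"
    and a: "\<And>s. s \<in> {0..T} \<Longrightarrow> a s = aT - (\<integral>r\<in>{s..T}. \<alpha> r \<partial>lborel)"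
    and \<theta>: "\<And>r. r \<in> {0..T} \<Longrightarrow> \<theta> r = (prim k r)"
  shows "integrable (leb T) (\<lambda>s. a s \<bullet> k s)" "integrable (leb T) (\<lambda>s. \<alpha> s \<bullet> \<theta> s)"
    "(\<integral>s. a s \<bullet> k s \<partial>leb T) + (\<integral>s. \<alpha> s \<bullet> \<theta> s \<partial>leb T) = aT \<bullet> \<theta> T"
proof -
  interpret l: finite_measure "leb T" by (rule finite_measure_leb)
  interpret p: pair_sigma_finite "leb T" "leb T" ..
  have [measurable]: "\<alpha> \<in> borel_measurable (leb T)" "k \<in> borel_measurable (leb T)" using \<alpha> k by auto
  have [measurable]: "fst \<in> borel_measurable (leb T \<Otimes>\<^sub>M leb T)" "snd \<in> borel_measurable (leb T \<Otimes>\<^sub>M leb T)"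
    by (auto intro: measurable_compose[OF measurable_fst] measurable_compose[OF measurable_snd] simp: measurable_restrict_space1)
  define f where "f s r = (if s \<le> r then \<alpha> r \<bullet> k s else 0)" for s r
  have fm: "case_prod f \<in> borel_measurable (leb T \<Otimes>\<^sub>M leb T)"
    unfolding f_def split_beta' by measurable
  have nk: "integrable (leb T) (\<lambda>s. norm (k s))" and na: "integrable (leb T) (\<lambda>s. norm (\<alpha> s))" using k \<alpha> by auto
  have fi: "integrable (leb T \<Otimes>\<^sub>M leb T) (case_prod f)"
  proof (rule bi_bound)
    show "integrable (leb T \<Otimes>\<^sub>M leb T) (\<lambda>(s, r). norm (k s) * norm (\<alpha> r))"
      using nk na by (intro p.Fubini_integrable) auto
    show "AE x in leb T \<Otimes>\<^sub>M leb T. norm (case_prod f x) \<le> norm (case x of (s, r) \<Rightarrow> norm (k s) * norm (\<alpha> r))"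
      by (intro AE_I2) (auto simp: f_def Cauchy_Schwarz_ineq2 mult.commute)
  qed (rule fm)
  have inner1: "(\<integral>r. f s r \<partial>leb T) = (\<integral>r\<in>{s..T}. \<alpha> r \<partial>lborel) \<bullet> k s" if "s \<in> {0..T}" for s
  proof -
    have "(\<integral>r. f s r \<partial>leb T) = (\<integral>r. (indicator {s..T} r *\<^sub>R \<alpha> r) \<bullet> k s \<partial>leb T)"
      by (intro bint_cong) (auto simp: f_def indicator_def)
    also have "\<dots> = (\<integral>r. indicator {s..T} r *\<^sub>R \<alpha> r \<partial>leb T) \<bullet> k s"
      using \<alpha> that by (intro integral_inner_left) (auto intro!: integrable_mult_indicator sets_leb)
    finally show ?thesis using that set_integral_leb[of s T T \<alpha>] by simp
  qed
  have inner2: "(\<integral>s. f s r \<partial>leb T) = \<alpha> r \<bullet> \<theta> r" if "r \<in> {0..T}" for r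
  proof -
    have "(\<integral>s. f s r \<partial>leb T) = (\<integral>s. \<alpha> r \<bullet> (indicator {0..r} s *\<^sub>R k s) \<partial>leb T)"
      by (intro bint_cong) (auto simp: f_def indicator_def)
    also have "\<dots> = \<alpha> r \<bullet> (\<integral>s. indicator {0..r} s *\<^sub>R k s \<partial>leb T)"
      using k that by (intro integral_inner_right) (auto intro!: integrable_mult_indicator sets_leb)
    finally show ?thesis using that set_integral_leb[of 0 r T k] by (simp add: \<theta>)
  qed
  have i1: "integrable (leb T) (\<lambda>s. \<integral>r. f s r \<partial>leb T)" by (rule p.integrable_fst[OF fi])
  have i2: "integrable (leb T) (\<lambda>r. \<integral>s. f s r \<partial>leb T)" by (rule p.integrable_snd[OF fi])
  show "integrable (leb T) (\<lambda>s. \<alpha> s \<bullet> \<theta> s)"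
    by (rule Bochner_Integration.integrable_cong[THEN iffD1, OF refl _ i2]) (simp add: inner2)
  have ak: "a s \<bullet> k s = aT \<bullet> k s - (\<integral>r. f s r \<partial>leb T)" if "s \<in> {0..T}" for s
    using that by (simp add: inner1 a inner_diff_left)
  have kk: "integrable (leb T) (\<lambda>s. aT \<bullet> k s)" using k by auto
  show "integrable (leb T) (\<lambda>s. a s \<bullet> k s)"
    by (rule Bochner_Integration.integrable_cong[THEN iffD1, OF refl _ bi_diff[OF kk i1]])
       (simp add: ak)
  have "(\<integral>s. a s \<bullet> k s \<partial>leb T) = (\<integral>s. aT \<bullet> k s - (\<integral>r. f s r \<partial>leb T) \<partial>leb T)"
    by (rule bint_cong) (auto simp: ak)
  also have "\<dots> = aT \<bullet> (\<integral>s. k s \<partial>leb T) - (\<integral>s. (\<integral>r. f s r \<partial>leb T) \<partial>leb T)"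
    using kk i1 k by simp
  also have "(\<integral>s. (\<integral>r. f s r \<partial>leb T) \<partial>leb T) = (\<integral>r. (\<integral>s. f s r \<partial>leb T) \<partial>leb T)"
    by (rule p.Fubini_integral[OF fi, symmetric])
  also have "\<dots> = (\<integral>r. \<alpha> r \<bullet> \<theta> r \<partial>leb T)"
    by (rule bint_cong) (auto simp: inner2)
  finally show "(\<integral>s. a s \<bullet> k s \<partial>leb T) + (\<integral>s. \<alpha> s \<bullet> \<theta> s \<partial>leb T) = aT \<bullet> \<theta> T"
    using \<theta>[of T] T by (simp add: set_integral_leb')
qed

text \<open>The moving upper limit is turned into a factor of the integrand on a fixed interval. As
  t and F are arbitrary, this also shows that primitives of progressively measurable processes are
  progressively measurable.\<close>

lemma measurable_primitive:
  fixes u :: "real \<Rightarrow> 'w \<Rightarrow> 'b::euclidean_space"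
  assumes u: "(\<lambda>(s, \<omega>). u s \<omega>) \<in> borel_measurable (leb t \<Otimes>\<^sub>M F)"
  shows "(\<lambda>(s, \<omega>). \<integral>r\<in>{0..s}. u r \<omega> \<partial>lborel) \<in> borel_measurable (leb t \<Otimes>\<^sub>M F)"
proof -
  interpret l: finite_measure "leb t" by (rule finite_measure_leb)
  have [measurable]: "(\<lambda>q. u (snd q) (snd (fst q))) \<in> borel_measurable ((leb t \<Otimes>\<^sub>M F) \<Otimes>\<^sub>M leb t)"
  proof -
    have "(\<lambda>q. (snd q, snd (fst q))) \<in> measurable ((leb t \<Otimes>\<^sub>M F) \<Otimes>\<^sub>M leb t) (leb t \<Otimes>\<^sub>M F)" by measurable
    from measurable_compose[OF this u] show ?thesis by simp
  qed
  have [measurable]: "(\<lambda>q. snd q) \<in> borel_measurable ((leb t \<Otimes>\<^sub>M F) \<Otimes>\<^sub>M leb t)"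
     "(\<lambda>q. fst (fst q)) \<in> borel_measurable ((leb t \<Otimes>\<^sub>M F) \<Otimes>\<^sub>M leb t)"
    by (auto intro!: measurable_compose[OF measurable_snd] measurable_compose[OF measurable_fst]
        measurable_compose[OF measurable_fst[of "leb t" F]] simp: measurable_restrict_space1)
  have "(\<lambda>p. \<integral>r. (if r \<le> fst p then u r (snd p) else 0) \<partial>leb t) \<in> borel_measurable (leb t \<Otimes>\<^sub>M F)"
    by (rule l.borel_measurable_lebesgue_integral) (simp add: split_beta')
  moreover have "(\<integral>r. (if r \<le> fst p then u r (snd p) else 0) \<partial>leb t) = (case p of (s, \<omega>) \<Rightarrow> \<integral>r\<in>{0..s}. u r \<omega> \<partial>lborel)"
    if p: "p \<in> space (leb t \<Otimes>\<^sub>M F)" for p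
  proof -
    obtain s \<omega> where s: "p = (s, \<omega>)" "s \<in> {0..t}" using p by (auto simp: space_pair_measure)
    then show ?thesis
      by (auto simp: set_integral_leb[of 0 s t] indicator_def intro!: bint_cong)
  qed
  ultimately show ?thesis by (simp cong: measurable_cong)
qed

lemma fubini_sections_L2:
  fixes u :: "'x \<Rightarrow> 'y \<Rightarrow> 'v::euclidean_space"
  assumes "sigma_finite_measure M" "sigma_finite_measure N"
    and u: "L2 (M \<Otimes>\<^sub>M N) (\<lambda>p. u (fst p) (snd p))"
  shows "AE x in M. L2 N (u x)" "integrable M (\<lambda>x. n2 N (u x))"
    "(\<integral>x. n2 N (u x) \<partial>M) = n2 (M \<Otimes>\<^sub>M N) (\<lambda>p. u (fst p) (snd p))"
    "AE y in N. L2 M (\<lambda>x. u x y)" "integrable N (\<lambda>y. n2 M (\<lambda>x. u x y))"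
    "(\<integral>y. n2 M (\<lambda>x. u x y) \<partial>N) = n2 (M \<Otimes>\<^sub>M N) (\<lambda>p. u (fst p) (snd p))"
proof -
  interpret M: sigma_finite_measure M by fact
  interpret N: sigma_finite_measure N by fact
  interpret p: pair_sigma_finite M N ..
  have m: "(\<lambda>p. u (fst p) (snd p)) \<in> borel_measurable (M \<Otimes>\<^sub>M N)" using u by (simp add: L2_def)
  have mx: "u x \<in> borel_measurable N" if "x \<in> space M" for x
    using measurable_compose[OF measurable_Pair1'[OF that] m] by simp
  have my: "(\<lambda>x. u x y) \<in> borel_measurable M" if "y \<in> space N" for y
    using measurable_compose[OF measurable_Pair2'[OF that] m] by simp
  have i: "integrable (M \<Otimes>\<^sub>M N) (case_prod (\<lambda>x y. (norm (u x y))\<^sup>2))"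
    using u by (simp add: L2_def split_beta')
  show "AE x in M. L2 N (u x)"
    using p.AE_integrable_fst[OF i] by (rule AE_mp) (auto simp: L2_def mx)
  show "AE y in N. L2 M (\<lambda>x. u x y)"
    using p.AE_integrable_snd[OF i] by (rule AE_mp) (auto simp: L2_def my)
  show "integrable M (\<lambda>x. n2 N (u x))" unfolding n2_def by (rule p.integrable_fst[OF i])
  show "integrable N (\<lambda>y. n2 M (\<lambda>x. u x y))" unfolding n2_def by (rule p.integrable_snd[OF i])
  show "(\<integral>x. n2 N (u x) \<partial>M) = n2 (M \<Otimes>\<^sub>M N) (\<lambda>p. u (fst p) (snd p))"
    using p.integral_fst[OF i] by (simp add: n2_def split_beta')
  show "(\<integral>y. n2 M (\<lambda>x. u x y) \<partial>N) = n2 (M \<Otimes>\<^sub>M N) (\<lambda>p. u (fst p) (snd p))"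
    using p.integral_snd[OF i] by (simp add: n2_def split_beta')
qed

lemma measurable_pair_subalgebra:
  assumes "subalgebra M F" and f: "f \<in> borel_measurable (N \<Otimes>\<^sub>M F)"
  shows "f \<in> borel_measurable (N \<Otimes>\<^sub>M M)"
proof -
  have "(\<lambda>x. x) \<in> measurable M F" using assms(1) by (auto simp: measurable_def subalgebra_def dest: sets.sets_into_space)
  then have "(\<lambda>p. (fst p, snd p)) \<in> measurable (N \<Otimes>\<^sub>M M) (N \<Otimes>\<^sub>M F)"
    by (intro measurable_Pair measurable_fst) (rule measurable_compose[OF measurable_snd])
  from measurable_compose[OF this f] show ?thesis by simp
qed

section \<open>Square-integrable processes on the product of [0,T] and the probability space\<close>

locale horizon = prob_space \<Omega> for \<Omega> :: "'w measure" +
  fixes T :: real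
  assumes T_pos: "T > 0"
begin

abbreviation "PP \<equiv> leb T \<Otimes>\<^sub>M \<Omega>"

abbreviation L2p :: "(real \<Rightarrow> 'w \<Rightarrow> 'v::euclidean_space) \<Rightarrow> bool" where
  "L2p u \<equiv> L2 PP (\<lambda>p. u (fst p) (snd p))"

abbreviation n2p :: "(real \<Rightarrow> 'w \<Rightarrow> 'v::euclidean_space) \<Rightarrow> real" where
  "n2p u \<equiv> n2 PP (\<lambda>p. u (fst p) (snd p))"

sublocale leb: finite_measure "leb T" by (rule finite_measure_leb)
sublocale P: pair_sigma_finite "leb T" \<Omega> ..

lemma T_in [simp]: "T \<in> {0..T}" "0 \<in> {0..T}" "0 \<le> T" using T_pos by auto

lemma finite_PP: "finite_measure PP"
proof (rule finite_measureI)
  have "emeasure PP (space PP) = emeasure (leb T) (space (leb T)) * emeasure \<Omega> (space \<Omega>)"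
    by (simp add: space_pair_measure emeasure_pair_measure_Times del: space_restrict_space2)
  then show "emeasure PP (space PP) \<noteq> \<infinity>"
    using leb.emeasure_finite by (simp add: emeasure_space_1)
qed

lemmas sections = fubini_sections_L2[OF leb.sigma_finite_measure_axioms sigma_finite_measure_axioms]

lemma AE_snd_PP:
  assumes "AE \<omega> in \<Omega>. Q \<omega>"
  shows "AE p in PP. Q (snd p)"
proof -
  obtain N where N: "N \<in> null_sets \<Omega>" "{\<omega> \<in> space \<Omega>. \<not> Q \<omega>} \<subseteq> N"
    using assms by (auto elim!: AE_E intro: null_setsI)
  have "space (leb T) \<times> N \<in> null_sets PP"
    using N by (auto simp: null_sets_def emeasure_pair_measure_Times simp del: space_restrict_space2)
  moreover have "{p \<in> space PP. \<not> Q (snd p)} \<subseteq> space (leb T) \<times> N"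
    using N by (auto simp: space_pair_measure)
  ultimately show ?thesis by (rule AE_I')
qed

lemma AE_PP_ball:
  assumes "AE \<omega> in \<Omega>. \<forall>t\<in>{0..T}. Q t \<omega>"
  shows "AE p in PP. Q (fst p) (snd p)"
  using AE_snd_PP[OF assms] by (rule AE_mp) (auto simp: space_pair_measure)

lemma integrable_snd_PP:
  assumes "integrable \<Omega> f"
  shows "integrable PP (\<lambda>p. f (snd p) :: 'v::euclidean_space)" "(\<integral>p. f (snd p) \<partial>PP) = T *\<^sub>R (\<integral>\<omega>. f \<omega> \<partial>\<Omega>)"
proof -
  have [measurable]: "f \<in> borel_measurable \<Omega>" using assms by auto
  show i: "integrable PP (\<lambda>p. f (snd p))"
    by (rule P.Fubini_integrable) (use assms in auto)
  have "(\<integral>p. f (snd p) \<partial>PP) = (\<integral>s. (\<integral>\<omega>. f \<omega> \<partial>\<Omega>) \<partial>leb T)"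
    using P.integral_fst[of "\<lambda>s \<omega>. f \<omega>"] i by (simp add: split_beta')
  then show "(\<integral>p. f (snd p) \<partial>PP) = T *\<^sub>R (\<integral>\<omega>. f \<omega> \<partial>\<Omega>)" using measure_leb[of T] T_in by simp
qed

lemma integrable_fst_PP:
  assumes "integrable (leb T) f"
  shows "integrable PP (\<lambda>p. f (fst p) :: 'v::euclidean_space)" "(\<integral>p. f (fst p) \<partial>PP) = (\<integral>s. f s \<partial>leb T)"
proof -
  have [measurable]: "f \<in> borel_measurable (leb T)" using assms by auto
  show i: "integrable PP (\<lambda>p. f (fst p))"
    by (rule P.Fubini_integrable) (use assms in \<open>auto simp: prob_space\<close>)
  show "(\<integral>p. f (fst p) \<partial>PP) = (\<integral>s. f s \<partial>leb T)"
    using P.integral_fst[of "\<lambda>s \<omega>. f s"] i by (simp add: split_beta' prob_space)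
qed

lemma L2p_fst:
  assumes f: "L2 (leb T) f"
  shows "L2p (\<lambda>s \<omega>. f s)" "n2p (\<lambda>s \<omega>. f s) = n2 (leb T) f"
proof -
  have [measurable]: "f \<in> borel_measurable (leb T)" using f by (simp add: L2_def)
  show "L2p (\<lambda>s \<omega>. f s)" "n2p (\<lambda>s \<omega>. f s) = n2 (leb T) f"
    using integrable_fst_PP[of "\<lambda>s. (norm (f s))\<^sup>2"] f by (auto simp: L2_def n2_def)
qed

lemma L2p_snd:
  assumes f: "L2 \<Omega> f"
  shows "L2p (\<lambda>s \<omega>. f \<omega>)" "n2p (\<lambda>s \<omega>. f \<omega>) = T * n2 \<Omega> f"
proof -
  have [measurable]: "f \<in> borel_measurable \<Omega>" using f by (simp add: L2_def)
  show "L2p (\<lambda>s \<omega>. f \<omega>)" "n2p (\<lambda>s \<omega>. f \<omega>) = T * n2 \<Omega> f"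
    using integrable_snd_PP[of "\<lambda>s. (norm (f s))\<^sup>2"] f by (auto simp: L2_def n2_def)
qed

lemma L2p_from_sq_integrable:
  fixes u :: "real \<Rightarrow> 'w \<Rightarrow> 'v::euclidean_space"
  assumes m: "(\<lambda>p. u (fst p) (snd p)) \<in> borel_measurable PP" and s: "sq_integrable \<Omega> T u"
  shows "L2p u"
  unfolding L2_def
proof (intro conjI m)
  have [measurable]: "(\<lambda>p. u (fst p) (snd p)) \<in> borel_measurable PP" by fact
  show "integrable PP (\<lambda>p. (norm (u (fst p) (snd p)))\<^sup>2)"
  proof (rule integrableI_bounded)
    have "(\<integral>\<^sup>+ p. ennreal (norm ((norm (u (fst p) (snd p)))\<^sup>2)) \<partial>PP)
        = (\<integral>\<^sup>+ \<omega>. \<integral>\<^sup>+ s. ennreal ((norm (u s \<omega>))\<^sup>2) \<partial>leb T \<partial>\<Omega>)"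
      by (subst P.nn_integral_snd[symmetric]) (simp_all)
    also have "\<dots> < \<infinity>" using s unfolding sq_integrable_def
      by (simp add: nn_integral_restrict_space)
    finally show "(\<integral>\<^sup>+ p. ennreal (norm ((norm (u (fst p) (snd p)))\<^sup>2)) \<partial>PP) < \<infinity>" .
  qed measurable
qed

lemma section_measurable:
  assumes "(\<lambda>p. u (fst p) (snd p)) \<in> borel_measurable PP" "t \<in> {0..T}"
  shows "u t \<in> borel_measurable \<Omega>"
  using measurable_compose[OF measurable_Pair1'[of t "leb T" \<Omega>] assms(1)] assms(2) by simp

lemma L2p_paths: "L2p u \<Longrightarrow> AE \<omega> in \<Omega>. integrable (leb T) (\<lambda>s. u s \<omega>)"
  using sections(4)[of u] by (rule eventually_mono) (auto intro: leb.L2_integrable)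

lemma L2p_integrable_section: "L2p u \<Longrightarrow> AE s in leb T. integrable \<Omega> (u s)"
  using sections(1)[of u] by (rule eventually_mono) (auto intro: L2_integrable)

lemma L2p_integrable: "L2p u \<Longrightarrow> integrable PP (\<lambda>p. u (fst p) (snd p))"
  using finite_measure.L2_integrable(1)[OF finite_PP] .

lemma mean_L2:
  fixes u :: "real \<Rightarrow> 'w \<Rightarrow> 'v::euclidean_space"
  assumes u: "L2p u"
  shows "L2 (leb T) (\<lambda>s. expectation (u s))" "n2 (leb T) (\<lambda>s. expectation (u s)) \<le> n2p u"
proof -
  have m: "(\<lambda>s. expectation (u s)) \<in> borel_measurable (leb T)"
    using P.integrable_fst[of u] L2p_integrable[OF u] by (auto simp: split_beta')
  have "AE s in leb T. (norm (expectation (u s)))\<^sup>2 \<le> n2 \<Omega> (u s)"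
    using sections(1)[OF u] by (rule AE_mp) (use L2_integrable(2) in \<open>auto simp: prob_space\<close>)
  from L2_dominated[OF m sections(2)[OF u] this] sections(3)[OF u]
  show "L2 (leb T) (\<lambda>s. expectation (u s))" "n2 (leb T) (\<lambda>s. expectation (u s)) \<le> n2p u" by auto
qed

lemma mean_primitive:
  fixes u :: "real \<Rightarrow> 'w \<Rightarrow> 'v::euclidean_space"
  assumes u: "L2p u" and t: "t \<in> {0..T}"
  shows "integrable \<Omega> (\<lambda>\<omega>. \<integral>s\<in>{0..t}. u s \<omega> \<partial>lborel)"
    "expectation (\<lambda>\<omega>. \<integral>s\<in>{0..t}. u s \<omega> \<partial>lborel) = (prim (\<lambda>s. expectation (u s)) t)"
proof -
  have i: "integrable PP (case_prod (\<lambda>s \<omega>. indicator {0..t} s *\<^sub>R u s \<omega>))"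
  proof (rule bi_bound[OF L2p_integrable[OF u]])
    have [measurable]: "(\<lambda>p. u (fst p) (snd p)) \<in> borel_measurable PP" using u by (simp add: L2_def)
    have [measurable]: "{0..t} \<in> sets (leb T)" using t by (intro sets_leb) auto
    show "case_prod (\<lambda>s \<omega>. indicator {0..t} s *\<^sub>R u s \<omega>) \<in> borel_measurable PP"
      unfolding split_beta' by measurable
  qed (auto simp: indicator_def)
  have eq: "(prim v t) = (\<integral>s. indicator {0..t} s *\<^sub>R v s \<partial>leb T)" for v :: "real \<Rightarrow> 'v"
    using t by (intro set_integral_leb) auto
  show "integrable \<Omega> (\<lambda>\<omega>. \<integral>s\<in>{0..t}. u s \<omega> \<partial>lborel)"
    unfolding eq by (rule P.integrable_snd[OF i])
  show "expectation (\<lambda>\<omega>. \<integral>s\<in>{0..t}. u s \<omega> \<partial>lborel) = (prim (\<lambda>s. expectation (u s)) t)"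
    unfolding eq using P.Fubini_integral[OF i] by simp
qed

text \<open>Almost every path of the primitive is bounded uniformly in t by the L2 norm of the path
  of u. Hence, in contrast to u, the primitive is square integrable at every fixed time, in
  particular at T.\<close>

lemma primitive_L2:
  fixes u :: "real \<Rightarrow> 'w \<Rightarrow> 'v::euclidean_space"
  assumes u: "L2p u"
  shows "L2p (\<lambda>t \<omega>. \<integral>s\<in>{0..t}. u s \<omega> \<partial>lborel)"
    "n2p (\<lambda>t \<omega>. \<integral>s\<in>{0..t}. u s \<omega> \<partial>lborel) \<le> T\<^sup>2 * n2p u"
    "t \<in> {0..T} \<Longrightarrow> L2 \<Omega> (\<lambda>\<omega>. \<integral>s\<in>{0..t}. u s \<omega> \<partial>lborel)"
    "t \<in> {0..T} \<Longrightarrow> n2 \<Omega> (\<lambda>\<omega>. \<integral>s\<in>{0..t}. u s \<omega> \<partial>lborel) \<le> T * n2p u"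
proof -
  let ?U = "\<lambda>t \<omega>. \<integral>s\<in>{0..t}. u s \<omega> \<partial>lborel"
  have um: "(\<lambda>(s, \<omega>). u s \<omega>) \<in> borel_measurable PP" using u by (simp add: L2_def split_beta')
  have m: "(\<lambda>p. ?U (fst p) (snd p)) \<in> borel_measurable PP"
    using measurable_primitive[OF um] by (simp add: split_beta')
  have le: "AE \<omega> in \<Omega>. \<forall>t\<in>{0..T}. (norm (?U t \<omega>))\<^sup>2 \<le> T * n2 (leb T) (\<lambda>s. u s \<omega>)"
    using sections(4)[OF u] by eventually_elim (auto intro: n2_primitive)
  have i: "integrable \<Omega> (\<lambda>\<omega>. T * n2 (leb T) (\<lambda>s. u s \<omega>))" using sections(5)[OF u] by auto
  have "AE p in PP. (norm (?U (fst p) (snd p)))\<^sup>2 \<le> T * n2 (leb T) (\<lambda>s. u s (snd p))"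
    by (rule AE_PP_ball[OF le])
  from L2_dominated[OF m integrable_snd_PP(1)[OF i] this] integrable_snd_PP(2)[OF i] sections(6)[OF u]
  show "L2p ?U" "n2p ?U \<le> T\<^sup>2 * n2p u" by (auto simp: power2_eq_square mult.assoc)
  assume t: "t \<in> {0..T}"
  have "AE \<omega> in \<Omega>. (norm (?U t \<omega>))\<^sup>2 \<le> T * n2 (leb T) (\<lambda>s. u s \<omega>)"
    using le by (rule AE_mp) (use t in auto)
  from L2_dominated[OF section_measurable[OF m t] i this] sections(6)[OF u]
  show "L2 \<Omega> (?U t)" "n2 \<Omega> (?U t) \<le> T * n2p u" by auto
qed

lemma ie_L2_bound:
  fixes K :: "'a::euclidean_space \<Rightarrow> 'a"
  assumes K: "linear K"
  obtains C where "C > 0"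
    "\<And>c z. L2p c \<Longrightarrow> L2 \<Omega> (c T) \<Longrightarrow> (\<lambda>p. z (fst p) (snd p)) \<in> borel_measurable PP \<Longrightarrow>
      (AE \<omega> in \<Omega>. ie_sol K T (\<lambda>t. c t \<omega>) (\<lambda>t. z t \<omega>)) \<Longrightarrow>
      L2p z \<and> n2p z \<le> C * n2p c \<and> L2 \<Omega> (z T) \<and> n2 \<Omega> (z T) \<le> C * (n2p c + n2 \<Omega> (c T))"
proof -
  obtain C where C: "C > 0"
    "\<And>c z t. ie_sol K T c z \<Longrightarrow> t \<in> {0..T} \<Longrightarrow>
       norm (z t) \<le> norm (c t) + C * (prim (\<lambda>s. norm (c s)) T)"
    using ie_sol_bound[OF K] by blast
  \<comment> \<open>The summand 2 comes from |a+b|^2 \<le> 2|a|^2 + 2|b|^2; Cauchy-Schwarz on [0,T]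
    gives 2 C^2 T for the value at T, and a further integration over time gives 2 C^2 T^2.\<close>
  define D where "D = 2 + 2 * C\<^sup>2 * T + 2 * C\<^sup>2 * T\<^sup>2"
  have D: "D > 0" unfolding D_def by (intro add_pos_nonneg) auto
  have main: "L2p z \<and> n2p z \<le> D * n2p c \<and> L2 \<Omega> (z T) \<and> n2 \<Omega> (z T) \<le> D * (n2p c + n2 \<Omega> (c T))"
    if c: "L2p c" "L2 \<Omega> (c T)" and zm: "(\<lambda>p. z (fst p) (snd p)) \<in> borel_measurable PP"
      and ie: "AE \<omega> in \<Omega>. ie_sol K T (\<lambda>t. c t \<omega>) (\<lambda>t. z t \<omega>)" for c z
  proof -
    let ?J = "\<lambda>\<omega>. n2 (leb T) (\<lambda>s. c s \<omega>)"
    have Ji: "integrable \<Omega> (\<lambda>\<omega>. (2 * C\<^sup>2 * T) * ?J \<omega>)" using sections(5)[OF c(1)] by auto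
    have le: "AE \<omega> in \<Omega>. \<forall>t\<in>{0..T}. (norm (z t \<omega>))\<^sup>2 \<le> 2 * (norm (c t \<omega>))\<^sup>2 + (2 * C\<^sup>2 * T) * ?J \<omega>"
      using ie sections(4)[OF c(1)]
    proof eventually_elim
      case (elim \<omega>)
      show ?case
      proof
        fix t assume t: "t \<in> {0..T}"
        let ?I = "\<integral>s\<in>{0..T}. norm (c s \<omega>) \<partial>lborel"
        have I: "?I\<^sup>2 \<le> T * ?J \<omega>"
          using leb.L2_integrable(3)[OF elim(2)] measure_leb[of T] by (simp add: set_integral_leb')
        have "(norm (z t \<omega>))\<^sup>2 \<le> (norm (c t \<omega>) + C * ?I)\<^sup>2"
          using C(2)[OF elim(1) t] by (intro power_mono) auto
        also have "\<dots> \<le> 2 * (norm (c t \<omega>))\<^sup>2 + 2 * (C * ?I)\<^sup>2"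
          using norm_add_sq_le[of "norm (c t \<omega>)" "C * ?I"] by simp
        also have "\<dots> = 2 * (norm (c t \<omega>))\<^sup>2 + 2 * C\<^sup>2 * ?I\<^sup>2" by (simp add: power_mult_distrib)
        also have "\<dots> \<le> 2 * (norm (c t \<omega>))\<^sup>2 + 2 * C\<^sup>2 * (T * ?J \<omega>)"
          using I by (intro add_left_mono mult_left_mono) auto
        finally show "(norm (z t \<omega>))\<^sup>2 \<le> 2 * (norm (c t \<omega>))\<^sup>2 + (2 * C\<^sup>2 * T) * ?J \<omega>" by (simp add: mult.assoc)
      qed
    qed
    have ci: "integrable PP (\<lambda>p. 2 * (norm (c (fst p) (snd p)))\<^sup>2)" using c(1) by (auto simp: L2_def)
    have cT: "integrable \<Omega> (\<lambda>\<omega>. 2 * (norm (c T \<omega>))\<^sup>2)" using c(2) by (auto simp: L2_def)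
    note 1 = L2_dominated[OF zm bi_add[OF ci integrable_snd_PP(1)[OF Ji]] AE_PP_ball[OF le]]
    have b1: "n2p z \<le> 2 * n2p c + T * ((2 * C\<^sup>2 * T) * n2p c)"
    proof -
      have "n2p z \<le> (\<integral>p. 2 * (norm (c (fst p) (snd p)))\<^sup>2 \<partial>PP) + (\<integral>p. (2 * C\<^sup>2 * T) * ?J (snd p) \<partial>PP)"
        using 1(2) bint_add[OF ci integrable_snd_PP(1)[OF Ji]] by simp
      also have "(\<integral>p. 2 * (norm (c (fst p) (snd p)))\<^sup>2 \<partial>PP) = 2 * n2p c" by (simp add: n2_def)
      also have "(\<integral>p. (2 * C\<^sup>2 * T) * ?J (snd p) \<partial>PP) = T * ((2 * C\<^sup>2 * T) * n2p c)"
        unfolding integrable_snd_PP(2)[OF Ji] using sections(6)[OF c(1)] by simp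
      finally show ?thesis .
    qed
    have leT: "AE \<omega> in \<Omega>. (norm (z T \<omega>))\<^sup>2 \<le> 2 * (norm (c T \<omega>))\<^sup>2 + (2 * C\<^sup>2 * T) * ?J \<omega>"
      using le by (rule AE_mp) auto
    note 2 = L2_dominated[OF section_measurable[OF zm T_in(1)] bi_add[OF cT Ji] leT]
    have b2: "n2 \<Omega> (z T) \<le> 2 * n2 \<Omega> (c T) + (2 * C\<^sup>2 * T) * n2p c"
      using 2(2) bint_add[OF cT Ji] sections(6)[OF c(1)] by (simp add: n2_def)
    have "0 \<le> C\<^sup>2 * T * n2p c" "0 \<le> C\<^sup>2 * T * n2 \<Omega> (c T)" "0 \<le> C\<^sup>2 * T\<^sup>2 * n2 \<Omega> (c T)" "0 \<le> C\<^sup>2 * T\<^sup>2 * n2p c"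
      using T_in by auto
    moreover have "0 \<le> n2p c" "0 \<le> n2 \<Omega> (c T)" by simp_all
    moreover have "T * ((2 * C\<^sup>2 * T) * n2p c) = 2 * (C\<^sup>2 * T\<^sup>2 * n2p c)" by (simp add: power2_eq_square)
    moreover have "D * n2p c = 2 * n2p c + 2 * (C\<^sup>2 * T * n2p c) + 2 * (C\<^sup>2 * T\<^sup>2 * n2p c)"
      "D * (n2p c + n2 \<Omega> (c T)) = 2 * n2p c + 2 * (C\<^sup>2 * T * n2p c) + 2 * (C\<^sup>2 * T\<^sup>2 * n2p c)
         + 2 * n2 \<Omega> (c T) + 2 * (C\<^sup>2 * T * n2 \<Omega> (c T)) + 2 * (C\<^sup>2 * T\<^sup>2 * n2 \<Omega> (c T))"
      by (simp_all add: D_def algebra_simps)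
    moreover have "(2 * C\<^sup>2 * T) * n2p c = 2 * (C\<^sup>2 * T * n2p c)" by simp
    ultimately have "n2p z \<le> D * n2p c" "n2 \<Omega> (z T) \<le> D * (n2p c + n2 \<Omega> (c T))" using b1 b2 by linarith+
    with 1(1) 2(1) show ?thesis by blast
  qed
  show ?thesis by (rule that[OF D]) (rule main; assumption)
qed

end

section \<open>Filtrations of the Brownian family\<close>

text \<open>Vanishing on all events of F says that the conditional expectation of \<Delta> given F
  is zero. This passes from indicators to every F-measurable \<psi> whose product with \<Delta> is
  integrable, without boundedness of \<psi>.\<close>

lemma (in prob_space) integral_mult_eq_0_if_orthogonal:
  fixes \<Delta> \<psi> :: "'a \<Rightarrow> real"
  assumes F: "subalgebra M F" and \<Delta>: "integrable M \<Delta>"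
    and 0: "\<And>E. E \<in> sets F \<Longrightarrow> (\<integral>x. \<Delta> x * indicator E x \<partial>M) = 0"
    and \<psi>: "\<psi> \<in> borel_measurable F" and i: "integrable M (\<lambda>x. \<psi> x * \<Delta> x)"
  shows "(\<integral>x. \<psi> x * \<Delta> x \<partial>M) = 0"
proof -
  interpret finite_measure_subalgebra M F by unfold_locales (rule F)
  have "AE x in M. real_cond_exp M F \<Delta> x = 0"
  proof (rule real_cond_exp_charact)
    fix A assume "A \<in> sets F"
    from 0[OF this] show "(\<integral> x \<in> A. \<Delta> x \<partial>M) = (\<integral> x \<in> A. 0 \<partial>M)"
      by (simp add: set_lebesgue_integral_def mult.commute)
  qed (use \<Delta> in auto)
  then have "AE x in M. \<psi> x * real_cond_exp M F \<Delta> x = 0" by eventually_elim simp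
  then have "(\<integral>x. \<psi> x * real_cond_exp M F \<Delta> x \<partial>M) = 0"
    using real_cond_exp_intg(1)[OF i \<psi>] \<Delta> by (subst integral_cong_AE[where g = "\<lambda>_. 0"]) auto
  then show ?thesis using real_cond_exp_intg(2)[OF i \<psi>] \<Delta> by simp
qed

lemma nat_filt_sets:
  "sets (nat_filt \<Omega> W J t) = sigma_sets (space \<Omega>)
     {W j s -` A \<inter> space \<Omega> | j s A. j \<in> J \<and> 0 \<le> s \<and> s \<le> t \<and> A \<in> sets borel}"
  "space (nat_filt \<Omega> W J t) = space \<Omega>"
proof -
  have "{W j s -` A \<inter> space \<Omega> | j s A. j \<in> J \<and> 0 \<le> s \<and> s \<le> t \<and> A \<in> sets borel} \<subseteq> Pow (space \<Omega>)" by blast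
  then show "sets (nat_filt \<Omega> W J t) = sigma_sets (space \<Omega>)
     {W j s -` A \<inter> space \<Omega> | j s A. j \<in> J \<and> 0 \<le> s \<and> s \<le> t \<and> A \<in> sets borel}"
    "space (nat_filt \<Omega> W J t) = space \<Omega>"
    unfolding nat_filt_def by (rule sets_measure_of, rule space_measure_of)
qed

lemma nat_filt_mono:
  assumes "J \<subseteq> J'" "s \<le> t"
  shows "subalgebra (nat_filt \<Omega> W J' t) (nat_filt \<Omega> W J s)"
  unfolding subalgebra_def nat_filt_sets
  using assms by (auto intro!: sigma_sets_mono' intro: order_trans)

lemma nat_filt_W:
  fixes W :: "nat \<Rightarrow> real \<Rightarrow> 'w \<Rightarrow> real^'d"
  assumes "j \<in> J" "0 \<le> s" "s \<le> t"
  shows "W j s \<in> borel_measurable (nat_filt \<Omega> W J t)"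
proof (rule measurableI)
  fix A :: "(real^'d) set" assume "A \<in> sets borel"
  with assms show "W j s -` A \<inter> space (nat_filt \<Omega> W J t) \<in> sets (nat_filt \<Omega> W J t)"
    unfolding nat_filt_sets by (intro sigma_sets.Basic) blast
qed auto

definition bcoord :: "(nat \<Rightarrow> real \<Rightarrow> 'w \<Rightarrow> real^'d) \<Rightarrow> nat \<times> real \<times> 'd \<Rightarrow> 'w \<Rightarrow> real" where
  "bcoord W i \<omega> = (case i of (j, t, k) \<Rightarrow> W j t \<omega> $ k)"

text \<open>The variance of the Gaussian variable formed by the coordinates in P with weights
  c.\<close>

definition bvar :: "(nat \<times> real \<times> 'd) set \<Rightarrow> (nat \<times> real \<times> 'd \<Rightarrow> real) \<Rightarrow> real" where
  "bvar P c = (\<Sum>p\<in>P. \<Sum>q\<in>P. c p * c q * bm_cov p q)"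

lemma bvar_split:
  assumes P: "finite P"
  shows "bvar P c = bvar {i\<in>P. fst i = j} c + bvar {i\<in>P. fst i \<noteq> j} c"
proof -
  let ?f = "\<lambda>p q. c p * c q * bm_cov p q"
  have split: "(\<Sum>q\<in>P. g q) = (\<Sum>q\<in>{i\<in>P. fst i = j}. g q) + (\<Sum>q\<in>{i\<in>P. fst i \<noteq> j}. g q)" for g :: "_ \<Rightarrow> real"
    using P by (subst sum.union_disjoint[symmetric]) (auto intro!: sum.cong)
  have 0: "fst p = fst q" if "bm_cov p q \<noteq> 0" for p q :: "nat \<times> real \<times> 'a"
    using that by (auto simp: bm_cov_def split: prod.splits if_splits)
  have "bvar P c = (\<Sum>p\<in>{i\<in>P. fst i = j}. \<Sum>q\<in>P. ?f p q) + (\<Sum>p\<in>{i\<in>P. fst i \<noteq> j}. \<Sum>q\<in>P. ?f p q)"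
    unfolding bvar_def by (rule split)
  also have "(\<Sum>p\<in>{i\<in>P. fst i = j}. \<Sum>q\<in>P. ?f p q) = bvar {i\<in>P. fst i = j} c"
    unfolding bvar_def using P by (intro sum.cong[OF refl] sum.mono_neutral_right) (force dest: 0)+
  also have "(\<Sum>p\<in>{i\<in>P. fst i \<noteq> j}. \<Sum>q\<in>P. ?f p q) = bvar {i\<in>P. fst i \<noteq> j} c"
    unfolding bvar_def using P by (intro sum.cong[OF refl] sum.mono_neutral_right) (force dest: 0)+
  finally show ?thesis .
qed

text \<open>The covariance is block diagonal in the index of the motion, so reversing the sign of
  all blocks other than j leaves the variance unchanged. The sum and the difference of the two parts
  then have equal characteristic functions, and this is the source of independence.\<close>

lemma bvar_flip: "bvar {i\<in>P. fst i \<noteq> j} (\<lambda>i. if fst i = j then c i else - c i) = bvar {i\<in>P. fst i \<noteq> j} c"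
  "bvar {i\<in>P. fst i = j} (\<lambda>i. if fst i = j then c i else - c i) = bvar {i\<in>P. fst i = j} c"
  unfolding bvar_def by (auto intro!: sum.cong)

section \<open>Independence and second moments of the Brownian family\<close>

locale brownian = prob_space \<Omega> for \<Omega> :: "'w measure" +
  fixes W :: "nat \<Rightarrow> real \<Rightarrow> 'w \<Rightarrow> real^'d"
  assumes BM: "brownian_family \<Omega> W"
begin

lemma W_measurable: "1 \<le> j \<Longrightarrow> 0 \<le> t \<Longrightarrow> W j t \<in> borel_measurable \<Omega>"
  using BM by (simp add: brownian_family_def)

lemma W_continuous: "1 \<le> j \<Longrightarrow> \<omega> \<in> space \<Omega> \<Longrightarrow> continuous_on {0..} (\<lambda>t. W j t \<omega>)"
  using BM by (simp add: brownian_family_def)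

lemma W_char:
  assumes "finite P" "P \<subseteq> {i. 1 \<le> fst i \<and> 0 \<le> fst (snd i)}"
  shows "(\<integral>\<omega>. cos (\<Sum>i\<in>P. c i * bcoord W i \<omega>) \<partial>\<Omega>) = exp (- bvar P c / 2)"
    "(\<integral>\<omega>. sin (\<Sum>i\<in>P. c i * bcoord W i \<omega>) \<partial>\<Omega>) = 0"
proof -
  have eq: "(\<Sum>i\<in>P. c i * bcoord W i \<omega>) = (\<Sum>(j, t, k)\<in>P. c (j, t, k) * (W j t \<omega> $ k))" for \<omega>
    by (intro sum.cong) (auto simp: bcoord_def)
  have "\<forall>(j, t, k)\<in>P. 1 \<le> j \<and> 0 \<le> t" using assms by auto
  then show "(\<integral>\<omega>. cos (\<Sum>i\<in>P. c i * bcoord W i \<omega>) \<partial>\<Omega>) = exp (- bvar P c / 2)"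
    "(\<integral>\<omega>. sin (\<Sum>i\<in>P. c i * bcoord W i \<omega>) \<partial>\<Omega>) = 0"
    using BM assms(1) unfolding eq bvar_def brownian_family_def Let_def by blast+
qed

lemma bcoord_measurable: "1 \<le> fst i \<Longrightarrow> 0 \<le> fst (snd i) \<Longrightarrow> bcoord W i \<in> borel_measurable \<Omega>"
proof -
  assume *: "1 \<le> fst i" "0 \<le> fst (snd i)"
  obtain j t k where i: "i = (j, t, k)" by (cases i) auto
  have [measurable]: "W j t \<in> borel_measurable \<Omega>" using * by (intro W_measurable) (auto simp: i)
  have "(\<lambda>\<omega>. W j t \<omega> \<bullet> axis k 1) \<in> borel_measurable \<Omega>" by measurable
  then show ?thesis by (simp add: bcoord_def[abs_def] i inner_axis)
qed

lemma nat_filt_subalgebra: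
  assumes "J \<subseteq> {1..}"
  shows "subalgebra \<Omega> (nat_filt \<Omega> W J t)"
  unfolding subalgebra_def nat_filt_sets
proof (intro conjI refl sets.sigma_sets_subset subsetI)
  fix x assume "x \<in> {W j s -` A \<inter> space \<Omega> |j s A. j \<in> J \<and> 0 \<le> s \<and> s \<le> t \<and> A \<in> sets borel}"
  then show "x \<in> sets \<Omega>" using W_measurable assms by (auto intro!: measurable_sets)
qed

definition coords :: "nat set \<Rightarrow> real \<Rightarrow> (nat \<times> real \<times> 'd) set" where
  "coords J t = {i. fst i \<in> J \<and> 0 \<le> fst (snd i) \<and> fst (snd i) \<le> t}"

text \<open>Fourier uniqueness is about real-valued families; this passes from the vector values
  generating the filtration to their scalar coordinates.\<close>

lemma nat_filt_coords:
  assumes "E \<in> sets (nat_filt \<Omega> W J t)"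
  shows "E \<in> sigma_sets (space \<Omega>) {bcoord W i -` A \<inter> space \<Omega> | i A. i \<in> coords J t \<and> A \<in> sets borel}"
proof -
  let ?G = "{bcoord W i -` A \<inter> space \<Omega> | i A. i \<in> coords J t \<and> A \<in> sets borel}"
  let ?S = "sigma (space \<Omega>) ?G"
  have "?G \<subseteq> Pow (space \<Omega>)" by blast
  then have sS: "sets ?S = sigma_sets (space \<Omega>) ?G" "space ?S = space \<Omega>"
    by (rule sets_measure_of, rule space_measure_of)
  have c: "bcoord W i \<in> borel_measurable ?S" if "i \<in> coords J t" for i
  proof (rule measurableI)
    fix A :: "real set" assume "A \<in> sets borel"
    then show "bcoord W i -` A \<inter> space ?S \<in> sets ?S"
      unfolding sS using that by (intro sigma_sets.Basic) blast
  qed auto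
  have w: "W j s \<in> borel_measurable ?S" if "j \<in> J" "0 \<le> s" "s \<le> t" for j s
  proof (subst borel_measurable_euclidean_space, rule ballI)
    fix b :: "real^'d" assume "b \<in> Basis"
    then obtain k where "b = axis k 1" by (auto simp: Basis_vec_def)
    then show "(\<lambda>x. W j s x \<bullet> b) \<in> borel_measurable ?S"
      using c[of "(j, s, k)"] that by (simp add: coords_def bcoord_def[abs_def] inner_axis)
  qed
  have "W j s -` A \<inter> space \<Omega> \<in> sets ?S" if "j \<in> J" "0 \<le> s" "s \<le> t" "A \<in> sets borel" for j s A
    using measurable_sets[OF w[OF that(1-3)] that(4)] by (simp only: sS)
  then have "{W j s -` A \<inter> space \<Omega> | j s A. j \<in> J \<and> 0 \<le> s \<and> s \<le> t \<and> A \<in> sets borel} \<subseteq> sets ?S"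
    by blast
  from subsetD[OF sets.sigma_sets_subset[OF this, unfolded sS(2)] assms[unfolded nat_filt_sets]]
  show ?thesis unfolding sS .
qed

lemma integrable_trig:
  fixes S :: "'w \<Rightarrow> real"
  assumes "S \<in> borel_measurable \<Omega>"
  shows "integrable \<Omega> (\<lambda>x. cos (S x))" "integrable \<Omega> (\<lambda>x. sin (S x))"
proof -
  have [measurable]: "S \<in> borel_measurable \<Omega>" by fact
  show "integrable \<Omega> (\<lambda>x. cos (S x))" by (rule integrable_const_bound[where B = 1]) simp_all
  show "integrable \<Omega> (\<lambda>x. sin (S x))" by (rule integrable_const_bound[where B = 1]) simp_all
qed

lemma linear_combination_measurable:
  assumes "P \<subseteq> {i. 1 \<le> fst i \<and> 0 \<le> fst (snd i)}"
  shows "(\<lambda>\<omega>. \<Sum>i\<in>P. c i * bcoord W i \<omega>) \<in> borel_measurable \<Omega>"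
  using assms by (intro borel_measurable_sum borel_measurable_times bcoord_measurable) auto

text \<open>S1 + S2 and S1 - S2 have the same variance, so their cosine integrals coincide and their
  sine integrals vanish. Product-to-sum formulas convert this into the stated products; for cosines
  the exponential of the summed variances factorises.\<close>

lemma trig_products:
  fixes c :: "nat \<times> real \<times> 'd \<Rightarrow> real" and j :: nat
  assumes P: "finite P" "P \<subseteq> {i. 1 \<le> fst i \<and> 0 \<le> fst (snd i)}"
  defines "S1 \<equiv> \<lambda>\<omega>. \<Sum>i\<in>{i\<in>P. fst i = j}. c i * bcoord W i \<omega>"
    and "S2 \<equiv> \<lambda>\<omega>. \<Sum>i\<in>{i\<in>P. fst i \<noteq> j}. c i * bcoord W i \<omega>"
  shows "(\<integral>\<omega>. cos (S1 \<omega>) * cos (S2 \<omega>) \<partial>\<Omega>) = (\<integral>\<omega>. cos (S1 \<omega>) \<partial>\<Omega>) * (\<integral>\<omega>. cos (S2 \<omega>) \<partial>\<Omega>)"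
    "(\<integral>\<omega>. sin (S1 \<omega>) * cos (S2 \<omega>) \<partial>\<Omega>) = 0" "(\<integral>\<omega>. cos (S1 \<omega>) * sin (S2 \<omega>) \<partial>\<Omega>) = 0"
    "(\<integral>\<omega>. sin (S1 \<omega>) * sin (S2 \<omega>) \<partial>\<Omega>) = 0"
    "(\<integral>\<omega>. sin (S1 \<omega>) \<partial>\<Omega>) = 0" "(\<integral>\<omega>. sin (S2 \<omega>) \<partial>\<Omega>) = 0"
proof -
  let ?P1 = "{i\<in>P. fst i = j}" and ?P2 = "{i\<in>P. fst i \<noteq> j}"
  let ?d = "\<lambda>i. if fst i = j then c i else - c i"
  have split: "(\<Sum>i\<in>P. g i) = (\<Sum>i\<in>?P1. g i) + (\<Sum>i\<in>?P2. g i)" for g :: "_ \<Rightarrow> real"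
    using P by (subst sum.union_disjoint[symmetric]) (auto intro!: sum.cong)
  have p: "(\<Sum>i\<in>P. c i * bcoord W i \<omega>) = S1 \<omega> + S2 \<omega>" for \<omega>
    unfolding S1_def S2_def by (rule split)
  have m: "(\<Sum>i\<in>P. ?d i * bcoord W i \<omega>) = S1 \<omega> - S2 \<omega>" for \<omega>
  proof -
    have "(\<Sum>i\<in>?P1. ?d i * bcoord W i \<omega>) = S1 \<omega>" unfolding S1_def by (intro sum.cong) auto
    moreover have "(\<Sum>i\<in>?P2. ?d i * bcoord W i \<omega>) = - S2 \<omega>" unfolding S2_def sum_negf[symmetric] by (intro sum.cong) auto
    ultimately show ?thesis by (subst split) simp
  qed
  have v: "bvar P ?d = bvar P c"
    using bvar_split[OF P(1), of ?d j] bvar_split[OF P(1), of c j] by (simp only: bvar_flip)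
  have [measurable]: "S1 \<in> borel_measurable \<Omega>" "S2 \<in> borel_measurable \<Omega>"
    unfolding S1_def S2_def using P by (auto intro!: linear_combination_measurable)
  note I = integrable_trig
  have cp: "(\<integral>\<omega>. cos (S1 \<omega> + S2 \<omega>) \<partial>\<Omega>) = exp (- bvar P c / 2)" "(\<integral>\<omega>. sin (S1 \<omega> + S2 \<omega>) \<partial>\<Omega>) = 0"
    using W_char[OF P, of c] unfolding p by auto
  have cm: "(\<integral>\<omega>. cos (S1 \<omega> - S2 \<omega>) \<partial>\<Omega>) = exp (- bvar P c / 2)" "(\<integral>\<omega>. sin (S1 \<omega> - S2 \<omega>) \<partial>\<Omega>) = 0"
    using W_char[OF P, of ?d] unfolding m v by auto
  have c1: "(\<integral>\<omega>. cos (S1 \<omega>) \<partial>\<Omega>) = exp (- bvar ?P1 c / 2)" "(\<integral>\<omega>. sin (S1 \<omega>) \<partial>\<Omega>) = 0"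
    using W_char[of ?P1 c] P unfolding S1_def by auto
  have c2: "(\<integral>\<omega>. cos (S2 \<omega>) \<partial>\<Omega>) = exp (- bvar ?P2 c / 2)" "(\<integral>\<omega>. sin (S2 \<omega>) \<partial>\<Omega>) = 0"
    using W_char[of ?P2 c] P unfolding S2_def by auto
  have "exp (- bvar P c / 2) = exp (- bvar ?P1 c / 2) * exp (- bvar ?P2 c / 2)"
    unfolding exp_add[symmetric] by (subst bvar_split[OF P(1), of c j]) (simp add: add_divide_distrib)
  then show "(\<integral>\<omega>. cos (S1 \<omega>) * cos (S2 \<omega>) \<partial>\<Omega>) = (\<integral>\<omega>. cos (S1 \<omega>) \<partial>\<Omega>) * (\<integral>\<omega>. cos (S2 \<omega>) \<partial>\<Omega>)"
    using cp(1) cm(1) c1 c2 by (simp add: cos_times_cos I)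
  show "(\<integral>\<omega>. sin (S1 \<omega>) * cos (S2 \<omega>) \<partial>\<Omega>) = 0" using cp(2) cm(2) by (simp add: sin_times_cos I)
  show "(\<integral>\<omega>. cos (S1 \<omega>) * sin (S2 \<omega>) \<partial>\<Omega>) = 0" using cp(2) cm(2) by (simp add: cos_times_sin I)
  show "(\<integral>\<omega>. sin (S1 \<omega>) * sin (S2 \<omega>) \<partial>\<Omega>) = 0" using cp(1) cm(1) by (simp add: sin_times_sin I)
  show "(\<integral>\<omega>. sin (S1 \<omega>) \<partial>\<Omega>) = 0" "(\<integral>\<omega>. sin (S2 \<omega>) \<partial>\<Omega>) = 0" by fact+
qed

text \<open>For S built from motions other than W_j, both cos S - E cos S and sin S are Fourier-null
  with respect to the coordinates of W_j. They are therefore orthogonal to every event of its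
  filtration, and then to \<psi>.\<close>

lemma independent_trig:
  fixes c :: "nat \<times> real \<times> 'd \<Rightarrow> real" and j :: nat
  assumes j: "1 \<le> j" and P: "finite P" "P \<subseteq> {i. 1 \<le> fst i \<and> 0 \<le> fst (snd i) \<and> fst i \<noteq> j}"
    and \<psi>: "\<psi> \<in> borel_measurable (nat_filt \<Omega> W {j} t)" "integrable \<Omega> \<psi>"
  defines "S \<equiv> \<lambda>\<omega>. \<Sum>i\<in>P. c i * bcoord W i \<omega>"
  shows "(\<integral>\<omega>. \<psi> \<omega> * cos (S \<omega>) \<partial>\<Omega>) = (\<integral>\<omega>. \<psi> \<omega> \<partial>\<Omega>) * (\<integral>\<omega>. cos (S \<omega>) \<partial>\<Omega>)"
    "(\<integral>\<omega>. \<psi> \<omega> * sin (S \<omega>) \<partial>\<Omega>) = 0"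
proof -
  have [measurable]: "S \<in> borel_measurable \<Omega>"
    unfolding S_def using P by (intro linear_combination_measurable) auto
  note I = integrable_trig[OF \<open>S \<in> _\<close>]
  have sub: "subalgebra \<Omega> (nat_filt \<Omega> W {j} t)" using j by (intro nat_filt_subalgebra) auto
  have \<psi>I: "integrable \<Omega> (\<lambda>x. \<psi> x * cos (S x))" "integrable \<Omega> (\<lambda>x. \<psi> x * sin (S x))"
    using \<psi>(2) by (auto intro!: integrable_mult_bounded)
  have prods: "(\<integral>\<omega>. cos (S \<omega>) * cos (\<Sum>i\<in>Q. d i * bcoord W i \<omega>) \<partial>\<Omega>)
        = (\<integral>\<omega>. cos (S \<omega>) \<partial>\<Omega>) * (\<integral>\<omega>. cos (\<Sum>i\<in>Q. d i * bcoord W i \<omega>) \<partial>\<Omega>)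
     \<and> (\<integral>\<omega>. cos (S \<omega>) * sin (\<Sum>i\<in>Q. d i * bcoord W i \<omega>) \<partial>\<Omega>) = 0
     \<and> (\<integral>\<omega>. sin (S \<omega>) * cos (\<Sum>i\<in>Q. d i * bcoord W i \<omega>) \<partial>\<Omega>) = 0
     \<and> (\<integral>\<omega>. sin (S \<omega>) * sin (\<Sum>i\<in>Q. d i * bcoord W i \<omega>) \<partial>\<Omega>) = 0
     \<and> (\<integral>\<omega>. sin (\<Sum>i\<in>Q. d i * bcoord W i \<omega>) \<partial>\<Omega>) = 0"
    if Q: "finite Q" "Q \<subseteq> coords {j} t" for Q d
  proof -
    let ?e = "\<lambda>i. if fst i = j then d i else c i"
    have fin: "finite (P \<union> Q)" "P \<union> Q \<subseteq> {i. 1 \<le> fst i \<and> 0 \<le> fst (snd i)}"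
      using P Q j by (auto simp: coords_def)
    have "{i \<in> P \<union> Q. fst i = j} = Q" "{i \<in> P \<union> Q. fst i \<noteq> j} = P" using P Q by (auto simp: coords_def)
    moreover have "(\<Sum>i\<in>Q. ?e i * bcoord W i \<omega>) = (\<Sum>i\<in>Q. d i * bcoord W i \<omega>)" for \<omega>
      using Q by (intro sum.cong) (auto simp: coords_def)
    moreover have "(\<Sum>i\<in>P. ?e i * bcoord W i \<omega>) = S \<omega>" for \<omega>
      unfolding S_def using P by (intro sum.cong) auto
    ultimately show ?thesis using trig_products[OF fin, where c = ?e and j = j] by (simp add: mult.commute)
  qed
  have U: "bcoord W i \<in> borel_measurable \<Omega>" if "i \<in> coords {j} t" for i
    using that j by (intro bcoord_measurable) (auto simp: coords_def)
  let ?m = "\<integral>\<omega>. cos (S \<omega>) \<partial>\<Omega>"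
  have lin: "(\<lambda>\<omega>. \<Sum>i\<in>Q. d i * bcoord W i \<omega>) \<in> borel_measurable \<Omega>" if "Q \<subseteq> coords {j} t" for Q d
    using that j by (intro linear_combination_measurable) (auto simp: coords_def)
  have Cn: "fourier_null \<Omega> (coords {j} t) (bcoord W) (\<lambda>\<omega>. cos (S \<omega>) - ?m)"
    unfolding fourier_null_def
  proof (intro conjI allI impI)
    fix Q d assume Q: "finite Q" "Q \<subseteq> coords {j} t"
    let ?S = "\<lambda>\<omega>. \<Sum>i\<in>Q. d i * bcoord W i \<omega>"
    have [measurable]: "?S \<in> borel_measurable \<Omega>" by (rule lin[OF Q(2)])
    note I' = integrable_trig[OF this]
    have "integrable \<Omega> (\<lambda>\<omega>. cos (S \<omega>) * cos (?S \<omega>))" "integrable \<Omega> (\<lambda>\<omega>. cos (S \<omega>) * sin (?S \<omega>))"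
      using I by (auto intro!: integrable_mult_bounded)
    then show "(\<integral>\<omega>. (cos (S \<omega>) - ?m) * cos (?S \<omega>) \<partial>\<Omega>) = 0" "(\<integral>\<omega>. (cos (S \<omega>) - ?m) * sin (?S \<omega>) \<partial>\<Omega>) = 0"
      using prods[OF Q, of d] I' by (simp_all add: left_diff_distrib)
  qed (use I in auto)
  have Sn: "fourier_null \<Omega> (coords {j} t) (bcoord W) (\<lambda>\<omega>. sin (S \<omega>))"
    unfolding fourier_null_def using prods I by auto
  have "(\<integral>\<omega>. \<psi> \<omega> * (cos (S \<omega>) - ?m) \<partial>\<Omega>) = 0"
    by (rule integral_mult_eq_0_if_orthogonal[OF sub _ fourier_null_integral_eq_0[OF U Cn nat_filt_coords] \<psi>(1)])
       (use I \<psi>I \<psi>(2) in \<open>auto simp: right_diff_distrib\<close>)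
  then show "(\<integral>\<omega>. \<psi> \<omega> * cos (S \<omega>) \<partial>\<Omega>) = (\<integral>\<omega>. \<psi> \<omega> \<partial>\<Omega>) * (\<integral>\<omega>. cos (S \<omega>) \<partial>\<Omega>)"
    using \<psi>I \<psi>(2) by (simp add: right_diff_distrib)
  show "(\<integral>\<omega>. \<psi> \<omega> * sin (S \<omega>) \<partial>\<Omega>) = 0"
    by (rule integral_mult_eq_0_if_orthogonal[OF sub _ fourier_null_integral_eq_0[OF U Sn nat_filt_coords] \<psi>(1)])
       (use I \<psi>I in auto)
qed

text \<open>Increments that are orthogonal to the past of \<open>W j\<close> stay orthogonal when the past is
  enlarged by the other, independent Brownian motions.\<close>
lemma orthogonal_enlarged_filtration:
  fixes \<Delta> :: "'w \<Rightarrow> real"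
  assumes j: "j \<in> J" "J \<subseteq> {1..}" and \<Delta>: "integrable \<Omega> \<Delta>" "\<Delta> \<in> borel_measurable (nat_filt \<Omega> W {j} t)" and st: "s \<le> t"
    and 0: "\<And>E. E \<in> sets (nat_filt \<Omega> W {j} s) \<Longrightarrow> (\<integral>x. \<Delta> x * indicator E x \<partial>\<Omega>) = 0"
    and E: "E \<in> sets (nat_filt \<Omega> W J s)"
  shows "(\<integral>x. \<Delta> x * indicator E x \<partial>\<Omega>) = 0"
proof (rule fourier_null_integral_eq_0[OF _ _ nat_filt_coords[OF E]])
  have j1: "1 \<le> j" using j by auto
  show "bcoord W i \<in> borel_measurable \<Omega>" if "i \<in> coords J s" for i
    using that j by (intro bcoord_measurable) (auto simp: coords_def)
  have subs: "subalgebra \<Omega> (nat_filt \<Omega> W {j} s)" using j1 by (intro nat_filt_subalgebra) auto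
  show "fourier_null \<Omega> (coords J s) (bcoord W) \<Delta>"
    unfolding fourier_null_def
  proof (intro conjI allI impI)
    fix P and c :: "nat \<times> real \<times> 'd \<Rightarrow> real" assume P: "finite P" "P \<subseteq> coords J s"
    let ?P1 = "{i\<in>P. fst i = j}" and ?P2 = "{i\<in>P. fst i \<noteq> j}"
    define S1 where "S1 = (\<lambda>\<omega>. \<Sum>i\<in>?P1. c i * bcoord W i \<omega>)"
    define S2 where "S2 = (\<lambda>\<omega>. \<Sum>i\<in>?P2. c i * bcoord W i \<omega>)"
    have sum: "(\<Sum>i\<in>P. c i * bcoord W i \<omega>) = S1 \<omega> + S2 \<omega>" for \<omega>
      unfolding S1_def S2_def using P by (subst sum.union_disjoint[symmetric]) (auto intro!: sum.cong)
    have bm: "bcoord W i \<in> borel_measurable (nat_filt \<Omega> W {j} s)" if "i \<in> ?P1" for i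
    proof -
      have "i \<in> coords J s" "fst i = j" using that P by auto
      then obtain r k where i: "i = (j, r, k)" "0 \<le> r" "r \<le> s"
        by (cases i) (simp add: coords_def)
      have [measurable]: "W j r \<in> borel_measurable (nat_filt \<Omega> W {j} s)" using i by (intro nat_filt_W) auto
      have "(\<lambda>\<omega>. W j r \<omega> \<bullet> axis k 1) \<in> borel_measurable (nat_filt \<Omega> W {j} s)" by measurable
      then show ?thesis by (simp add: bcoord_def[abs_def] i inner_axis)
    qed
    have S1s[measurable]: "S1 \<in> borel_measurable (nat_filt \<Omega> W {j} s)"
      unfolding S1_def using bm by (intro borel_measurable_sum borel_measurable_times) auto
    have S1t[measurable]: "S1 \<in> borel_measurable (nat_filt \<Omega> W {j} t)"
      by (rule measurable_from_subalg[OF nat_filt_mono S1s]) (use st in auto)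
    have S1m[measurable]: "S1 \<in> borel_measurable \<Omega>" by (rule measurable_from_subalg[OF subs S1s])
    have S2m[measurable]: "S2 \<in> borel_measurable \<Omega>"
      unfolding S2_def using P j by (intro linear_combination_measurable) (auto simp: coords_def)
    have [measurable]: "\<Delta> \<in> borel_measurable (nat_filt \<Omega> W {j} t)" by fact
    have i1: "integrable \<Omega> (\<lambda>x. \<Delta> x * cos (S1 x))" "integrable \<Omega> (\<lambda>x. \<Delta> x * sin (S1 x))"
      using \<Delta>(1) by (auto intro!: integrable_mult_bounded)
    have S2e: "(\<Sum>i\<in>?P2. c i * bcoord W i \<omega>) = S2 \<omega>" for \<omega> by (simp add: S2_def)
    \<comment> \<open>S1 uses W_j only up to time s, so \<Delta> is orthogonal to cos S1 and sin S1.
      As \<Delta> cos S1 and \<Delta> sin S1 depend on W_j alone, the trigonometric functions of S2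
      split off afterwards and multiply these zeros.\<close>
    have z: "(\<integral>x. cos (S1 x) * \<Delta> x \<partial>\<Omega>) = 0" "(\<integral>x. sin (S1 x) * \<Delta> x \<partial>\<Omega>) = 0"
      by (rule integral_mult_eq_0_if_orthogonal[OF subs \<Delta>(1) 0]; use i1 in \<open>simp add: mult.commute\<close>)+
    then have z': "(\<integral>x. \<Delta> x * cos (S1 x) \<partial>\<Omega>) = 0" "(\<integral>x. \<Delta> x * sin (S1 x) \<partial>\<Omega>) = 0"
      by (simp_all add: mult.commute)
    have P2: "finite ?P2" "?P2 \<subseteq> {i. 1 \<le> fst i \<and> 0 \<le> fst (snd i) \<and> fst i \<noteq> j}"
      using P j by (auto simp: coords_def)
    have mt: "(\<lambda>x. \<Delta> x * cos (S1 x)) \<in> borel_measurable (nat_filt \<Omega> W {j} t)"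
      "(\<lambda>x. \<Delta> x * sin (S1 x)) \<in> borel_measurable (nat_filt \<Omega> W {j} t)" by measurable
    note ind1 = independent_trig[OF j1 P2 mt(1) i1(1), of c, unfolded S2e]
    note ind2 = independent_trig[OF j1 P2 mt(2) i1(2), of c, unfolded S2e]
    have i2: "integrable \<Omega> (\<lambda>x. \<Delta> x * cos (S1 x) * cos (S2 x))" "integrable \<Omega> (\<lambda>x. \<Delta> x * sin (S1 x) * cos (S2 x))"
      "integrable \<Omega> (\<lambda>x. \<Delta> x * cos (S1 x) * sin (S2 x))" "integrable \<Omega> (\<lambda>x. \<Delta> x * sin (S1 x) * sin (S2 x))"
      using i1 by (auto intro!: integrable_mult_bounded)
    have c: "\<Delta> x * cos (S1 x + S2 x) = \<Delta> x * cos (S1 x) * cos (S2 x) - \<Delta> x * sin (S1 x) * sin (S2 x)"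
      "\<Delta> x * sin (S1 x + S2 x) = \<Delta> x * sin (S1 x) * cos (S2 x) + \<Delta> x * cos (S1 x) * sin (S2 x)" for x
      by (simp_all add: cos_add sin_add algebra_simps)
    show "(\<integral>x. \<Delta> x * cos (\<Sum>i\<in>P. c i * bcoord W i x) \<partial>\<Omega>) = 0"
      unfolding sum c using i2 ind1 ind2 z' by simp
    show "(\<integral>x. \<Delta> x * sin (\<Sum>i\<in>P. c i * bcoord W i x) \<partial>\<Omega>) = 0"
      unfolding sum c using i2 ind1 ind2 z' by simp
  qed (rule \<Delta>)
qed

text \<open>The variance of a weighted sum of the independent motions needs only their covariance.\<close>
lemma weighted_W_moments:
  fixes a :: "nat \<Rightarrow> real" and t :: real
  assumes t: "0 \<le> t" and J: "finite J" "J \<subseteq> {1..}"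
  defines "S \<equiv> \<lambda>\<omega>. \<Sum>j\<in>J. a j *\<^sub>R W j t \<omega>"
  shows "L2 \<Omega> S" "n2 \<Omega> S \<le> CARD('d) * t * (\<Sum>j\<in>J. (a j)\<^sup>2)" "expectation S = 0"
proof -
  let ?V = "t * (\<Sum>j\<in>J. (a j)\<^sup>2)"
  have V: "?V \<ge> 0" using t by (simp add: sum_nonneg)
  have Sm: "S \<in> borel_measurable \<Omega>"
    unfolding S_def using W_measurable t J by (intro borel_measurable_sum borel_measurable_scaleR) auto
  have comp: "integrable \<Omega> (\<lambda>\<omega>. (S \<omega> $ k)\<^sup>2)" "(\<integral>\<omega>. (S \<omega> $ k)\<^sup>2 \<partial>\<Omega>) \<le> ?V"
    "integrable \<Omega> (\<lambda>\<omega>. S \<omega> $ k)" "(\<integral>\<omega>. S \<omega> $ k \<partial>\<Omega>) = 0" for k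
  proof -
    let ?P = "(\<lambda>j. (j, t, k)) ` J"
    have inj: "inj_on (\<lambda>j. (j, t, k)) J" by (auto simp: inj_on_def)
    have P: "finite ?P" "?P \<subseteq> {i. 1 \<le> fst i \<and> 0 \<le> fst (snd i)}" using J t by auto
    have eq: "(\<Sum>i\<in>?P. (r * a (fst i)) * bcoord W i \<omega>) = r * (S \<omega> $ k)" for r \<omega>
      unfolding sum.reindex[OF inj] by (simp add: S_def bcoord_def sum_distrib_left mult.assoc)
    have bv: "bvar ?P (\<lambda>i. r * a (fst i)) = r\<^sup>2 * ?V" for r
    proof -
      have "bvar ?P (\<lambda>i. r * a (fst i)) = (\<Sum>p\<in>J. \<Sum>q\<in>J. if p = q then (r * a p) * (r * a q) * t else 0)"
        unfolding bvar_def sum.reindex[OF inj] by (intro sum.cong[OF refl]) (auto simp: bm_cov_def intro!: sum.cong)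
      also have "\<dots> = (\<Sum>p\<in>J. (r * a p) * (r * a p) * t)" using J by (simp add: sum.delta)
      also have "\<dots> = r\<^sup>2 * ?V" by (simp add: sum_distrib_left power2_eq_square mult_ac)
      finally show ?thesis .
    qed
    have m: "(\<lambda>\<omega>. S \<omega> $ k) \<in> borel_measurable \<Omega>"
      using linear_combination_measurable[OF P(2), of "\<lambda>i. 1 * a (fst i)"] by (simp only: eq) simp
    have "(\<integral>\<omega>. cos (r * (S \<omega> $ k)) \<partial>\<Omega>) = exp (- (r\<^sup>2 * ?V) / 2)" "(\<integral>\<omega>. sin (r * (S \<omega> $ k)) \<partial>\<Omega>) = 0" for r
      using W_char[OF P, of "\<lambda>i. r * a (fst i)"] by (simp_all only: eq bv)
    from square_mean_from_characteristic_function[OF prob_space_axioms m V this]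
    show "integrable \<Omega> (\<lambda>\<omega>. (S \<omega> $ k)\<^sup>2)" "(\<integral>\<omega>. (S \<omega> $ k)\<^sup>2 \<partial>\<Omega>) \<le> ?V"
      "integrable \<Omega> (\<lambda>\<omega>. S \<omega> $ k)" "(\<integral>\<omega>. S \<omega> $ k \<partial>\<Omega>) = 0" .
  qed
  have nrm: "(norm v)\<^sup>2 = (\<Sum>k\<in>UNIV. (v $ k)\<^sup>2)" for v :: "real^'d"
    unfolding power2_norm_eq_inner by (simp add: inner_vec_def power2_eq_square)
  show L: "L2 \<Omega> S" unfolding L2_def nrm using Sm comp by auto
  have "n2 \<Omega> S = (\<Sum>k\<in>UNIV. \<integral>\<omega>. (S \<omega> $ k)\<^sup>2 \<partial>\<Omega>)" unfolding n2_def nrm using comp by simp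
  also have "\<dots> \<le> (\<Sum>k\<in>(UNIV :: 'd set). ?V)" by (intro sum_mono comp)
  finally show "n2 \<Omega> S \<le> CARD('d) * t * (\<Sum>j\<in>J. (a j)\<^sup>2)" by (simp add: mult.assoc)
  have i: "integrable \<Omega> S" by (rule L2_integrable(1)[OF L])
  show "expectation S = 0"
  proof (rule vec_eq_iff[THEN iffD2], rule allI)
    fix k
    have "expectation S \<bullet> axis k 1 = (\<integral>\<omega>. S \<omega> \<bullet> axis k 1 \<partial>\<Omega>)" using i by simp
    then show "expectation S $ k = 0 $ k" using comp(4)[of k] by (simp add: inner_axis)
  qed
qed

end

section \<open>Progressively measurable processes\<close>

lemma eflow_measurable:
  fixes K :: "'a::euclidean_space \<Rightarrow> 'a"
  assumes K: "linear K" and \<phi>: "\<phi> \<in> borel_measurable M" and v: "v \<in> borel_measurable M"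
  shows "(\<lambda>x. eflow K (\<phi> x) (v x)) \<in> borel_measurable M"
proof -
  note expand = eflow_expand[OF K]
  have c: "continuous_on UNIV (\<lambda>t. eflow K t b)" for b
    by (intro eflow_continuous[OF K] continuous_intros)
  have [measurable]: "(\<lambda>x. eflow K (\<phi> x) b) \<in> borel_measurable M" for b
    by (rule measurable_compose[OF \<phi> borel_measurable_continuous_onI[OF c]])
  have [measurable]: "v \<in> borel_measurable M" by fact
  show ?thesis unfolding expand[of _ "v _"] by measurable
qed

lemma linear_measurable:
  fixes K :: "'a::euclidean_space \<Rightarrow> 'b::euclidean_space"
  assumes "linear K" "f \<in> borel_measurable M"
  shows "(\<lambda>x. K (f x)) \<in> borel_measurable M"
proof -
  have "K \<in> borel_measurable borel"
    using assms(1) linear_continuous_on linear_conv_bounded_linear by (blast intro: borel_measurable_continuous_onI)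
  from measurable_compose[OF assms(2) this] show ?thesis .
qed

lemma ie_formula_measurable:
  fixes K :: "'a::euclidean_space \<Rightarrow> 'a" and c :: "real \<Rightarrow> 'w \<Rightarrow> 'a"
  assumes K: "linear K" and c: "(\<lambda>(s, \<omega>). c s \<omega>) \<in> borel_measurable (leb t \<Otimes>\<^sub>M F)"
  shows "(\<lambda>(s, \<omega>). ie_formula K (\<lambda>r. c r \<omega>) s) \<in> borel_measurable (leb t \<Otimes>\<^sub>M F)"
proof -
  have f: "fst \<in> borel_measurable (leb t \<Otimes>\<^sub>M F)"
    by (rule measurable_compose[OF measurable_fst]) (simp add: measurable_restrict_space1)
  have "(\<lambda>(s, \<omega>). eflow K (- s) (K (c s \<omega>))) \<in> borel_measurable (leb t \<Otimes>\<^sub>M F)"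
    unfolding split_beta' using f c by (intro eflow_measurable[OF K] linear_measurable[OF K]) (auto simp: split_beta')
  from measurable_primitive[OF this] f c show ?thesis
    unfolding ie_formula_def split_beta' by (intro borel_measurable_add eflow_measurable[OF K]) auto
qed

text \<open>A game state has to be measurable for all real times, while the construction lives on
  [0,T]; clamping the time extends it without changing it there.\<close>

lemma measurable_clamp:
  assumes h: "(\<lambda>p. h (fst p) (snd p)) \<in> borel_measurable (leb T \<Otimes>\<^sub>M M)" and T: "0 \<le> T"
  shows "(\<lambda>(t, \<omega>). h (max 0 (min T t)) \<omega>) \<in> borel_measurable (lborel \<Otimes>\<^sub>M M)"
proof -
  have "(\<lambda>t. max 0 (min T t)) \<in> measurable lborel (leb T)"
    using T by (intro measurable_restrict_space2) auto
  then have "(\<lambda>p. (max 0 (min T (fst p)), snd p)) \<in> measurable (lborel \<Otimes>\<^sub>M M) (leb T \<Otimes>\<^sub>M M)"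
    by (intro measurable_Pair measurable_snd) (rule measurable_compose[OF measurable_fst])
  from measurable_compose[OF this h] show ?thesis by (simp add: split_beta')
qed

lemma measurable_leb_mono:
  assumes "f \<in> borel_measurable (leb T)" "t \<le> T"
  shows "f \<in> borel_measurable (leb t)"
proof -
  have "leb t = restrict_space (leb T) {0..t}"
    using assms(2) by (subst restrict_restrict_space) (auto simp: Int_absorb1)
  then show ?thesis using assms(1) by (simp add: measurable_restrict_space1)
qed

lemma prog_linear:
  fixes K :: "'a::euclidean_space \<Rightarrow> 'b::euclidean_space"
  assumes "linear K" "prog_meas \<Omega> W J T u"
  shows "prog_meas \<Omega> W J T (\<lambda>t \<omega>. K (u t \<omega>))"
  using assms(2) unfolding prog_meas_def split_beta' by (auto intro: linear_measurable[OF assms(1)])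

lemma prog_add:
  fixes u v :: "real \<Rightarrow> 'w \<Rightarrow> 'a::euclidean_space"
  shows "prog_meas \<Omega> W J T u \<Longrightarrow> prog_meas \<Omega> W J T v \<Longrightarrow> prog_meas \<Omega> W J T (\<lambda>t \<omega>. u t \<omega> + v t \<omega>)"
  unfolding prog_meas_def split_beta' by (intro ballI borel_measurable_add) auto

lemma prog_diff:
  fixes u v :: "real \<Rightarrow> 'w \<Rightarrow> 'a::euclidean_space"
  shows "prog_meas \<Omega> W J T u \<Longrightarrow> prog_meas \<Omega> W J T v \<Longrightarrow> prog_meas \<Omega> W J T (\<lambda>t \<omega>. u t \<omega> - v t \<omega>)"
  unfolding prog_meas_def split_beta' by (intro ballI borel_measurable_diff) auto

lemma prog_scaleR:
  fixes u :: "real \<Rightarrow> 'w \<Rightarrow> 'a::euclidean_space"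
  shows "prog_meas \<Omega> W J T u \<Longrightarrow> prog_meas \<Omega> W J T (\<lambda>t \<omega>. c *\<^sub>R u t \<omega>)"
  unfolding prog_meas_def split_beta' by auto

lemma prog_sum:
  fixes u :: "'i \<Rightarrow> real \<Rightarrow> 'w \<Rightarrow> 'a::euclidean_space"
  shows "(\<And>i. i \<in> I \<Longrightarrow> prog_meas \<Omega> W J T (u i)) \<Longrightarrow> prog_meas \<Omega> W J T (\<lambda>t \<omega>. \<Sum>i\<in>I. u i t \<omega>)"
  unfolding prog_meas_def split_beta' by (intro ballI borel_measurable_sum) auto

lemma prog_deterministic:
  fixes f :: "real \<Rightarrow> 'a::euclidean_space"
  assumes "f \<in> borel_measurable (leb T)"
  shows "prog_meas \<Omega> W J T (\<lambda>t \<omega>. f t)"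
  unfolding prog_meas_def split_beta'
proof
  fix t assume "t \<in> {0..T}"
  then have "f \<in> borel_measurable (leb t)" using measurable_leb_mono[OF assms] by auto
  then show "(\<lambda>p. f (fst p)) \<in> borel_measurable (leb t \<Otimes>\<^sub>M nat_filt \<Omega> W J t)"
    by (rule measurable_compose[OF measurable_fst])
qed

lemma prog_mono:
  assumes "prog_meas \<Omega> W J T u" "J \<subseteq> J'"
  shows "prog_meas \<Omega> W J' T u"
  using assms measurable_pair_subalgebra[OF nat_filt_mono[OF assms(2) order_refl]]
  unfolding prog_meas_def by blast

lemma prog_primitive:
  fixes u :: "real \<Rightarrow> 'w \<Rightarrow> 'a::euclidean_space"
  shows "prog_meas \<Omega> W J T u \<Longrightarrow> prog_meas \<Omega> W J T (\<lambda>t \<omega>. \<integral>s\<in>{0..t}. u s \<omega> \<partial>lborel)"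
  unfolding prog_meas_def using measurable_primitive by blast

lemma prog_ie_formula:
  fixes K :: "'a::euclidean_space \<Rightarrow> 'a"
  shows "linear K \<Longrightarrow> prog_meas \<Omega> W J T c \<Longrightarrow> prog_meas \<Omega> W J T (\<lambda>t \<omega>. ie_formula K (\<lambda>r. c r \<omega>) t)"
  unfolding prog_meas_def using ie_formula_measurable by blast

lemma prog_section:
  assumes "prog_meas \<Omega> W J T u" "t \<in> {0..T}"
  shows "u t \<in> borel_measurable (nat_filt \<Omega> W J t)"
proof -
  have "(\<lambda>(s, \<omega>). u s \<omega>) \<in> borel_measurable (leb t \<Otimes>\<^sub>M nat_filt \<Omega> W J t)"
    using assms by (auto simp: prog_meas_def)
  from measurable_compose[OF measurable_Pair1'[of t "leb t"] this] show ?thesis using assms(2) by simp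
qed

text \<open>Brings a response into the form of a plain primitive, with density K z + b, which is
  what integration by parts accepts.\<close>

lemma ie_sol_primitive:
  fixes K :: "'a::euclidean_space \<Rightarrow> 'a"
  assumes K: "linear K" and b: "integrable (leb T) b"
    and z: "ie_sol K T (\<lambda>t. \<integral>s\<in>{0..t}. b s \<partial>lborel) z"
  shows "integrable (leb T) (\<lambda>s. K (z s) + b s)"
    "t \<in> {0..T} \<Longrightarrow> z t = (prim (\<lambda>s. K (z s) + b s) t)"
proof -
  have Kz: "integrable (leb T) (\<lambda>s. K (z s))"
    by (intro integrable_leb_continuous linear_continuous_on_compose[OF K] ie_sol_continuous[OF z])
  show i: "integrable (leb T) (\<lambda>s. K (z s) + b s)" using Kz b by simp
  assume t: "t \<in> {0..T}"
  have "((\<lambda>s. K (z s)) has_integral (prim (\<lambda>s. K (z s)) t)) {0..t}"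
    using t by (intro has_integral_leb[OF Kz]) auto
  moreover have "((\<lambda>s. K (z s)) has_integral (z t - (prim b t))) {0..t}"
    using z t by (auto simp: ie_sol_def)
  ultimately have "z t - (prim b t) = (prim (\<lambda>s. K (z s)) t)"
    by (rule has_integral_unique[symmetric])
  moreover have "(prim (\<lambda>s. K (z s) + b s) t) = (prim (\<lambda>s. K (z s)) t) + (prim b t)"
    using t by (intro set_integral_add set_integrable_leb_sub[OF Kz] set_integrable_leb_sub[OF b]) auto
  ultimately show "z t = (prim (\<lambda>s. K (z s) + b s) t)" by (simp add: algebra_simps)
qed

lemma set_integral_split:
  fixes f :: "real \<Rightarrow> 'a::euclidean_space"
  assumes f: "integrable (leb T) f" and s: "s \<in> {0..T}"
  shows "(prim f T) = (prim f s) + (\<integral>r\<in>{s..T}. f r \<partial>lborel)"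
proof -
  have "(f has_integral (prim f s) + (\<integral>r\<in>{s..T}. f r \<partial>lborel)) {0..T}"
    using s by (intro has_integral_combine[of 0 s T] has_integral_leb[OF f]) auto
  moreover have "(f has_integral (prim f T)) {0..T}" using s by (intro has_integral_leb[OF f]) auto
  ultimately show ?thesis by (rule has_integral_unique[symmetric])
qed

section \<open>Linear responses and integration by parts against a martingale\<close>

locale brownian_horizon = horizon \<Omega> T + brownian \<Omega> W
  for \<Omega> :: "'w measure" and T :: real and W :: "nat \<Rightarrow> real \<Rightarrow> 'w \<Rightarrow> real^'d"
begin

lemma prog_PP:
  assumes "prog_meas \<Omega> W J T u" "J \<subseteq> {1..}"
  shows "(\<lambda>p. u (fst p) (snd p)) \<in> borel_measurable PP"
proof -
  have "(\<lambda>(s, \<omega>). u s \<omega>) \<in> borel_measurable (leb T \<Otimes>\<^sub>M nat_filt \<Omega> W J T)"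
    using assms(1) T_in by (simp add: prog_meas_def)
  from measurable_pair_subalgebra[OF nat_filt_subalgebra[OF assms(2)] this] show ?thesis
    by (simp add: split_beta')
qed

lemma prog_L2p: "prog_meas \<Omega> W J T u \<Longrightarrow> J \<subseteq> {1..} \<Longrightarrow> sq_integrable \<Omega> T u \<Longrightarrow> L2p u"
  for u :: "real \<Rightarrow> 'w \<Rightarrow> 'v::euclidean_space"
  by (intro L2p_from_sq_integrable prog_PP)

text \<open>The response of the linear system to the forcing b from zero initial state. Taking the
  explicit formula instead of choosing a solution lets measurability and adaptedness be inherited
  from b.\<close>

definition resp :: "('v::euclidean_space \<Rightarrow> 'v) \<Rightarrow> (real \<Rightarrow> 'w \<Rightarrow> 'v) \<Rightarrow> real \<Rightarrow> 'w \<Rightarrow> 'v" where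
  "resp K b t \<omega> = ie_formula K (\<lambda>r. \<integral>s\<in>{0..r}. b s \<omega> \<partial>lborel) t"

lemma resp_prog: "linear K \<Longrightarrow> prog_meas \<Omega> W J T b \<Longrightarrow> prog_meas \<Omega> W J T (resp K b)"
  unfolding resp_def[abs_def] by (intro prog_ie_formula prog_primitive)

lemma resp_sol:
  assumes K: "linear K" and b: "integrable (leb T) (\<lambda>s. b s \<omega>)"
  shows "ie_sol K T (\<lambda>t. \<integral>s\<in>{0..t}. b s \<omega> \<partial>lborel) (\<lambda>t. resp K b t \<omega>)"
  unfolding resp_def by (intro ie_formula_sol[OF K] continuous_on_int_leb b)

lemma resp_PP: "linear K \<Longrightarrow> L2p b \<Longrightarrow> (\<lambda>p. resp K b (fst p) (snd p)) \<in> borel_measurable PP"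
  using ie_formula_measurable[OF _ measurable_primitive[of b T \<Omega>]]
  by (simp add: resp_def L2_def split_beta')

lemma resp_bound:
  fixes K :: "'v::euclidean_space \<Rightarrow> 'v"
  assumes K: "linear K"
  obtains C where "C > 0"
    "\<And>b. L2p b \<Longrightarrow> L2p (resp K b) \<and> n2p (resp K b) \<le> C * n2p b
       \<and> L2 \<Omega> (resp K b T) \<and> n2 \<Omega> (resp K b T) \<le> C * n2p b"
proof -
  obtain C where C: "C > 0"
    "\<And>c z. L2p c \<Longrightarrow> L2 \<Omega> (c T) \<Longrightarrow> (\<lambda>p. z (fst p) (snd p)) \<in> borel_measurable PP \<Longrightarrow>
      (AE \<omega> in \<Omega>. ie_sol K T (\<lambda>t. c t \<omega>) (\<lambda>t. z t \<omega>)) \<Longrightarrow>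
      L2p z \<and> n2p z \<le> C * n2p c \<and> L2 \<Omega> (z T) \<and> n2 \<Omega> (z T) \<le> C * (n2p c + n2 \<Omega> (c T))"
    using ie_L2_bound[OF K] by blast
  define D where "D = C * (T\<^sup>2 + T)"
  have D: "D > 0" unfolding D_def using C(1) T_pos by (intro mult_pos_pos add_pos_pos) auto
  have "L2p (resp K b) \<and> n2p (resp K b) \<le> D * n2p b
       \<and> L2 \<Omega> (resp K b T) \<and> n2 \<Omega> (resp K b T) \<le> D * n2p b" if b: "L2p b" for b
  proof -
    let ?c = "\<lambda>t \<omega>. \<integral>s\<in>{0..t}. b s \<omega> \<partial>lborel"
    note p = primitive_L2[OF b]
    have ie: "AE \<omega> in \<Omega>. ie_sol K T (\<lambda>t. ?c t \<omega>) (\<lambda>t. resp K b t \<omega>)"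
      using L2p_paths[OF b] by eventually_elim (rule resp_sol[OF K])
    note q = C(2)[OF p(1) p(3)[OF T_in(1)] resp_PP[OF K b] ie]
    have "C * n2p ?c \<le> C * (T\<^sup>2 * n2p b)" using p(2) C(1) by (intro mult_left_mono) auto
    also have "\<dots> \<le> D * n2p b" unfolding D_def using C(1) T_pos by (simp add: algebra_simps)
    finally have 1: "C * n2p ?c \<le> D * n2p b" .
    have "C * (n2p ?c + n2 \<Omega> (?c T)) \<le> C * (T\<^sup>2 * n2p b + T * n2p b)"
      using p(2) p(4)[OF T_in(1)] C(1) by (intro mult_left_mono add_mono) auto
    then have 2: "C * (n2p ?c + n2 \<Omega> (?c T)) \<le> D * n2p b" by (simp add: D_def algebra_simps)
    from q 1 2 show ?thesis by (blast intro: order_trans)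
  qed
  then show ?thesis using that[OF D] by blast
qed

text \<open>The mean form of Ito's product rule for a semimartingale Y and an absolutely continuous
  \<theta>, with no stochastic integral. Y belongs to the filtration of W_j alone, whereas k may use
  all motions in J; the increments of the martingale part stay orthogonal to this larger past by
  independence.\<close>

lemma martingale_integration_by_parts:
  fixes Y g k :: "real \<Rightarrow> 'w \<Rightarrow> 'v::euclidean_space"
  assumes j: "j \<in> J" "J \<subseteq> {1..}"
    and Y: "prog_meas \<Omega> W {j} T Y" "L2p Y" "L2 \<Omega> (Y T)"
    and g: "prog_meas \<Omega> W {j} T g" "L2p g"
    and k: "prog_meas \<Omega> W J T k" "L2p k"
  defines "Mart \<equiv> \<lambda>t \<omega>. Y t \<omega> - (prim (\<lambda>s. g s \<omega>) t)"
    and "\<theta> \<equiv> \<lambda>t \<omega>. \<integral>s\<in>{0..t}. k s \<omega> \<partial>lborel"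
  assumes Mi: "\<And>t. t \<in> {0..T} \<Longrightarrow> integrable \<Omega> (Mart t)"
    and M: "\<And>s E. s \<in> {0..T} \<Longrightarrow> E \<in> sets (nat_filt \<Omega> W {j} s) \<Longrightarrow> (\<integral>\<omega>\<in>E. (Mart T \<omega> - Mart s \<omega>) \<partial>\<Omega>) = 0"
  shows "(\<integral>\<omega>. Y T \<omega> \<bullet> \<theta> T \<omega> \<partial>\<Omega>)
      = (\<integral>p. Y (fst p) (snd p) \<bullet> k (fst p) (snd p) \<partial>PP) + (\<integral>p. g (fst p) (snd p) \<bullet> \<theta> (fst p) (snd p) \<partial>PP)"
proof -
  define G where "G = (\<lambda>t \<omega>. \<integral>s\<in>{0..t}. g s \<omega> \<partial>lborel)"
  \<comment> \<open>This is Y(T) minus the integral of g from s to T: an absolutely continuous but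
    non-adapted substitute for Y, differing from Y(s) by the future increment of the martingale.
    Pathwise integration by parts applies to it.\<close>
  define a where "a = (\<lambda>s \<omega>. Mart T \<omega> + G s \<omega>)"
  have pg: "L2p G" "L2 \<Omega> (G T)" and pk: "L2p \<theta>" "L2 \<Omega> (\<theta> T)"
    unfolding G_def \<theta>_def using primitive_L2(1,3)[OF g(2)] primitive_L2(1,3)[OF k(2)] by simp_all
  have MT: "Mart T = (\<lambda>\<omega>. Y T \<omega> - G T \<omega>)" by (simp add: Mart_def G_def)
  have MTL: "L2 \<Omega> (Mart T)" unfolding MT using Y(3) pg(2) by (rule L2_diff)
  have aL: "L2p a" unfolding a_def by (intro L2_add(1) L2p_snd(1)[OF MTL] pg(1))
  have sub: "subalgebra \<Omega> (nat_filt \<Omega> W J s)" for s by (rule nat_filt_subalgebra[OF j(2)])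
  have Gm: "prog_meas \<Omega> W {j} T G" unfolding G_def by (rule prog_primitive[OF g(1)])
  have Mm: "Mart t \<in> borel_measurable (nat_filt \<Omega> W {j} T)" if t: "t \<in> {0..T}" for t
  proof -
    have "Y t \<in> borel_measurable (nat_filt \<Omega> W {j} t)" "G t \<in> borel_measurable (nat_filt \<Omega> W {j} t)"
      using prog_section[OF Y(1) t] prog_section[OF Gm t] by auto
    then have "Mart t \<in> borel_measurable (nat_filt \<Omega> W {j} t)" unfolding Mart_def G_def by auto
    then show ?thesis using t by (intro measurable_from_subalg[OF nat_filt_mono[OF order_refl, of t T]]) auto
  qed
  \<comment> \<open>Replacing \<open>a\<close> by Y is possible for almost every s only, because k,
    Y and \<open>a\<close> are known to be square integrable in omega just for almost every
    s.\<close>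
  have orth: "AE s in leb T. (\<integral>\<omega>. a s \<omega> \<bullet> k s \<omega> \<partial>\<Omega>) = (\<integral>\<omega>. Y s \<omega> \<bullet> k s \<omega> \<partial>\<Omega>)"
    using sections(1)[OF k(2)] sections(1)[OF Y(2)] sections(1)[OF aL] AE_space
  proof eventually_elim
    case (elim s)
    then have s: "s \<in> {0..T}" by simp
    let ?D = "\<lambda>\<omega>. Mart T \<omega> - Mart s \<omega>"
    have aY: "a s \<omega> = Y s \<omega> + ?D \<omega>" for \<omega> by (simp add: a_def Mart_def G_def)
    have DL: "L2 \<Omega> ?D" using L2_diff(1)[OF elim(3,2)] by (simp add: aY)
    have Di: "integrable \<Omega> ?D" using Mi s by auto
    have Dm: "?D \<in> borel_measurable (nat_filt \<Omega> W {j} T)" using Mm[OF T_in(1)] Mm[OF s] by auto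
    have ks: "k s \<in> borel_measurable (nat_filt \<Omega> W J s)" by (rule prog_section[OF k(1) s])
    have comp: "(\<integral>\<omega>. (k s \<omega> \<bullet> b) * (?D \<omega> \<bullet> b) \<partial>\<Omega>) = 0" and compi: "integrable \<Omega> (\<lambda>\<omega>. (k s \<omega> \<bullet> b) * (?D \<omega> \<bullet> b))"
      if b: "b \<in> Basis" for b
    proof -
      have lin: "linear (\<lambda>x::'v. x \<bullet> b)" by (rule bounded_linear.linear) (rule bounded_linear_inner_left)
      show compi: "integrable \<Omega> (\<lambda>\<omega>. (k s \<omega> \<bullet> b) * (?D \<omega> \<bullet> b))"
        using L2_inner(1)[OF L2_linear'[OF lin elim(1)] L2_linear'[OF lin DL]] by simp
      have Db: "(\<integral>\<omega>. (?D \<omega> \<bullet> b) * indicator E \<omega> \<partial>\<Omega>) = 0" if E: "E \<in> sets (nat_filt \<Omega> W {j} s)" for E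
      proof -
        have "E \<in> sets \<Omega>" using E nat_filt_subalgebra[of "{j}" s] j by (auto simp: subalgebra_def)
        then have "integrable \<Omega> (\<lambda>\<omega>. indicator E \<omega> *\<^sub>R ?D \<omega>)" using Di by (rule integrable_mult_indicator)
        then have "(\<integral>\<omega>. (indicator E \<omega> *\<^sub>R ?D \<omega>) \<bullet> b \<partial>\<Omega>) = (\<integral>\<omega>\<in>E. ?D \<omega> \<partial>\<Omega>) \<bullet> b"
          by (simp add: set_lebesgue_integral_def del: inner_scaleR_left)
        then show ?thesis using M[OF s E] by (simp add: mult.commute)
      qed
      show "(\<integral>\<omega>. (k s \<omega> \<bullet> b) * (?D \<omega> \<bullet> b) \<partial>\<Omega>) = 0"
      proof (rule integral_mult_eq_0_if_orthogonal[OF sub _ _ _ compi])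
        show "integrable \<Omega> (\<lambda>\<omega>. ?D \<omega> \<bullet> b)" using Di by auto
        show "(\<lambda>\<omega>. k s \<omega> \<bullet> b) \<in> borel_measurable (nat_filt \<Omega> W J s)" using ks by auto
        fix E assume "E \<in> sets (nat_filt \<Omega> W J s)"
        then show "(\<integral>\<omega>. (?D \<omega> \<bullet> b) * indicator E \<omega> \<partial>\<Omega>) = 0"
          using Di Dm s by (intro orthogonal_enlarged_filtration[OF j _ _ _ Db, of T]) auto
      qed
    qed
    have "(\<integral>\<omega>. ?D \<omega> \<bullet> k s \<omega> \<partial>\<Omega>) = (\<integral>\<omega>. (\<Sum>b\<in>Basis. (k s \<omega> \<bullet> b) * (?D \<omega> \<bullet> b)) \<partial>\<Omega>)"
      by (intro bint_cong refl) (subst euclidean_inner, simp add: mult.commute)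
    also have "\<dots> = 0" using comp compi by simp
    finally have "(\<integral>\<omega>. ?D \<omega> \<bullet> k s \<omega> \<partial>\<Omega>) = 0" .
    then show ?case
      using L2_inner(1)[OF elim(2) elim(1)] L2_inner(1)[OF DL elim(1)] by (simp add: aY inner_add_left)
  qed
  have ibp: "AE \<omega> in \<Omega>. (\<integral>s. a s \<omega> \<bullet> k s \<omega> \<partial>leb T) + (\<integral>s. g s \<omega> \<bullet> \<theta> s \<omega> \<partial>leb T) = Y T \<omega> \<bullet> \<theta> T \<omega>"
    using L2p_paths[OF g(2)] L2p_paths[OF k(2)]
  proof eventually_elim
    case (elim \<omega>)
    show ?case
    proof (rule integral_by_parts_L1(3)[OF T_in(3) elim])
      fix s assume s: "s \<in> {0..T}"
      show "a s \<omega> = Y T \<omega> - (\<integral>r\<in>{s..T}. g r \<omega> \<partial>lborel)"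
        using set_integral_split[OF elim(1) s] by (simp add: a_def Mart_def G_def)
    qed (simp add: \<theta>_def)
  qed
  have i1: "integrable PP (\<lambda>p. a (fst p) (snd p) \<bullet> k (fst p) (snd p))" by (rule L2_inner(1)[OF aL k(2)])
  have i2: "integrable PP (\<lambda>p. g (fst p) (snd p) \<bullet> \<theta> (fst p) (snd p))" by (rule L2_inner(1)[OF g(2) pk(1)])
  have i3: "integrable PP (\<lambda>p. Y (fst p) (snd p) \<bullet> k (fst p) (snd p))" by (rule L2_inner(1)[OF Y(2) k(2)])
  have snd: "integrable PP (\<lambda>p. f (fst p) (snd p)) \<Longrightarrow> integrable \<Omega> (\<lambda>\<omega>. \<integral>s. f s \<omega> \<partial>leb T)
      \<and> (\<integral>\<omega>. (\<integral>s. f s \<omega> \<partial>leb T) \<partial>\<Omega>) = (\<integral>p. f (fst p) (snd p) \<partial>PP)" for f :: "real \<Rightarrow> 'w \<Rightarrow> real"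
    using P.integrable_snd[of f] P.integral_snd[of f] by (simp add: split_beta')
  have fst: "integrable PP (\<lambda>p. f (fst p) (snd p)) \<Longrightarrow> integrable (leb T) (\<lambda>s. \<integral>\<omega>. f s \<omega> \<partial>\<Omega>)
      \<and> (\<integral>s. (\<integral>\<omega>. f s \<omega> \<partial>\<Omega>) \<partial>leb T) = (\<integral>p. f (fst p) (snd p) \<partial>PP)" for f :: "real \<Rightarrow> 'w \<Rightarrow> real"
    using P.integrable_fst[of f] P.integral_fst[of f] by (simp add: split_beta')
  have "(\<integral>\<omega>. Y T \<omega> \<bullet> \<theta> T \<omega> \<partial>\<Omega>) = (\<integral>\<omega>. (\<integral>s. a s \<omega> \<bullet> k s \<omega> \<partial>leb T) + (\<integral>s. g s \<omega> \<bullet> \<theta> s \<omega> \<partial>leb T) \<partial>\<Omega>)"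
    using ibp snd[OF i1] snd[OF i2] L2_inner(1)[OF Y(3) pk(2)]
    by (intro integral_cong_AE) (auto elim: eventually_mono)
  also have "\<dots> = (\<integral>p. a (fst p) (snd p) \<bullet> k (fst p) (snd p) \<partial>PP) + (\<integral>p. g (fst p) (snd p) \<bullet> \<theta> (fst p) (snd p) \<partial>PP)"
    using snd[OF i1] snd[OF i2] by simp
  also have "(\<integral>p. a (fst p) (snd p) \<bullet> k (fst p) (snd p) \<partial>PP) = (\<integral>s. (\<integral>\<omega>. a s \<omega> \<bullet> k s \<omega> \<partial>\<Omega>) \<partial>leb T)"
    using fst[OF i1] by simp
  also have "\<dots> = (\<integral>s. (\<integral>\<omega>. Y s \<omega> \<bullet> k s \<omega> \<partial>\<Omega>) \<partial>leb T)"
    using orth fst[OF i1] fst[OF i3] by (intro integral_cong_AE) auto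
  also have "\<dots> = (\<integral>p. Y (fst p) (snd p) \<bullet> k (fst p) (snd p) \<partial>PP)"
    using fst[OF i3] by simp
  finally show ?thesis .
qed

end

section \<open>The strategies\<close>

lemma inner_transpose: "(transpose A *v x) \<bullet> y = x \<bullet> (A *v y)" for A :: "real^'m^'n"
  by (simp add: transpose_matrix_vector dot_lmul_matrix)

lemma sym_mat_inner: "sym_mat S \<Longrightarrow> (S *v x) \<bullet> y = x \<bullet> (S *v y)"
  using inner_transpose[of S x y] by (simp add: sym_mat_def)

lemma qf_add: "sym_mat S \<Longrightarrow> qf S (x + y) = qf S x + 2 * ((S *v x) \<bullet> y) + qf S y"
  using sym_mat_inner[of S x y]
  by (simp add: qf_def matrix_vector_right_distrib inner_add_left inner_add_right inner_commute)

lemma qf_scaleR: "qf S (c *\<^sub>R x) = c\<^sup>2 * qf S x"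
  by (simp add: qf_def matrix_vector_mult_scaleR power2_eq_square)

lemma qf_uminus: "qf S (- x) = qf S x"
  using qf_scaleR[of S "-1" x] by simp

text \<open>Completing the square: x/2 - h has a nonnegative quadratic form.\<close>

lemma psd_cross_le: "psd S \<Longrightarrow> (S *v (x - h)) \<bullet> h \<le> qf S x / 4"
proof -
  assume S: "psd S"
  have "0 \<le> qf S ((1/2) *\<^sub>R x + (- h))" using S by (simp add: psd_def)
  also have "\<dots> = qf S x / 4 - (S *v x) \<bullet> h + (S *v h) \<bullet> h"
    using S qf_add[of S "(1/2) *\<^sub>R x" "- h"]
    by (simp add: psd_def qf_scaleR qf_uminus matrix_vector_mult_scaleR power2_eq_square) (simp add: qf_def inner_commute)
  finally show ?thesis by (simp add: matrix_vector_mult_diff_distrib inner_diff_left)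
qed

lemma qf_bound: obtains c where "c > 0" "\<And>x. \<bar>qf S x\<bar> \<le> c * (norm x)\<^sup>2"
proof -
  obtain c where c: "c > 0" "\<And>x. norm (S *v x) \<le> c * norm x"
    using linear_bounded_pos[OF matrix_vector_mul_linear[of S]] by blast
  have "\<bar>qf S x\<bar> \<le> c * (norm x)\<^sup>2" for x
  proof -
    have "\<bar>qf S x\<bar> \<le> norm x * norm (S *v x)" unfolding qf_def by (rule Cauchy_Schwarz_ineq2)
    also have "\<dots> \<le> norm x * (c * norm x)" by (intro mult_left_mono c) auto
    finally show ?thesis by (simp add: power2_eq_square mult_ac)
  qed
  with c(1) show ?thesis by (rule that)
qed

lemma pd_coercive:
  fixes S :: "real^'n^'n"
  assumes "pd S" obtains c where "c > 0" "\<And>x. c * (norm x)\<^sup>2 \<le> qf S x"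
proof -
  have cont: "continuous_on (sphere 0 1) (qf S)"
    unfolding qf_def by (intro continuous_intros linear_continuous_on_compose matrix_vector_mul_linear)
  obtain b :: "real^'n" where b: "b \<in> Basis" using nonempty_Basis by blast
  then have "sphere (0 :: real^'n) 1 \<noteq> {}" by (auto intro!: exI[of _ b])
  from continuous_attains_inf[OF compact_sphere this cont]
  obtain x0 where x0: "x0 \<in> sphere 0 1" "\<And>x. x \<in> sphere 0 1 \<Longrightarrow> qf S x0 \<le> qf S x" by blast
  have "x0 \<noteq> 0" using x0(1) by auto
  then have "qf S x0 > 0" using assms by (simp add: pd_def)
  moreover have "qf S x0 * (norm x)\<^sup>2 \<le> qf S x" for x
  proof (cases "x = 0")
    case False
    have "qf S x0 \<le> qf S ((1 / norm x) *\<^sub>R x)" using False by (intro x0(2)) simp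
    also have "\<dots> = qf S x / (norm x)\<^sup>2" by (simp add: qf_scaleR power_divide)
    finally show ?thesis using False by (simp add: field_simps)
  qed (simp add: qf_def)
  ultimately show ?thesis by (rule that)
qed

lemma pd_inverse:
  fixes S :: "real^'n^'n"
  assumes "pd S" shows "S *v (matrix_inv S *v x) = x"
proof -
  have "S *v x = 0 \<Longrightarrow> x = 0" for x using assms by (force simp: pd_def qf_def)
  then have "invertible S"
    by (simp add: invertible_left_inverse matrix_left_invertible_ker)
  then have "S ** matrix_inv S = mat 1"
    unfolding invertible_def matrix_inv_def by (rule someI2_ex) blast
  then show ?thesis by (simp add: matrix_vector_mul_assoc)
qed

lemma ie_sol_sum:
  fixes K :: "'a::euclidean_space \<Rightarrow> 'a"
  assumes K: "linear K" and "\<And>j. j \<in> J \<Longrightarrow> ie_sol K T (c j) (z j)"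
  shows "ie_sol K T (\<lambda>t. \<Sum>j\<in>J. a j *\<^sub>R c j t) (\<lambda>t. \<Sum>j\<in>J. a j *\<^sub>R z j t)"
  unfolding ie_sol_def
proof (intro conjI ballI)
  fix t assume t: "t \<in> {0..T}"
  show "((\<lambda>s. K (\<Sum>j\<in>J. a j *\<^sub>R z j s)) has_integral (\<Sum>j\<in>J. a j *\<^sub>R z j t) - (\<Sum>j\<in>J. a j *\<^sub>R c j t)) {0..t}"
  proof (cases "finite J")
    case True
    have "((\<lambda>s. \<Sum>j\<in>J. a j *\<^sub>R K (z j s)) has_integral (\<Sum>j\<in>J. a j *\<^sub>R (z j t - c j t))) {0..t}"
      using assms t by (intro has_integral_sum True has_integral_cmul) (auto simp: ie_sol_def)
    then show ?thesis
      by (simp add: linear_sum[OF K] linear_scale[OF K] scaleR_diff_right sum_subtractf)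
  qed (simp add: linear_0[OF K])
qed (use assms in \<open>auto simp: ie_sol_def intro!: continuous_intros\<close>)

text \<open>Moves an integrable forcing into the continuous datum; controls, disturbances and
  population terms all enter the state equations in this way.\<close>

lemma ie_sol_forced:
  fixes K :: "'a::euclidean_space \<Rightarrow> 'a"
  assumes K: "linear K" and b: "integrable (leb T) b" and c: "continuous_on {0..T} c"
    and z: "\<And>t. t \<in> {0..T} \<Longrightarrow> ((\<lambda>s. K (z s) + b s) has_integral (z t - c t)) {0..t}"
  shows "ie_sol K T (\<lambda>t. c t + (prim b t)) z"
  unfolding ie_sol_def
proof (intro conjI ballI)
  show "continuous_on {0..T} (\<lambda>t. c t + (prim b t))"
    by (intro continuous_on_add c continuous_on_int_leb b)
  fix t assume t: "t \<in> {0..T}"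
  have "((\<lambda>s. (K (z s) + b s) - b s) has_integral (z t - c t) - (prim b t)) {0..t}"
    using t by (intro has_integral_diff z has_integral_leb[OF b]) auto
  then show "((\<lambda>s. K (z s)) has_integral (z t - (c t + (prim b t)))) {0..t}"
    by (simp add: algebra_simps)
qed

lemma ie_sol_cong:
  assumes "ie_sol K T c z" "\<And>t. t \<in> {0..T} \<Longrightarrow> c t = c' t"
  shows "ie_sol K T c' z"
  using assms continuous_on_cong[of "{0..T}" "{0..T}" c c'] by (auto simp: ie_sol_def)

lemma has_vector_derivative_imp_has_integral:
  fixes f :: "real \<Rightarrow> 'a::euclidean_space"
  assumes "\<forall>t\<in>{0..T}. (f has_vector_derivative f' t) (at t within {0..T})" "t \<in> {0..T}"
  shows "(f' has_integral (f t - f 0)) {0..t}"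
  using assms
  by (intro fundamental_theorem_of_calculus)
     (auto intro: has_vector_derivative_within_subset[of f _ _ "{0..T}" "{0..t}"])

lemma has_vector_derivative_imp_continuous_on:
  assumes "\<forall>t\<in>{0..T}. (f has_vector_derivative f' t) (at t within {0..T})"
  shows "continuous_on {0..T} f"
  unfolding continuous_on_eq_continuous_within
  using assms by (blast intro: has_vector_derivative_continuous)

lemma (in horizon) mean_linear:
  fixes K :: "'a::euclidean_space \<Rightarrow> 'b::euclidean_space"
  assumes K: "linear K" and f: "integrable \<Omega> f"
  shows "expectation (\<lambda>\<omega>. K (f \<omega>)) = K (expectation f)" "integrable \<Omega> (\<lambda>\<omega>. K (f \<omega>))"
  using integral_bounded_linear[of K \<Omega> f] integrable_bounded_linear[of K \<Omega> f] K f linear_conv_bounded_linear by auto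

context brownian_horizon
begin

text \<open>Expectations are taken in the primitive form of the response and interchanged with the
  time integral. The identity holds at every t even though the forcing has integrable sections only
  for almost every s, since only its integral over time appears.\<close>

lemma mean_resp:
  fixes K :: "'v::euclidean_space \<Rightarrow> 'v"
  assumes K: "linear K" and b: "L2p b"
  shows "ie_sol K T (\<lambda>t. \<integral>s\<in>{0..t}. expectation (b s) \<partial>lborel) (\<lambda>t. expectation (resp K b t))"
proof -
  obtain C where "L2p (resp K b)" using resp_bound[OF K] b by blast
  note rL = this
  have Kr: "L2p (\<lambda>s \<omega>. K (resp K b s \<omega>))" by (rule L2_linear'[OF K rL])
  have kL: "L2p (\<lambda>s \<omega>. K (resp K b s \<omega>) + b s \<omega>)" by (rule L2_add(1)[OF Kr b])
  have eq: "AE \<omega> in \<Omega>. \<forall>t\<in>{0..T}. resp K b t \<omega> = (prim (\<lambda>s. K (resp K b s \<omega>) + b s \<omega>) t)"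
    using L2p_paths[OF b]
  proof eventually_elim
    case (elim \<omega>)
    show ?case using ie_sol_primitive(2)[OF K elim resp_sol[of K b \<omega>, OF K elim]] by blast
  qed
  have m: "expectation (resp K b t) = (prim (\<lambda>s. expectation (\<lambda>\<omega>. K (resp K b s \<omega>) + b s \<omega>)) t)"
    if t: "t \<in> {0..T}" for t
  proof -
    have "expectation (resp K b t) = expectation (\<lambda>\<omega>. \<integral>s\<in>{0..t}. K (resp K b s \<omega>) + b s \<omega> \<partial>lborel)"
      using eq t section_measurable[OF resp_PP[OF K b] t] mean_primitive(1)[OF kL t]
      by (intro integral_cong_AE) (auto elim: eventually_mono)
    then show ?thesis using mean_primitive(2)[OF kL t] by simp
  qed
  have bL: "integrable (leb T) (\<lambda>s. expectation (b s))" using leb.L2_integrable(1)[OF mean_L2(1)[OF b]] .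
  have KrL: "integrable (leb T) (\<lambda>s. K (expectation (resp K b s)))"
    using leb.L2_integrable(1)[OF L2_linear'[OF K mean_L2(1)[OF rL]]] .
  have kLL: "integrable (leb T) (\<lambda>s. expectation (\<lambda>\<omega>. K (resp K b s \<omega>) + b s \<omega>))"
    using leb.L2_integrable(1)[OF mean_L2(1)[OF kL]] .
  have "AE s in leb T. expectation (\<lambda>\<omega>. K (resp K b s \<omega>) + b s \<omega>) = K (expectation (resp K b s)) + expectation (b s)"
    using L2p_integrable_section[OF b] L2p_integrable_section[OF rL]
    by eventually_elim (simp add: mean_linear[OF K])
  note ae = this
  have "expectation (resp K b t) = (prim (\<lambda>s. K (expectation (resp K b s)) + expectation (b s)) t)"
    if t: "t \<in> {0..T}" for t
  proof -
    have "(prim (\<lambda>s. expectation (\<lambda>\<omega>. K (resp K b s \<omega>) + b s \<omega>)) t)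
        = (prim (\<lambda>s. K (expectation (resp K b s)) + expectation (b s)) t)"
    proof -
      have tT: "0 \<le> (0::real)" "t \<le> T" using t by auto
      show ?thesis unfolding set_integral_leb[OF tT]
        using ae kLL KrL bL by (intro integral_cong_AE) (auto intro!: borel_measurable_scaleR borel_measurable_indicator sets_leb simp: t tT elim: eventually_mono)
    qed
    then show ?thesis using m[OF t] by simp
  qed
  note m' = this
  have "((\<lambda>s. K (expectation (resp K b s)) + expectation (b s)) has_integral (expectation (resp K b t) - 0)) {0..t}"
    if t: "t \<in> {0..T}" for t
    unfolding m'[OF t] diff_0_right using t by (intro has_integral_leb[OF bi_add[OF KrL bL]]) auto
  from ie_sol_forced[OF K bL _ this] show ?thesis by simp
qed

end

section \<open>The game, the regularity of the strategies and their stationarity\<close>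

locale lq_game = brownian_horizon \<Omega> T W
  for \<Omega> :: "'w measure" and T :: real and W :: "nat \<Rightarrow> real \<Rightarrow> 'w \<Rightarrow> real^'d" +
  fixes A G \<Gamma> Q H :: "real^'n^'n" and B :: "real^'k^'n" and D :: "real^'d^'n"
    and R :: "real^'k^'k" and \<eta> m0 :: "real^'n" and \<gamma> M0 :: real
    and x0 :: "nat \<Rightarrow> real^'n" and m p y :: "real \<Rightarrow> real^'n"
    and X Y :: "nat \<Rightarrow> real \<Rightarrow> 'w \<Rightarrow> real^'n" and M P :: "nat \<Rightarrow> real \<Rightarrow> real^'n"
  assumes gam: "\<gamma> > 0"
    and Qpsd: "psd Q" and Hpsd: "psd H" and Rpd: "pd R"
    and hyp1: "H1 A G \<Gamma> Q H \<gamma> T" and hyp2: "H2 A B G \<Gamma> Q R H \<gamma> T"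
    and init: "\<forall>i\<ge>1. norm (x0 i) \<le> M0"
    and mf: "MF_sol A B G \<Gamma> \<eta> Q R H \<gamma> T m0 m p y"
    and strat: "\<forall>i\<ge>1. FBSDE_sol A B G D \<Gamma> \<eta> Q R H \<gamma> T \<Omega> W x0 m0 y i (X i) (M i) (P i) (Y i)"
begin

abbreviation "Fb \<equiv> \<lambda>v. matrix_inv R *v (transpose B *v v)"

lemma linear_Fb: "linear Fb"
  using linear_compose[OF matrix_vector_mul_linear[of "transpose B"] matrix_vector_mul_linear[of "matrix_inv R"]]
  by (simp add: o_def)

lemmas lin = matrix_vector_mul_linear linear_Fb

lemma R_Fb: "R *v Fb v = transpose B *v v"
  by (rule pd_inverse[OF Rpd])

text \<open>The optimality condition R u = B^T Y in weak form. It turns the pairing with the adjoint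
  process, as produced by integration by parts, into the cross term of the control cost.\<close>

lemma Y_B: "v \<bullet> (B *v w) = (R *v Fb v) \<bullet> w"
  unfolding R_Fb by (rule inner_transpose[symmetric])

lemma Qsym: "sym_mat Q" and Hsym: "sym_mat H" and Rsym: "sym_mat R"
  using Qpsd Hpsd Rpd by (auto simp: psd_def pd_def)

text \<open>Half the gradient of the running state cost along the strategy; apart from the adjoint
  term in A, it is the generator of the backward equation.\<close>

definition drift :: "nat \<Rightarrow> real \<Rightarrow> 'w \<Rightarrow> real^'n" where
  "drift i s \<omega> = Q *v (X i s \<omega> - (\<Gamma> *v M i s + \<eta>))"

definition gen :: "nat \<Rightarrow> real \<Rightarrow> 'w \<Rightarrow> real^'n" where
  "gen i s \<omega> = - (transpose A *v Y i s \<omega>) + drift i s \<omega>"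

lemma fbsde:
  assumes i: "1 \<le> i"
  shows "prog_meas \<Omega> W {i} T (X i)" "prog_meas \<Omega> W {i} T (Y i)"
    "L2p (X i)" "L2p (Y i)"
    "M i 0 = m0" "P i T = H *v expectation (X i T)"
    "\<forall>t\<in>{0..T}. (M i has_vector_derivative ((A + G) *v M i t + B *v Fb (y t) + \<gamma> *\<^sub>R P i t)) (at t within {0..T})"
    "\<forall>t\<in>{0..T}. (P i has_vector_derivative (- (transpose (A + G) *v P i t)
        - transpose (mat 1 - \<Gamma>) *v (Q *v (expectation (X i t) - (\<Gamma> *v M i t + \<eta>))))) (at t within {0..T})"
    "AE \<omega> in \<Omega>. \<forall>t\<in>{0..T}.
       ((\<lambda>s. A *v X i s \<omega> + B *v Fb (Y i s \<omega>) + G *v M i s + \<gamma> *\<^sub>R P i s)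
          has_integral (X i t \<omega> - x0 i - D *v W i t \<omega>)) {0..t}"
    "AE \<omega> in \<Omega>. Y i T \<omega> = - (H *v X i T \<omega>)"
    "\<And>t. t \<in> {0..T} \<Longrightarrow> integrable \<Omega> (\<lambda>\<omega>. Y i t \<omega> - (prim (\<lambda>s. gen i s \<omega>) t))"
    "\<And>s t E. 0 \<le> s \<Longrightarrow> s \<le> t \<Longrightarrow> t \<le> T \<Longrightarrow> E \<in> sets (nat_filt \<Omega> W {i} s) \<Longrightarrow>
       (\<integral>\<omega>\<in>E. ((Y i t \<omega> - (prim (\<lambda>s. gen i s \<omega>) t)) - (Y i s \<omega> - (prim (\<lambda>s. gen i s \<omega>) s))) \<partial>\<Omega>) = 0"
proof -
  note F = strat[rule_format, OF i, unfolded FBSDE_sol_def Let_def]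
  have sub: "{i} \<subseteq> {1..}" using i by auto
  show "prog_meas \<Omega> W {i} T (X i)" "prog_meas \<Omega> W {i} T (Y i)"
    "L2p (X i)" "L2p (Y i)"
    "M i 0 = m0" "P i T = H *v expectation (X i T)"
    using F prog_L2p[OF _ sub] by blast+
  show "\<forall>t\<in>{0..T}. (M i has_vector_derivative ((A + G) *v M i t + B *v Fb (y t) + \<gamma> *\<^sub>R P i t)) (at t within {0..T})"
    "\<forall>t\<in>{0..T}. (P i has_vector_derivative (- (transpose (A + G) *v P i t)
        - transpose (mat 1 - \<Gamma>) *v (Q *v (expectation (X i t) - (\<Gamma> *v M i t + \<eta>))))) (at t within {0..T})"
    using F by blast+
  show "AE \<omega> in \<Omega>. \<forall>t\<in>{0..T}.
       ((\<lambda>s. A *v X i s \<omega> + B *v Fb (Y i s \<omega>) + G *v M i s + \<gamma> *\<^sub>R P i s)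
          has_integral (X i t \<omega> - x0 i - D *v W i t \<omega>)) {0..t}"
    "AE \<omega> in \<Omega>. Y i T \<omega> = - (H *v X i T \<omega>)"
    using F by blast+
  show "integrable \<Omega> (\<lambda>\<omega>. Y i t \<omega> - (prim (\<lambda>s. gen i s \<omega>) t))" if "t \<in> {0..T}" for t
    using F that unfolding gen_def drift_def by blast
  show "(\<integral>\<omega>\<in>E. ((Y i t \<omega> - (prim (\<lambda>s. gen i s \<omega>) t)) - (Y i s \<omega> - (prim (\<lambda>s. gen i s \<omega>) s))) \<partial>\<Omega>) = 0"
    if "0 \<le> s" "s \<le> t" "t \<le> T" "E \<in> sets (nat_filt \<Omega> W {i} s)" for s t E
    using F that unfolding gen_def drift_def by blast
qed

lemma MP_continuous:
  assumes i: "1 \<le> i"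
  shows "continuous_on {0..T} (M i)" "continuous_on {0..T} (P i)"
  using fbsde(7,8)[OF i] by (auto intro: has_vector_derivative_imp_continuous_on)

lemma MP_L2:
  assumes i: "1 \<le> i"
  shows "L2 (leb T) (M i)" "L2 (leb T) (P i)"
  using MP_continuous[OF i] by (auto intro: L2_leb_continuous)

lemma drift_L2:
  assumes i: "1 \<le> i"
  shows "prog_meas \<Omega> W {i} T (drift i)" "L2p (drift i)" "prog_meas \<Omega> W {i} T (gen i)" "L2p (gen i)"
proof -
  have Mm: "(\<lambda>s. \<Gamma> *v M i s + \<eta>) \<in> borel_measurable (leb T)"
    by (intro measurable_leb_continuous continuous_intros linear_continuous_on_compose[OF lin(1)] MP_continuous[OF i])
  have MmL: "L2 (leb T) (\<lambda>s. \<Gamma> *v M i s + \<eta>)"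
    by (intro L2_leb_continuous continuous_intros linear_continuous_on_compose[OF lin(1)] MP_continuous[OF i])
  show a: "prog_meas \<Omega> W {i} T (drift i)" unfolding drift_def[abs_def]
    by (intro prog_linear[OF lin(1)] prog_diff fbsde(1)[OF i] prog_deterministic Mm)
  show b: "L2p (drift i)" unfolding drift_def
    by (intro L2_linear'[OF lin(1)] L2_diff(1) fbsde(3)[OF i] L2p_fst(1)[OF MmL])
  have e: "gen i = (\<lambda>s \<omega>. drift i s \<omega> - transpose A *v Y i s \<omega>)" by (auto simp: gen_def fun_eq_iff)
  show "prog_meas \<Omega> W {i} T (gen i)" unfolding e
    by (intro prog_linear[OF lin(1)] prog_diff a fbsde(2)[OF i])
  show "L2p (gen i)" unfolding e
    by (intro L2_linear'[OF lin(1)] L2_diff(1) b fbsde(4)[OF i])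
qed

definition forcing :: "nat \<Rightarrow> real \<Rightarrow> 'w \<Rightarrow> real^'n" where
  "forcing i s \<omega> = B *v Fb (Y i s \<omega>) + G *v M i s + \<gamma> *\<^sub>R P i s"

lemma forcing_L2:
  assumes i: "1 \<le> i" shows "L2p (forcing i)"
  unfolding forcing_def
  by (intro L2_add(1) L2_linear'[OF lin(1)] L2_linear'[OF lin(2)] L2_scaleR fbsde(4)[OF i]
      L2p_fst(1)[OF MP_L2(1)[OF i]] L2p_fst(1)[OF MP_L2(2)[OF i]])

lemma W_paths: "1 \<le> j \<Longrightarrow> \<omega> \<in> space \<Omega> \<Longrightarrow> continuous_on {0..T} (\<lambda>t. D *v W j t \<omega>)"
  by (intro linear_continuous_on_compose[OF lin(1)] continuous_on_subset[OF W_continuous]) auto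

lemma X_ie:
  assumes i: "1 \<le> i"
  shows "AE \<omega> in \<Omega>. ie_sol ((*v) A) T (\<lambda>t. x0 i + D *v W i t \<omega> + (prim (\<lambda>s. forcing i s \<omega>) t)) (\<lambda>t. X i t \<omega>)"
  using fbsde(9)[OF i] L2p_paths[OF forcing_L2[OF i]] AE_space
proof eventually_elim
  case (elim \<omega>)
  show ?case
  proof (rule ie_sol_forced[OF lin(1) elim(2)])
    show "continuous_on {0..T} (\<lambda>t. x0 i + D *v W i t \<omega>)" by (intro continuous_intros W_paths i elim)
    fix t assume "t \<in> {0..T}"
    with elim(1) have "((\<lambda>s. A *v X i s \<omega> + B *v Fb (Y i s \<omega>) + G *v M i s + \<gamma> *\<^sub>R P i s)
          has_integral (X i t \<omega> - x0 i - D *v W i t \<omega>)) {0..t}" by blast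
    then show "((\<lambda>s. A *v X i s \<omega> + forcing i s \<omega>) has_integral X i t \<omega> - (x0 i + D *v W i t \<omega>)) {0..t}"
      by (simp add: forcing_def add.assoc diff_diff_eq)
  qed
qed

text \<open>General weights treat the single player (weight 1 on {i}) and the population average
  (weights 1/N) at once; the sum of the squared weights, which governs the variance, is 1 and 1/N
  respectively.\<close>

definition noise :: "nat set \<Rightarrow> (nat \<Rightarrow> real) \<Rightarrow> real \<Rightarrow> 'w \<Rightarrow> real^'n" where
  "noise J a t \<omega> = D *v (\<Sum>j\<in>J. a j *\<^sub>R W j t \<omega>)"

lemma L2p_from_sections:
  fixes u :: "real \<Rightarrow> 'w \<Rightarrow> 'v::euclidean_space"
  assumes m: "(\<lambda>p. u (fst p) (snd p)) \<in> borel_measurable PP"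
    and s: "\<And>s. s \<in> {0..T} \<Longrightarrow> L2 \<Omega> (u s) \<and> n2 \<Omega> (u s) \<le> c"
  shows "L2p u" "n2p u \<le> T * c"
proof -
  have [measurable]: "(\<lambda>p. u (fst p) (snd p)) \<in> borel_measurable PP" by fact
  have nm: "(\<lambda>s. n2 \<Omega> (u s)) \<in> borel_measurable (leb T)"
    unfolding n2_def by (rule borel_measurable_lebesgue_integral) (simp add: split_beta')
  have ni: "integrable (leb T) (\<lambda>s. n2 \<Omega> (u s))"
    using s by (intro leb.integrable_const_bound[of _ c] nm AE_I2) auto
  have "integrable PP (\<lambda>p. (norm (u (fst p) (snd p)))\<^sup>2)"
  proof (rule P.Fubini_integrable)
    show "integrable (leb T) (\<lambda>x. \<integral>y. norm ((norm (u (fst (x, y)) (snd (x, y))))\<^sup>2) \<partial>\<Omega>)"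
      using ni by (simp add: n2_def)
    show "AE x in leb T. integrable \<Omega> (\<lambda>y. (norm (u (fst (x, y)) (snd (x, y))))\<^sup>2)"
      using s by (intro AE_I2) (auto simp: L2_def)
  qed measurable
  then show L: "L2p u" by (simp add: L2_def)
  have "n2p u = (\<integral>s. n2 \<Omega> (u s) \<partial>leb T)" using sections(3)[OF L] by simp
  also have "\<dots> \<le> (\<integral>s. c \<partial>leb T)" using ni s by (intro integral_mono) auto
  also have "\<dots> = T * c" using measure_leb[of T] by simp
  finally show "n2p u \<le> T * c" .
qed

lemma noise_bound:
  obtains C where "C > 0"
    "\<And>J a. finite J \<Longrightarrow> J \<subseteq> {1..} \<Longrightarrow> L2p (noise J a) \<and> n2p (noise J a) \<le> C * (\<Sum>j\<in>J. (a j)\<^sup>2)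
       \<and> L2 \<Omega> (noise J a T) \<and> n2 \<Omega> (noise J a T) \<le> C * (\<Sum>j\<in>J. (a j)\<^sup>2)
       \<and> (\<forall>t\<in>{0..T}. integrable \<Omega> (noise J a t) \<and> expectation (noise J a t) = 0)"
proof -
  obtain d where d: "d > 0" "\<And>x. norm (D *v x) \<le> d * norm x"
    using linear_bounded_pos[OF lin(1)[of D]] by blast
  let ?c = "d\<^sup>2 * (CARD('d) * T)"
  have c0: "?c > 0" using d T_pos by simp
  have main: "L2p (noise J a) \<and> n2p (noise J a) \<le> ((1 + T) * ?c) * (\<Sum>j\<in>J. (a j)\<^sup>2)
       \<and> L2 \<Omega> (noise J a T) \<and> n2 \<Omega> (noise J a T) \<le> ((1 + T) * ?c) * (\<Sum>j\<in>J. (a j)\<^sup>2)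
       \<and> (\<forall>t\<in>{0..T}. integrable \<Omega> (noise J a t) \<and> expectation (noise J a t) = 0)"
    if J: "finite J" "J \<subseteq> {1..}" for J a
  proof -
    let ?S = "\<Sum>j\<in>J. (a j)\<^sup>2"
    have S0: "?S \<ge> 0" by (simp add: sum_nonneg)
    have Wm: "(\<lambda>p. W j (fst p) (snd p)) \<in> borel_measurable PP" if "j \<in> J" for j
      using borel_measurable_pair_continuous[of "W j" \<Omega> T] W_measurable W_continuous J that
      by (auto simp: split_beta')
    have m: "(\<lambda>p. noise J a (fst p) (snd p)) \<in> borel_measurable PP"
      unfolding noise_def using Wm by (intro linear_measurable[OF lin(1)] borel_measurable_sum borel_measurable_scaleR) auto
    have sec: "L2 \<Omega> (noise J a s) \<and> n2 \<Omega> (noise J a s) \<le> ?c * ?S" if s: "s \<in> {0..T}" for s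
    proof -
      have s0: "0 \<le> s" using s by simp
      note w = weighted_W_moments[OF s0 J, of a]
      have "n2 \<Omega> (noise J a s) \<le> d\<^sup>2 * (CARD('d) * s * ?S)"
        unfolding noise_def using L2_linear(2)[OF lin(1) d(2) w(1)] w(2) d
        by (meson mult_left_mono order_trans zero_le_power2)
      also have "\<dots> \<le> d\<^sup>2 * (CARD('d) * T * ?S)"
        using s S0 by (intro mult_left_mono mult_right_mono) auto
      finally have "n2 \<Omega> (noise J a s) \<le> ?c * ?S" by (simp add: mult.assoc)
      then show ?thesis unfolding noise_def using L2_linear'[OF lin(1) w(1)] by simp
    qed
    have "expectation (noise J a t) = 0" "integrable \<Omega> (noise J a t)" if t: "t \<in> {0..T}" for t
    proof -
      have t0: "0 \<le> t" using t by simp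
      note w = weighted_W_moments[OF t0 J, of a]
      show "expectation (noise J a t) = 0" "integrable \<Omega> (noise J a t)"
        using mean_linear[OF lin(1)[of D] L2_integrable(1)[OF w(1)]] w(3) by (simp_all add: noise_def[abs_def])
    qed
    moreover have "?c * ?S \<le> ((1 + T) * ?c) * ?S" "T * (?c * ?S) \<le> ((1 + T) * ?c) * ?S"
      using c0 S0 T_pos by (simp_all add: algebra_simps)
    ultimately show ?thesis using L2p_from_sections[OF m sec] sec[OF T_in(1)] by fastforce
  qed
  show ?thesis by (rule that[OF _ main]) (use c0 T_pos in auto)
qed

lemma noise_L2:
  assumes "finite J" "J \<subseteq> {1..}"
  shows "L2p (noise J a)" "L2 \<Omega> (noise J a T)"
  by (rule noise_bound, use assms in blast)+

lemma noise_single: "noise {i} (\<lambda>_. 1) = (\<lambda>t \<omega>. D *v W i t \<omega>)"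
  by (intro ext) (simp add: noise_def)

text \<open>Square integrability over [0,T] times the probability space says nothing about one fixed
  time. For X it is recovered at T from the pathwise integral equation, and the terminal condition
  passes it on to Y.\<close>

lemma XT_L2:
  assumes i: "1 \<le> i"
  shows "L2 \<Omega> (X i T)" "L2 \<Omega> (Y i T)"
proof -
  have n: "L2p (\<lambda>t \<omega>. D *v W i t \<omega>)" "L2 \<Omega> (\<lambda>\<omega>. D *v W i T \<omega>)"
    using noise_L2[of "{i}" "\<lambda>_. 1"] i unfolding noise_single by simp_all
  note pr = primitive_L2[OF forcing_L2[OF i]]
  let ?c = "\<lambda>t \<omega>. x0 i + D *v W i t \<omega> + (prim (\<lambda>s. forcing i s \<omega>) t)"
  have c: "L2p ?c" "L2 \<Omega> (?c T)"
    using L2_add(1)[OF L2_add(1)[OF L2p_snd(1)[OF L2_const[of "x0 i"]] n(1)] pr(1)]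
      L2_add(1)[OF L2_add(1)[OF L2_const[of "x0 i"] n(2)] pr(3)[OF T_in(1)]] by simp_all
  obtain C2 where "C2 > 0" "\<And>c z. L2p c \<Longrightarrow> L2 \<Omega> (c T) \<Longrightarrow> (\<lambda>p. z (fst p) (snd p)) \<in> borel_measurable PP \<Longrightarrow>
      (AE \<omega> in \<Omega>. ie_sol ((*v) A) T (\<lambda>t. c t \<omega>) (\<lambda>t. z t \<omega>)) \<Longrightarrow>
      L2p z \<and> n2p z \<le> C2 * n2p c \<and> L2 \<Omega> (z T) \<and> n2 \<Omega> (z T) \<le> C2 * (n2p c + n2 \<Omega> (c T))"
    using ie_L2_bound[OF lin(1)[of A]] by blast
  from this(2)[OF c L2_measurable[OF fbsde(3)[OF i]] X_ie[OF i]] show XT: "L2 \<Omega> (X i T)" by blast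
  have Ym: "Y i T \<in> borel_measurable \<Omega>"
    by (rule section_measurable[OF L2_measurable[OF fbsde(4)[OF i]]]) simp
  have HX: "L2 \<Omega> (\<lambda>\<omega>. H *v X i T \<omega>)" by (rule L2_linear'[OF lin(1) XT])
  have "integrable \<Omega> (\<lambda>\<omega>. (norm (H *v X i T \<omega>))\<^sup>2)" using HX by (simp add: L2_def)
  moreover have "AE \<omega> in \<Omega>. (norm (Y i T \<omega>))\<^sup>2 \<le> (norm (H *v X i T \<omega>))\<^sup>2"
    using fbsde(10)[OF i] by eventually_elim simp
  ultimately show "L2 \<Omega> (Y i T)" by (rule L2_dominated(1)[OF Ym])
qed

text \<open>Integration by parts of Y_j against the response \<theta> to b. The term A \<theta> of
  its density cancels with the term -A^T Y_j of the generator, leaving the gradient of the cost and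
  the pairing of Y_j with b. The direction b may be adapted to the larger family J.\<close>

lemma stationarity:
  assumes j: "j \<in> J" "J \<subseteq> {1..}" and b: "prog_meas \<Omega> W J T b" "L2p b"
  defines "\<theta> \<equiv> resp ((*v) A) b"
  shows "- (\<integral>\<omega>. (H *v X j T \<omega>) \<bullet> \<theta> T \<omega> \<partial>\<Omega>) =
     (\<integral>p. drift j (fst p) (snd p) \<bullet> \<theta> (fst p) (snd p) \<partial>PP) + (\<integral>p. Y j (fst p) (snd p) \<bullet> b (fst p) (snd p) \<partial>PP)"
proof -
  have j1: "1 \<le> j" using j by auto
  have th: "L2p \<theta>" "L2 \<Omega> (\<theta> T)" unfolding \<theta>_def using resp_bound[OF lin(1)[of A]] b(2) by metis+
  define k where "k = (\<lambda>t \<omega>. A *v \<theta> t \<omega> + b t \<omega>)"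
  have k: "prog_meas \<Omega> W J T k" "L2p k"
    unfolding k_def by (intro prog_add prog_linear[OF lin(1)] b, unfold \<theta>_def, intro resp_prog lin b)
      (intro L2_add(1) b L2_linear'[OF lin(1)], use th in \<open>simp add: \<theta>_def\<close>)
  have eq: "AE \<omega> in \<Omega>. \<forall>t\<in>{0..T}. \<theta> t \<omega> = (prim (\<lambda>s. k s \<omega>) t)"
    using L2p_paths[OF b(2)]
  proof eventually_elim
    case (elim \<omega>)
    show ?case unfolding \<theta>_def k_def
      using ie_sol_primitive(2)[OF lin(1) elim resp_sol[of "(*v) A" b \<omega>, OF lin(1) elim]] by blast
  qed
  let ?\<theta> = "\<lambda>t \<omega>. \<integral>s\<in>{0..t}. k s \<omega> \<partial>lborel"
  note pk = primitive_L2[OF k(2)]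
  have "(\<integral>\<omega>. Y j T \<omega> \<bullet> ?\<theta> T \<omega> \<partial>\<Omega>)
      = (\<integral>p. Y j (fst p) (snd p) \<bullet> k (fst p) (snd p) \<partial>PP) + (\<integral>p. gen j (fst p) (snd p) \<bullet> ?\<theta> (fst p) (snd p) \<partial>PP)"
    by (rule martingale_integration_by_parts[OF j fbsde(2,4)[OF j1] XT_L2(2)[OF j1] drift_L2(3,4)[OF j1] k
          fbsde(11)[OF j1] fbsde(12)[OF j1]]) auto
  also have "(\<integral>\<omega>. Y j T \<omega> \<bullet> ?\<theta> T \<omega> \<partial>\<Omega>) = - (\<integral>\<omega>. (H *v X j T \<omega>) \<bullet> \<theta> T \<omega> \<partial>\<Omega>)"
  proof -
    have HX: "L2 \<Omega> (\<lambda>\<omega>. H *v X j T \<omega>)" by (rule L2_linear'[OF lin(1) XT_L2(1)[OF j1]])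
    have "(\<integral>\<omega>. Y j T \<omega> \<bullet> ?\<theta> T \<omega> \<partial>\<Omega>) = (\<integral>\<omega>. - ((H *v X j T \<omega>) \<bullet> \<theta> T \<omega>) \<partial>\<Omega>)"
      using L2_inner(1)[OF XT_L2(2)[OF j1] pk(3)[OF T_in(1)]] L2_inner(1)[OF HX th(2)] fbsde(10)[OF j1] eq
      by (intro integral_cong_AE) (auto elim!: eventually_elim2)
    then show ?thesis by simp
  qed
  also have "(\<integral>p. gen j (fst p) (snd p) \<bullet> ?\<theta> (fst p) (snd p) \<partial>PP) = (\<integral>p. gen j (fst p) (snd p) \<bullet> \<theta> (fst p) (snd p) \<partial>PP)"
    using L2_inner(1)[OF drift_L2(4)[OF j1] pk(1)] L2_inner(1)[OF drift_L2(4)[OF j1] th(1)] AE_PP_ball[OF eq]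
    by (intro integral_cong_AE) (auto elim!: eventually_mono)
  also have "(\<integral>p. Y j (fst p) (snd p) \<bullet> k (fst p) (snd p) \<partial>PP) + (\<integral>p. gen j (fst p) (snd p) \<bullet> \<theta> (fst p) (snd p) \<partial>PP)
     = (\<integral>p. Y j (fst p) (snd p) \<bullet> k (fst p) (snd p) + gen j (fst p) (snd p) \<bullet> \<theta> (fst p) (snd p) \<partial>PP)"
    by (intro bint_add[symmetric] L2_inner(1) fbsde(4)[OF j1] k drift_L2(4)[OF j1] th)
  also have "\<dots> = (\<integral>p. drift j (fst p) (snd p) \<bullet> \<theta> (fst p) (snd p) + Y j (fst p) (snd p) \<bullet> b (fst p) (snd p) \<partial>PP)"
    by (intro bint_cong refl)
       (simp add: k_def gen_def inner_add_left inner_add_right inner_diff_left dot_lmul_matrix)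
  also have "\<dots> = (\<integral>p. drift j (fst p) (snd p) \<bullet> \<theta> (fst p) (snd p) \<partial>PP) + (\<integral>p. Y j (fst p) (snd p) \<bullet> b (fst p) (snd p) \<partial>PP)"
    by (intro bint_add L2_inner(1) fbsde(4)[OF j1] b drift_L2(2)[OF j1] th)
  finally show ?thesis .
qed

end

section \<open>Two-point problems: well-posedness and stability\<close>

lemma has_integral_Pair:
  fixes f :: "real \<Rightarrow> 'a::euclidean_space" and g :: "real \<Rightarrow> 'b::euclidean_space"
  assumes "(f has_integral a) S" "(g has_integral b) S"
  shows "((\<lambda>s. (f s, g s)) has_integral (a, b)) S"
proof -
  have l1: "bounded_linear (\<lambda>x::'a. (x, 0::'b))" and l2: "bounded_linear (\<lambda>x::'b. (0::'a, x))"
    by (auto intro!: bounded_linear_Pair bounded_linear_ident bounded_linear_zero)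
  from has_integral_add[OF has_integral_linear[OF assms(1) l1] has_integral_linear[OF assms(2) l2]]
  show ?thesis by (simp add: o_def)
qed

lemma ie_sol_component:
  fixes K :: "'a::euclidean_space \<Rightarrow> 'a" and L :: "'a \<Rightarrow> 'b::euclidean_space"
  assumes "ie_sol K T c z" "linear L" "t \<in> {0..T}"
  shows "((\<lambda>s. L (K (z s))) has_integral (L (z t) - L (c t))) {0..t}"
proof -
  have "bounded_linear L" using assms(2) linear_conv_bounded_linear by blast
  moreover have "((\<lambda>s. K (z s)) has_integral (z t - c t)) {0..t}" using assms by (auto simp: ie_sol_def)
  ultimately show ?thesis
    using has_integral_linear[of "\<lambda>s. K (z s)" "z t - c t" "{0..t}" L] by (simp add: o_def linear_diff[OF assms(2)])
qed

lemma has_integral_eq_set_integral: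
  fixes f :: "real \<Rightarrow> 'b::euclidean_space"
  assumes "integrable (leb T) f" "t \<in> {0..T}" "(f has_integral v) {0..t}"
  shows "v = (prim f t)"
  using has_integral_unique[OF assms(3) has_integral_leb[OF assms(1), of 0 t]] assms(2) by auto

text \<open>The flow is invertible, so a terminal value zero forces initial value zero; used for the
  costates, which are prescribed at T.\<close>

lemma ie_sol_const_final_zero:
  fixes K :: "'a::euclidean_space \<Rightarrow> 'a"
  assumes K: "linear K" and T: "0 \<le> T" and z: "ie_sol K T (\<lambda>_. w) z" and 0: "z T = 0"
  shows "w = 0"
proof -
  have e0: "ie_sol K T (\<lambda>_. 0) (\<lambda>_. 0)" by (simp add: ie_sol_def linear_0[OF K])
  have "z T = eflow K T w"
    using ie_sol_unique[OF K z ie_sol_add_const[OF K e0, of w, simplified], of T] T by simp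
  then have "eflow K (- T) (eflow K T w) = 0" using 0 by (simp add: linear_0[OF eflow_linear[OF K]])
  then show ?thesis using eflow_inverse[OF K, of "- T" w] by simp
qed

text \<open>\<open>L2fun\<close> demands measurability on the whole line, whereas functions on the
  horizon are controlled on [0,T] only; extension by zero bridges the two when (H1) or (H2) is
  applied.\<close>

lemma indicator_L2fun:
  fixes \<nu> :: "real \<Rightarrow> 'b::euclidean_space"
  assumes "L2 (leb T) \<nu>"
  shows "(\<lambda>s. indicator {0..T} s *\<^sub>R \<nu> s) \<in> L2fun T" "L2sq T (\<lambda>s. indicator {0..T} s *\<^sub>R \<nu> s) = n2 (leb T) \<nu>"
proof -
  have m: "(\<lambda>s. indicator {0..T} s *\<^sub>R \<nu> s) \<in> borel_measurable lborel"
    using assms borel_measurable_restrict_space_iff[of "{0..T}" lborel \<nu>] by (simp add: L2_def)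
  have "integrable (leb T) (\<lambda>s. (norm (indicator {0..T} s *\<^sub>R \<nu> s))\<^sup>2) \<longleftrightarrow> integrable (leb T) (\<lambda>s. (norm (\<nu> s))\<^sup>2)"
    by (intro Bochner_Integration.integrable_cong refl) simp
  then have "L2 (leb T) (\<lambda>s. indicator {0..T} s *\<^sub>R \<nu> s)"
    using assms m unfolding L2_def by (simp only: measurable_restrict_space1 simp_thms)
  then show "(\<lambda>s. indicator {0..T} s *\<^sub>R \<nu> s) \<in> L2fun T" using L2_leb_iff_L2fun[OF m] by simp
  show "L2sq T (\<lambda>s. indicator {0..T} s *\<^sub>R \<nu> s) = n2 (leb T) \<nu>"
    unfolding L2sq_eq_n2 n2_def by (intro bint_cong) auto
qed

lemma ie_sol_zero_if_forcing_null:
  fixes K :: "'a::euclidean_space \<Rightarrow> 'a"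
  assumes K: "linear K" and b: "L2 (leb T) b" "n2 (leb T) b = 0"
    and z: "\<And>t. t \<in> {0..T} \<Longrightarrow> ((\<lambda>s. K (z s) + b s) has_integral z t) {0..t}" and t: "t \<in> {0..T}"
  shows "z t = 0"
proof -
  have bi: "integrable (leb T) b" using finite_measure.L2_integrable(1)[OF finite_measure_leb b(1)] .
  have "(norm (prim b t))\<^sup>2 \<le> T * n2 (leb T) b" if "t \<in> {0..T}" for t
    by (rule n2_primitive[OF b(1) that])
  then have 0: "(prim b t) = 0" if "t \<in> {0..T}" for t using that b(2) by auto
  have "ie_sol K T (\<lambda>t. 0 + (prim b t)) z"
    by (rule ie_sol_forced[OF K bi]) (use z in auto)
  then have "ie_sol K T (\<lambda>_. 0) z" by (rule ie_sol_cong) (simp add: 0)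
  then show ?thesis by (rule ie_sol_zero[OF K _ t])
qed

lemma H1E:
  fixes A G \<Gamma> Q H :: "real^'n^'n"
  assumes "H1 A G \<Gamma> Q H \<gamma> T"
  obtains e where "e > 0"
    "\<And>g z. g \<in> L2fun T \<Longrightarrow> (\<And>t. t \<in> {0..T} \<Longrightarrow> ((\<lambda>s. (A + G) *v z s + g s) has_integral z t) {0..t}) \<Longrightarrow>
      e * L2sq T g \<le> (prim (\<lambda>t. - qf (transpose (mat 1 - \<Gamma>) ** Q ** (mat 1 - \<Gamma>)) (z t)
                   + (1 / \<gamma>) * (norm (g t))\<^sup>2) T) - qf H (z T)"
proof -
  obtain e where e: "e > 0" "\<forall>g\<in>L2fun T. \<forall>z :: real \<Rightarrow> real^'n.
     (\<forall>t\<in>{0..T}. ((\<lambda>s. (A + G) *v z s + g s) has_integral z t) {0..t}) \<longrightarrow>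
     (prim (\<lambda>t. - qf (transpose (mat 1 - \<Gamma>) ** Q ** (mat 1 - \<Gamma>)) (z t)
                   + (1 / \<gamma>) * (norm (g t))\<^sup>2) T) - qf H (z T)
       \<ge> e * L2sq T g"
    using assms unfolding H1_def by (elim exE conjE)
  show ?thesis by (rule that[OF e(1)]) (rule e(2)[rule_format]; assumption)
qed

lemma H2E:
  fixes A G \<Gamma> Q H :: "real^'n^'n" and B :: "real^'k^'n" and R :: "real^'k^'k"
  assumes "H2 A B G \<Gamma> Q R H \<gamma> T"
  obtains e where "e > 0"
    "\<And>\<nu> zi z q. \<nu> \<in> L2fun T \<Longrightarrow>
      (\<forall>t\<in>{0..T}. ((\<lambda>s. A *v zi s + B *v \<nu> s + G *v z s + \<gamma> *\<^sub>R q s) has_integral zi t) {0..t}) \<Longrightarrow>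
      (\<forall>t\<in>{0..T}. ((\<lambda>s. (A + G) *v z s + \<gamma> *\<^sub>R q s) has_integral z t) {0..t}) \<Longrightarrow>
      (\<forall>t\<in>{0..T}. ((\<lambda>s. transpose (A + G) *v q s + transpose (mat 1 - \<Gamma>) *v (Q *v (zi s - \<Gamma> *v z s)))
                      has_integral (q t - H *v zi T)) {t..T}) \<Longrightarrow>
     e * L2sq T \<nu> \<le> (prim (\<lambda>t. qf Q (zi t - \<Gamma> *v z t) + qf R (\<nu> t) - \<gamma> * (norm (q t))\<^sup>2) T) + qf H (zi T)"
proof -
  obtain e where e: "e > 0" "\<forall>\<nu>\<in>L2fun T. \<forall>(zi :: real \<Rightarrow> real^'n) z q.
     ((\<forall>t\<in>{0..T}. ((\<lambda>s. A *v zi s + B *v \<nu> s + G *v z s + \<gamma> *\<^sub>R q s) has_integral zi t) {0..t}) \<and>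
      (\<forall>t\<in>{0..T}. ((\<lambda>s. (A + G) *v z s + \<gamma> *\<^sub>R q s) has_integral z t) {0..t}) \<and>
      (\<forall>t\<in>{0..T}. ((\<lambda>s. transpose (A + G) *v q s + transpose (mat 1 - \<Gamma>) *v (Q *v (zi s - \<Gamma> *v z s)))
                      has_integral (q t - H *v zi T)) {t..T})) \<longrightarrow>
     (prim (\<lambda>t. qf Q (zi t - \<Gamma> *v z t) + qf R (\<nu> t) - \<gamma> * (norm (q t))\<^sup>2) T) + qf H (zi T)
       \<ge> e * L2sq T \<nu>"
    using assms unfolding H2_def by (elim exE conjE)
  show ?thesis
  proof (rule that[OF e(1)], goal_cases)
    case (1 \<nu> zi z q)
    show ?case
      by (rule e(2)[THEN bspec, OF 1(1), THEN spec, THEN spec, THEN spec, THEN mp]) (intro conjI 1)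
  qed
qed

lemma linear_mat_vec: "linear f \<Longrightarrow> linear (\<lambda>x. A *v f x)" for A :: "real^'m^'n"
  using linear_compose[OF _ matrix_vector_mul_linear[of A], of f] by (simp add: o_def)

lemma linear_fst_comp: "linear f \<Longrightarrow> linear (\<lambda>x. fst (f x))"
  and linear_snd_comp: "linear g \<Longrightarrow> linear (\<lambda>x. snd (g x))"
  by (auto simp: linear_iff)

lemma linear_Pair: "linear f \<Longrightarrow> linear g \<Longrightarrow> linear (\<lambda>x. (f x, g x))"
  by (auto simp: linear_iff)

lemmas linear_rules = linear_Pair linear_compose_add linear_compose_sub linear_compose_neg
  linear_compose_scale_right linear_mat_vec linear_fst_comp linear_snd_comp linear_ident

context lq_game
begin

text \<open>The system is the stationarity system of the functional of (H1) with g = \<gamma> q.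
  Integrating q against z by parts shows that the functional vanishes at this g, so coercivity makes
  q null; z then solves a homogeneous equation from 0, and q a homogeneous one with terminal value
  0.\<close>

lemma H1_unique:
  assumes z: "\<And>t. t \<in> {0..T} \<Longrightarrow> ((\<lambda>s. (A + G) *v z s + \<gamma> *\<^sub>R q s) has_integral z t) {0..t}"
    and q: "\<And>t. t \<in> {0..T} \<Longrightarrow> ((\<lambda>s. - (transpose (A + G) *v q s) - transpose (mat 1 - \<Gamma>) *v (Q *v (z s - \<Gamma> *v z s)))
        has_integral (q t - q0)) {0..t}"
    and cz: "continuous_on {0..T} z" and cq: "continuous_on {0..T} q" and qT: "q T = H *v z T"
    and t: "t \<in> {0..T}"
  shows "z t = 0 \<and> q0 = 0"
proof -
  let ?k = "\<lambda>s. (A + G) *v z s + \<gamma> *\<^sub>R q s"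
  let ?\<alpha> = "\<lambda>s. - (transpose (A + G) *v q s) - transpose (mat 1 - \<Gamma>) *v (Q *v (z s - \<Gamma> *v z s))"
  let ?g = "\<lambda>s. \<gamma> *\<^sub>R q s"
  note ci = linear_continuous_on_compose[OF lin(1)]
  have ck: "integrable (leb T) ?k" and ca: "integrable (leb T) ?\<alpha>"
    by (intro integrable_leb_continuous continuous_intros ci cz cq)+
  have gL: "L2 (leb T) ?g" by (intro L2_leb_continuous continuous_intros cq)
  let ?G = "\<lambda>s. indicator {0..T} s *\<^sub>R ?g s"
  have zG: "((\<lambda>s. (A + G) *v z s + ?G s) has_integral z t) {0..t}" if "t \<in> {0..T}" for t
    using z[OF that] by (rule has_integral_eq[rotated]) (use that in auto)
  obtain e where e: "e > 0" "e * L2sq T ?G \<le> (prim (\<lambda>t. - qf (transpose (mat 1 - \<Gamma>) ** Q ** (mat 1 - \<Gamma>)) (z t)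
        + (1 / \<gamma>) * (norm (?G t))\<^sup>2) T) - qf H (z T)"
    apply (rule H1E[OF hyp1])
    subgoal premises prems for e by (rule prems(1)[OF prems(2) prems(3)[OF indicator_L2fun(1)[OF gL] zG]])
    done
  have za: "z t = (prim ?k t)" if "t \<in> {0..T}" for t
    by (rule has_integral_eq_set_integral[OF ck that z[OF that]])
  have qa: "q s = q T - (\<integral>r\<in>{s..T}. ?\<alpha> r \<partial>lborel)" if "s \<in> {0..T}" for s
    using has_integral_eq_set_integral[OF ca that q[OF that]] has_integral_eq_set_integral[OF ca _ q[of T]]
      set_integral_split[OF ca that] by (simp add: algebra_simps)
  note ibp = integral_by_parts_L1[OF T_in(3) ca ck qa za]
  have "(\<integral>s. q s \<bullet> ?k s \<partial>leb T) + (\<integral>s. ?\<alpha> s \<bullet> z s \<partial>leb T) = (\<integral>s. q s \<bullet> ?k s + ?\<alpha> s \<bullet> z s \<partial>leb T)"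
    using ibp(1,2) by simp
  also have "\<dots> = (\<integral>s. - qf (transpose (mat 1 - \<Gamma>) ** Q ** (mat 1 - \<Gamma>)) (z s)
        + (1 / \<gamma>) * (norm (?G s))\<^sup>2 \<partial>leb T)"
  proof (intro bint_cong refl)
    fix s assume "s \<in> space (leb T)"
    then have n: "(1 / \<gamma>) * (norm (?G s))\<^sup>2 = \<gamma> * (q s \<bullet> q s)"
      using gam by (simp add: power_mult_distrib dot_square_norm power2_eq_square)
    have "qf (transpose (mat 1 - \<Gamma>) ** Q ** (mat 1 - \<Gamma>)) (z s) = (transpose (mat 1 - \<Gamma>) *v (Q *v (z s - \<Gamma> *v z s))) \<bullet> z s"
      by (simp add: qf_def matrix_vector_mul_assoc[symmetric] matrix_vector_mult_diff_rdistrib inner_commute del: transpose_matrix_vector)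
    with n show "q s \<bullet> ?k s + ?\<alpha> s \<bullet> z s = - qf (transpose (mat 1 - \<Gamma>) ** Q ** (mat 1 - \<Gamma>)) (z s)
        + (1 / \<gamma>) * (norm (?G s))\<^sup>2"
      using inner_transpose[of "A + G" "q s" "z s"]
      by (simp add: inner_add_right inner_diff_left del: transpose_matrix_vector)
  qed
  finally have "(\<integral>s. - qf (transpose (mat 1 - \<Gamma>) ** Q ** (mat 1 - \<Gamma>)) (z s)
        + (1 / \<gamma>) * (norm (?G s))\<^sup>2 \<partial>leb T) = qf H (z T)"
    using ibp(3) qT by (simp add: qf_def inner_commute)
  then have "e * n2 (leb T) ?g \<le> 0" using e(2) indicator_L2fun(2)[OF gL] by (simp add: set_integral_leb')
  then have n0: "n2 (leb T) ?g = 0" using e(1) n2_nonneg[of "leb T" ?g] by (simp add: mult_le_0_iff)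
  have z0: "z t = 0" if "t \<in> {0..T}" for t
    by (rule ie_sol_zero_if_forcing_null[OF lin(1) gL n0 z that])
  have K: "linear (\<lambda>v. - (transpose (A + G) *v v))"
    by (intro linear_compose_neg lin)
  have "ie_sol (\<lambda>v. - (transpose (A + G) *v v)) T (\<lambda>_. q0) q"
    unfolding ie_sol_def
  proof (intro conjI ballI)
    fix t assume t: "t \<in> {0..T}"
    show "((\<lambda>s. - (transpose (A + G) *v q s)) has_integral q t - q0) {0..t}"
      using q[OF t] by (rule has_integral_eq[rotated]) (use t z0 in simp)
  qed simp
  from ie_sol_const_final_zero[OF K T_in(3) this] have "q0 = 0" using qT z0[OF T_in(1)] by simp
  with z0[OF t] show ?thesis by simp
qed

text \<open>State \<open>((z_i, z), q)\<close> of (H2), with \<open>B \<nu>\<close> entering through the forcing term.\<close>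
definition KH :: "(((real^'n) \<times> (real^'n)) \<times> (real^'n)) \<Rightarrow> (((real^'n) \<times> (real^'n)) \<times> (real^'n))" where
  "KH v = ((A *v fst (fst v) + G *v snd (fst v) + \<gamma> *\<^sub>R snd v, (A + G) *v snd (fst v) + \<gamma> *\<^sub>R snd v),
     - (transpose (A + G) *v snd v) - transpose (mat 1 - \<Gamma>) *v (Q *v (fst (fst v) - \<Gamma> *v snd (fst v))))"

lemma linear_KH: "linear KH"
  unfolding KH_def[abs_def] by (intro linear_rules)

lemmas linear_components = linear_fst_comp[OF linear_fst_comp[OF linear_ident]]
  linear_snd_comp[OF linear_fst_comp[OF linear_ident]] linear_snd_comp[OF linear_ident]

text \<open>With \<nu> = 0 the difference z_i - z solves a homogeneous equation from 0. Hence z_i =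
  z, and what remains is the system settled by (H1).\<close>

lemma KH_unique:
  assumes z: "ie_sol KH T (\<lambda>_. (0, w)) z" and b0: "snd (z T) - H *v fst (fst (z T)) = 0"
  shows "w = 0"
proof -
  define zi where "zi t = fst (fst (z t))" for t
  define zz where "zz t = snd (fst (z t))" for t
  define q where "q t = snd (z t)" for t
  note comps = zi_def zz_def q_def
  have c: "continuous_on {0..T} zi" "continuous_on {0..T} zz" "continuous_on {0..T} q"
    unfolding comps using ie_sol_continuous[OF z] by (auto intro!: continuous_intros)
  have 1: "((\<lambda>s. A *v zi s + G *v zz s + \<gamma> *\<^sub>R q s) has_integral zi t) {0..t}"
    and 2: "((\<lambda>s. (A + G) *v zz s + \<gamma> *\<^sub>R q s) has_integral zz t) {0..t}"
    and 3: "((\<lambda>s. - (transpose (A + G) *v q s) - transpose (mat 1 - \<Gamma>) *v (Q *v (zi s - \<Gamma> *v zz s))) has_integral (q t - w)) {0..t}"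
    if t: "t \<in> {0..T}" for t
    using ie_sol_component[OF z linear_components(1) t] ie_sol_component[OF z linear_components(2) t] ie_sol_component[OF z linear_components(3) t]
    by (simp_all add: KH_def comps del: transpose_matrix_vector)
  have d: "((\<lambda>s. A *v (zi s - zz s) + 0) has_integral (zi t - zz t)) {0..t}" if t: "t \<in> {0..T}" for t
    using has_integral_diff[OF 1[OF t] 2[OF t]]
    by (simp add: algebra_simps matrix_vector_mult_add_rdistrib matrix_vector_mult_diff_distrib)
  have n0: "n2 (leb T) (\<lambda>_. 0 :: real^'n) = 0" by (simp add: n2_def)
  have eq: "zi t = zz t" if t: "t \<in> {0..T}" for t
    using ie_sol_zero_if_forcing_null[OF lin(1)[of A] L2_0 n0 d t] by simp
  have eq3: "((\<lambda>s. - (transpose (A + G) *v q s) - transpose (mat 1 - \<Gamma>) *v (Q *v (zz s - \<Gamma> *v zz s))) has_integral (q t - w)) {0..t}"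
    if t: "t \<in> {0..T}" for t
    using 3[OF t] by (rule has_integral_eq[rotated]) (use t eq in auto)
  have "q T = H *v zz T" using b0 eq[OF T_in(1)] by (simp add: comps)
  then show "w = 0" using H1_unique[OF 2 eq3 c(2) c(3) _ T_in(1)] by blast
qed

text \<open>(H2) only speaks about solutions of its system. Their existence, and a bound of q by
  \<nu>, come from the shooting lemma with the integral of B \<nu> as datum; (H2) then supplies the
  sign. The bound will limit the size of the disturbance used against a deviation.\<close>

lemma H2_response:
  obtains C where "C > 0"
    "\<And>\<nu>. L2 (leb T) \<nu> \<Longrightarrow> \<exists>zi z q. continuous_on {0..T} zi \<and> continuous_on {0..T} z \<and> continuous_on {0..T} q \<and>
      (\<forall>t\<in>{0..T}. ((\<lambda>s. A *v zi s + B *v \<nu> s + G *v z s + \<gamma> *\<^sub>R q s) has_integral zi t) {0..t}) \<and>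
      (\<forall>t\<in>{0..T}. ((\<lambda>s. (A + G) *v z s + \<gamma> *\<^sub>R q s) has_integral z t) {0..t}) \<and>
      n2 (leb T) q \<le> C * n2 (leb T) \<nu> \<and>
      (\<integral>t. qf Q (zi t - \<Gamma> *v z t) + qf R (\<nu> t) - \<gamma> * (norm (q t))\<^sup>2 \<partial>leb T) + qf H (zi T) \<ge> 0"
proof -
  define \<beta> where "\<beta> v = snd v - H *v fst (fst v)" for v :: "((real^'n) \<times> (real^'n)) \<times> (real^'n)"
  have \<beta>: "linear \<beta>"
    unfolding \<beta>_def[abs_def] by (intro linear_rules)
  have uniq: "\<And>z w. ie_sol KH T (\<lambda>_. (0, w)) z \<Longrightarrow> \<beta> (z T) = 0 \<Longrightarrow> w = 0"
    unfolding \<beta>_def by (rule KH_unique) auto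
  obtain C where C: "C > 0"
    "\<And>c. continuous_on {0..T} c \<Longrightarrow> \<exists>z w. ie_sol KH T (\<lambda>t. c t + (0, w)) z \<and> \<beta> (z T) = 0"
    "\<And>c z w t. ie_sol KH T (\<lambda>t. c t + (0, w)) z \<Longrightarrow> \<beta> (z T) = 0 \<Longrightarrow> t \<in> {0..T} \<Longrightarrow> continuous_on {0..T} c \<Longrightarrow>
       norm (z t) \<le> norm (c t) + C * (norm (c T) + (prim (\<lambda>s. norm (c s)) T))"
    apply (rule two_point_problem[OF T_in(3) linear_KH \<beta> uniq], assumption, assumption)
    subgoal premises prems for C
      by (rule prems(1), rule prems(2), erule prems(3), erule prems(4), assumption+)
    done
  obtain b where b: "b > 0" "\<And>x. norm (B *v x) \<le> b * norm x"
    using linear_bounded_pos[OF lin(1)[of B]] by blast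
  \<comment> \<open>The integral of B \<nu> is at most sqrt(T b^2 |\<nu>|^2) at every time. The
    shooting bound multiplies this by 1 + C(1 + T); squaring and integrating over [0,T] give the
    remaining factors.\<close>
  define D where "D = T * ((1 + C * (1 + T))\<^sup>2 * (T * b\<^sup>2))"
  have D: "D > 0" unfolding D_def using C(1) T_pos b(1)
    by (intro mult_pos_pos zero_less_power add_pos_pos) auto
  have main: "\<exists>zi z q. continuous_on {0..T} zi \<and> continuous_on {0..T} z \<and> continuous_on {0..T} q \<and>
      (\<forall>t\<in>{0..T}. ((\<lambda>s. A *v zi s + B *v \<nu> s + G *v z s + \<gamma> *\<^sub>R q s) has_integral zi t) {0..t}) \<and>
      (\<forall>t\<in>{0..T}. ((\<lambda>s. (A + G) *v z s + \<gamma> *\<^sub>R q s) has_integral z t) {0..t}) \<and>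
      n2 (leb T) q \<le> D * n2 (leb T) \<nu> \<and>
      (\<integral>t. qf Q (zi t - \<Gamma> *v z t) + qf R (\<nu> t) - \<gamma> * (norm (q t))\<^sup>2 \<partial>leb T) + qf H (zi T) \<ge> 0"
    if \<nu>: "L2 (leb T) \<nu>" for \<nu>
  proof -
    have BL: "L2 (leb T) (\<lambda>s. B *v \<nu> s)" by (rule L2_linear'[OF lin(1) \<nu>])
    have Bi: "integrable (leb T) (\<lambda>s. B *v \<nu> s)" by (rule leb.L2_integrable(1)[OF BL])
    define I where "I t = (prim (\<lambda>s. B *v \<nu> s) t)" for t
    have Ic: "continuous_on {0..T} I" unfolding I_def by (rule continuous_on_int_leb[OF Bi])
    have In: "norm (I t) \<le> sqrt (T * b\<^sup>2 * n2 (leb T) \<nu>)" if t: "t \<in> {0..T}" for t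
    proof (rule real_le_rsqrt)
      have "(norm (I t))\<^sup>2 \<le> T * n2 (leb T) (\<lambda>s. B *v \<nu> s)" unfolding I_def by (rule n2_primitive[OF BL t])
      also have "\<dots> \<le> T * (b\<^sup>2 * n2 (leb T) \<nu>)" using L2_linear(2)[OF lin(1) b(2) \<nu>] T_pos by (intro mult_left_mono) auto
      finally show "(norm (I t))\<^sup>2 \<le> T * b\<^sup>2 * n2 (leb T) \<nu>" by (simp add: mult.assoc)
    qed
    let ?c = "\<lambda>t. ((I t, 0), 0) :: ((real^'n) \<times> (real^'n)) \<times> (real^'n)"
    have cc: "continuous_on {0..T} ?c" using Ic by (intro continuous_intros)
    obtain z w where z: "ie_sol KH T (\<lambda>t. ?c t + (0, w)) z" and b0: "\<beta> (z T) = 0" using C(2)[OF cc] by blast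
    define zi where "zi t = fst (fst (z t))" for t
    define zz where "zz t = snd (fst (z t))" for t
    define q where "q t = snd (z t)" for t
    note comps = zi_def zz_def q_def
    have c: "continuous_on {0..T} zi" "continuous_on {0..T} zz" "continuous_on {0..T} q"
      unfolding comps using ie_sol_continuous[OF z] by (auto intro!: continuous_intros)
    have 1: "((\<lambda>s. A *v zi s + G *v zz s + \<gamma> *\<^sub>R q s) has_integral zi t - I t) {0..t}"
      and 2: "((\<lambda>s. (A + G) *v zz s + \<gamma> *\<^sub>R q s) has_integral zz t) {0..t}"
      and 3: "((\<lambda>s. - (transpose (A + G) *v q s) - transpose (mat 1 - \<Gamma>) *v (Q *v (zi s - \<Gamma> *v zz s))) has_integral (q t - w)) {0..t}"
      if t: "t \<in> {0..T}" for t
      using ie_sol_component[OF z linear_components(1) t] ie_sol_component[OF z linear_components(2) t] ie_sol_component[OF z linear_components(3) t]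
      by (simp_all add: KH_def comps del: transpose_matrix_vector)
    have eq1: "((\<lambda>s. A *v zi s + B *v \<nu> s + G *v zz s + \<gamma> *\<^sub>R q s) has_integral zi t) {0..t}" if t: "t \<in> {0..T}" for t
    proof -
      have "((\<lambda>s. B *v \<nu> s) has_integral I t) {0..t}" unfolding I_def using t by (intro has_integral_leb[OF Bi]) auto
      from has_integral_add[OF 1[OF t] this] show ?thesis by (simp add: algebra_simps)
    qed
    let ?\<nu> = "\<lambda>s. indicator {0..T} s *\<^sub>R \<nu> s"
    have h1: "\<forall>t\<in>{0..T}. ((\<lambda>s. A *v zi s + B *v ?\<nu> s + G *v zz s + \<gamma> *\<^sub>R q s) has_integral zi t) {0..t}"
    proof
      fix t assume t: "t \<in> {0..T}"
      show "((\<lambda>s. A *v zi s + B *v ?\<nu> s + G *v zz s + \<gamma> *\<^sub>R q s) has_integral zi t) {0..t}"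
        using eq1[OF t] by (rule has_integral_eq[rotated]) (use t in auto)
    qed
    let ?\<alpha> = "\<lambda>s. - (transpose (A + G) *v q s) - transpose (mat 1 - \<Gamma>) *v (Q *v (zi s - \<Gamma> *v zz s))"
    have ai: "integrable (leb T) ?\<alpha>"
      by (intro integrable_leb_continuous continuous_intros linear_continuous_on_compose[OF lin(1)] c)
    have h3: "\<forall>t\<in>{0..T}. ((\<lambda>s. transpose (A + G) *v q s + transpose (mat 1 - \<Gamma>) *v (Q *v (zi s - \<Gamma> *v zz s)))
                      has_integral (q t - H *v zi T)) {t..T}"
    proof
      fix t assume t: "t \<in> {0..T}"
      have "(?\<alpha> has_integral (\<integral>s\<in>{t..T}. ?\<alpha> s \<partial>lborel)) {t..T}" using t by (intro has_integral_leb[OF ai]) auto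
      moreover have "(\<integral>s\<in>{t..T}. ?\<alpha> s \<partial>lborel) = q T - q t"
        using set_integral_split[OF ai t] has_integral_eq_set_integral[OF ai t 3[OF t]]
          has_integral_eq_set_integral[OF ai T_in(1) 3[OF T_in(1)]] by (simp add: algebra_simps)
      moreover have "q T = H *v zi T" using b0 by (simp add: \<beta>_def comps)
      ultimately have "(?\<alpha> has_integral (H *v zi T - q t)) {t..T}" by simp
      from has_integral_neg[OF this]
      show "((\<lambda>s. transpose (A + G) *v q s + transpose (mat 1 - \<Gamma>) *v (Q *v (zi s - \<Gamma> *v zz s)))
                      has_integral (q t - H *v zi T)) {t..T}" by (simp add: add.commute del: transpose_matrix_vector)
    qed
    obtain \<delta> where \<delta>: "\<delta> > 0" "\<delta> * L2sq T ?\<nu> \<le>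
       (prim (\<lambda>t. qf Q (zi t - \<Gamma> *v zz t) + qf R (?\<nu> t) - \<gamma> * (norm (q t))\<^sup>2) T) + qf H (zi T)"
    proof -
      have h2: "\<forall>t\<in>{0..T}. ((\<lambda>s. (A + G) *v zz s + \<gamma> *\<^sub>R q s) has_integral zz t) {0..t}" using 2 by blast
      show ?thesis
        apply (rule H2E[OF hyp2])
        subgoal premises prems for e
          by (rule that[OF prems(1) prems(2)[OF indicator_L2fun(1)[OF \<nu>] h1 h2 h3]])
        done
    qed
    have "0 \<le> \<delta> * L2sq T ?\<nu>" using \<delta>(1) by (simp add: L2sq_eq_n2)
    also note \<delta>(2)
    also have "(prim (\<lambda>t. qf Q (zi t - \<Gamma> *v zz t) + qf R (?\<nu> t) - \<gamma> * (norm (q t))\<^sup>2) T)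
      = (\<integral>t. qf Q (zi t - \<Gamma> *v zz t) + qf R (\<nu> t) - \<gamma> * (norm (q t))\<^sup>2 \<partial>leb T)"
      unfolding set_integral_leb' by (intro bint_cong) auto
    finally have pos: "0 \<le> (\<integral>t. qf Q (zi t - \<Gamma> *v zz t) + qf R (\<nu> t) - \<gamma> * (norm (q t))\<^sup>2 \<partial>leb T) + qf H (zi T)" .
    let ?S = "sqrt (T * b\<^sup>2 * n2 (leb T) \<nu>)"
    have S0: "?S \<ge> 0" using T_pos by simp
    have qb: "(norm (q t))\<^sup>2 \<le> (1 + C * (1 + T))\<^sup>2 * (T * b\<^sup>2) * n2 (leb T) \<nu>" if t: "t \<in> {0..T}" for t
    proof -
      have nI: "norm (?c s) = norm (I s)" for s by (simp add: norm_Pair)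
      have "(prim (\<lambda>s. norm (I s)) T) \<le> (prim (\<lambda>s. ?S) T)"
        unfolding set_integral_leb' using In Ic
        by (intro integral_mono integrable_leb_continuous continuous_intros) auto
      also have "\<dots> = T * ?S" unfolding set_integral_leb' using measure_leb[of T] by simp
      finally have int: "(prim (\<lambda>s. norm (I s)) T) \<le> T * ?S" .
      have "norm (q t) \<le> norm (z t)" unfolding q_def by (metis norm_snd_le prod.collapse)
      also have "\<dots> \<le> norm (I t) + C * (norm (I T) + (prim (\<lambda>s. norm (I s)) T))"
        using C(3)[OF z b0 t cc] by (simp only: nI)
      also have "\<dots> \<le> ?S + C * (?S + T * ?S)"
        using In[OF t] In[OF T_in(1)] int C(1) by (intro add_mono mult_left_mono) auto
      also have "\<dots> = (1 + C * (1 + T)) * ?S" by (simp add: algebra_simps)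
      finally have "(norm (q t))\<^sup>2 \<le> ((1 + C * (1 + T)) * ?S)\<^sup>2" by (intro power_mono) auto
      also have "\<dots> = (1 + C * (1 + T))\<^sup>2 * (T * b\<^sup>2) * n2 (leb T) \<nu>"
        using T_pos by (simp add: power_mult_distrib)
      finally show ?thesis .
    qed
    have "n2 (leb T) q \<le> (\<integral>s. (1 + C * (1 + T))\<^sup>2 * (T * b\<^sup>2) * n2 (leb T) \<nu> \<partial>leb T)"
      unfolding n2_def[of _ q] using qb c(3)
      by (intro integral_mono integrable_leb_continuous continuous_intros) auto
    also have "\<dots> = D * n2 (leb T) \<nu>" using measure_leb[of T] by (simp add: D_def)
    finally have "n2 (leb T) q \<le> D * n2 (leb T) \<nu>" .
    with c eq1 2 pos show ?thesis by blast
  qed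
  show ?thesis by (rule that[OF D main])
qed

end

declare transpose_matrix_vector [simp del]

lemma set_integral_singleton: "(\<integral>s\<in>{t}. f s \<partial>lborel) = 0"
  for f :: "real \<Rightarrow> 'b::euclidean_space" and t :: real
  unfolding set_lebesgue_integral_def
  by (rule integral_eq_zero_AE, rule eventually_mono[OF AE_lborel_singleton[of t]]) auto

section \<open>Means and centred fluctuations of the strategies\<close>

context lq_game
begin

definition mX :: "nat \<Rightarrow> real \<Rightarrow> real^'n" where "mX i t = expectation (X i t)"
definition mY :: "nat \<Rightarrow> real \<Rightarrow> real^'n" where "mY i t = expectation (Y i t)"

lemma noise_mean:
  assumes "finite J" "J \<subseteq> {1..}" "t \<in> {0..T}"
  shows "integrable \<Omega> (noise J a t)" "expectation (noise J a t) = 0"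
  by (rule noise_bound, use assms in blast)+

lemma W_moments:
  assumes "1 \<le> i" "t \<in> {0..T}"
  shows "integrable \<Omega> (\<lambda>\<omega>. D *v W i t \<omega>)" "expectation (\<lambda>\<omega>. D *v W i t \<omega>) = 0"
  using noise_mean[of "{i}" t "\<lambda>_. 1"] assms unfolding noise_single by auto

text \<open>The equation is integrated in omega at each fixed time, so that the mean satisfies its
  integral equation for every t and not merely for almost every t.\<close>

lemma X_integrable:
  assumes i: "1 \<le> i" and t: "t \<in> {0..T}"
  shows "integrable \<Omega> (X i t)" "mX i t = x0 i + (prim (\<lambda>s. expectation (\<lambda>\<omega>. A *v X i s \<omega> + forcing i s \<omega>)) t)"
proof -
  have hL: "L2p (\<lambda>s \<omega>. A *v X i s \<omega> + forcing i s \<omega>)"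
    by (intro L2_add(1) L2_linear'[OF lin(1)] fbsde(3)[OF i] forcing_L2[OF i])
  have eq: "AE \<omega> in \<Omega>. X i t \<omega> = x0 i + D *v W i t \<omega> + (prim (\<lambda>s. A *v X i s \<omega> + forcing i s \<omega>) t)"
    using fbsde(9)[OF i] L2p_paths[OF hL]
  proof eventually_elim
    case (elim \<omega>)
    have "((\<lambda>s. A *v X i s \<omega> + forcing i s \<omega>) has_integral (X i t \<omega> - x0 i - D *v W i t \<omega>)) {0..t}"
      using elim(1)[rule_format, OF t] by (simp add: forcing_def add.assoc)
    from has_integral_eq_set_integral[OF elim(2) t this] show ?case by (simp add: algebra_simps)
  qed
  note w = W_moments[OF i t]
  note pr = mean_primitive[OF hL t]
  have Xm: "X i t \<in> borel_measurable \<Omega>" by (rule section_measurable[OF L2_measurable[OF fbsde(3)[OF i]] t])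
  have ri: "integrable \<Omega> (\<lambda>\<omega>. x0 i + D *v W i t \<omega> + (prim (\<lambda>s. A *v X i s \<omega> + forcing i s \<omega>) t))"
    using w(1) pr(1) by auto
  show "integrable \<Omega> (X i t)" using integrable_cong_AE[OF Xm _ eq] ri by auto
  have "mX i t = expectation (\<lambda>\<omega>. x0 i + D *v W i t \<omega> + (prim (\<lambda>s. A *v X i s \<omega> + forcing i s \<omega>) t))"
    unfolding mX_def by (rule integral_cong_AE[OF Xm _ eq]) (use ri in auto)
  also have "\<dots> = x0 i + (prim (\<lambda>s. expectation (\<lambda>\<omega>. A *v X i s \<omega> + forcing i s \<omega>)) t)"
    using w pr by (simp add: prob_space)
  finally show "mX i t = x0 i + (prim (\<lambda>s. expectation (\<lambda>\<omega>. A *v X i s \<omega> + forcing i s \<omega>)) t)" .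
qed

text \<open>The whole space is an event of time 0; the martingale property on it says that the
  martingale part has constant mean, which leaves an ordinary integral equation for the mean of
  Y.\<close>

lemma Y_integrable:
  assumes i: "1 \<le> i" and t: "t \<in> {0..T}"
  shows "integrable \<Omega> (Y i t)" "mY i t = mY i 0 + (prim (\<lambda>s. expectation (gen i s)) t)"
proof -
  define Mt where "Mt t \<omega> = Y i t \<omega> - (prim (\<lambda>s. gen i s \<omega>) t)" for t \<omega>
  have g: "L2p (gen i)" by (rule drift_L2(4)[OF i])
  have Mi: "integrable \<Omega> (Mt t)" if "t \<in> {0..T}" for t
    using fbsde(11)[OF i that] by (simp add: Mt_def[abs_def])
  have gi: "integrable \<Omega> (\<lambda>\<omega>. \<integral>s\<in>{0..t}. gen i s \<omega> \<partial>lborel)" if "t \<in> {0..T}" for t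
    by (rule mean_primitive(1)[OF g that])
  have Yi: "integrable \<Omega> (Y i t)" if t: "t \<in> {0..T}" for t
  proof -
    have "integrable \<Omega> (\<lambda>\<omega>. Mt t \<omega> + (prim (\<lambda>s. gen i s \<omega>) t))"
      by (intro bi_add Mi[OF t] gi[OF t])
    then show ?thesis by (simp add: Mt_def)
  qed
  show "integrable \<Omega> (Y i t)" by (rule Yi[OF t])
  have sp: "space \<Omega> \<in> sets (nat_filt \<Omega> W {i} 0)" using nat_filt_sets(2)[of \<Omega> W "{i}" 0] sets.top by metis
  have "0 = (\<integral>\<omega>\<in>space \<Omega>. (Mt t \<omega> - Mt 0 \<omega>) \<partial>\<Omega>)"
    using fbsde(12)[OF i _ _ _ sp, of t] t by (simp add: Mt_def)
  also have "\<dots> = expectation (\<lambda>\<omega>. Mt t \<omega> - Mt 0 \<omega>)" using Mi t by (subst set_integral_space) auto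
  also have "\<dots> = expectation (Mt t) - expectation (Mt 0)" using Mi t by (intro bint_diff) auto
  also have "expectation (Mt 0) = mY i 0" by (simp add: Mt_def[abs_def] mY_def set_integral_singleton)
  also have "expectation (Mt t) = mY i t - (prim (\<lambda>s. expectation (gen i s)) t)"
    unfolding Mt_def mY_def using Yi[OF t] gi[OF t] mean_primitive(2)[OF g t] by simp
  finally show "mY i t = mY i 0 + (prim (\<lambda>s. expectation (gen i s)) t)" by (simp add: algebra_simps)
qed

lemma mean_XY:
  assumes i: "1 \<le> i"
  shows "L2 (leb T) (mX i)" "L2 (leb T) (mY i)"
    "\<And>t. t \<in> {0..T} \<Longrightarrow> ((\<lambda>s. A *v mX i s + B *v Fb (mY i s) + G *v M i s + \<gamma> *\<^sub>R P i s) has_integral (mX i t - x0 i)) {0..t}"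
    "\<And>t. t \<in> {0..T} \<Longrightarrow> ((\<lambda>s. - (transpose A *v mY i s) + Q *v (mX i s - (\<Gamma> *v M i s + \<eta>))) has_integral (mY i t - mY i 0)) {0..t}"
proof -
  show XL: "L2 (leb T) (mX i)" and YL: "L2 (leb T) (mY i)"
    using mean_L2(1)[OF fbsde(3)[OF i]] mean_L2(1)[OF fbsde(4)[OF i]] by (simp_all add: mX_def[abs_def] mY_def[abs_def])
  have c1: "expectation (\<lambda>\<omega>. A *v X i s \<omega> + forcing i s \<omega>) = A *v mX i s + B *v Fb (mY i s) + G *v M i s + \<gamma> *\<^sub>R P i s"
    if "s \<in> {0..T}" for s
    using X_integrable(1)[OF i that] Y_integrable(1)[OF i that]
    by (simp add: forcing_def mX_def mY_def prob_space mean_linear[OF lin(1)] mean_linear[OF linear_mat_vec[OF lin(2)]] add.assoc)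
  have c2: "expectation (gen i s) = - (transpose A *v mY i s) + Q *v (mX i s - (\<Gamma> *v M i s + \<eta>))"
    if "s \<in> {0..T}" for s
    using X_integrable(1)[OF i that] Y_integrable(1)[OF i that]
    by (simp add: gen_def[abs_def] drift_def mX_def mY_def prob_space mean_linear[OF lin(1)] del: transpose_matrix_vector)
  show "((\<lambda>s. A *v mX i s + B *v Fb (mY i s) + G *v M i s + \<gamma> *\<^sub>R P i s) has_integral (mX i t - x0 i)) {0..t}"
    if t: "t \<in> {0..T}" for t
  proof -
    have "L2p (\<lambda>s \<omega>. A *v X i s \<omega> + forcing i s \<omega>)"
      by (intro L2_add(1) L2_linear'[OF lin(1)] fbsde(3)[OF i] forcing_L2[OF i])
    then have "integrable (leb T) (\<lambda>s. expectation (\<lambda>\<omega>. A *v X i s \<omega> + forcing i s \<omega>))"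
      by (intro leb.L2_integrable(1) mean_L2(1))
    from has_integral_leb[OF this, of 0 t]
    have "((\<lambda>s. expectation (\<lambda>\<omega>. A *v X i s \<omega> + forcing i s \<omega>)) has_integral (mX i t - x0 i)) {0..t}"
      using t X_integrable(2)[OF i t] by simp
    then show ?thesis by (rule has_integral_eq[rotated]) (use t c1 in auto)
  qed
  show "((\<lambda>s. - (transpose A *v mY i s) + Q *v (mX i s - (\<Gamma> *v M i s + \<eta>))) has_integral (mY i t - mY i 0)) {0..t}"
    if t: "t \<in> {0..T}" for t
  proof -
    have "integrable (leb T) (\<lambda>s. expectation (gen i s))"
      by (intro leb.L2_integrable(1) mean_L2(1) drift_L2(4)[OF i])
    from has_integral_leb[OF this, of 0 t]
    have "((\<lambda>s. expectation (gen i s)) has_integral (mY i t - mY i 0)) {0..t}"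
      using t Y_integrable(2)[OF i t] by simp
    then show ?thesis by (rule has_integral_eq[rotated]) (use t c2 in auto)
  qed
qed

definition Xc :: "nat \<Rightarrow> real \<Rightarrow> 'w \<Rightarrow> real^'n" where "Xc i t \<omega> = X i t \<omega> - mX i t"
definition Yc :: "nat \<Rightarrow> real \<Rightarrow> 'w \<Rightarrow> real^'n" where "Yc i t \<omega> = Y i t \<omega> - mY i t"

text \<open>M_i, P_i and x_i(0) are deterministic. Subtracting means therefore eliminates them and
  leaves a state driven by D W_i and the centred control only.\<close>

lemma centered:
  assumes i: "1 \<le> i"
  shows "L2p (Xc i)" "L2p (Yc i)" "prog_meas \<Omega> W {i} T (Yc i)" "L2 \<Omega> (Xc i T)"
    "\<And>t. t \<in> {0..T} \<Longrightarrow> integrable \<Omega> (Yc i t)" "\<And>t. t \<in> {0..T} \<Longrightarrow> expectation (Yc i t) = 0"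
    "AE \<omega> in \<Omega>. ie_sol ((*v) A) T (\<lambda>t. D *v W i t \<omega> + (prim (\<lambda>s. B *v Fb (Yc i s \<omega>)) t)) (\<lambda>t. Xc i t \<omega>)"
proof -
  note XL = mean_XY(1)[OF i] and YL = mean_XY(2)[OF i]
  show "L2p (Xc i)" unfolding Xc_def by (intro L2_diff(1) fbsde(3)[OF i] L2p_fst(1)[OF XL])
  show Yc2: "L2p (Yc i)" unfolding Yc_def by (intro L2_diff(1) fbsde(4)[OF i] L2p_fst(1)[OF YL])
  show "prog_meas \<Omega> W {i} T (Yc i)" unfolding Yc_def[abs_def]
    by (intro prog_diff fbsde(2)[OF i] prog_deterministic L2_measurable[OF YL])
  show "L2 \<Omega> (Xc i T)" unfolding Xc_def[abs_def] by (intro L2_diff(1) XT_L2(1)[OF i] L2_const)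
  show "integrable \<Omega> (Yc i t)" "expectation (Yc i t) = 0" if "t \<in> {0..T}" for t
    using Y_integrable(1)[OF i that] unfolding Yc_def[abs_def] by (simp_all add: prob_space mY_def)
  have bL: "L2 (leb T) (\<lambda>s. B *v Fb (mY i s) + G *v M i s + \<gamma> *\<^sub>R P i s)"
    by (intro L2_add(1) L2_linear'[OF lin(1)] L2_linear'[OF lin(2)] L2_scaleR YL MP_L2[OF i])
  note bi = leb.L2_integrable(1)[OF bL]
  have mie: "ie_sol ((*v) A) T (\<lambda>t. x0 i + (prim (\<lambda>s. B *v Fb (mY i s) + G *v M i s + \<gamma> *\<^sub>R P i s) t)) (mX i)"
    by (rule ie_sol_forced[OF lin(1) bi]) (use mean_XY(3)[OF i] in \<open>simp_all add: add.assoc\<close>)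
  show "AE \<omega> in \<Omega>. ie_sol ((*v) A) T (\<lambda>t. D *v W i t \<omega> + (prim (\<lambda>s. B *v Fb (Yc i s \<omega>)) t)) (\<lambda>t. Xc i t \<omega>)"
    using X_ie[OF i] L2p_paths[OF forcing_L2[OF i]]
  proof eventually_elim
    case (elim \<omega>)
    have "ie_sol ((*v) A) T (\<lambda>t. (x0 i + D *v W i t \<omega> + (prim (\<lambda>s. forcing i s \<omega>) t))
        - (x0 i + (prim (\<lambda>s. B *v Fb (mY i s) + G *v M i s + \<gamma> *\<^sub>R P i s) t))) (\<lambda>t. Xc i t \<omega>)"
      unfolding Xc_def by (rule ie_sol_diff[OF lin(1) elim(1) mie])
    then show ?case
    proof (rule ie_sol_cong)
      fix t assume t: "t \<in> {0..T}"
      have "(prim (\<lambda>s. forcing i s \<omega>) t) - (prim (\<lambda>s. B *v Fb (mY i s) + G *v M i s + \<gamma> *\<^sub>R P i s) t)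
         = (prim (\<lambda>s. forcing i s \<omega> - (B *v Fb (mY i s) + G *v M i s + \<gamma> *\<^sub>R P i s)) t)"
        using t by (intro set_integral_diff(2)[symmetric] set_integrable_leb_sub[OF elim(2)] set_integrable_leb_sub[OF bi]) auto
      also have "\<dots> = (prim (\<lambda>s. B *v Fb (Yc i s \<omega>)) t)"
        by (simp add: forcing_def Yc_def matrix_vector_mult_diff_distrib)
      finally show "(x0 i + D *v W i t \<omega> + (prim (\<lambda>s. forcing i s \<omega>) t))
        - (x0 i + (prim (\<lambda>s. B *v Fb (mY i s) + G *v M i s + \<gamma> *\<^sub>R P i s) t))
        = D *v W i t \<omega> + (prim (\<lambda>s. B *v Fb (Yc i s \<omega>)) t)" by (simp add: algebra_simps)
    qed
  qed
qed

lemma deterministic_orthogonal: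
  fixes f :: "real \<Rightarrow> 'v::euclidean_space"
  assumes f: "L2 (leb T) f" and u: "L2p u" and 0: "\<And>s. s \<in> {0..T} \<Longrightarrow> expectation (u s) = 0"
  shows "(\<integral>p. f (fst p) \<bullet> u (fst p) (snd p) \<partial>PP) = 0"
proof -
  have "(\<integral>p. f (fst p) \<bullet> u (fst p) (snd p) \<partial>PP) = (\<integral>s. (\<integral>\<omega>. f s \<bullet> u s \<omega> \<partial>\<Omega>) \<partial>leb T)"
    using P.integral_fst[of "\<lambda>s \<omega>. f s \<bullet> u s \<omega>"] L2_inner(1)[OF L2p_fst(1)[OF f] u] by (simp add: split_beta')
  also have "\<dots> = (\<integral>s. 0 \<partial>leb T)"
  proof (rule integral_cong_AE)
    show "(\<lambda>s. \<integral>\<omega>. f s \<bullet> u s \<omega> \<partial>\<Omega>) \<in> borel_measurable (leb T)"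
      using P.integrable_fst[of "\<lambda>s \<omega>. f s \<bullet> u s \<omega>"] L2_inner(1)[OF L2p_fst(1)[OF f] u] by (auto simp: split_beta')
    show "AE s in leb T. (\<integral>\<omega>. f s \<bullet> u s \<omega> \<partial>\<Omega>) = 0"
      using L2p_integrable_section[OF u] AE_space by eventually_elim (simp add: 0)
  qed simp
  finally show ?thesis by simp
qed

definition Xs :: "nat set \<Rightarrow> (nat \<Rightarrow> real) \<Rightarrow> real \<Rightarrow> 'w \<Rightarrow> real^'n" where
  "Xs J a t \<omega> = (\<Sum>j\<in>J. a j *\<^sub>R Xc j t \<omega>)"
definition Ys :: "nat set \<Rightarrow> (nat \<Rightarrow> real) \<Rightarrow> real \<Rightarrow> 'w \<Rightarrow> real^'n" where
  "Ys J a t \<omega> = (\<Sum>j\<in>J. a j *\<^sub>R Yc j t \<omega>)"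

text \<open>The centred strategies are optimal for a convex linear-quadratic problem, hence no more
  expensive than the zero control, whose cost is governed by the noise alone.\<close>
lemma fluctuation_identity:
  fixes a :: "nat \<Rightarrow> real"
  assumes J: "finite J" "J \<subseteq> {1..}"
  defines "v \<equiv> \<lambda>t \<omega>. Fb (Ys J a t \<omega>)"
  defines "\<theta> \<equiv> resp ((*v) A) (\<lambda>t \<omega>. B *v v t \<omega>)"
  shows "L2p (Xs J a)" "L2p v" "L2 \<Omega> (Xs J a T)"
    "(\<integral>p. qf R (v (fst p) (snd p)) \<partial>PP) = - (\<integral>p. (Q *v Xs J a (fst p) (snd p)) \<bullet> \<theta> (fst p) (snd p) \<partial>PP)
       - (\<integral>\<omega>. (H *v Xs J a T \<omega>) \<bullet> \<theta> T \<omega> \<partial>\<Omega>)"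
    "AE \<omega> in \<Omega>. ie_sol ((*v) A) T (\<lambda>t. noise J a t \<omega>) (\<lambda>t. Xs J a t \<omega> - \<theta> t \<omega>)"
proof -
  have J1: "1 \<le> j" if "j \<in> J" for j using that J by auto
  show XsL: "L2p (Xs J a)" unfolding Xs_def by (intro L2_sum L2_scaleR centered(1) J1)
  have YsL: "L2p (Ys J a)" unfolding Ys_def by (intro L2_sum L2_scaleR centered(2) J1)
  show vL: "L2p v" unfolding v_def by (rule L2_linear'[OF lin(2) YsL])
  show XsT: "L2 \<Omega> (Xs J a T)" unfolding Xs_def[abs_def] by (intro L2_sum L2_scaleR centered(4) J1)
  \<comment> \<open>Every player's stationarity condition is tested in one common direction, the
    weighted sum of all centred controls. This direction is adapted only to all motions in J
    together, hence the need for stationarity in the enlarged filtration.\<close>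
  define b where "b = (\<lambda>t \<omega>. B *v v t \<omega>)"
  have bL: "L2p b" unfolding b_def by (rule L2_linear'[OF lin(1) vL])
  have bp: "prog_meas \<Omega> W J T b"
  proof -
    have "prog_meas \<Omega> W J T (Yc j)" if "j \<in> J" for j
      by (rule prog_mono[OF centered(3)[OF J1[OF that]]]) (use that in auto)
    then show ?thesis unfolding b_def v_def Ys_def
      by (intro prog_linear[OF lin(1)] prog_linear[OF lin(2)] prog_sum prog_scaleR)
  qed
  have \<theta>: "\<theta> = resp ((*v) A) b" by (simp add: \<theta>_def b_def)
  have th: "L2p \<theta>" "L2 \<Omega> (\<theta> T)"
    unfolding \<theta> by (rule resp_bound[OF lin(1)[of A]], use bL in blast)+
  have Eb: "expectation (b s) = 0" if s: "s \<in> {0..T}" for s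
  proof -
    have l: "linear (\<lambda>w. B *v Fb w)" by (rule linear_mat_vec[OF lin(2)])
    have i: "integrable \<Omega> (Ys J a s)" unfolding Ys_def[abs_def]
      using centered(5)[OF J1 s] by (intro Bochner_Integration.integrable_sum integrable_scaleR_right) auto
    have "expectation (Ys J a s) = 0" unfolding Ys_def
      using centered(5,6)[OF J1 s] by (subst Bochner_Integration.integral_sum) auto
    then show ?thesis unfolding b_def v_def using mean_linear(1)[OF l i] by (simp add: linear_0[OF l])
  qed
  have Eth: "expectation (\<theta> t) = 0" if t: "t \<in> {0..T}" for t
  proof -
    have "ie_sol ((*v) A) T (\<lambda>_. 0) (\<lambda>t. expectation (\<theta> t))"
    proof (rule ie_sol_cong[OF mean_resp[OF lin(1)[of A] bL, folded \<theta>]])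
      fix t assume "t \<in> {0..T}"
      then have "(prim (\<lambda>s. expectation (b s)) t) = (prim (\<lambda>s. 0) t)"
        by (intro set_lebesgue_integral_cong) (auto simp: Eb)
      then show "(prim (\<lambda>s. expectation (b s)) t) = 0" by simp
    qed
    from ie_sol_zero[OF lin(1) this t] show ?thesis .
  qed
  \<comment> \<open>Both b and its response \<theta> have mean zero at every time, so their pairings
    with deterministic functions vanish and X_j, Y_j may be replaced by their centred
    versions.\<close>
  have one: "- (\<integral>\<omega>. (H *v Xc j T \<omega>) \<bullet> \<theta> T \<omega> \<partial>\<Omega>) =
     (\<integral>p. (Q *v Xc j (fst p) (snd p)) \<bullet> \<theta> (fst p) (snd p) \<partial>PP) + (\<integral>p. Yc j (fst p) (snd p) \<bullet> b (fst p) (snd p) \<partial>PP)"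
    if j: "j \<in> J" for j
  proof -
    note j1 = J1[OF j]
    have dL: "L2 (leb T) (\<lambda>s. Q *v (mX j s - (\<Gamma> *v M j s + \<eta>)))"
      by (intro L2_linear'[OF lin(1)] L2_diff(1) L2_add(1) mean_XY(1)[OF j1] MP_L2(1)[OF j1] leb.L2_const)
    have QX: "L2p (\<lambda>t \<omega>. Q *v Xc j t \<omega>)" by (rule L2_linear'[OF lin(1) centered(1)[OF j1]])
    have HX: "L2 \<Omega> (\<lambda>\<omega>. H *v Xc j T \<omega>)" by (rule L2_linear'[OF lin(1) centered(4)[OF j1]])
    have "(\<integral>p. drift j (fst p) (snd p) \<bullet> \<theta> (fst p) (snd p) \<partial>PP)
        = (\<integral>p. (Q *v Xc j (fst p) (snd p)) \<bullet> \<theta> (fst p) (snd p) + (Q *v (mX j (fst p) - (\<Gamma> *v M j (fst p) + \<eta>))) \<bullet> \<theta> (fst p) (snd p) \<partial>PP)"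
    proof -
      have "drift j t \<omega> = Q *v Xc j t \<omega> + Q *v (mX j t - (\<Gamma> *v M j t + \<eta>))" for t \<omega>
        unfolding drift_def Xc_def matrix_vector_right_distrib[symmetric] by (rule arg_cong[of _ _ "(*v) Q"]) simp
      then show ?thesis by (simp add: inner_add_left)
    qed
    also have "\<dots> = (\<integral>p. (Q *v Xc j (fst p) (snd p)) \<bullet> \<theta> (fst p) (snd p) \<partial>PP) + 0"
      using L2_inner(1)[OF QX th(1)] L2_inner(1)[OF L2p_fst(1)[OF dL] th(1)] deterministic_orthogonal[OF dL th(1) Eth]
      by (subst bint_add) auto
    finally have 1: "(\<integral>p. drift j (fst p) (snd p) \<bullet> \<theta> (fst p) (snd p) \<partial>PP) = (\<integral>p. (Q *v Xc j (fst p) (snd p)) \<bullet> \<theta> (fst p) (snd p) \<partial>PP)" by simp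
    have "(\<integral>p. Y j (fst p) (snd p) \<bullet> b (fst p) (snd p) \<partial>PP) = (\<integral>p. Yc j (fst p) (snd p) \<bullet> b (fst p) (snd p) + mY j (fst p) \<bullet> b (fst p) (snd p) \<partial>PP)"
      unfolding Yc_def inner_add_left[symmetric] by simp
    also have "\<dots> = (\<integral>p. Yc j (fst p) (snd p) \<bullet> b (fst p) (snd p) \<partial>PP) + 0"
      using L2_inner(1)[OF centered(2)[OF j1] bL] L2_inner(1)[OF L2p_fst(1)[OF mean_XY(2)[OF j1]] bL]
        deterministic_orthogonal[OF mean_XY(2)[OF j1] bL Eb]
      by (subst bint_add) auto
    finally have 2: "(\<integral>p. Y j (fst p) (snd p) \<bullet> b (fst p) (snd p) \<partial>PP) = (\<integral>p. Yc j (fst p) (snd p) \<bullet> b (fst p) (snd p) \<partial>PP)" by simp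
    have thi: "integrable \<Omega> (\<theta> T)" by (rule L2_integrable(1)[OF th(2)])
    have "(\<integral>\<omega>. (H *v X j T \<omega>) \<bullet> \<theta> T \<omega> \<partial>\<Omega>) = (\<integral>\<omega>. (H *v Xc j T \<omega>) \<bullet> \<theta> T \<omega> + (H *v mX j T) \<bullet> \<theta> T \<omega> \<partial>\<Omega>)"
      unfolding Xc_def inner_add_left[symmetric] matrix_vector_right_distrib[symmetric] by simp
    also have "\<dots> = (\<integral>\<omega>. (H *v Xc j T \<omega>) \<bullet> \<theta> T \<omega> \<partial>\<Omega>) + 0"
      using L2_inner(1)[OF HX th(2)] thi Eth[OF T_in(1)] by (subst bint_add) auto
    finally have 3: "(\<integral>\<omega>. (H *v X j T \<omega>) \<bullet> \<theta> T \<omega> \<partial>\<Omega>) = (\<integral>\<omega>. (H *v Xc j T \<omega>) \<bullet> \<theta> T \<omega> \<partial>\<Omega>)" by simp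
    show ?thesis using stationarity[OF j J(2) bp bL, folded \<theta>] unfolding 1 2 3 .
  qed
  have i1: "integrable \<Omega> (\<lambda>\<omega>. (H *v Xc j T \<omega>) \<bullet> \<theta> T \<omega>)" if "j \<in> J" for j
    by (rule L2_inner(1)[OF L2_linear'[OF lin(1) centered(4)[OF J1[OF that]]] th(2)])
  have i2: "integrable PP (\<lambda>p. (Q *v Xc j (fst p) (snd p)) \<bullet> \<theta> (fst p) (snd p))" if "j \<in> J" for j
    by (rule L2_inner(1)[OF L2_linear'[OF lin(1) centered(1)[OF J1[OF that]]] th(1)])
  have i3: "integrable PP (\<lambda>p. Yc j (fst p) (snd p) \<bullet> b (fst p) (snd p))" if "j \<in> J" for j
    by (rule L2_inner(1)[OF centered(2)[OF J1[OF that]] bL])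
  have s1: "(\<integral>\<omega>. (H *v Xs J a T \<omega>) \<bullet> \<theta> T \<omega> \<partial>\<Omega>) = (\<Sum>j\<in>J. a j * (\<integral>\<omega>. (H *v Xc j T \<omega>) \<bullet> \<theta> T \<omega> \<partial>\<Omega>))"
    unfolding Xs_def using i1 by (simp add: linear_sum[OF lin(1)] inner_sum_left matrix_vector_mult_scaleR)
  have s2: "(\<integral>p. (Q *v Xs J a (fst p) (snd p)) \<bullet> \<theta> (fst p) (snd p) \<partial>PP) = (\<Sum>j\<in>J. a j * (\<integral>p. (Q *v Xc j (fst p) (snd p)) \<bullet> \<theta> (fst p) (snd p) \<partial>PP))"
    unfolding Xs_def using i2 by (simp add: linear_sum[OF lin(1)] inner_sum_left matrix_vector_mult_scaleR)
  have s3: "(\<integral>p. qf R (v (fst p) (snd p)) \<partial>PP) = (\<Sum>j\<in>J. a j * (\<integral>p. Yc j (fst p) (snd p) \<bullet> b (fst p) (snd p) \<partial>PP))"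
  proof -
    have q: "qf R (v t \<omega>) = (\<Sum>j\<in>J. a j * (Yc j t \<omega> \<bullet> b t \<omega>))" for t \<omega>
    proof -
      have "qf R (v t \<omega>) = (R *v Fb (Ys J a t \<omega>)) \<bullet> v t \<omega>" by (simp add: qf_def v_def inner_commute)
      also have "\<dots> = Ys J a t \<omega> \<bullet> b t \<omega>" by (simp add: Y_B b_def)
      finally show ?thesis by (simp add: Ys_def inner_sum_left)
    qed
    show ?thesis unfolding q using i3 by simp
  qed
  have "- (\<Sum>j\<in>J. a j * (\<integral>\<omega>. (H *v Xc j T \<omega>) \<bullet> \<theta> T \<omega> \<partial>\<Omega>)) = (\<Sum>j\<in>J. a j * (\<integral>p. (Q *v Xc j (fst p) (snd p)) \<bullet> \<theta> (fst p) (snd p) \<partial>PP))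
     + (\<Sum>j\<in>J. a j * (\<integral>p. Yc j (fst p) (snd p) \<bullet> b (fst p) (snd p) \<partial>PP))"
    unfolding sum_negf[symmetric] sum.distrib[symmetric] mult_minus_right[symmetric] distrib_left[symmetric]
    using one by (intro sum.cong) auto
  then show "(\<integral>p. qf R (v (fst p) (snd p)) \<partial>PP) = - (\<integral>p. (Q *v Xs J a (fst p) (snd p)) \<bullet> \<theta> (fst p) (snd p) \<partial>PP)
       - (\<integral>\<omega>. (H *v Xs J a T \<omega>) \<bullet> \<theta> T \<omega> \<partial>\<Omega>)"
    unfolding s1 s2 s3 by simp
  have "AE \<omega> in \<Omega>. \<forall>j\<in>J. ie_sol ((*v) A) T (\<lambda>t. D *v W j t \<omega> + (prim (\<lambda>s. B *v Fb (Yc j s \<omega>)) t)) (\<lambda>t. Xc j t \<omega>)"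
    using J(1) centered(7)[OF J1] by (rule AE_finite_allI)
  moreover have "AE \<omega> in \<Omega>. \<forall>j\<in>J. integrable (leb T) (\<lambda>s. B *v Fb (Yc j s \<omega>))"
    using J(1) by (rule AE_finite_allI) (intro L2p_paths L2_linear'[OF lin(1)] L2_linear'[OF lin(2)] centered(2) J1)
  ultimately show "AE \<omega> in \<Omega>. ie_sol ((*v) A) T (\<lambda>t. noise J a t \<omega>) (\<lambda>t. Xs J a t \<omega> - \<theta> t \<omega>)"
    using L2p_paths[OF bL]
  proof eventually_elim
    case (elim \<omega>)
    let ?c = "\<lambda>j t. D *v W j t \<omega> + (prim (\<lambda>s. B *v Fb (Yc j s \<omega>)) t)"
    have 1: "ie_sol ((*v) A) T (\<lambda>t. \<Sum>j\<in>J. a j *\<^sub>R ?c j t) (\<lambda>t. Xs J a t \<omega>)"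
      unfolding Xs_def using elim(1) by (intro ie_sol_sum[OF lin(1)]) auto
    have 2: "ie_sol ((*v) A) T (\<lambda>t. \<integral>s\<in>{0..t}. b s \<omega> \<partial>lborel) (\<lambda>t. \<theta> t \<omega>)"
      unfolding \<theta> by (rule resp_sol[of "(*v) A" b \<omega>, OF lin(1) elim(3)])
    show ?case
    proof (rule ie_sol_cong[OF ie_sol_diff[OF lin(1) 1 2]])
      fix t assume t: "t \<in> {0..T}"
      have be: "b s \<omega> = (\<Sum>j\<in>J. a j *\<^sub>R (B *v Fb (Yc j s \<omega>)))" for s
        by (simp add: b_def v_def Ys_def linear_sum[OF lin(1)] matrix_vector_mult_scaleR)
      have "(prim (\<lambda>s. b s \<omega>) t) = (\<Sum>j\<in>J. a j *\<^sub>R (prim (\<lambda>s. B *v Fb (Yc j s \<omega>)) t))"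
      proof -
        have "set_integrable lborel {0..t} (\<lambda>s. B *v Fb (Yc j s \<omega>))" if "j \<in> J" for j
          using elim(2) that t by (intro set_integrable_leb_sub) auto
        note i = this
        have "(prim (\<lambda>s. b s \<omega>) t) = (\<integral>s. (\<Sum>j\<in>J. a j *\<^sub>R (indicator {0..t} s *\<^sub>R (B *v Fb (Yc j s \<omega>)))) \<partial>lborel)"
          unfolding be set_lebesgue_integral_def by (simp add: scaleR_sum_right mult.commute)
        also have "\<dots> = (\<Sum>j\<in>J. \<integral>s. a j *\<^sub>R (indicator {0..t} s *\<^sub>R (B *v Fb (Yc j s \<omega>))) \<partial>lborel)"
          using i unfolding set_integrable_def by (intro Bochner_Integration.integral_sum integrable_scaleR_right) auto
        finally show ?thesis unfolding set_lebesgue_integral_def by (simp only: integral_scaleR_right)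
      qed
      then show "(\<Sum>j\<in>J. a j *\<^sub>R ?c j t) - (prim (\<lambda>s. b s \<omega>) t) = noise J a t \<omega>"
        by (simp add: noise_def scaleR_add_right sum.distrib linear_sum[OF lin(1)] matrix_vector_mult_scaleR)
    qed
  qed
qed

end

lemma qf_L2:
  fixes S :: "real^'n^'n"
  assumes "L2 N f"
  shows "integrable N (\<lambda>x. qf S (f x))"
  unfolding qf_def by (rule L2_inner(1)[OF assms L2_linear'[OF matrix_vector_mul_linear assms]])

lemma qf_L2_bound:
  fixes S :: "real^'n^'n"
  obtains c where "c > 0" "\<And>N f. L2 N f \<Longrightarrow> \<bar>\<integral>x. qf S (f x) \<partial>N\<bar> \<le> c * n2 N f"
proof -
  obtain c where c: "c > 0" "\<And>x. \<bar>qf S x\<bar> \<le> c * (norm x)\<^sup>2" using qf_bound by blast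
  have "\<bar>\<integral>x. qf S (f x) \<partial>N\<bar> \<le> c * n2 N f" if f: "L2 N f" for N f
  proof -
    have "\<bar>\<integral>x. qf S (f x) \<partial>N\<bar> \<le> (\<integral>x. c * (norm (f x))\<^sup>2 \<partial>N)"
      using f c(2) qf_L2[OF f, of S]
      by (intro order_trans[OF integral_abs_bound] integral_mono) (auto simp: L2_def)
    then show ?thesis by (simp add: n2_def)
  qed
  with c(1) show ?thesis by (rule that)
qed

lemma pd_L2_coercive:
  fixes S :: "real^'n^'n"
  assumes "pd S"
  obtains c where "c > 0" "\<And>N f. L2 N f \<Longrightarrow> c * n2 N f \<le> (\<integral>x. qf S (f x) \<partial>N)"
proof -
  obtain c where c: "c > 0" "\<And>x. c * (norm x)\<^sup>2 \<le> qf S x" using pd_coercive[OF assms] by blast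
  have "c * n2 N f \<le> (\<integral>x. qf S (f x) \<partial>N)" if f: "L2 N f" for N f
  proof -
    have "(\<integral>x. c * (norm (f x))\<^sup>2 \<partial>N) \<le> (\<integral>x. qf S (f x) \<partial>N)"
      using f c(2) qf_L2[OF f, of S] by (intro integral_mono) (auto simp: L2_def)
    then show ?thesis by (simp add: n2_def)
  qed
  with c(1) show ?thesis by (rule that)
qed

lemma matrix_L2_bound:
  fixes S :: "real^'m^'n"
  obtains c where "c > 0" "\<And>N f. L2 N f \<Longrightarrow> n2 N (\<lambda>x. S *v f x) \<le> c * n2 N f"
proof -
  obtain c where c: "c > 0" "\<And>x. norm (S *v x) \<le> c * norm x"
    using linear_bounded_pos[OF matrix_vector_mul_linear[of S]] by blast
  have "n2 N (\<lambda>x. S *v f x) \<le> c\<^sup>2 * n2 N f" if "L2 N f" for N f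
    by (rule L2_linear(2)[OF matrix_vector_mul_linear c(2) that])
  with c(1) show ?thesis by (intro that[of "c\<^sup>2"]) auto
qed

lemma (in horizon) ie_bound_matrix:
  fixes S :: "real^'n^'n"
  obtains C where "C > 0"
    "\<And>c z. L2p c \<Longrightarrow> L2 \<Omega> (c T) \<Longrightarrow> (\<lambda>p. z (fst p) (snd p)) \<in> borel_measurable PP \<Longrightarrow>
      (AE \<omega> in \<Omega>. ie_sol ((*v) S) T (\<lambda>t. c t \<omega>) (\<lambda>t. z t \<omega>)) \<Longrightarrow>
      L2p z \<and> n2p z \<le> C * n2p c \<and> L2 \<Omega> (z T) \<and> n2 \<Omega> (z T) \<le> C * (n2p c + n2 \<Omega> (c T))"
  using ie_L2_bound[OF matrix_vector_mul_linear[of S]] by blast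

section \<open>Size of the fluctuations, and the distance of the means from (MF)\<close>

context lq_game
begin

text \<open>Write the weighted sum as \<xi> + \<theta>, where \<xi> is the path with zero control,
  driven by noise alone. In the stationarity identity the mixed terms of \<xi> and \<theta> are
  completed to squares, so the control cost is at most a quarter of the state cost of \<xi>.
  Independence of the noises makes that proportional to the sum of the squared weights.\<close>

lemma fluctuation_bound:
  obtains C where "C > 0"
    "\<And>J a. finite J \<Longrightarrow> J \<subseteq> {1..} \<Longrightarrow>
       n2p (\<lambda>t \<omega>. Fb (Ys J a t \<omega>)) \<le> C * (\<Sum>j\<in>J. (a j)\<^sup>2) \<and>
       n2p (Xs J a) \<le> C * (\<Sum>j\<in>J. (a j)\<^sup>2) \<and> n2 \<Omega> (Xs J a T) \<le> C * (\<Sum>j\<in>J. (a j)\<^sup>2)"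
proof -
  obtain C1 where C1: "C1 > 0"
    "\<And>c z. L2p c \<Longrightarrow> L2 \<Omega> (c T) \<Longrightarrow> (\<lambda>p. z (fst p) (snd p)) \<in> borel_measurable PP \<Longrightarrow>
      (AE \<omega> in \<Omega>. ie_sol ((*v) A) T (\<lambda>t. c t \<omega>) (\<lambda>t. z t \<omega>)) \<Longrightarrow>
      L2p z \<and> n2p z \<le> C1 * n2p c \<and> L2 \<Omega> (z T) \<and> n2 \<Omega> (z T) \<le> C1 * (n2p c + n2 \<Omega> (c T))"
    using ie_bound_matrix[of A] by blast
  obtain C2 where C2: "C2 > 0"
    "\<And>J a. finite J \<Longrightarrow> J \<subseteq> {1..} \<Longrightarrow> L2p (noise J a) \<and> n2p (noise J a) \<le> C2 * (\<Sum>j\<in>J. (a j)\<^sup>2)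
       \<and> L2 \<Omega> (noise J a T) \<and> n2 \<Omega> (noise J a T) \<le> C2 * (\<Sum>j\<in>J. (a j)\<^sup>2)
       \<and> (\<forall>t\<in>{0..T}. integrable \<Omega> (noise J a t) \<and> expectation (noise J a t) = 0)"
    using noise_bound by blast
  obtain C3 where C3: "C3 > 0"
    "\<And>b. L2p b \<Longrightarrow> L2p (resp ((*v) A) b) \<and> n2p (resp ((*v) A) b) \<le> C3 * n2p b
       \<and> L2 \<Omega> (resp ((*v) A) b T) \<and> n2 \<Omega> (resp ((*v) A) b T) \<le> C3 * n2p b"
    using resp_bound[OF lin(1)[of A]] by blast
  obtain cQ where cQ: "cQ > 0" "\<And>N f. L2 N f \<Longrightarrow> \<bar>\<integral>x. qf Q (f x) \<partial>N\<bar> \<le> cQ * n2 (N :: (real \<times> 'w) measure) f"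
    using qf_L2_bound by blast
  obtain cH where cH: "cH > 0" "\<And>N f. L2 N f \<Longrightarrow> \<bar>\<integral>x. qf H (f x) \<partial>N\<bar> \<le> cH * n2 (N :: 'w measure) f"
    using qf_L2_bound by blast
  obtain cR where cR: "cR > 0" "\<And>N f. L2 N f \<Longrightarrow> cR * n2 N f \<le> (\<integral>x. qf R (f x) \<partial>(N :: (real \<times> 'w) measure))"
    using pd_L2_coercive[OF Rpd] by blast
  obtain cB where cB: "cB > 0" "\<And>N f. L2 N f \<Longrightarrow> n2 (N :: (real \<times> 'w) measure) (\<lambda>x. B *v f x) \<le> cB * n2 N f"
    using matrix_L2_bound by blast
  \<comment> \<open>E1 controls \<xi> over time and at T. E2 controls the control: the 4 is that of
    the completed square and cR the coercivity of R. E3 controls \<theta>, the response to the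
    control.\<close>
  define E1 where "E1 = C1 * C2 + C1 * (C2 + C2)"
  define E2 where "E2 = (cQ * E1 + cH * E1) / (4 * cR)"
  define E3 where "E3 = C3 * (cB * E2)"
  define E where "E = E2 + 2 * E1 + 2 * E3"
  have pos: "E1 > 0" "E2 > 0" "E3 > 0"
    unfolding E3_def E2_def E1_def using C1(1) C2(1) C3(1) cQ(1) cH(1) cR(1) cB(1)
    by (auto intro!: mult_pos_pos divide_pos_pos add_pos_pos)
  have main: "n2p (\<lambda>t \<omega>. Fb (Ys J a t \<omega>)) \<le> E * (\<Sum>j\<in>J. (a j)\<^sup>2) \<and>
       n2p (Xs J a) \<le> E * (\<Sum>j\<in>J. (a j)\<^sup>2) \<and> n2 \<Omega> (Xs J a T) \<le> E * (\<Sum>j\<in>J. (a j)\<^sup>2)"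
    if J: "finite J" "J \<subseteq> {1..}" for J a
  proof -
    let ?S = "\<Sum>j\<in>J. (a j)\<^sup>2"
    have S0: "?S \<ge> 0" by (simp add: sum_nonneg)
    define v where "v = (\<lambda>t \<omega>. Fb (Ys J a t \<omega>))"
    define \<theta> where "\<theta> = resp ((*v) A) (\<lambda>t \<omega>. B *v v t \<omega>)"
    define \<xi> where "\<xi> = (\<lambda>t \<omega>. Xs J a t \<omega> - \<theta> t \<omega>)"
    have F: "L2p (Xs J a)" "L2p v" "L2 \<Omega> (Xs J a T)"
      "(\<integral>p. qf R (v (fst p) (snd p)) \<partial>PP) = - (\<integral>p. (Q *v Xs J a (fst p) (snd p)) \<bullet> \<theta> (fst p) (snd p) \<partial>PP)
         - (\<integral>\<omega>. (H *v Xs J a T \<omega>) \<bullet> \<theta> T \<omega> \<partial>\<Omega>)"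
      "AE \<omega> in \<Omega>. ie_sol ((*v) A) T (\<lambda>t. noise J a t \<omega>) (\<lambda>t. Xs J a t \<omega> - \<theta> t \<omega>)"
      using fluctuation_identity[OF J, of a] unfolding \<theta>_def v_def by simp_all
    have BvL: "L2p (\<lambda>t \<omega>. B *v v t \<omega>)" by (rule L2_linear'[OF lin(1) F(2)])
    have th: "L2p \<theta>" "n2p \<theta> \<le> C3 * n2p (\<lambda>t \<omega>. B *v v t \<omega>)" "L2 \<Omega> (\<theta> T)" "n2 \<Omega> (\<theta> T) \<le> C3 * n2p (\<lambda>t \<omega>. B *v v t \<omega>)"
      using C3(2)[OF BvL] by (simp_all add: \<theta>_def)
    have \<xi>m: "(\<lambda>p. \<xi> (fst p) (snd p)) \<in> borel_measurable PP"
      unfolding \<xi>_def by (intro L2_measurable L2_diff(1) F(1) th(1))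
    note nb = C2(2)[OF J, of a]
    have xb: "L2p \<xi>" "n2p \<xi> \<le> C1 * n2p (noise J a)" "L2 \<Omega> (\<xi> T)"
      "n2 \<Omega> (\<xi> T) \<le> C1 * (n2p (noise J a) + n2 \<Omega> (noise J a T))"
      using C1(2)[of "noise J a" \<xi>] nb \<xi>m F(5) by (auto simp: \<xi>_def)
    have x1: "n2p \<xi> \<le> E1 * ?S"
    proof -
      have "C1 * n2p (noise J a) \<le> C1 * (C2 * ?S)" using nb C1(1) by (intro mult_left_mono) auto
      also have "\<dots> \<le> E1 * ?S" unfolding E1_def using S0 C1(1) C2(1) by (simp add: algebra_simps)
      finally show ?thesis using xb(2) by linarith
    qed
    have x2: "n2 \<Omega> (\<xi> T) \<le> E1 * ?S"
    proof -
      have "C1 * (n2p (noise J a) + n2 \<Omega> (noise J a T)) \<le> C1 * (C2 * ?S + C2 * ?S)"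
        using nb C1(1) by (intro mult_left_mono add_mono) auto
      also have "\<dots> \<le> E1 * ?S" unfolding E1_def using S0 C1(1) C2(1) by (simp add: algebra_simps)
      finally show ?thesis using xb(4) by linarith
    qed
    \<comment> \<open>The completed square is applied with h = -\<theta>, so that \<xi> - h is the
      full state.\<close>
    have cross: "- ((S *v Xs J a t \<omega>) \<bullet> \<theta> t \<omega>) \<le> qf S (\<xi> t \<omega>) / 4" if "psd S" for S t \<omega>
      using psd_cross_le[OF that, of "\<xi> t \<omega>" "- \<theta> t \<omega>"] by (simp add: \<xi>_def)
    have "- (\<integral>p. (Q *v Xs J a (fst p) (snd p)) \<bullet> \<theta> (fst p) (snd p) \<partial>PP) = (\<integral>p. - ((Q *v Xs J a (fst p) (snd p)) \<bullet> \<theta> (fst p) (snd p)) \<partial>PP)" by simp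
    also have "\<dots> \<le> (\<integral>p. qf Q (\<xi> (fst p) (snd p)) / 4 \<partial>PP)"
      using L2_inner(1)[OF L2_linear'[OF lin(1)[of Q] F(1)] th(1)] qf_L2[OF xb(1), of Q] cross[OF Qpsd]
      by (intro integral_mono) auto
    also have "\<dots> \<le> cQ * n2p \<xi> / 4" using cQ(2)[OF xb(1)] by simp
    also have "\<dots> \<le> cQ * (E1 * ?S) / 4" using x1 cQ(1) by (intro divide_right_mono mult_left_mono) auto
    finally have q1: "- (\<integral>p. (Q *v Xs J a (fst p) (snd p)) \<bullet> \<theta> (fst p) (snd p) \<partial>PP) \<le> cQ * (E1 * ?S) / 4" .
    have "- (\<integral>\<omega>. (H *v Xs J a T \<omega>) \<bullet> \<theta> T \<omega> \<partial>\<Omega>) = (\<integral>\<omega>. - ((H *v Xs J a T \<omega>) \<bullet> \<theta> T \<omega>) \<partial>\<Omega>)" by simp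
    also have "\<dots> \<le> (\<integral>\<omega>. qf H (\<xi> T \<omega>) / 4 \<partial>\<Omega>)"
      using L2_inner(1)[OF L2_linear'[OF lin(1)[of H] F(3)] th(3)] qf_L2[OF xb(3), of H] cross[OF Hpsd]
      by (intro integral_mono) auto
    also have "\<dots> \<le> cH * n2 \<Omega> (\<xi> T) / 4" using cH(2)[OF xb(3)] by simp
    also have "\<dots> \<le> cH * (E1 * ?S) / 4" using x2 cH(1) by (intro divide_right_mono mult_left_mono) auto
    finally have q2: "- (\<integral>\<omega>. (H *v Xs J a T \<omega>) \<bullet> \<theta> T \<omega> \<partial>\<Omega>) \<le> cH * (E1 * ?S) / 4" .
    have "cR * n2p v \<le> cQ * (E1 * ?S) / 4 + cH * (E1 * ?S) / 4"
      using cR(2)[OF F(2)] F(4) q1 q2 by linarith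
    also have "\<dots> = cR * (E2 * ?S)" unfolding E2_def using cR(1) by (simp add: field_simps)
    finally have v: "n2p v \<le> E2 * ?S" using cR(1) by simp
    have "C3 * n2p (\<lambda>t \<omega>. B *v v t \<omega>) \<le> C3 * (cB * n2p v)" using cB(2)[OF F(2)] C3(1) by (intro mult_left_mono) auto
    also have "\<dots> \<le> C3 * (cB * (E2 * ?S))" using v cB(1) C3(1) by (intro mult_left_mono) auto
    finally have t0: "C3 * n2p (\<lambda>t \<omega>. B *v v t \<omega>) \<le> E3 * ?S" by (simp add: E3_def mult.assoc)
    have Xe: "Xs J a = (\<lambda>t \<omega>. \<xi> t \<omega> + \<theta> t \<omega>)" by (simp add: \<xi>_def)
    have "n2p (Xs J a) \<le> 2 * n2p \<xi> + 2 * n2p \<theta>" unfolding Xe by (rule L2_add(2)[OF xb(1) th(1)])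
    moreover have "n2 \<Omega> (Xs J a T) \<le> 2 * n2 \<Omega> (\<xi> T) + 2 * n2 \<Omega> (\<theta> T)" unfolding Xe by (rule L2_add(2)[OF xb(3) th(3)])
    moreover have "E * ?S = E2 * ?S + 2 * (E1 * ?S) + 2 * (E3 * ?S)" by (simp add: E_def algebra_simps)
    moreover have "0 \<le> E1 * ?S" "0 \<le> E2 * ?S" "0 \<le> E3 * ?S" using S0 pos by auto
    moreover have "n2p (\<lambda>t \<omega>. Fb (Ys J a t \<omega>)) = n2p v" by (simp add: v_def)
    ultimately show ?thesis using v x1 x2 th(2,4) t0 by (intro conjI) linarith+
  qed
  have "E > 0" unfolding E_def using pos by simp
  then show ?thesis by (rule that[OF _ main])
qed

text \<open>State \<open>((X, M), (P, Y))\<close> of the linearised mean system.\<close>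
definition KD :: "(((real^'n) \<times> (real^'n)) \<times> ((real^'n) \<times> (real^'n))) \<Rightarrow> (((real^'n) \<times> (real^'n)) \<times> ((real^'n) \<times> (real^'n)))" where
  "KD v = ((A *v fst (fst v) + B *v Fb (snd (snd v)) + G *v snd (fst v) + \<gamma> *\<^sub>R fst (snd v),
            (A + G) *v snd (fst v) + \<gamma> *\<^sub>R fst (snd v)),
     (- (transpose (A + G) *v fst (snd v)) - transpose (mat 1 - \<Gamma>) *v (Q *v (fst (fst v) - \<Gamma> *v snd (fst v))),
      - (transpose A *v snd (snd v)) + Q *v (fst (fst v) - \<Gamma> *v snd (fst v))))"

lemma linear_KD: "linear KD"
  unfolding KD_def[abs_def] by (intro linear_rules)

lemmas linear_components4 = linear_fst_comp[OF linear_fst_comp[OF linear_ident]]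
  linear_snd_comp[OF linear_fst_comp[OF linear_ident]]
  linear_fst_comp[OF linear_snd_comp[OF linear_ident]] linear_snd_comp[OF linear_snd_comp[OF linear_ident]]

text \<open>A homogeneous solution is a stationary point for (H2) with \<nu> = R^(-1) B^T Y.
  Integration by parts shows that the functional of (H2) vanishes there, so \<nu> is null. Then the
  X and M components coincide, (H1) removes them together with P, and Y follows from its terminal
  value.\<close>

lemma KD_unique:
  assumes z: "ie_sol KD T (\<lambda>_. (0, w)) z"
    and bP: "fst (snd (z T)) = H *v fst (fst (z T))" and bY: "snd (snd (z T)) = - (H *v fst (fst (z T)))"
  shows "w = 0"
proof -
  define zi where "zi t = fst (fst (z t))" for t
  define zz where "zz t = snd (fst (z t))" for t
  define q where "q t = fst (snd (z t))" for t
  define yy where "yy t = snd (snd (z t))" for t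
  note comps = zi_def zz_def q_def yy_def
  note ci = linear_continuous_on_compose[OF lin(1)] linear_continuous_on_compose[OF lin(2)]
  have c: "continuous_on {0..T} zi" "continuous_on {0..T} zz" "continuous_on {0..T} q" "continuous_on {0..T} yy"
    unfolding comps using ie_sol_continuous[OF z] by (auto intro!: continuous_intros)
  have 1: "((\<lambda>s. A *v zi s + B *v Fb (yy s) + G *v zz s + \<gamma> *\<^sub>R q s) has_integral zi t) {0..t}"
    and 2: "((\<lambda>s. (A + G) *v zz s + \<gamma> *\<^sub>R q s) has_integral zz t) {0..t}"
    and 3: "((\<lambda>s. - (transpose (A + G) *v q s) - transpose (mat 1 - \<Gamma>) *v (Q *v (zi s - \<Gamma> *v zz s))) has_integral (q t - fst w)) {0..t}"
    and 4: "((\<lambda>s. - (transpose A *v yy s) + Q *v (zi s - \<Gamma> *v zz s)) has_integral (yy t - snd w)) {0..t}"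
    if t: "t \<in> {0..T}" for t
    using ie_sol_component[OF z linear_components4(1) t] ie_sol_component[OF z linear_components4(2) t]
      ie_sol_component[OF z linear_components4(3) t] ie_sol_component[OF z linear_components4(4) t]
    by (simp_all add: KD_def comps)
  let ?\<nu> = "\<lambda>s. Fb (yy s)"
  let ?a3 = "\<lambda>s. - (transpose (A + G) *v q s) - transpose (mat 1 - \<Gamma>) *v (Q *v (zi s - \<Gamma> *v zz s))"
  let ?a4 = "\<lambda>s. - (transpose A *v yy s) + Q *v (zi s - \<Gamma> *v zz s)"
  let ?k2 = "\<lambda>s. (A + G) *v zz s + \<gamma> *\<^sub>R q s"
  let ?k1 = "\<lambda>s. A *v (zi s - zz s) + B *v ?\<nu> s"
  have i: "integrable (leb T) ?a3" "integrable (leb T) ?a4" "integrable (leb T) ?k2" "integrable (leb T) ?k1"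
    by (intro integrable_leb_continuous continuous_intros ci c)+
  have \<nu>L: "L2 (leb T) ?\<nu>" by (intro L2_leb_continuous ci c)
  have d: "(?k1 has_integral (zi t - zz t)) {0..t}" if t: "t \<in> {0..T}" for t
  proof -
    have e: "(A *v zi s + B *v Fb (yy s) + G *v zz s + \<gamma> *\<^sub>R q s) - ((A + G) *v zz s + \<gamma> *\<^sub>R q s) = ?k1 s" for s
      by (simp add: matrix_vector_mult_add_rdistrib matrix_vector_mult_diff_distrib)
    show ?thesis using has_integral_diff[OF 1[OF t] 2[OF t]] unfolding e .
  qed
  have qT: "q T = H *v zi T" and yT: "yy T = - (H *v zi T)" using bP bY by (simp_all add: comps)
  let ?I = "\<lambda>s. indicator {0..T} s *\<^sub>R ?\<nu> s"
  have h1: "\<forall>t\<in>{0..T}. ((\<lambda>s. A *v zi s + B *v ?I s + G *v zz s + \<gamma> *\<^sub>R q s) has_integral zi t) {0..t}"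
  proof
    fix t assume t: "t \<in> {0..T}"
    show "((\<lambda>s. A *v zi s + B *v ?I s + G *v zz s + \<gamma> *\<^sub>R q s) has_integral zi t) {0..t}"
      using 1[OF t] by (rule has_integral_eq[rotated]) (use t in auto)
  qed
  have h2: "\<forall>t\<in>{0..T}. (?k2 has_integral zz t) {0..t}" using 2 by blast
  have bwd: "(\<integral>s\<in>{t..T}. f s \<partial>lborel) = g T - g t"
    if f: "integrable (leb T) f" and g: "\<And>t. t \<in> {0..T} \<Longrightarrow> (f has_integral (g t - g0)) {0..t}" and t: "t \<in> {0..T}"
    for f g :: "real \<Rightarrow> real^'n" and g0 t
    using set_integral_split[OF f t] has_integral_eq_set_integral[OF f t g[OF t]]
      has_integral_eq_set_integral[OF f T_in(1) g[OF T_in(1)]] by (simp add: algebra_simps)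
  have h3: "\<forall>t\<in>{0..T}. ((\<lambda>s. transpose (A + G) *v q s + transpose (mat 1 - \<Gamma>) *v (Q *v (zi s - \<Gamma> *v zz s)))
                      has_integral (q t - H *v zi T)) {t..T}"
  proof
    fix t assume t: "t \<in> {0..T}"
    have "(?a3 has_integral (\<integral>s\<in>{t..T}. ?a3 s \<partial>lborel)) {t..T}" using t by (intro has_integral_leb[OF i(1)]) auto
    then have "(?a3 has_integral (H *v zi T - q t)) {t..T}" using bwd[OF i(1) 3 t] qT by simp
    from has_integral_neg[OF this]
    show "((\<lambda>s. transpose (A + G) *v q s + transpose (mat 1 - \<Gamma>) *v (Q *v (zi s - \<Gamma> *v zz s)))
                      has_integral (q t - H *v zi T)) {t..T}" by (simp add: add.commute)
  qed
  obtain \<delta> where \<delta>: "\<delta> > 0" "\<delta> * L2sq T ?I \<le>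
     (prim (\<lambda>t. qf Q (zi t - \<Gamma> *v zz t) + qf R (?I t) - \<gamma> * (norm (q t))\<^sup>2) T) + qf H (zi T)"
    apply (rule H2E[OF hyp2])
    subgoal premises prems for e
      by (rule prems(1)[OF prems(2) prems(3)[OF indicator_L2fun(1)[OF \<nu>L] h1 h2 h3]])
    done
  have ay: "yy s = yy T - (\<integral>r\<in>{s..T}. ?a4 r \<partial>lborel)" if "s \<in> {0..T}" for s using bwd[OF i(2) 4 that] by simp
  have aq: "q s = q T - (\<integral>r\<in>{s..T}. ?a3 r \<partial>lborel)" if "s \<in> {0..T}" for s using bwd[OF i(1) 3 that] by simp
  have t1: "zi r - zz r = (prim (\<lambda>s. ?k1 s) r)" if "r \<in> {0..T}" for r
    by (rule has_integral_eq_set_integral[OF i(4) that d[OF that]])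
  have t2: "zz r = (prim (\<lambda>s. ?k2 s) r)" if "r \<in> {0..T}" for r
    by (rule has_integral_eq_set_integral[OF i(3) that 2[OF that]])
  note ibpY = integral_by_parts_L1[OF T_in(3) i(2,4) ay t1]
  note ibpP = integral_by_parts_L1[OF T_in(3) i(1,3) aq t2]
  \<comment> \<open>The Y component is paired with z_i - z and the P component with z; the
    difference of the two identities is the running cost of (H2). Their boundary terms combine to
    -|z_i(T)|_H^2, cancelling the terminal cost.\<close>
  have "(prim (\<lambda>t. qf Q (zi t - \<Gamma> *v zz t) + qf R (?I t) - \<gamma> * (norm (q t))\<^sup>2) T)
     = (\<integral>s. (yy s \<bullet> ?k1 s + ?a4 s \<bullet> (zi s - zz s)) - (q s \<bullet> ?k2 s + ?a3 s \<bullet> zz s) \<partial>leb T)"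
    unfolding set_integral_leb'
  proof (intro bint_cong refl)
    fix s assume "s \<in> space (leb T)"
    then have s: "?I s = ?\<nu> s" by simp
    have r: "qf R (?\<nu> s) = yy s \<bullet> (B *v ?\<nu> s)" unfolding Y_B by (simp add: qf_def inner_commute)
    have "(transpose (mat 1 - \<Gamma>) *v (Q *v (zi s - \<Gamma> *v zz s))) \<bullet> zz s
      = (Q *v (zi s - \<Gamma> *v zz s)) \<bullet> (zz s - \<Gamma> *v zz s)"
      by (simp add: inner_transpose matrix_vector_mult_diff_rdistrib)
    moreover have "qf Q (zi s - \<Gamma> *v zz s) = (Q *v (zi s - \<Gamma> *v zz s)) \<bullet> (zi s - zz s) + (Q *v (zi s - \<Gamma> *v zz s)) \<bullet> (zz s - \<Gamma> *v zz s)"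
      using inner_add_left[of "zi s - zz s" "zz s - \<Gamma> *v zz s" "Q *v (zi s - \<Gamma> *v zz s)"]
      by (simp add: qf_def inner_commute)
    ultimately show "qf Q (zi s - \<Gamma> *v zz s) + qf R (?I s) - \<gamma> * (norm (q s))\<^sup>2
      = (yy s \<bullet> ?k1 s + ?a4 s \<bullet> (zi s - zz s)) - (q s \<bullet> ?k2 s + ?a3 s \<bullet> zz s)"
      unfolding s r using inner_transpose[of A "yy s" "zi s - zz s"] inner_transpose[of "A + G" "q s" "zz s"]
      by (simp add: inner_add_right inner_add_left inner_diff_left power2_norm_eq_inner)
  qed
  also have "\<dots> = yy T \<bullet> (zi T - zz T) - q T \<bullet> zz T"
    using ibpY ibpP by simp
  also have "\<dots> = - qf H (zi T)"
    by (simp add: qT yT qf_def inner_diff_right inner_commute)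
  finally have "\<delta> * n2 (leb T) ?\<nu> \<le> 0" using \<delta>(2) indicator_L2fun(2)[OF \<nu>L] by simp
  then have n0: "n2 (leb T) ?\<nu> = 0" using \<delta>(1) n2_nonneg[of "leb T" ?\<nu>] by (simp add: mult_le_0_iff)
  have BL: "L2 (leb T) (\<lambda>s. B *v ?\<nu> s)" by (rule L2_linear'[OF lin(1) \<nu>L])
  obtain cB where "cB > 0" "\<And>N f. L2 N f \<Longrightarrow> n2 (N :: real measure) (\<lambda>x. B *v f x) \<le> cB * n2 N f"
    using matrix_L2_bound by blast
  from this(2)[OF \<nu>L] n0 have Bn: "n2 (leb T) (\<lambda>s. B *v ?\<nu> s) = 0" by (intro antisym n2_nonneg) simp
  have eq: "zi t = zz t" if t: "t \<in> {0..T}" for t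
    using ie_sol_zero_if_forcing_null[OF lin(1)[of A] BL Bn d t] by simp
  have eq3: "((\<lambda>s. - (transpose (A + G) *v q s) - transpose (mat 1 - \<Gamma>) *v (Q *v (zz s - \<Gamma> *v zz s))) has_integral (q t - fst w)) {0..t}"
    if t: "t \<in> {0..T}" for t
    using 3[OF t] by (rule has_integral_eq[rotated]) (use t eq in auto)
  have qTz: "q T = H *v zz T" using qT eq[OF T_in(1)] by simp
  have z0: "zz t = 0" and w1: "fst w = 0" if t: "t \<in> {0..T}" for t
    using H1_unique[OF 2 eq3 c(2) c(3) qTz t] by auto
  have K: "linear (\<lambda>v. - (transpose A *v v))" by (intro linear_rules)
  have "ie_sol (\<lambda>v. - (transpose A *v v)) T (\<lambda>_. snd w) yy"
    unfolding ie_sol_def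
  proof (intro conjI ballI)
    fix t assume t: "t \<in> {0..T}"
    show "((\<lambda>s. - (transpose A *v yy s)) has_integral yy t - snd w) {0..t}"
      using 4[OF t] by (rule has_integral_eq[rotated]) (use t eq z0 in simp)
  qed simp
  from ie_sol_const_final_zero[OF K T_in(3) this] have "snd w = 0"
    using yT eq[OF T_in(1)] z0[OF T_in(1)] by simp
  with w1[OF T_in(1)] show ?thesis by (simp add: prod_eq_iff)
qed

definition dev :: "nat \<Rightarrow> real \<Rightarrow> (((real^'n) \<times> (real^'n)) \<times> ((real^'n) \<times> (real^'n)))" where
  "dev i t = ((mX i t - m t, M i t - m t), (P i t - p t, mY i t - y t))"

text \<open>(MF) is the mean system of a player with initial state m_0, in which the X and M
  components are both m. In the difference the common terms in \<eta> and in the control of the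
  population disappear, and x_i(0) - m_0 is the only inhomogeneity besides the unknown initial
  costates.\<close>

lemma dev_sol:
  assumes i: "1 \<le> i"
  shows "ie_sol KD T (\<lambda>_. ((x0 i - m0, 0), (P i 0 - p 0, mY i 0 - y 0))) (dev i)"
    "fst (snd (dev i T)) = H *v fst (fst (dev i T))" "snd (snd (dev i T)) = - (H *v fst (fst (dev i T)))"
proof -
  note MF = mf[unfolded MF_sol_def]
  have m': "\<forall>t\<in>{0..T}. (m has_vector_derivative ((A + G) *v m t + B *v Fb (y t) + \<gamma> *\<^sub>R p t)) (at t within {0..T})"
    and p': "\<forall>t\<in>{0..T}. (p has_vector_derivative (- (transpose (A + G) *v p t)
             - transpose (mat 1 - \<Gamma>) *v (Q *v (m t - (\<Gamma> *v m t + \<eta>))))) (at t within {0..T})"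
    and y': "\<forall>t\<in>{0..T}. (y has_vector_derivative (- (transpose A *v y t) + Q *v (m t - (\<Gamma> *v m t + \<eta>)))) (at t within {0..T})"
    using MF by auto
  show "ie_sol KD T (\<lambda>_. ((x0 i - m0, 0), (P i 0 - p 0, mY i 0 - y 0))) (dev i)"
    unfolding ie_sol_def
  proof (intro conjI ballI)
    fix t assume t: "t \<in> {0..T}"
    have X: "((\<lambda>s. fst (fst (KD (dev i s)))) has_integral (mX i t - m t - (x0 i - m0))) {0..t}"
    proof -
      have "((\<lambda>s. (A *v mX i s + B *v Fb (mY i s) + G *v M i s + \<gamma> *\<^sub>R P i s) - ((A + G) *v m s + B *v Fb (y s) + \<gamma> *\<^sub>R p s))
        has_integral ((mX i t - x0 i) - (m t - m 0))) {0..t}"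
        by (intro has_integral_diff mean_XY(3)[OF i t] has_vector_derivative_imp_has_integral[OF m' t])
      moreover have "(A *v mX i s + B *v Fb (mY i s) + G *v M i s + \<gamma> *\<^sub>R P i s) - ((A + G) *v m s + B *v Fb (y s) + \<gamma> *\<^sub>R p s)
         = fst (fst (KD (dev i s)))" for s
        by (simp add: KD_def dev_def matrix_vector_mult_add_rdistrib matrix_vector_mult_diff_distrib scaleR_diff_right)
      moreover have "(mX i t - x0 i) - (m t - m 0) = mX i t - m t - (x0 i - m0)" using MF by (simp add: algebra_simps)
      ultimately show ?thesis by simp
    qed
    have Mi: "((\<lambda>s. snd (fst (KD (dev i s)))) has_integral (M i t - m t - 0)) {0..t}"
    proof -
      have "((\<lambda>s. ((A + G) *v M i s + B *v Fb (y s) + \<gamma> *\<^sub>R P i s) - ((A + G) *v m s + B *v Fb (y s) + \<gamma> *\<^sub>R p s))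
        has_integral ((M i t - M i 0) - (m t - m 0))) {0..t}"
        by (intro has_integral_diff has_vector_derivative_imp_has_integral[OF fbsde(7)[OF i] t] has_vector_derivative_imp_has_integral[OF m' t])
      moreover have "((A + G) *v M i s + B *v Fb (y s) + \<gamma> *\<^sub>R P i s) - ((A + G) *v m s + B *v Fb (y s) + \<gamma> *\<^sub>R p s)
         = snd (fst (KD (dev i s)))" for s
        by (simp add: KD_def dev_def matrix_vector_mult_diff_distrib scaleR_diff_right)
      moreover have "(M i t - M i 0) - (m t - m 0) = M i t - m t - 0" using MF fbsde(5)[OF i] by simp
      ultimately show ?thesis by simp
    qed
    have Qe: "Q *v (mX i s - (\<Gamma> *v M i s + \<eta>)) - Q *v (m s - (\<Gamma> *v m s + \<eta>)) = Q *v (mX i s - m s - \<Gamma> *v (M i s - m s))" for s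
      unfolding matrix_vector_mult_diff_distrib[symmetric]
      by (rule arg_cong[of _ _ "(*v) Q"]) (simp add: matrix_vector_mult_diff_distrib)
    have Pi: "((\<lambda>s. fst (snd (KD (dev i s)))) has_integral (P i t - p t - (P i 0 - p 0))) {0..t}"
    proof -
      have "((\<lambda>s. (- (transpose (A + G) *v P i s) - transpose (mat 1 - \<Gamma>) *v (Q *v (mX i s - (\<Gamma> *v M i s + \<eta>))))
          - (- (transpose (A + G) *v p s) - transpose (mat 1 - \<Gamma>) *v (Q *v (m s - (\<Gamma> *v m s + \<eta>)))))
        has_integral ((P i t - P i 0) - (p t - p 0))) {0..t}"
        unfolding mX_def
        by (intro has_integral_diff has_vector_derivative_imp_has_integral[OF fbsde(8)[OF i] t] has_vector_derivative_imp_has_integral[OF p' t])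
      moreover have "(- (transpose (A + G) *v P i s) - transpose (mat 1 - \<Gamma>) *v (Q *v (mX i s - (\<Gamma> *v M i s + \<eta>))))
          - (- (transpose (A + G) *v p s) - transpose (mat 1 - \<Gamma>) *v (Q *v (m s - (\<Gamma> *v m s + \<eta>))))
         = fst (snd (KD (dev i s)))" for s
      proof -
        have "fst (snd (KD (dev i s))) = - (transpose (A + G) *v (P i s - p s))
           - transpose (mat 1 - \<Gamma>) *v (Q *v (mX i s - (\<Gamma> *v M i s + \<eta>)) - Q *v (m s - (\<Gamma> *v m s + \<eta>)))"
          unfolding Qe by (simp add: KD_def dev_def)
        then show ?thesis by (simp only: matrix_vector_mult_diff_distrib[of "transpose _"]) simp
      qed
      ultimately show ?thesis by (simp add: algebra_simps)
    qed
    have Yi: "((\<lambda>s. snd (snd (KD (dev i s)))) has_integral (mY i t - y t - (mY i 0 - y 0))) {0..t}"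
    proof -
      have "((\<lambda>s. (- (transpose A *v mY i s) + Q *v (mX i s - (\<Gamma> *v M i s + \<eta>)))
          - (- (transpose A *v y s) + Q *v (m s - (\<Gamma> *v m s + \<eta>))))
        has_integral ((mY i t - mY i 0) - (y t - y 0))) {0..t}"
        by (intro has_integral_diff mean_XY(4)[OF i t] has_vector_derivative_imp_has_integral[OF y' t])
      moreover have "(- (transpose A *v mY i s) + Q *v (mX i s - (\<Gamma> *v M i s + \<eta>)))
          - (- (transpose A *v y s) + Q *v (m s - (\<Gamma> *v m s + \<eta>)))
         = snd (snd (KD (dev i s)))" for s
      proof -
        have "snd (snd (KD (dev i s))) = - (transpose A *v (mY i s - y s))
           + (Q *v (mX i s - (\<Gamma> *v M i s + \<eta>)) - Q *v (m s - (\<Gamma> *v m s + \<eta>)))"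
          unfolding Qe by (simp add: KD_def dev_def)
        then show ?thesis by (simp only: matrix_vector_mult_diff_distrib[of "transpose _"]) simp
      qed
      ultimately show ?thesis by (simp add: algebra_simps)
    qed
    from has_integral_Pair[OF has_integral_Pair[OF X Mi] has_integral_Pair[OF Pi Yi]]
    show "((\<lambda>s. KD (dev i s)) has_integral dev i t - ((x0 i - m0, 0), (P i 0 - p 0, mY i 0 - y 0))) {0..t}"
      by (simp add: dev_def)
  qed simp
  show "fst (snd (dev i T)) = H *v fst (fst (dev i T))"
    using fbsde(6)[OF i] MF by (simp add: dev_def mX_def matrix_vector_mult_diff_distrib)
  have "mY i T = - (H *v mX i T)"
  proof -
    have HX: "integrable \<Omega> (\<lambda>\<omega>. H *v X i T \<omega>)" "expectation (\<lambda>\<omega>. H *v X i T \<omega>) = H *v expectation (X i T)"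
      using mean_linear[OF lin(1)[of H] X_integrable(1)[OF i T_in(1)]] by auto
    have "mY i T = expectation (\<lambda>\<omega>. - (H *v X i T \<omega>))" unfolding mY_def
      using fbsde(10)[OF i] HX Y_integrable(1)[OF i T_in(1)] by (intro integral_cong_AE) auto
    then show ?thesis using HX by (simp add: mX_def)
  qed
  then show "snd (snd (dev i T)) = - (H *v fst (fst (dev i T)))"
    using MF by (simp add: dev_def matrix_vector_mult_diff_distrib)
qed

text \<open>Each single deviation is of order one, but it depends linearly on x_j(0) - m_0 through a
  uniquely solvable problem. Applied to weighted sums, the bound sees only the weighted sum of the
  initial differences; with weights 1/N this is x^(N)(0) - m_0.\<close>

lemma dev_bound:
  obtains C where "C > 0"
    "\<And>J a t. J \<subseteq> {1..} \<Longrightarrow> t \<in> {0..T} \<Longrightarrow>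
       norm (\<Sum>j\<in>J. a j *\<^sub>R dev j t) \<le> C * norm (\<Sum>j\<in>J. a j *\<^sub>R (x0 j - m0))"
proof -
  define \<beta> where "\<beta> v = (fst (snd v) - H *v fst (fst v), snd (snd v) + H *v fst (fst v))"
    for v :: "((real^'n) \<times> (real^'n)) \<times> ((real^'n) \<times> (real^'n))"
  have \<beta>: "linear \<beta>" unfolding \<beta>_def[abs_def] by (intro linear_rules)
  have uniq: "\<And>z w. ie_sol KD T (\<lambda>_. (0, w)) z \<Longrightarrow> \<beta> (z T) = 0 \<Longrightarrow> w = 0"
    unfolding \<beta>_def by (rule KD_unique) (auto simp: prod_eq_iff eq_neg_iff_add_eq_0)
  obtain C where C: "C > 0"
    "\<And>c. continuous_on {0..T} c \<Longrightarrow> \<exists>z w. ie_sol KD T (\<lambda>t. c t + (0, w)) z \<and> \<beta> (z T) = 0"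
    "\<And>c z w t. ie_sol KD T (\<lambda>t. c t + (0, w)) z \<Longrightarrow> \<beta> (z T) = 0 \<Longrightarrow> t \<in> {0..T} \<Longrightarrow> continuous_on {0..T} c \<Longrightarrow>
       norm (z t) \<le> norm (c t) + C * (norm (c T) + (prim (\<lambda>s. norm (c s)) T))"
    apply (rule two_point_problem[OF T_in(3) linear_KD \<beta> uniq], assumption, assumption)
    subgoal premises prems for C
      by (rule prems(1), rule prems(2), erule prems(3), erule prems(4), assumption+)
    done
  define C' where "C' = 1 + C * (1 + T)"
  have C': "C' > 0" unfolding C'_def using C(1) T_pos by (intro add_pos_pos mult_pos_pos) auto
  have main: "norm (\<Sum>j\<in>J. a j *\<^sub>R dev j t) \<le> C' * norm (\<Sum>j\<in>J. a j *\<^sub>R (x0 j - m0))"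
    if J: "J \<subseteq> {1..}" and t: "t \<in> {0..T}" for J a t
  proof -
    have J1: "1 \<le> j" if "j \<in> J" for j using that J by auto
    let ?w = "\<lambda>j. (P j 0 - p 0, mY j 0 - y 0)"
    let ?xi = "\<Sum>j\<in>J. a j *\<^sub>R (x0 j - m0)"
    let ?z = "\<lambda>t. \<Sum>j\<in>J. a j *\<^sub>R dev j t"
    have "ie_sol KD T (\<lambda>t. \<Sum>j\<in>J. a j *\<^sub>R ((x0 j - m0, 0), ?w j)) ?z"
      by (rule ie_sol_sum[OF linear_KD dev_sol(1)[OF J1]])
    moreover have "(\<Sum>j\<in>J. a j *\<^sub>R ((x0 j - m0, 0 :: real^'n), ?w j)) = ((?xi, 0), 0) + (0, \<Sum>j\<in>J. a j *\<^sub>R ?w j)"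
      by (induction J rule: infinite_finite_induct) (simp_all add: zero_prod_def)
    ultimately have z: "ie_sol KD T (\<lambda>t. ((?xi, 0), 0) + (0, \<Sum>j\<in>J. a j *\<^sub>R ?w j)) ?z" by simp
    have "\<beta> (dev j T) = 0" if "j \<in> J" for j
      unfolding \<beta>_def dev_sol(2,3)[OF J1[OF that]] by (simp add: zero_prod_def)
    then have b0: "\<beta> (?z T) = 0" by (simp add: linear_sum[OF \<beta>] linear_scale[OF \<beta>])
    have n: "norm ((?xi, 0 :: real^'n), 0 :: (real^'n) \<times> (real^'n)) = norm ?xi" by (simp add: norm_Pair)
    have "norm (?z t) \<le> norm ?xi + C * (norm ?xi + (prim (\<lambda>s. norm ?xi) T))"
      using C(3)[OF z b0 t continuous_on_const] unfolding n .
    also have "(prim (\<lambda>s. norm ?xi) T) = T * norm ?xi"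
      unfolding set_integral_leb' using measure_leb[of T] by simp
    also have "norm ?xi + C * (norm ?xi + T * norm ?xi) = C' * norm ?xi" by (simp add: C'_def algebra_simps)
    finally show ?thesis .
  qed
  show ?thesis by (rule that[OF C' main])
qed

end

section \<open>Bounds uniform in the players, the rate, and the first-order conditions\<close>

context lq_game
begin

lemma M0_nonneg: "0 \<le> M0"
  using init[rule_format, of 1] norm_ge_zero[of "x0 1"] by linarith

lemma mf_continuous: "continuous_on {0..T} m" "continuous_on {0..T} p" "continuous_on {0..T} y"
  using mf unfolding MF_sol_def by (auto intro!: has_vector_derivative_imp_continuous_on)

lemma single_sums: "Xs {i} (\<lambda>_. 1) = Xc i" "Ys {i} (\<lambda>_. 1) = Yc i"
  by (intro ext; simp add: Xs_def Ys_def)+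

lemma n2_leb_le:
  assumes "continuous_on {0..T} f" "\<And>t. t \<in> {0..T} \<Longrightarrow> norm (f t) \<le> r"
  shows "n2 (leb T) f \<le> T * r\<^sup>2"
proof -
  have "n2 (leb T) f \<le> (\<integral>t. r\<^sup>2 \<partial>leb T)"
    unfolding n2_def using assms(2) L2_leb_continuous[OF assms(1)]
    by (intro integral_mono power_mono) (auto simp: L2_def)
  then show ?thesis using measure_leb[of T] by simp
qed

text \<open>The mean parts stay within a fixed distance of (MF) because |x_i(0)| \<le> M_0, and the
  centred parts are bounded by the fluctuation estimate with the single weight 1. Neither constant
  depends on i.\<close>

lemma uniform_bounds:
  obtains C where "C > 0"
    "\<And>i. 1 \<le> i \<Longrightarrow> n2p (X i) \<le> C \<and> n2 \<Omega> (X i T) \<le> C \<and> n2 (leb T) (M i) \<le> C \<and> n2 (leb T) (P i) \<le> C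
      \<and> n2p (\<lambda>t \<omega>. Fb (Y i t \<omega>)) \<le> C"
proof -
  obtain C1 where C1: "C1 > 0"
    "\<And>J a t. J \<subseteq> {1..} \<Longrightarrow> t \<in> {0..T} \<Longrightarrow>
       norm (\<Sum>j\<in>J. a j *\<^sub>R dev j t) \<le> C1 * norm (\<Sum>j\<in>J. a j *\<^sub>R (x0 j - m0))"
    using dev_bound by blast
  obtain C2 where C2: "C2 > 0"
    "\<And>J a. finite J \<Longrightarrow> J \<subseteq> {1..} \<Longrightarrow>
       n2p (\<lambda>t \<omega>. Fb (Ys J a t \<omega>)) \<le> C2 * (\<Sum>j\<in>J. (a j)\<^sup>2) \<and>
       n2p (Xs J a) \<le> C2 * (\<Sum>j\<in>J. (a j)\<^sup>2) \<and> n2 \<Omega> (Xs J a T) \<le> C2 * (\<Sum>j\<in>J. (a j)\<^sup>2)"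
    using fluctuation_bound by blast
  obtain cF where cF: "cF > 0" "\<And>x. norm (Fb x) \<le> cF * norm x"
    using linear_bounded_pos[OF lin(2)] by blast
  define r where "r = C1 * (M0 + norm m0)"
  define rr cc mm where sq: "rr = r\<^sup>2" "cc = cF\<^sup>2" "mm = (norm (m T))\<^sup>2"
  have sq0: "0 \<le> rr" "0 \<le> cc" "0 \<le> mm" by (simp_all add: sq)
  have r0: "r \<ge> 0" using C1(1) M0_nonneg by (simp add: r_def)
  define D where "D = 4 * C2 + 6 * (T * rr) + 10 * n2 (leb T) m + 6 * rr + 6 * mm + 2 * n2 (leb T) p
       + 4 * (rr * cc) + 4 * (T * rr * cc) + 4 * (cc * n2 (leb T) y)"
  have main: "n2p (X i) \<le> D \<and> n2 \<Omega> (X i T) \<le> D \<and> n2 (leb T) (M i) \<le> D \<and> n2 (leb T) (P i) \<le> D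
      \<and> n2p (\<lambda>t \<omega>. Fb (Y i t \<omega>)) \<le> D" if i: "1 \<le> i" for i
  proof -
    have J: "finite {i}" "{i} \<subseteq> {1..}" using i by auto
    have db: "norm (dev i t) \<le> r" if t: "t \<in> {0..T}" for t
    proof -
      have "norm (dev i t) \<le> C1 * norm (x0 i - m0)" using C1(2)[OF J(2) t, of "\<lambda>_. 1"] by simp
      also have "\<dots> \<le> r" unfolding r_def using init i C1(1) norm_triangle_ineq4[of "x0 i" m0]
        by (intro mult_left_mono) (auto intro: order_trans add_mono)
      finally show ?thesis .
    qed
    have comp: "norm (mX i t - m t) \<le> r" "norm (M i t - m t) \<le> r" "norm (P i t - p t) \<le> r" "norm (mY i t - y t) \<le> r"
      if t: "t \<in> {0..T}" for t
    proof -
      have n: "norm (fst v) \<le> norm v" "norm (snd v) \<le> norm v" for v :: "'x::real_normed_vector \<times> 'y::real_normed_vector"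
        using norm_fst_le[of "fst v" "snd v"] norm_snd_le[of "snd v" "fst v"] by simp_all
      have "norm (fst (fst (dev i t))) \<le> r" "norm (snd (fst (dev i t))) \<le> r" "norm (fst (snd (dev i t))) \<le> r" "norm (snd (snd (dev i t))) \<le> r"
        using db[OF t] n[of "dev i t"] n[of "fst (dev i t)"] n[of "snd (dev i t)"] by linarith+
      then show "norm (mX i t - m t) \<le> r" "norm (M i t - m t) \<le> r" "norm (P i t - p t) \<le> r" "norm (mY i t - y t) \<le> r"
        by (simp_all add: dev_def)
    qed
    have dc: "continuous_on {0..T} (dev i)" by (rule ie_sol_continuous[OF dev_sol(1)[OF i]])
    have ctn: "continuous_on {0..T} (\<lambda>t. mX i t - m t)" "continuous_on {0..T} (\<lambda>t. M i t - m t)"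
      "continuous_on {0..T} (\<lambda>t. P i t - p t)" "continuous_on {0..T} (\<lambda>t. mY i t - y t)"
      using continuous_on_fst[OF continuous_on_fst[OF dc]] continuous_on_snd[OF continuous_on_fst[OF dc]]
        continuous_on_fst[OF continuous_on_snd[OF dc]] continuous_on_snd[OF continuous_on_snd[OF dc]]
      by (simp_all add: dev_def)
    have sp: "n2 (leb T) f \<le> 2 * (T * rr) + 2 * n2 (leb T) h"
      if "continuous_on {0..T} (\<lambda>t. f t - h t)" "continuous_on {0..T} h" "\<And>t. t \<in> {0..T} \<Longrightarrow> norm (f t - h t) \<le> r"
      for f h :: "real \<Rightarrow> real^'n"
    proof -
      have "n2 (leb T) (\<lambda>t. (f t - h t) + h t) \<le> 2 * n2 (leb T) (\<lambda>t. f t - h t) + 2 * n2 (leb T) h"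
        by (intro L2_add(2) L2_leb_continuous that)
      moreover have "n2 (leb T) (\<lambda>t. f t - h t) \<le> T * rr" unfolding sq by (rule n2_leb_le[OF that(1,3)])
      ultimately show ?thesis by simp
    qed
    have b1: "n2 (leb T) (mX i) \<le> 2 * (T * rr) + 2 * n2 (leb T) m" by (rule sp[OF ctn(1) mf_continuous(1) comp(1)])
    have b2: "n2 (leb T) (M i) \<le> 2 * (T * rr) + 2 * n2 (leb T) m" by (rule sp[OF ctn(2) mf_continuous(1) comp(2)])
    have b3: "n2 (leb T) (P i) \<le> 2 * (T * rr) + 2 * n2 (leb T) p" by (rule sp[OF ctn(3) mf_continuous(2) comp(3)])
    have b4: "n2 (leb T) (mY i) \<le> 2 * (T * rr) + 2 * n2 (leb T) y" by (rule sp[OF ctn(4) mf_continuous(3) comp(4)])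
    have fl: "n2p (\<lambda>t \<omega>. Fb (Yc i t \<omega>)) \<le> C2" "n2p (Xc i) \<le> C2" "n2 \<Omega> (Xc i T) \<le> C2"
      using C2(2)[OF J, of "\<lambda>_. 1"] unfolding single_sums by simp_all
    have Xe: "X i = (\<lambda>t \<omega>. Xc i t \<omega> + mX i t)" by (simp add: Xc_def)
    have x1: "n2p (X i) \<le> 2 * C2 + 2 * (2 * (T * rr) + 2 * n2 (leb T) m)"
    proof -
      have "n2p (X i) \<le> 2 * n2p (Xc i) + 2 * n2p (\<lambda>t \<omega>. mX i t)"
        unfolding Xe by (rule L2_add(2)[OF centered(1)[OF i] L2p_fst(1)[OF mean_XY(1)[OF i]]])
      also have "n2p (\<lambda>t \<omega>. mX i t) = n2 (leb T) (mX i)" by (rule L2p_fst(2)[OF mean_XY(1)[OF i]])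
      also have "2 * n2p (Xc i) + 2 * n2 (leb T) (mX i) \<le> 2 * C2 + 2 * (2 * (T * rr) + 2 * n2 (leb T) m)"
        by (intro add_mono mult_left_mono fl(2) b1) simp_all
      finally show ?thesis .
    qed
    have x2: "n2 \<Omega> (X i T) \<le> 2 * C2 + 2 * (2 * rr + 2 * mm)"
    proof -
      have "n2 \<Omega> (X i T) \<le> 2 * n2 \<Omega> (Xc i T) + 2 * n2 \<Omega> (\<lambda>\<omega>. mX i T)"
        unfolding Xe by (rule L2_add(2)[OF centered(4)[OF i] L2_const])
      also have "n2 \<Omega> (\<lambda>\<omega>. mX i T) = (norm (mX i T))\<^sup>2" by (simp add: n2_def prob_space)
      also have "2 * n2 \<Omega> (Xc i T) + 2 * (norm (mX i T))\<^sup>2 \<le> 2 * C2 + 2 * (2 * rr + 2 * mm)"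
      proof (intro add_mono mult_left_mono fl(3))
        show "(norm (mX i T))\<^sup>2 \<le> 2 * rr + 2 * mm"
        using norm_add_sq_le[of "mX i T - m T" "m T"] power_mono[OF comp(1)[OF T_in(1)], of 2] by (simp add: sq)
      qed simp_all
      finally show ?thesis .
    qed
    have Ye: "(\<lambda>t \<omega>. Fb (Y i t \<omega>)) = (\<lambda>t \<omega>. Fb (Yc i t \<omega>) + Fb (mY i t))"
      by (intro ext) (simp add: linear_add[OF lin(2), symmetric] Yc_def)
    have x3: "n2p (\<lambda>t \<omega>. Fb (Y i t \<omega>)) \<le> 2 * C2 + 2 * (cc * (2 * (T * rr) + 2 * n2 (leb T) y))"
    proof -
      have FL: "L2 (leb T) (\<lambda>t. Fb (mY i t))" by (rule L2_linear'[OF lin(2) mean_XY(2)[OF i]])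
      have "n2p (\<lambda>t \<omega>. Fb (Y i t \<omega>)) \<le> 2 * n2p (\<lambda>t \<omega>. Fb (Yc i t \<omega>)) + 2 * n2p (\<lambda>t \<omega>. Fb (mY i t))"
        using L2_add(2)[OF L2_linear'[OF lin(2) centered(2)[OF i]] L2p_fst(1)[OF FL]] unfolding fun_cong[OF fun_cong[OF Ye]] .
      also have "\<dots> \<le> 2 * C2 + 2 * (cc * (2 * (T * rr) + 2 * n2 (leb T) y))"
      proof (intro add_mono mult_left_mono fl(1))
        have "n2p (\<lambda>t \<omega>. Fb (mY i t)) \<le> cc * n2 (leb T) (mY i)"
        unfolding L2p_fst(2)[OF FL] sq by (rule L2_linear(2)[OF lin(2) cF(2) mean_XY(2)[OF i]])
        also have "\<dots> \<le> cc * (2 * (T * rr) + 2 * n2 (leb T) y)"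
        using b4 sq0 by (intro mult_left_mono) auto
        finally show "n2p (\<lambda>t \<omega>. Fb (mY i t)) \<le> cc * (2 * (T * rr) + 2 * n2 (leb T) y)" .
      qed simp_all
      finally show ?thesis .
    qed
    have nn: "0 \<le> T * rr" "0 \<le> rr" "0 \<le> T * rr * cc" "0 \<le> rr * cc" "0 \<le> n2 (leb T) m" "0 \<le> n2 (leb T) p"
      "0 \<le> cc * n2 (leb T) y" "0 \<le> mm" "0 \<le> C2" using C2(1) T_in(3) sq0 by auto
    have x3': "n2p (\<lambda>t \<omega>. Fb (Y i t \<omega>)) \<le> 2 * C2 + 4 * (T * rr * cc) + 4 * (cc * n2 (leb T) y)"
      using x3 by (simp add: algebra_simps)
    have x12: "n2p (X i) \<le> 2 * C2 + 4 * (T * rr) + 4 * n2 (leb T) m" "n2 \<Omega> (X i T) \<le> 2 * C2 + 4 * rr + 4 * mm"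
      using x1 x2 by simp_all
    show ?thesis unfolding D_def using x12 x3' b2 b3 nn by (intro conjI) linarith+
  qed
  have "D > 0"
  proof -
    have "0 \<le> T * rr" "0 \<le> n2 (leb T) m" "0 \<le> n2 (leb T) p" "0 \<le> rr * cc" "0 \<le> T * rr * cc" "0 \<le> cc * n2 (leb T) y"
      using T_in(3) sq0 by auto
    then show ?thesis unfolding D_def using C2(1) sq0 by linarith
  qed
  then show ?thesis by (rule that[OF _ main])
qed

definition eN :: "nat \<Rightarrow> real" where
  "eN N = 1 / sqrt (real N) + norm (mf_avg N x0 - m0)"

text \<open>Squared errors arrive as 1/N or as the squared initial gap, and both are at most the
  square of \<open>eN N\<close>. The uniform upper bound later allows that square to be traded for a
  multiple of \<open>eN N\<close>.\<close>

lemma eN_props: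
  assumes N: "1 \<le> N"
  shows "eN N > 0" "1 / real N \<le> (eN N)\<^sup>2" "(norm (mf_avg N x0 - m0))\<^sup>2 \<le> (eN N)\<^sup>2" "1 / real N \<le> eN N"
    "eN N \<le> 1 + M0 + norm m0"
proof -
  have s: "sqrt (real N) \<ge> 1" using N by simp
  then have s1: "0 < 1 / sqrt (real N)" "1 / sqrt (real N) \<le> 1" by auto
  show "eN N > 0" unfolding eN_def using s1 by (intro add_pos_nonneg) auto
  have "1 / real N = (1 / sqrt (real N))\<^sup>2" using N by (simp add: power_divide)
  also have "\<dots> \<le> (eN N)\<^sup>2" unfolding eN_def using s1 by (intro power_mono) auto
  finally show "1 / real N \<le> (eN N)\<^sup>2" .
  show "(norm (mf_avg N x0 - m0))\<^sup>2 \<le> (eN N)\<^sup>2" unfolding eN_def using s1 by (intro power_mono) auto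
  have "1 / real N = 1 / sqrt (real N) * (1 / sqrt (real N))" by simp
  also have "\<dots> \<le> 1 / sqrt (real N) * 1" using s1 by (intro mult_left_mono) auto
  finally show "1 / real N \<le> eN N" unfolding eN_def by (simp add: add_increasing2)
  have "norm (mf_avg N x0) \<le> M0"
  proof -
    have "norm (\<Sum>j\<in>{1..N}. x0 j) \<le> (\<Sum>j\<in>{1..N}. M0)"
      using init by (intro order_trans[OF norm_sum] sum_mono) auto
    then show ?thesis using N by (simp add: mf_avg_def field_simps)
  qed
  then show "eN N \<le> 1 + M0 + norm m0" unfolding eN_def
    using s1 norm_triangle_ineq4[of "mf_avg N x0" m0] by linarith
qed

lemma mf_avg_sum: "mf_avg N x = (\<Sum>j\<in>{1..N}. (1 / real N) *\<^sub>R x j)"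
  by (simp add: mf_avg_def scaleR_sum_right)

lemma average_const:
  fixes c :: "'v::real_vector"
  shows "1 \<le> N \<Longrightarrow> (\<Sum>j\<in>{1..N}. (1 / real N) *\<^sub>R c) = c"
  by (simp only: scaleR_sum_left[symmetric] sum_constant card_atLeastAtMost) simp

definition ugap :: "nat \<Rightarrow> real \<Rightarrow> 'w \<Rightarrow> real^'k" where
  "ugap N t \<omega> = mf_avg N (\<lambda>j. Fb (Y j t \<omega>)) - Fb (y t)"

text \<open>The average of the strategies minus the control of (MF) splits into centred fluctuations
  with weights 1/N and the Y component of the averaged mean deviation; these account for the two
  terms of the rate.\<close>

lemma ugap_bound:
  obtains C where "C > 0" "\<And>N. 1 \<le> N \<Longrightarrow> L2p (ugap N) \<and> n2p (ugap N) \<le> C * (eN N)\<^sup>2"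
proof -
  obtain C1 where C1: "C1 > 0"
    "\<And>J a t. J \<subseteq> {1..} \<Longrightarrow> t \<in> {0..T} \<Longrightarrow>
       norm (\<Sum>j\<in>J. a j *\<^sub>R dev j t) \<le> C1 * norm (\<Sum>j\<in>J. a j *\<^sub>R (x0 j - m0))"
    using dev_bound by blast
  obtain C2 where C2: "C2 > 0"
    "\<And>J a. finite J \<Longrightarrow> J \<subseteq> {1..} \<Longrightarrow>
       n2p (\<lambda>t \<omega>. Fb (Ys J a t \<omega>)) \<le> C2 * (\<Sum>j\<in>J. (a j)\<^sup>2) \<and>
       n2p (Xs J a) \<le> C2 * (\<Sum>j\<in>J. (a j)\<^sup>2) \<and> n2 \<Omega> (Xs J a T) \<le> C2 * (\<Sum>j\<in>J. (a j)\<^sup>2)"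
    using fluctuation_bound by blast
  obtain cF where cF: "cF > 0" "\<And>x. norm (Fb x) \<le> cF * norm x"
    using linear_bounded_pos[OF lin(2)] by blast
  define D where "D = 2 * C2 + 2 * (T * (cF * C1)\<^sup>2)"
  have D: "D > 0" unfolding D_def using C2(1) T_pos by (intro add_pos_nonneg) auto
  have main: "L2p (ugap N) \<and> n2p (ugap N) \<le> D * (eN N)\<^sup>2" if N: "1 \<le> N" for N
  proof -
    let ?J = "{1..N}" and ?a = "\<lambda>_::nat. 1 / real N"
    let ?d = "\<lambda>t. \<Sum>j\<in>?J. ?a j *\<^sub>R dev j t"
    let ?h = "\<lambda>t. Fb (snd (snd (?d t)))"
    have J: "finite ?J" "?J \<subseteq> {1..}" by auto
    have J1: "1 \<le> j" if "j \<in> ?J" for j using that by auto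
    have sa: "(\<Sum>j\<in>?J. (?a j)\<^sup>2) = 1 / real N" using N by (simp add: power2_eq_square)
    have sx: "(\<Sum>j\<in>?J. ?a j *\<^sub>R (x0 j - m0)) = mf_avg N x0 - m0"
      by (simp only: mf_avg_sum scaleR_diff_right sum_subtractf average_const[OF N])
    have dc: "continuous_on {0..T} ?d"
      by (intro continuous_intros ie_sol_continuous[OF dev_sol(1)] J1)
    have hc: "continuous_on {0..T} ?h" by (intro linear_continuous_on_compose[OF lin(2)] continuous_intros dc)
    have hb: "norm (?h t) \<le> cF * C1 * norm (mf_avg N x0 - m0)" if t: "t \<in> {0..T}" for t
    proof -
      have "norm (?h t) \<le> cF * norm (snd (snd (?d t)))" by (rule cF)
      also have "norm (snd (snd (?d t))) \<le> norm (?d t)"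
        using norm_snd_le[of "snd (snd (?d t))" "fst (snd (?d t))"] norm_snd_le[of "snd (?d t)" "fst (?d t)"] by simp
      also have "\<dots> \<le> C1 * norm (mf_avg N x0 - m0)" using C1(2)[OF J(2) t, of ?a] unfolding sx .
      finally show ?thesis using cF(1) by (simp add: mult.assoc)
    qed
    have e: "ugap N t \<omega> = Fb (Ys ?J ?a t \<omega>) + ?h t" for t \<omega>
    proof -
      have "Ys ?J ?a t \<omega> + snd (snd (?d t)) = (\<Sum>j\<in>?J. ?a j *\<^sub>R Y j t \<omega>) - y t"
      proof -
        have "snd (snd (?d t)) = (\<Sum>j\<in>?J. ?a j *\<^sub>R (mY j t - y t))" by (simp add: dev_def snd_sum)
        moreover have "(\<Sum>j\<in>?J. ?a j *\<^sub>R y t) = y t" by (rule average_const[OF N])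
        ultimately show ?thesis
          by (simp add: Ys_def Yc_def scaleR_diff_right sum_subtractf)
      qed
      then have "Fb (Ys ?J ?a t \<omega>) + ?h t = Fb ((\<Sum>j\<in>?J. ?a j *\<^sub>R Y j t \<omega>) - y t)"
        using linear_add[OF lin(2), of "Ys ?J ?a t \<omega>" "snd (snd (?d t))"] by simp
      also have "\<dots> = ugap N t \<omega>"
        unfolding ugap_def mf_avg_sum linear_diff[OF lin(2)] linear_sum[OF lin(2)] by (simp add: linear_scale[OF lin(2)])
      finally show ?thesis by simp
    qed
    have YL: "L2p (\<lambda>t \<omega>. Fb (Ys ?J ?a t \<omega>))" by (rule fluctuation_identity(2)[OF J])
    note hL = L2_leb_continuous[OF hc]
    have 1: "L2p (ugap N)" unfolding e by (intro L2_add(1) YL L2p_fst(1)[OF hL])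
    have "n2p (ugap N) \<le> 2 * n2p (\<lambda>t \<omega>. Fb (Ys ?J ?a t \<omega>)) + 2 * n2p (\<lambda>t \<omega>. ?h t)"
      unfolding e by (rule L2_add(2)[OF YL L2p_fst(1)[OF hL]])
    also have "n2p (\<lambda>t \<omega>. ?h t) = n2 (leb T) ?h" by (rule L2p_fst(2)[OF hL])
    also have "\<dots> \<le> T * (cF * C1 * norm (mf_avg N x0 - m0))\<^sup>2" by (rule n2_leb_le[OF hc hb])
    also have "\<dots> \<le> T * ((cF * C1)\<^sup>2 * (eN N)\<^sup>2)"
      unfolding power_mult_distrib using eN_props(3)[OF N] T_pos by (intro mult_left_mono) auto
    also have "n2p (\<lambda>t \<omega>. Fb (Ys ?J ?a t \<omega>)) \<le> C2 * (eN N)\<^sup>2"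
    proof -
      have "n2p (\<lambda>t \<omega>. Fb (Ys ?J ?a t \<omega>)) \<le> C2 * (1 / real N)" using C2(2)[OF J, of ?a] unfolding sa by blast
      also have "\<dots> \<le> C2 * (eN N)\<^sup>2" using eN_props(2)[OF N] C2(1) by (intro mult_left_mono) auto
      finally show ?thesis .
    qed
    finally have "n2p (ugap N) \<le> D * (eN N)\<^sup>2" by (simp add: D_def algebra_simps)
    with 1 show ?thesis by blast
  qed
  show ?thesis by (rule that[OF D main])
qed

text \<open>Stationarity with respect to the disturbance. P_i is integrated by parts against the
  path z driven by a perturbation g; the terms in A + G cancel, and P_i(T) = H E X_i(T) matches the
  terminal cost.\<close>

lemma costate_identity:
  assumes i: "1 \<le> i" and g: "L2 (leb T) g" and zc: "continuous_on {0..T} z"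
    and z: "\<And>t. t \<in> {0..T} \<Longrightarrow> ((\<lambda>s. (A + G) *v z s + g s) has_integral z t) {0..t}"
  shows "(H *v mX i T) \<bullet> z T = (\<integral>s. P i s \<bullet> g s \<partial>leb T)
     - (\<integral>s. (Q *v (mX i s - (\<Gamma> *v M i s + \<eta>))) \<bullet> (z s - \<Gamma> *v z s) \<partial>leb T)"
proof -
  let ?k = "\<lambda>s. (A + G) *v z s + g s"
  let ?q = "\<lambda>s. Q *v (mX i s - (\<Gamma> *v M i s + \<eta>))"
  let ?a = "\<lambda>s. - (transpose (A + G) *v P i s) - transpose (mat 1 - \<Gamma>) *v ?q s"
  have gi: "integrable (leb T) g" by (rule leb.L2_integrable(1)[OF g])
  have zL: "L2 (leb T) z" by (rule L2_leb_continuous[OF zc])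
  have qL: "L2 (leb T) ?q"
    by (intro L2_linear'[OF lin(1)] L2_diff(1) L2_add(1) mean_XY(1)[OF i] MP_L2(1)[OF i] leb.L2_const)
  have kL: "L2 (leb T) ?k" by (intro L2_add(1) L2_linear'[OF lin(1)] zL g)
  have aL: "L2 (leb T) ?a" by (intro L2_diff(1) L2_uminus L2_linear'[OF lin(1)] MP_L2(2)[OF i] qL)
  note ki = leb.L2_integrable(1)[OF kL] and ai = leb.L2_integrable(1)[OF aL]
  have zp: "z t = (prim ?k t)" if "t \<in> {0..T}" for t
    by (rule has_integral_eq_set_integral[OF ki that z[OF that]])
  have hp: "(?a has_integral (P i t - P i 0)) {0..t}" if "t \<in> {0..T}" for t
    using has_vector_derivative_imp_has_integral[OF fbsde(8)[OF i] that] by (simp add: mX_def)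
  have Pp: "P i s = P i T - (\<integral>r\<in>{s..T}. ?a r \<partial>lborel)" if s: "s \<in> {0..T}" for s
    using set_integral_split[OF ai s] has_integral_eq_set_integral[OF ai s hp[OF s]]
      has_integral_eq_set_integral[OF ai T_in(1) hp[OF T_in(1)]] by (simp add: algebra_simps)
  note ibp = integral_by_parts_L1[OF T_in(3) ai ki Pp zp]
  have "P i T \<bullet> z T = (\<integral>s. P i s \<bullet> ?k s + ?a s \<bullet> z s \<partial>leb T)"
    using ibp by simp
  also have "\<dots> = (\<integral>s. P i s \<bullet> g s - ?q s \<bullet> (z s - \<Gamma> *v z s) \<partial>leb T)"
  proof (intro bint_cong refl)
    fix s
    have "(transpose (mat 1 - \<Gamma>) *v ?q s) \<bullet> z s = ?q s \<bullet> (z s - \<Gamma> *v z s)"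
      by (simp add: inner_transpose matrix_vector_mult_diff_rdistrib)
    then show "P i s \<bullet> ?k s + ?a s \<bullet> z s = P i s \<bullet> g s - ?q s \<bullet> (z s - \<Gamma> *v z s)"
      using inner_transpose[of "A + G" "P i s" "z s"] by (simp add: inner_add_right inner_diff_left)
  qed
  also have "\<dots> = (\<integral>s. P i s \<bullet> g s \<partial>leb T) - (\<integral>s. ?q s \<bullet> (z s - \<Gamma> *v z s) \<partial>leb T)"
    by (intro bint_diff L2_inner(1) MP_L2(2)[OF i] g qL L2_diff(1) zL L2_linear'[OF lin(1)])
  finally show ?thesis using fbsde(6)[OF i] by (simp add: mX_def)
qed

lemma mean_inner_deterministic:
  fixes f :: "real \<Rightarrow> 'v::euclidean_space"
  assumes f: "L2 (leb T) f" and u: "L2p u"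
  shows "(\<integral>p. u (fst p) (snd p) \<bullet> f (fst p) \<partial>PP) = (\<integral>s. expectation (u s) \<bullet> f s \<partial>leb T)"
proof -
  have i: "integrable PP (\<lambda>p. u (fst p) (snd p) \<bullet> f (fst p))" by (rule L2_inner(1)[OF u L2p_fst(1)[OF f]])
  have "(\<integral>p. u (fst p) (snd p) \<bullet> f (fst p) \<partial>PP) = (\<integral>s. (\<integral>\<omega>. u s \<omega> \<bullet> f s \<partial>\<Omega>) \<partial>leb T)"
    using P.integral_fst[of "\<lambda>s \<omega>. u s \<omega> \<bullet> f s"] i by (simp add: split_beta')
  also have "\<dots> = (\<integral>s. expectation (u s) \<bullet> f s \<partial>leb T)"
  proof (rule integral_cong_AE)
    show "(\<lambda>s. \<integral>\<omega>. u s \<omega> \<bullet> f s \<partial>\<Omega>) \<in> borel_measurable (leb T)"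
      using P.integrable_fst[of "\<lambda>s \<omega>. u s \<omega> \<bullet> f s"] i by (auto simp: split_beta')
    show "(\<lambda>s. expectation (u s) \<bullet> f s) \<in> borel_measurable (leb T)"
      using L2_inner(1)[OF mean_L2(1)[OF u] f] by auto
    show "AE s in leb T. (\<integral>\<omega>. u s \<omega> \<bullet> f s \<partial>\<Omega>) = expectation (u s) \<bullet> f s"
      using L2p_integrable_section[OF u] by eventually_elim simp
  qed
  finally show ?thesis .
qed

lemma resp_L2:
  fixes S :: "real^'n^'n"
  assumes "L2p b"
  shows "L2p (resp ((*v) S) b)" "L2 \<Omega> (resp ((*v) S) b T)"
proof -
  have "L2p (resp ((*v) S) b) \<and> L2 \<Omega> (resp ((*v) S) b T)"
    by (rule resp_bound[OF lin(1)[of S]]) (use assms in blast)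
  then show "L2p (resp ((*v) S) b)" "L2 \<Omega> (resp ((*v) S) b T)" by blast+
qed

text \<open>Adds stationarity in the control to stationarity in the disturbance: the linear part of
  the limiting cost vanishes in every admissible direction (\<nu>, g). The pairing of P_i with g is
  what the cross term of |\<gamma> P_i + g|^2 / \<gamma> produces.\<close>

lemma first_order_zero:
  assumes i: "i \<in> J" "J \<subseteq> {1..}" and \<nu>: "prog_meas \<Omega> W J T \<nu>" "L2p \<nu>"
    and g: "L2 (leb T) g" and zc: "continuous_on {0..T} z"
    and z: "\<And>t. t \<in> {0..T} \<Longrightarrow> ((\<lambda>s. (A + G) *v z s + g s) has_integral z t) {0..t}"
  defines "\<theta> \<equiv> resp ((*v) A) (\<lambda>t \<omega>. B *v \<nu> t \<omega>)"
  shows "(\<integral>p. drift i (fst p) (snd p) \<bullet> (\<theta> (fst p) (snd p) + (z (fst p) - \<Gamma> *v z (fst p))) \<partial>PP)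
     + (\<integral>p. (R *v Fb (Y i (fst p) (snd p))) \<bullet> \<nu> (fst p) (snd p) \<partial>PP) - (\<integral>s. P i s \<bullet> g s \<partial>leb T)
     + (\<integral>\<omega>. (H *v X i T \<omega>) \<bullet> (\<theta> T \<omega> + z T) \<partial>\<Omega>) = 0"
proof -
  have i1: "1 \<le> i" using i by auto
  have b: "prog_meas \<Omega> W J T (\<lambda>t \<omega>. B *v \<nu> t \<omega>)" "L2p (\<lambda>t \<omega>. B *v \<nu> t \<omega>)"
    by (rule prog_linear[OF lin(1) \<nu>(1)], rule L2_linear'[OF lin(1) \<nu>(2)])
  have th: "L2p \<theta>" "L2 \<Omega> (\<theta> T)"
    unfolding \<theta>_def by (rule resp_L2[OF b(2)])+
  have zL: "L2 (leb T) (\<lambda>s. z s - \<Gamma> *v z s)"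
    by (intro L2_diff(1) L2_linear'[OF lin(1)] L2_leb_continuous[OF zc])
  have HX: "L2 \<Omega> (\<lambda>\<omega>. H *v X i T \<omega>)" by (rule L2_linear'[OF lin(1) XT_L2(1)[OF i1]])
  have HXi: "expectation (\<lambda>\<omega>. H *v X i T \<omega>) = H *v mX i T" "integrable \<Omega> (\<lambda>\<omega>. H *v X i T \<omega>)"
    using mean_linear[OF lin(1)[of H] X_integrable(1)[OF i1 T_in(1)]] by (auto simp: mX_def)
  have Ed: "expectation (drift i s) = Q *v (mX i s - (\<Gamma> *v M i s + \<eta>))" if "s \<in> {0..T}" for s
    using X_integrable(1)[OF i1 that] by (simp add: drift_def[abs_def] mX_def prob_space mean_linear[OF lin(1)])
  have "(\<integral>p. drift i (fst p) (snd p) \<bullet> (\<theta> (fst p) (snd p) + (z (fst p) - \<Gamma> *v z (fst p))) \<partial>PP)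
     = (\<integral>p. drift i (fst p) (snd p) \<bullet> \<theta> (fst p) (snd p) \<partial>PP) + (\<integral>p. drift i (fst p) (snd p) \<bullet> (z (fst p) - \<Gamma> *v z (fst p)) \<partial>PP)"
    unfolding inner_add_right
    by (intro bint_add L2_inner(1) drift_L2(2)[OF i1] th L2p_fst(1)[OF zL])
  also have "(\<integral>p. drift i (fst p) (snd p) \<bullet> (z (fst p) - \<Gamma> *v z (fst p)) \<partial>PP)
     = (\<integral>s. (Q *v (mX i s - (\<Gamma> *v M i s + \<eta>))) \<bullet> (z s - \<Gamma> *v z s) \<partial>leb T)"
    unfolding mean_inner_deterministic[OF zL drift_L2(2)[OF i1]]
    by (intro bint_cong refl) (simp add: Ed)
  finally have 1: "(\<integral>p. drift i (fst p) (snd p) \<bullet> (\<theta> (fst p) (snd p) + (z (fst p) - \<Gamma> *v z (fst p))) \<partial>PP)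
     = (\<integral>p. drift i (fst p) (snd p) \<bullet> \<theta> (fst p) (snd p) \<partial>PP)
      + (\<integral>s. (Q *v (mX i s - (\<Gamma> *v M i s + \<eta>))) \<bullet> (z s - \<Gamma> *v z s) \<partial>leb T)" .
  have 2: "(\<integral>\<omega>. (H *v X i T \<omega>) \<bullet> (\<theta> T \<omega> + z T) \<partial>\<Omega>) = (\<integral>\<omega>. (H *v X i T \<omega>) \<bullet> \<theta> T \<omega> \<partial>\<Omega>) + (H *v mX i T) \<bullet> z T"
    unfolding inner_add_right using L2_inner(1)[OF HX th(2)] HXi by simp
  show ?thesis
    using stationarity[OF i b, folded \<theta>_def] costate_identity[OF i1 g zc z]
    unfolding 1 2 Y_B by linarith
qed

end

section \<open>The N-player state equation\<close>

context lq_game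
begin

lemma linear_mf_avg:
  fixes K :: "'u::real_vector \<Rightarrow> 'v::real_vector"
  shows "linear K \<Longrightarrow> K (mf_avg N x) = mf_avg N (\<lambda>j. K (x j))"
  by (simp only: mf_avg_sum linear_sum linear_scale)

lemma mf_avg_add: "mf_avg N (\<lambda>j. v j + w j) = mf_avg N v + mf_avg N w"
  for v w :: "nat \<Rightarrow> 'v::real_vector"
  by (simp only: mf_avg_sum scaleR_add_right sum.distrib)

lemma mf_avg_diff: "mf_avg N (\<lambda>j. v j - w j) = mf_avg N v - mf_avg N w"
  for v w :: "nat \<Rightarrow> 'v::real_vector"
  by (simp only: mf_avg_sum scaleR_diff_right sum_subtractf)

lemma mf_avg_const: "1 \<le> N \<Longrightarrow> mf_avg N (\<lambda>j. c) = c"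
  for c :: "'v::real_vector"
  unfolding mf_avg_sum by (rule average_const)

lemma noise_avg: "noise {1..N} (\<lambda>_. 1 / real N) t \<omega> = mf_avg N (\<lambda>j. D *v W j t \<omega>)"
  unfolding noise_def mf_avg_sum[symmetric] by (rule linear_mf_avg[OF lin(1)])

lemma mf_avg_integrable:
  fixes u :: "nat \<Rightarrow> 'x \<Rightarrow> 'v::euclidean_space"
  shows "(\<And>j. j \<in> {1..N} \<Longrightarrow> integrable \<mu> (u j)) \<Longrightarrow> integrable \<mu> (\<lambda>s. mf_avg N (\<lambda>j. u j s))"
  unfolding mf_avg_sum by (intro Bochner_Integration.integrable_sum integrable_scaleR_right) auto

lemma matrix_integrable: "integrable \<mu> f \<Longrightarrow> integrable \<mu> (\<lambda>s. S *v f s)"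
  for S :: "real^'r^'q"
  by (rule integrable_bounded_linear[OF matrix_vector_mul_bounded_linear])

lemma mf_avg_has_integral:
  fixes h :: "nat \<Rightarrow> real \<Rightarrow> 'v::euclidean_space"
  assumes "\<And>j. j \<in> {1..N} \<Longrightarrow> (h j has_integral v j) S"
  shows "((\<lambda>s. mf_avg N (\<lambda>j. h j s)) has_integral mf_avg N v) S"
  unfolding mf_avg_sum by (intro has_integral_sum has_integral_cmul assms) auto

lemma mf_avg_continuous:
  fixes h :: "nat \<Rightarrow> real \<Rightarrow> 'v::euclidean_space"
  assumes "\<And>j. j \<in> {1..N} \<Longrightarrow> continuous_on S (h j)"
  shows "continuous_on S (\<lambda>t. mf_avg N (\<lambda>j. h j t))"
  unfolding mf_avg_sum by (intro continuous_intros assms)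

lemma noise_continuous: "\<omega> \<in> space \<Omega> \<Longrightarrow> continuous_on {0..T} (\<lambda>t. noise {1..N} (\<lambda>_. 1 / real N) t \<omega>)"
  unfolding noise_avg by (intro mf_avg_continuous W_paths) auto

text \<open>Averaging the N equations gives a closed equation for x^(N) with matrix A + G. Once the
  average is regarded as given, each player's equation decouples and has matrix A.\<close>

lemma game_state_paths:
  assumes N: "1 \<le> N" and u: "\<And>j. j \<in> {1..N} \<Longrightarrow> L2p (u j)" and f: "L2 (leb T) f"
    and x: "game_state A B G D T \<Omega> W x0 N u f x"
  shows "AE \<omega> in \<Omega>. ie_sol ((*v) (A + G)) T (\<lambda>t. mf_avg N x0 + noise {1..N} (\<lambda>_. 1 / real N) t \<omega>
        + (prim (\<lambda>s. B *v mf_avg N (\<lambda>j. u j s \<omega>) + f s) t)) (\<lambda>t. mf_avg N (\<lambda>l. x l t \<omega>)) \<and>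
     (\<forall>j\<in>{1..N}. ie_sol ((*v) A) T (\<lambda>t. x0 j + D *v W j t \<omega>
        + (prim (\<lambda>s. B *v u j s \<omega> + G *v mf_avg N (\<lambda>l. x l s \<omega>) + f s) t)) (\<lambda>t. x j t \<omega>))"
proof -
  have fi: "integrable (leb T) f" by (rule leb.L2_integrable(1)[OF f])
  have X: "AE \<omega> in \<Omega>. \<forall>j\<in>{1..N}. \<forall>t\<in>{0..T}.
        ((\<lambda>s. A *v x j s \<omega> + B *v u j s \<omega> + G *v mf_avg N (\<lambda>l. x l s \<omega>) + f s)
           has_integral (x j t \<omega> - x0 j - D *v W j t \<omega>)) {0..t}"
    by (rule AE_finite_allI) (use x in \<open>auto simp: game_state_def\<close>)
  have U: "AE \<omega> in \<Omega>. \<forall>j\<in>{1..N}. integrable (leb T) (\<lambda>s. u j s \<omega>)"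
    by (intro AE_finite_allI L2p_paths u) auto
  from X U AE_space show ?thesis
  proof eventually_elim
    case (elim \<omega>)
    let ?xb = "\<lambda>t. mf_avg N (\<lambda>l. x l t \<omega>)"
    have ui: "integrable (leb T) (\<lambda>s. u j s \<omega>)" if "j \<in> {1..N}" for j using elim(2) that by blast
    have bi: "integrable (leb T) (\<lambda>s. B *v mf_avg N (\<lambda>j. u j s \<omega>) + f s)"
      by (intro bi_add matrix_integrable mf_avg_integrable ui fi)
    have avg: "ie_sol ((*v) (A + G)) T (\<lambda>t. mf_avg N x0 + noise {1..N} (\<lambda>_. 1 / real N) t \<omega>
        + (prim (\<lambda>s. B *v mf_avg N (\<lambda>j. u j s \<omega>) + f s) t)) ?xb"
    proof (rule ie_sol_forced[OF lin(1) bi])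
      show "continuous_on {0..T} (\<lambda>t. mf_avg N x0 + noise {1..N} (\<lambda>_. 1 / real N) t \<omega>)"
        by (intro continuous_intros noise_continuous elim(3))
      fix t assume t: "t \<in> {0..T}"
      have "((\<lambda>s. mf_avg N (\<lambda>j. A *v x j s \<omega> + B *v u j s \<omega> + G *v ?xb s + f s))
          has_integral mf_avg N (\<lambda>j. x j t \<omega> - x0 j - D *v W j t \<omega>)) {0..t}"
        by (rule mf_avg_has_integral) (use elim(1) t in blast)
      moreover have "mf_avg N (\<lambda>j. x j t \<omega> - x0 j - D *v W j t \<omega>) = ?xb t - (mf_avg N x0 + noise {1..N} (\<lambda>_. 1 / real N) t \<omega>)"
        unfolding mf_avg_diff noise_avg by simp
      moreover have "mf_avg N (\<lambda>j. A *v x j s \<omega> + B *v u j s \<omega> + G *v ?xb s + f s)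
          = (A + G) *v ?xb s + (B *v mf_avg N (\<lambda>j. u j s \<omega>) + f s)" for s
        unfolding mf_avg_add mf_avg_const[OF N] linear_mf_avg[OF lin(1), symmetric] matrix_vector_mult_add_rdistrib
        by (simp add: ac_simps)
      ultimately show "((\<lambda>s. (A + G) *v ?xb s + (B *v mf_avg N (\<lambda>j. u j s \<omega>) + f s)) has_integral
          ?xb t - (mf_avg N x0 + noise {1..N} (\<lambda>_. 1 / real N) t \<omega>)) {0..t}" by simp
    qed
    have "ie_sol ((*v) A) T (\<lambda>t. x0 j + D *v W j t \<omega>
        + (prim (\<lambda>s. B *v u j s \<omega> + G *v ?xb s + f s) t)) (\<lambda>t. x j t \<omega>)" if j: "j \<in> {1..N}" for j
    proof (rule ie_sol_forced[OF lin(1)])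
      show "integrable (leb T) (\<lambda>s. B *v u j s \<omega> + G *v ?xb s + f s)"
        by (intro bi_add matrix_integrable ui[OF j] fi
            integrable_leb_continuous ie_sol_continuous[OF avg])
      show "continuous_on {0..T} (\<lambda>t. x0 j + D *v W j t \<omega>)"
        using j by (intro continuous_intros W_paths elim(3)) auto
      fix t assume t: "t \<in> {0..T}"
      show "((\<lambda>s. A *v x j s \<omega> + (B *v u j s \<omega> + G *v ?xb s + f s)) has_integral x j t \<omega> - (x0 j + D *v W j t \<omega>)) {0..t}"
        using elim(1)[rule_format, OF j t] by (simp add: add.assoc diff_diff_eq)
    qed
    with avg show ?case by blast
  qed
qed

lemma W_PP: "1 \<le> j \<Longrightarrow> (\<lambda>p. D *v W j (fst p) (snd p)) \<in> borel_measurable PP"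
  using linear_measurable[OF lin(1)[of D] borel_measurable_pair_continuous[of "W j" \<Omega> T]] W_measurable W_continuous
  by (auto simp: split_beta')

lemma ie_formula_PP:
  fixes K :: "'v::euclidean_space \<Rightarrow> 'v"
  assumes "linear K" "(\<lambda>p. c (fst p) (snd p)) \<in> borel_measurable PP"
  shows "(\<lambda>p. ie_formula K (\<lambda>r. c r (snd p)) (fst p)) \<in> borel_measurable PP"
  using ie_formula_measurable[OF assms(1), of c T \<Omega>] assms(2) by (simp add: split_beta')

lemma primitive_PP:
  fixes u :: "real \<Rightarrow> 'w \<Rightarrow> 'v::euclidean_space"
  assumes "(\<lambda>p. u (fst p) (snd p)) \<in> borel_measurable PP"
  shows "(\<lambda>p. \<integral>s\<in>{0..fst p}. u s (snd p) \<partial>lborel) \<in> borel_measurable PP"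
  using measurable_primitive[of u T \<Omega>] assms by (simp add: split_beta')

lemma matrix_PP: "f \<in> borel_measurable \<mu> \<Longrightarrow> (\<lambda>p. S *v f p) \<in> borel_measurable \<mu>"
  for S :: "real^'r^'q"
  by (rule linear_measurable[OF lin(1)])

text \<open>The cost is defined through a chosen state, so a state must exist. The average is solved
  first from its closed equation and then inserted as a known input into the individual equations;
  uniqueness confirms that their solutions do have this average.\<close>

lemma game_state_exists:
  assumes N: "1 \<le> N" and u: "\<And>j. j \<in> {1..N} \<Longrightarrow> L2p (u j)" and f: "L2 (leb T) f"
  shows "\<exists>x. game_state A B G D T \<Omega> W x0 N u f x"
proof -
  have fi: "integrable (leb T) f" by (rule leb.L2_integrable(1)[OF f])
  note um = L2_measurable[OF u]
  note fm = L2_measurable[OF L2p_fst(1)[OF f]]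
  define ub where "ub s \<omega> = B *v mf_avg N (\<lambda>j. u j s \<omega>) + f s" for s \<omega>
  define cb where "cb t \<omega> = mf_avg N x0 + noise {1..N} (\<lambda>_. 1 / real N) t \<omega> + (prim (\<lambda>s. ub s \<omega>) t)" for t \<omega>
  define xb where "xb t \<omega> = ie_formula ((*v) (A + G)) (\<lambda>r. cb r \<omega>) t" for t \<omega>
  define b where "b j s \<omega> = B *v u j s \<omega> + G *v xb s \<omega> + f s" for j s \<omega>
  define c where "c j t \<omega> = x0 j + D *v W j t \<omega> + (prim (\<lambda>s. b j s \<omega>) t)" for j t \<omega>
  define h where "h j t \<omega> = ie_formula ((*v) A) (\<lambda>r. c j r \<omega>) t" for j t \<omega>
  \<comment> \<open>Clamped in time to be jointly measurable on the whole line; on [0,T] it is the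
    solution h.\<close>
  define x where "x j t \<omega> = h j (max 0 (min T t)) \<omega>" for j t \<omega>
  have xh: "x j t \<omega> = h j t \<omega>" if "t \<in> {0..T}" for j t \<omega> using that by (simp add: x_def)
  have ubm: "(\<lambda>p. ub (fst p) (snd p)) \<in> borel_measurable PP"
    unfolding ub_def mf_avg_sum by (intro borel_measurable_add matrix_PP borel_measurable_sum borel_measurable_scaleR um fm) auto
  have cbm: "(\<lambda>p. cb (fst p) (snd p)) \<in> borel_measurable PP"
    unfolding cb_def
    by (intro borel_measurable_add primitive_PP ubm borel_measurable_const L2_measurable[OF noise_L2(1)]) auto
  have xbm: "(\<lambda>p. xb (fst p) (snd p)) \<in> borel_measurable PP"
    unfolding xb_def by (rule ie_formula_PP[OF lin(1) cbm])
  have bm: "(\<lambda>p. b j (fst p) (snd p)) \<in> borel_measurable PP" if "j \<in> {1..N}" for j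
    unfolding b_def by (intro borel_measurable_add matrix_PP um xbm fm that)
  have cm: "(\<lambda>p. c j (fst p) (snd p)) \<in> borel_measurable PP" if "j \<in> {1..N}" for j
    unfolding c_def using that by (intro borel_measurable_add primitive_PP bm borel_measurable_const W_PP) auto
  have hm: "(\<lambda>p. h j (fst p) (snd p)) \<in> borel_measurable PP" if "j \<in> {1..N}" for j
    unfolding h_def by (rule ie_formula_PP[OF lin(1) cm[OF that]])
  have xm: "(\<lambda>(t, \<omega>). x j t \<omega>) \<in> borel_measurable (lborel \<Otimes>\<^sub>M \<Omega>)" if "j \<in> {1..N}" for j
    unfolding x_def by (rule measurable_clamp[OF hm[OF that]]) simp
  have U: "AE \<omega> in \<Omega>. \<forall>j\<in>{1..N}. integrable (leb T) (\<lambda>s. u j s \<omega>)"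
    by (intro AE_finite_allI L2p_paths u) auto
  from U AE_space have paths: "AE \<omega> in \<Omega>. \<forall>j\<in>{1..N}. \<forall>t\<in>{0..T}.
        ((\<lambda>s. A *v x j s \<omega> + B *v u j s \<omega> + G *v mf_avg N (\<lambda>l. x l s \<omega>) + f s)
           has_integral (x j t \<omega> - x0 j - D *v W j t \<omega>)) {0..t}"
  proof eventually_elim
    case (elim \<omega>)
    have ui: "integrable (leb T) (\<lambda>s. u j s \<omega>)" if "j \<in> {1..N}" for j using elim that by blast
    have ubi: "integrable (leb T) (\<lambda>s. ub s \<omega>)"
      unfolding ub_def by (intro bi_add matrix_integrable mf_avg_integrable ui fi)
    have cbc: "continuous_on {0..T} (\<lambda>t. cb t \<omega>)"
      unfolding cb_def by (intro continuous_intros noise_continuous continuous_on_int_leb ubi elim(2))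
    have xbs: "ie_sol ((*v) (A + G)) T (\<lambda>t. cb t \<omega>) (\<lambda>t. xb t \<omega>)"
      unfolding xb_def[abs_def] by (rule ie_formula_sol[OF lin(1) cbc])
    have xbi: "integrable (leb T) (\<lambda>s. xb s \<omega>)" by (intro integrable_leb_continuous ie_sol_continuous[OF xbs])
    have bi: "integrable (leb T) (\<lambda>s. b j s \<omega>)" if "j \<in> {1..N}" for j
      unfolding b_def by (intro bi_add matrix_integrable ui fi xbi that)
    have hs: "ie_sol ((*v) A) T (\<lambda>t. c j t \<omega>) (\<lambda>t. h j t \<omega>)" if j: "j \<in> {1..N}" for j
      unfolding h_def[abs_def] c_def[abs_def]
      using j by (intro ie_formula_sol[OF lin(1)] continuous_intros W_paths continuous_on_int_leb bi elim(2)) auto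
    \<comment> \<open>The term G xb is moved to the forcing, so that xb and the average of the h j
      solve equations with the same matrix A and can be compared.\<close>
    have avg1: "ie_sol ((*v) A) T (\<lambda>t. mf_avg N x0 + noise {1..N} (\<lambda>_. 1 / real N) t \<omega>
        + (prim (\<lambda>s. ub s \<omega> + G *v xb s \<omega>) t)) (\<lambda>t. xb t \<omega>)"
    proof (rule ie_sol_forced[OF lin(1)])
      show "integrable (leb T) (\<lambda>s. ub s \<omega> + G *v xb s \<omega>)"
        by (intro bi_add matrix_integrable ubi xbi)
      show "continuous_on {0..T} (\<lambda>t. mf_avg N x0 + noise {1..N} (\<lambda>_. 1 / real N) t \<omega>)"
        by (intro continuous_intros noise_continuous elim(2))
      fix t assume t: "t \<in> {0..T}"
      have 1: "((\<lambda>s. (A + G) *v xb s \<omega>) has_integral xb t \<omega> - cb t \<omega>) {0..t}"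
        using xbs t by (simp add: ie_sol_def)
      have 2: "((\<lambda>s. ub s \<omega>) has_integral (prim (\<lambda>s. ub s \<omega>) t)) {0..t}"
        using t by (intro has_integral_leb[OF ubi]) auto
      show "((\<lambda>s. A *v xb s \<omega> + (ub s \<omega> + G *v xb s \<omega>)) has_integral
          xb t \<omega> - (mf_avg N x0 + noise {1..N} (\<lambda>_. 1 / real N) t \<omega>)) {0..t}"
      proof -
        have "xb t \<omega> - cb t \<omega> + (prim (\<lambda>s. ub s \<omega>) t)
            = xb t \<omega> - (mf_avg N x0 + noise {1..N} (\<lambda>_. 1 / real N) t \<omega>)" by (simp add: cb_def)
        with has_integral_add[OF 1 2] show ?thesis
          unfolding matrix_vector_mult_add_rdistrib by (simp only: add.assoc add.commute[of "G *v _"])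
      qed
    qed
    have avg2: "ie_sol ((*v) A) T (\<lambda>t. mf_avg N (\<lambda>j. c j t \<omega>)) (\<lambda>t. mf_avg N (\<lambda>j. h j t \<omega>))"
      unfolding mf_avg_sum by (rule ie_sol_sum[OF lin(1) hs])
    have "mf_avg N (\<lambda>j. c j t \<omega>) = mf_avg N x0 + noise {1..N} (\<lambda>_. 1 / real N) t \<omega>
        + (prim (\<lambda>s. ub s \<omega> + G *v xb s \<omega>) t)" if t: "t \<in> {0..T}" for t
    proof -
      have i1: "((\<lambda>s. mf_avg N (\<lambda>j. b j s \<omega>)) has_integral mf_avg N (\<lambda>j. \<integral>s\<in>{0..t}. b j s \<omega> \<partial>lborel)) {0..t}"
        using t by (intro mf_avg_has_integral has_integral_leb[OF bi]) auto
      have e: "mf_avg N (\<lambda>j. b j s \<omega>) = ub s \<omega> + G *v xb s \<omega>" for s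
        unfolding b_def ub_def mf_avg_add mf_avg_const[OF N] linear_mf_avg[OF lin(1)] by (simp add: ac_simps)
      have "mf_avg N (\<lambda>j. \<integral>s\<in>{0..t}. b j s \<omega> \<partial>lborel) = (prim (\<lambda>s. ub s \<omega> + G *v xb s \<omega>) t)"
        using i1 unfolding e
        by (intro has_integral_eq_set_integral[OF _ t] bi_add matrix_integrable ubi xbi)
      then show ?thesis unfolding c_def mf_avg_add noise_avg by simp
    qed
    then have xbh: "mf_avg N (\<lambda>j. h j t \<omega>) = xb t \<omega>" if "t \<in> {0..T}" for t
      by (intro ie_sol_unique[OF lin(1) ie_sol_cong[OF avg2] avg1 that]) blast
    show ?case
    proof (intro ballI)
      fix j t assume j: "j \<in> {1..N}" and t: "t \<in> {0..T}"
      have 1: "((\<lambda>s. A *v h j s \<omega>) has_integral h j t \<omega> - c j t \<omega>) {0..t}"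
        using hs[OF j] t by (simp add: ie_sol_def)
      have 2: "((\<lambda>s. b j s \<omega>) has_integral (prim (\<lambda>s. b j s \<omega>) t)) {0..t}"
        using t by (intro has_integral_leb[OF bi[OF j]]) auto
      have "((\<lambda>s. A *v h j s \<omega> + b j s \<omega>) has_integral (x j t \<omega> - x0 j - D *v W j t \<omega>)) {0..t}"
      proof -
        have "h j t \<omega> - c j t \<omega> + (prim (\<lambda>s. b j s \<omega>) t) = x j t \<omega> - x0 j - D *v W j t \<omega>"
          using xh[OF t] by (simp add: c_def)
        with has_integral_add[OF 1 2] show ?thesis by simp
      qed
      then show "((\<lambda>s. A *v x j s \<omega> + B *v u j s \<omega> + G *v mf_avg N (\<lambda>l. x l s \<omega>) + f s)
           has_integral (x j t \<omega> - x0 j - D *v W j t \<omega>)) {0..t}"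
        by (rule has_integral_eq[rotated]) (use t xh xbh in \<open>simp add: b_def ac_simps\<close>)
    qed
  qed
  have "game_state A B G D T \<Omega> W x0 N u f x"
    unfolding game_state_def
  proof (intro ballI conjI xm)
    fix j assume j: "j \<in> {1..N}"
    from paths show "AE \<omega> in \<Omega>. \<forall>t\<in>{0..T}.
        ((\<lambda>s. A *v x j s \<omega> + B *v u j s \<omega> + G *v mf_avg N (\<lambda>l. x l s \<omega>) + f s)
           has_integral (x j t \<omega> - x0 j - D *v W j t \<omega>)) {0..t}"
      by eventually_elim (use j in blast)
  qed
  then show ?thesis by blast
qed

end

section \<open>Deviation of one player: error of the limiting prediction\<close>

context lq_game
begin

definition udev :: "nat \<Rightarrow> (real \<Rightarrow> 'w \<Rightarrow> real^'k) \<Rightarrow> real \<Rightarrow> 'w \<Rightarrow> real^'k" where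
  "udev i v t \<omega> = v t \<omega> - Fb (Y i t \<omega>)"

definition xdev :: "nat \<Rightarrow> (real \<Rightarrow> 'w \<Rightarrow> real^'k) \<Rightarrow> real \<Rightarrow> 'w \<Rightarrow> real^'n" where
  "xdev i v = resp ((*v) A) (\<lambda>t \<omega>. B *v udev i v t \<omega>)"

text \<open>To leading order the average is M_i + z, and the own state is X_i plus the response to
  the control deviation plus z; \<open>avg_err\<close> and \<open>own_err\<close> measure the
  failure of these predictions.\<close>

definition avg_err :: "nat \<Rightarrow> nat \<Rightarrow> (real \<Rightarrow> real^'n) \<Rightarrow> (nat \<Rightarrow> real \<Rightarrow> 'w \<Rightarrow> real^'n) \<Rightarrow> real \<Rightarrow> 'w \<Rightarrow> real^'n" where
  "avg_err N i z x t \<omega> = mf_avg N (\<lambda>l. x l t \<omega>) - M i t - z t"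

definition own_err :: "nat \<Rightarrow> (real \<Rightarrow> 'w \<Rightarrow> real^'k) \<Rightarrow> (real \<Rightarrow> real^'n) \<Rightarrow> (nat \<Rightarrow> real \<Rightarrow> 'w \<Rightarrow> real^'n) \<Rightarrow> real \<Rightarrow> 'w \<Rightarrow> real^'n" where
  "own_err i v z x t \<omega> = x i t \<omega> - X i t \<omega> - xdev i v t \<omega> - z t"

text \<open>Player \<open>i\<close> deviates to \<open>v\<close> while the disturbance is \<open>\<gamma> P i + g\<close>; to leading order the latter
  shifts every state by the deterministic path \<open>z\<close>.\<close>
definition deviation where
  "deviation N i v f g z x \<longleftrightarrow> i \<in> {1..N} \<and> prog_meas \<Omega> W {1..N} T v \<and> L2p v \<and> L2 (leb T) f \<and> L2 (leb T) g \<and>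
     (\<forall>t\<in>{0..T}. f t = \<gamma> *\<^sub>R P i t + g t) \<and> continuous_on {0..T} z \<and>
     (\<forall>t\<in>{0..T}. ((\<lambda>s. (A + G) *v z s + g s) has_integral z t) {0..t}) \<and>
     game_state A B G D T \<Omega> W x0 N ((uhat B R Y)(i := v)) f x"

lemma Fb_Y_L2: "1 \<le> j \<Longrightarrow> L2p (\<lambda>t \<omega>. Fb (Y j t \<omega>))"
  by (intro L2_linear'[OF lin(2)] fbsde(4))

lemma uhat_L2: "1 \<le> j \<Longrightarrow> L2p (uhat B R Y j)"
  using Fb_Y_L2 by (simp add: uhat_def)

lemma udev_L2: "1 \<le> i \<Longrightarrow> L2p v \<Longrightarrow> L2p (udev i v)"
  unfolding udev_def by (intro L2_diff(1) Fb_Y_L2)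

lemma xdev_L2:
  assumes "1 \<le> i" "L2p v"
  shows "L2p (xdev i v)" "L2 \<Omega> (xdev i v T)"
  unfolding xdev_def by (rule resp_L2[OF L2_linear'[OF lin(1) udev_L2[OF assms]]])+

lemma mf_avg_update:
  assumes "i \<in> {1..N}"
  shows "mf_avg N (\<lambda>j. ((uhat B R Y)(i := v)) j s \<omega>) = mf_avg N (\<lambda>j. Fb (Y j s \<omega>)) + (1 / real N) *\<^sub>R udev i v s \<omega>"
proof -
  have "((uhat B R Y)(i := v)) j s \<omega> = Fb (Y j s \<omega>) + (if j = i then udev i v s \<omega> else 0)" for j
    by (simp add: uhat_def udev_def)
  then have "mf_avg N (\<lambda>j. ((uhat B R Y)(i := v)) j s \<omega>)
      = mf_avg N (\<lambda>j. Fb (Y j s \<omega>)) + mf_avg N (\<lambda>j. if j = i then udev i v s \<omega> else 0)"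
    by (simp only: mf_avg_add)
  also have "mf_avg N (\<lambda>j. if j = i then udev i v s \<omega> else 0) = (1 / real N) *\<^sub>R udev i v s \<omega>"
    unfolding mf_avg_def using assms by simp
  finally show ?thesis .
qed

lemma int_diff:
  fixes a b :: "real \<Rightarrow> 'v::euclidean_space"
  assumes "integrable (leb T) a" "integrable (leb T) b" "t \<in> {0..T}"
  shows "(prim a t) - (prim b t) = (prim (\<lambda>s. a s - b s) t)"
  using assms by (intro set_integral_diff(2)[symmetric] set_integrable_leb_sub) auto

lemma int_cong: "(\<And>s. s \<in> {0..t} \<Longrightarrow> a s = b s) \<Longrightarrow> (prim a t) = (prim b t)"
  for a b :: "real \<Rightarrow> 'v::euclidean_space"
  by (intro set_lebesgue_integral_cong) auto

text \<open>The limiting equations are subtracted from those of the game. The average error is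
  driven by the initial gap, the averaged noise, the control gap and 1/N times the deviation. In the
  own error the initial state, the own noise, the own control and the disturbance cancel exactly,
  leaving only the average error.\<close>

lemma deviation_paths:
  assumes dv: "deviation N i v f g z x"
  shows "AE \<omega> in \<Omega>. ie_sol ((*v) (A + G)) T (\<lambda>t. mf_avg N x0 - m0 + noise {1..N} (\<lambda>_. 1 / real N) t \<omega>
        + (prim (\<lambda>s. B *v (ugap N s \<omega> + (1 / real N) *\<^sub>R udev i v s \<omega>)) t)) (\<lambda>t. avg_err N i z x t \<omega>) \<and>
      ie_sol ((*v) A) T (\<lambda>t. \<integral>s\<in>{0..t}. G *v avg_err N i z x s \<omega> \<partial>lborel) (\<lambda>t. own_err i v z x t \<omega>)"
proof -
  note d = dv[unfolded deviation_def]
  have i: "1 \<le> i" "1 \<le> N" "i \<in> {1..N}" and v: "L2p v" and f: "L2 (leb T) f" and g: "L2 (leb T) g"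
    and zc: "continuous_on {0..T} z"
    and z: "\<And>t. t \<in> {0..T} \<Longrightarrow> ((\<lambda>s. (A + G) *v z s + g s) has_integral z t) {0..t}"
    and gs: "game_state A B G D T \<Omega> W x0 N ((uhat B R Y)(i := v)) f x" using d by auto
  have fg: "f t = \<gamma> *\<^sub>R P i t + g t" if "t \<in> {0..T}" for t using d that by blast
  have u: "L2p (((uhat B R Y)(i := v)) j)" if "j \<in> {1..N}" for j using uhat_L2[of j] v that by auto
  note fi = leb.L2_integrable(1)[OF f] and gi = leb.L2_integrable(1)[OF g]
  have ug: "L2p (ugap N)" by (rule ugap_bound) (use i(2) in blast)
  have yc: "continuous_on {0..T} (\<lambda>s. B *v Fb (y s) + \<gamma> *\<^sub>R P i s)"
    by (intro continuous_intros linear_continuous_on_compose[OF lin(1)] linear_continuous_on_compose[OF lin(2)]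
      mf_continuous MP_continuous[OF i(1)])
  have Ms: "ie_sol ((*v) (A + G)) T (\<lambda>t. m0 + (prim (\<lambda>s. B *v Fb (y s) + \<gamma> *\<^sub>R P i s) t)) (M i)"
  proof (rule ie_sol_forced[OF lin(1) integrable_leb_continuous[OF yc]])
    fix t assume t: "t \<in> {0..T}"
    show "((\<lambda>s. (A + G) *v M i s + (B *v Fb (y s) + \<gamma> *\<^sub>R P i s)) has_integral M i t - m0) {0..t}"
      using has_vector_derivative_imp_has_integral[OF fbsde(7)[OF i(1)] t] unfolding fbsde(5)[OF i(1)] by (simp only: add.assoc)
  qed simp
  have zs: "ie_sol ((*v) (A + G)) T (\<lambda>t. 0 + (prim g t)) z"
    by (rule ie_sol_forced[OF lin(1) gi]) (use z in auto)
  have zi: "integrable (leb T) (\<lambda>s. g s + G *v z s)"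
    by (intro bi_add gi matrix_integrable integrable_leb_continuous zc)
  have zs2: "ie_sol ((*v) A) T (\<lambda>t. 0 + (prim (\<lambda>s. g s + G *v z s) t)) z"
  proof (rule ie_sol_forced[OF lin(1) zi])
    fix t assume "t \<in> {0..T}"
    from z[OF this] have "((\<lambda>s. A *v z s + (g s + G *v z s)) has_integral z t) {0..t}"
      by (rule has_integral_eq[rotated]) (simp add: matrix_vector_mult_add_rdistrib)
    then show "((\<lambda>s. A *v z s + (g s + G *v z s)) has_integral z t - 0) {0..t}" by simp
  qed simp
  have Bv: "L2p (\<lambda>t \<omega>. B *v udev i v t \<omega>)" by (rule L2_linear'[OF lin(1) udev_L2[OF i(1) v]])
  have gap: "L2p (\<lambda>t \<omega>. B *v (ugap N t \<omega> + (1 / real N) *\<^sub>R udev i v t \<omega>))"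
    by (intro L2_linear'[OF lin(1)] L2_add(1) L2_scaleR ug udev_L2 i v)
  have U: "AE \<omega> in \<Omega>. \<forall>j\<in>{1..N}. integrable (leb T) (\<lambda>s. ((uhat B R Y)(i := v)) j s \<omega>)"
    by (rule AE_finite_allI) (use L2p_paths[OF u] in auto)
  have "AE \<omega> in \<Omega>. ie_sol ((*v) (A + G)) T (\<lambda>t. mf_avg N x0 + noise {1..N} (\<lambda>_. 1 / real N) t \<omega>
        + (prim (\<lambda>s. B *v mf_avg N (\<lambda>j. ((uhat B R Y)(i := v)) j s \<omega>) + f s) t)) (\<lambda>t. mf_avg N (\<lambda>l. x l t \<omega>)) \<and>
     (\<forall>j\<in>{1..N}. ie_sol ((*v) A) T (\<lambda>t. x0 j + D *v W j t \<omega>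
        + (prim (\<lambda>s. B *v ((uhat B R Y)(i := v)) j s \<omega> + G *v mf_avg N (\<lambda>l. x l s \<omega>) + f s) t)) (\<lambda>t. x j t \<omega>))"
    by (rule game_state_paths[OF i(2) _ f gs]) (rule u)
  from this X_ie[OF i(1)] L2p_paths[OF Bv] L2p_paths[OF gap] U L2p_paths[OF forcing_L2[OF i(1)]]
  show ?thesis
  proof eventually_elim
    case (elim \<omega>)
    let ?xb = "\<lambda>t. mf_avg N (\<lambda>l. x l t \<omega>)"
    let ?u = "\<lambda>s. mf_avg N (\<lambda>j. ((uhat B R Y)(i := v)) j s \<omega>)"
    note ui = elim(5)[rule_format]
    have vi: "integrable (leb T) (\<lambda>s. v s \<omega>)" using ui[OF i(3)] by simp
    have s1: "ie_sol ((*v) (A + G)) T (\<lambda>t. mf_avg N x0 + noise {1..N} (\<lambda>_. 1 / real N) t \<omega>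
        + (prim (\<lambda>s. B *v ?u s + f s) t)) ?xb" using elim(1) by blast
    have s2: "ie_sol ((*v) A) T (\<lambda>t. x0 i + D *v W i t \<omega>
        + (prim (\<lambda>s. B *v v s \<omega> + G *v ?xb s + f s) t)) (\<lambda>t. x i t \<omega>)"
      using elim(1) i(3) by fastforce
    have s3: "ie_sol ((*v) A) T (\<lambda>t. \<integral>s\<in>{0..t}. B *v udev i v s \<omega> \<partial>lborel) (\<lambda>t. xdev i v t \<omega>)"
      unfolding xdev_def by (rule resp_sol[of "(*v) A" "\<lambda>t \<omega>. B *v udev i v t \<omega>" \<omega>, OF lin(1) elim(3)])
    have xbi: "integrable (leb T) ?xb" by (rule integrable_leb_continuous[OF ie_sol_continuous[OF s1]])
    have i1: "integrable (leb T) (\<lambda>s. B *v ?u s + f s)"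
      by (intro bi_add matrix_integrable mf_avg_integrable ui fi)
    have i2: "integrable (leb T) (\<lambda>s. B *v v s \<omega> + G *v ?xb s + f s)"
      by (intro bi_add matrix_integrable vi fi xbi)
    note yi = integrable_leb_continuous[OF yc]
    have avg: "ie_sol ((*v) (A + G)) T (\<lambda>t. mf_avg N x0 - m0 + noise {1..N} (\<lambda>_. 1 / real N) t \<omega>
        + (prim (\<lambda>s. B *v (ugap N s \<omega> + (1 / real N) *\<^sub>R udev i v s \<omega>)) t)) (\<lambda>t. avg_err N i z x t \<omega>)"
      unfolding avg_err_def
    proof (rule ie_sol_cong[OF ie_sol_diff[OF lin(1) ie_sol_diff[OF lin(1) s1 Ms] zs]])
      fix t assume t: "t \<in> {0..T}"
      have "(prim (\<lambda>s. B *v ?u s + f s) t) - (prim (\<lambda>s. B *v Fb (y s) + \<gamma> *\<^sub>R P i s) t) - (prim g t)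
          = (prim (\<lambda>s. B *v ?u s + f s - (B *v Fb (y s) + \<gamma> *\<^sub>R P i s) - g s) t)"
        unfolding int_diff[OF i1 yi t] by (rule int_diff[OF bi_diff[OF i1 yi] gi t])
      also have "\<dots> = (prim (\<lambda>s. B *v (ugap N s \<omega> + (1 / real N) *\<^sub>R udev i v s \<omega>)) t)"
      proof (rule int_cong)
        fix s assume "s \<in> {0..t}"
        then have "f s = \<gamma> *\<^sub>R P i s + g s" using fg t by auto
        then have "B *v ?u s + f s - (B *v Fb (y s) + \<gamma> *\<^sub>R P i s) - g s = B *v ?u s - B *v Fb (y s)" by simp
        also have "\<dots> = B *v (ugap N s \<omega> + (1 / real N) *\<^sub>R udev i v s \<omega>)"
          unfolding mf_avg_update[OF i(3)] ugap_def matrix_vector_mult_diff_distrib[symmetric]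
          by (rule arg_cong[of _ _ "(*v) B"]) simp
        finally show "B *v ?u s + f s - (B *v Fb (y s) + \<gamma> *\<^sub>R P i s) - g s = B *v (ugap N s \<omega> + (1 / real N) *\<^sub>R udev i v s \<omega>)" .
      qed
      finally have e: "(prim (\<lambda>s. B *v ?u s + f s) t) - (prim (\<lambda>s. B *v Fb (y s) + \<gamma> *\<^sub>R P i s) t) - (prim g t)
          = (prim (\<lambda>s. B *v (ugap N s \<omega> + (1 / real N) *\<^sub>R udev i v s \<omega>)) t)" .
      have rearrange: "\<And>c n a b d e :: real^'n. c + n + a - (d + b) - (0 + e) = c - d + n + (a - b - e)"
        by (simp add: algebra_simps)
      show "mf_avg N x0 + noise {1..N} (\<lambda>_. 1 / real N) t \<omega> + (prim (\<lambda>s. B *v ?u s + f s) t)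
          - (m0 + (prim (\<lambda>s. B *v Fb (y s) + \<gamma> *\<^sub>R P i s) t)) - (0 + (prim g t))
        = mf_avg N x0 - m0 + noise {1..N} (\<lambda>_. 1 / real N) t \<omega>
          + (prim (\<lambda>s. B *v (ugap N s \<omega> + (1 / real N) *\<^sub>R udev i v s \<omega>)) t)" unfolding e[symmetric] by (rule rearrange)
    qed
    have own: "ie_sol ((*v) A) T (\<lambda>t. \<integral>s\<in>{0..t}. G *v avg_err N i z x s \<omega> \<partial>lborel) (\<lambda>t. own_err i v z x t \<omega>)"
      unfolding own_err_def
    proof (rule ie_sol_cong[OF ie_sol_diff[OF lin(1) ie_sol_diff[OF lin(1) ie_sol_diff[OF lin(1) s2 elim(2)] s3] zs2]])
      fix t assume t: "t \<in> {0..T}"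
      note i3 = elim(6) and i4 = elim(3)
      have "(prim (\<lambda>s. B *v v s \<omega> + G *v ?xb s + f s) t) - (prim (\<lambda>s. forcing i s \<omega>) t)
            - (prim (\<lambda>s. B *v udev i v s \<omega>) t) - (prim (\<lambda>s. g s + G *v z s) t)
          = (prim (\<lambda>s. B *v v s \<omega> + G *v ?xb s + f s - forcing i s \<omega> - B *v udev i v s \<omega> - (g s + G *v z s)) t)"
        unfolding int_diff[OF i2 i3 t] int_diff[OF bi_diff[OF i2 i3] i4 t]
        by (rule int_diff[OF bi_diff[OF bi_diff[OF i2 i3] i4] zi t])
      also have "\<dots> = (prim (\<lambda>s. G *v avg_err N i z x s \<omega>) t)"
      proof (rule int_cong)
        fix s assume "s \<in> {0..t}"
        then have "f s = \<gamma> *\<^sub>R P i s + g s" using fg t by auto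
        then show "B *v v s \<omega> + G *v ?xb s + f s - forcing i s \<omega> - B *v udev i v s \<omega> - (g s + G *v z s) = G *v avg_err N i z x s \<omega>"
          by (simp add: forcing_def udev_def avg_err_def matrix_vector_mult_diff_distrib)
      qed
      finally show "x0 i + D *v W i t \<omega> + (prim (\<lambda>s. B *v v s \<omega> + G *v ?xb s + f s) t)
          - (x0 i + D *v W i t \<omega> + (prim (\<lambda>s. forcing i s \<omega>) t)) - (prim (\<lambda>s. B *v udev i v s \<omega>) t)
          - (0 + (prim (\<lambda>s. g s + G *v z s) t)) = (prim (\<lambda>s. G *v avg_err N i z x s \<omega>) t)" by simp
    qed
    from avg own show ?case by blast
  qed
qed

lemma game_state_measurable:
  assumes "game_state A B G D T \<Omega> W x0 N u f x" "j \<in> {1..N}"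
  shows "(\<lambda>p. x j (fst p) (snd p)) \<in> borel_measurable PP"
proof -
  have 1: "(\<lambda>(t, \<omega>). x j t \<omega>) \<in> borel_measurable (lborel \<Otimes>\<^sub>M \<Omega>)" using assms unfolding game_state_def by blast
  have 2: "(\<lambda>p. (fst p, snd p)) \<in> PP \<rightarrow>\<^sub>M lborel \<Otimes>\<^sub>M \<Omega>"
    by (intro measurable_Pair measurable_snd measurable_compose[OF measurable_fst] measurable_restrict_space1) simp
  from measurable_compose[OF 2 1] show ?thesis by simp
qed

lemma err_measurable:
  assumes dv: "deviation N i v f g z x"
  shows "(\<lambda>p. avg_err N i z x (fst p) (snd p)) \<in> borel_measurable PP"
    "(\<lambda>p. own_err i v z x (fst p) (snd p)) \<in> borel_measurable PP"
proof -
  have i: "1 \<le> i" "i \<in> {1..N}" "L2p v" and zc: "continuous_on {0..T} z"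
    and gs: "game_state A B G D T \<Omega> W x0 N ((uhat B R Y)(i := v)) f x" using dv unfolding deviation_def by auto
  note m = L2_measurable[OF L2p_fst(1)[OF L2_leb_continuous[OF zc]]] L2_measurable[OF L2p_fst(1)[OF MP_L2(1)[OF i(1)]]]
    L2_measurable[OF fbsde(3)[OF i(1)]] L2_measurable[OF xdev_L2(1)[OF i(1,3)]] game_state_measurable[OF gs]
  show "(\<lambda>p. avg_err N i z x (fst p) (snd p)) \<in> borel_measurable PP"
    unfolding avg_err_def mf_avg_sum by (intro borel_measurable_diff borel_measurable_sum borel_measurable_scaleR borel_measurable_const m)
  show "(\<lambda>p. own_err i v z x (fst p) (snd p)) \<in> borel_measurable PP"
    unfolding own_err_def by (intro borel_measurable_diff m i)
qed

text \<open>Every driver of the average error has squared size at most of order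
  \<open>(eN N)^2\<close> times 1 plus the squared deviation, and the own error is a linear response
  to it. The disturbance g does not occur in the bound, since z already accounts for it
  exactly.\<close>

lemma perturbation:
  obtains C where "C > 0"
    "\<And>N i v f g z x. deviation N i v f g z x \<Longrightarrow>
      L2p (avg_err N i z x) \<and> n2p (avg_err N i z x) \<le> C * ((eN N)\<^sup>2 * (1 + n2p (udev i v))) \<and>
      L2p (own_err i v z x) \<and> n2p (own_err i v z x) \<le> C * ((eN N)\<^sup>2 * (1 + n2p (udev i v))) \<and>
      L2 \<Omega> (own_err i v z x T) \<and> n2 \<Omega> (own_err i v z x T) \<le> C * ((eN N)\<^sup>2 * (1 + n2p (udev i v)))"
proof -
  obtain C1 where C1: "C1 > 0"
    "\<And>c z. L2p c \<Longrightarrow> L2 \<Omega> (c T) \<Longrightarrow> (\<lambda>p. z (fst p) (snd p)) \<in> borel_measurable PP \<Longrightarrow>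
      (AE \<omega> in \<Omega>. ie_sol ((*v) (A + G)) T (\<lambda>t. c t \<omega>) (\<lambda>t. z t \<omega>)) \<Longrightarrow>
      L2p z \<and> n2p z \<le> C1 * n2p c \<and> L2 \<Omega> (z T) \<and> n2 \<Omega> (z T) \<le> C1 * (n2p c + n2 \<Omega> (c T))"
    using ie_bound_matrix[of "A + G"] by blast
  obtain C2 where C2: "C2 > 0"
    "\<And>c z. L2p c \<Longrightarrow> L2 \<Omega> (c T) \<Longrightarrow> (\<lambda>p. z (fst p) (snd p)) \<in> borel_measurable PP \<Longrightarrow>
      (AE \<omega> in \<Omega>. ie_sol ((*v) A) T (\<lambda>t. c t \<omega>) (\<lambda>t. z t \<omega>)) \<Longrightarrow>
      L2p z \<and> n2p z \<le> C2 * n2p c \<and> L2 \<Omega> (z T) \<and> n2 \<Omega> (z T) \<le> C2 * (n2p c + n2 \<Omega> (c T))"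
    using ie_bound_matrix[of A] by blast
  obtain Cu where Cu: "Cu > 0" "\<And>N. 1 \<le> N \<Longrightarrow> L2p (ugap N) \<and> n2p (ugap N) \<le> Cu * (eN N)\<^sup>2"
    by (fact ugap_bound)
  obtain Cn where Cn: "Cn > 0"
    "\<And>J a. finite J \<Longrightarrow> J \<subseteq> {1..} \<Longrightarrow> L2p (noise J a) \<and> n2p (noise J a) \<le> Cn * (\<Sum>j\<in>J. (a j)\<^sup>2)
       \<and> L2 \<Omega> (noise J a T) \<and> n2 \<Omega> (noise J a T) \<le> Cn * (\<Sum>j\<in>J. (a j)\<^sup>2)
       \<and> (\<forall>t\<in>{0..T}. integrable \<Omega> (noise J a t) \<and> expectation (noise J a t) = 0)"
    using noise_bound by blast
  obtain cB where cB: "cB > 0"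
    "\<And>N f. L2 N f \<Longrightarrow> n2 (N :: (real \<times> 'w) measure) (\<lambda>x. B *v f x) \<le> cB * n2 N f"
    using matrix_L2_bound by blast
  obtain cG where cG: "cG > 0"
    "\<And>N f. L2 N f \<Longrightarrow> n2 (N :: (real \<times> 'w) measure) (\<lambda>x. G *v f x) \<le> cG * n2 N f"
    using matrix_L2_bound by blast
  \<comment> \<open>Applying |a+b|^2 \<le> 2|a|^2 + 2|b|^2 twice gives the factor 4 in front of the
    initial gap and the noise and the factor 2 in front of the primitive of the control gap.\<close>
  define K where "K = 4 * T + 4 * Cn + 2 * (T\<^sup>2 * (cB * (2 * Cu + 2)))"
  have K: "K > 0" unfolding K_def using T_pos Cn(1) cB(1) Cu(1) by (intro add_pos_nonneg) auto
  define L where "L = C1 * K"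
  have L: "L > 0" using C1(1) K by (simp add: L_def)
  \<comment> \<open>L bounds the average error. The own error responds to the primitive of G times
    that error, which costs T^2 over time and T at the terminal time.\<close>
  define C where "C = L + C2 * (T\<^sup>2 + T) * cG * L"
  have CL: "L \<le> C" "C2 * (T\<^sup>2 + T) * cG * L \<le> C" "C > 0"
  proof -
    have "0 \<le> C2 * (T\<^sup>2 + T) * cG * L" using L C2(1) cG(1) T_pos by simp
    then show "L \<le> C" "C2 * (T\<^sup>2 + T) * cG * L \<le> C" "C > 0" using L by (auto simp: C_def)
  qed
  show ?thesis
  proof (rule that[OF CL(3)])
    fix N i v f g z x assume dv: "deviation N i v f g z x"
    have i: "1 \<le> i" "1 \<le> N" and v: "L2p v" using dv unfolding deviation_def by auto
    define w where "w = (eN N)\<^sup>2 * (1 + n2p (udev i v))"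
    have ew: "(eN N)\<^sup>2 \<le> w" "(eN N)\<^sup>2 * n2p (udev i v) \<le> w" "0 \<le> w"
      by (simp_all add: w_def distrib_left)
    let ?no = "noise {1..N} (\<lambda>_. 1 / real N)"
    let ?k = "\<lambda>s \<omega>. B *v (ugap N s \<omega> + (1 / real N) *\<^sub>R udev i v s \<omega>)"
    let ?pk = "\<lambda>t \<omega>. \<integral>s\<in>{0..t}. ?k s \<omega> \<partial>lborel"
    let ?c = "\<lambda>t \<omega>. mf_avg N x0 - m0 + ?no t \<omega> + ?pk t \<omega>"
    have sa: "(\<Sum>j\<in>{1..N}. (1 / real N)\<^sup>2) = 1 / real N" using i by (simp add: power2_eq_square)
    have no: "L2p ?no" "n2p ?no \<le> Cn * w" "L2 \<Omega> (?no T)"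
    proof -
      have "Cn * (1 / real N) \<le> Cn * w" using Cn(1) eN_props(2)[OF i(2)] ew(1) by (intro mult_left_mono) auto
      then show "L2p ?no" "n2p ?no \<le> Cn * w" "L2 \<Omega> (?no T)"
        using Cn(2)[of "{1..N}" "\<lambda>_. 1 / real N"] unfolding sa by auto
    qed
    have ul: "L2p (\<lambda>t \<omega>. ugap N t \<omega> + (1 / real N) *\<^sub>R udev i v t \<omega>)"
      by (intro L2_add(1) L2_scaleR udev_L2 i v conjunct1[OF Cu(2)])
    have kl: "L2p ?k" by (rule L2_linear'[OF lin(1) ul])
    have kb: "n2p ?k \<le> (cB * (2 * Cu + 2)) * w"
    proof -
      have "n2p (\<lambda>t \<omega>. ugap N t \<omega> + (1 / real N) *\<^sub>R udev i v t \<omega>) \<le> 2 * n2p (ugap N) + 2 * n2p (\<lambda>t \<omega>. (1 / real N) *\<^sub>R udev i v t \<omega>)"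
        by (intro L2_add(2) L2_scaleR udev_L2 i v conjunct1[OF Cu(2)])
      also have "\<dots> \<le> 2 * (Cu * w) + 2 * w"
      proof (intro add_mono mult_left_mono)
        show "n2p (ugap N) \<le> Cu * w"
          using conjunct2[OF Cu(2)[OF i(2)]] mult_left_mono[OF ew(1), of Cu] Cu(1) by linarith
        have "(1 / real N)\<^sup>2 \<le> (eN N)\<^sup>2" using eN_props(4)[OF i(2)] by (intro power_mono) auto
        then have "(1 / real N)\<^sup>2 * n2p (udev i v) \<le> (eN N)\<^sup>2 * n2p (udev i v)" by (intro mult_right_mono) auto
        then show "n2p (\<lambda>t \<omega>. (1 / real N) *\<^sub>R udev i v t \<omega>) \<le> w" unfolding n2_scaleR using ew(2) by linarith
      qed simp_all
      finally have "n2p (\<lambda>t \<omega>. ugap N t \<omega> + (1 / real N) *\<^sub>R udev i v t \<omega>) \<le> (2 * Cu + 2) * w" by (simp add: distrib_right)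
      then have "cB * n2p (\<lambda>t \<omega>. ugap N t \<omega> + (1 / real N) *\<^sub>R udev i v t \<omega>) \<le> cB * ((2 * Cu + 2) * w)"
        using cB(1) by (intro mult_left_mono) auto
      with cB(2)[OF ul] show ?thesis by (simp add: mult.assoc)
    qed
    note pk = primitive_L2[OF kl]
    have cl: "L2p ?c" "L2 \<Omega> (?c T)"
      using L2_add(1)[OF L2_add(1)[OF L2p_snd(1)[OF L2_const[of "mf_avg N x0 - m0"]] no(1)] pk(1)]
        L2_add(1)[OF L2_add(1)[OF L2_const[of "mf_avg N x0 - m0"] no(3)] pk(3)[OF T_in(1)]] by simp_all
    have cb: "n2p ?c \<le> K * w"
    proof -
      have c0: "n2p (\<lambda>t \<omega>. mf_avg N x0 - m0) = T * (norm (mf_avg N x0 - m0))\<^sup>2"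
        using L2p_snd(2)[OF L2_const[of "mf_avg N x0 - m0"]] by (simp add: n2_def prob_space)
      have "n2p ?c \<le> 2 * n2p (\<lambda>t \<omega>. mf_avg N x0 - m0 + ?no t \<omega>) + 2 * n2p ?pk"
        by (rule L2_add(2)[OF L2_add(1)[OF L2p_snd(1)[OF L2_const] no(1)] pk(1)])
      also have "n2p (\<lambda>t \<omega>. mf_avg N x0 - m0 + ?no t \<omega>) \<le> 2 * n2p (\<lambda>t \<omega>. mf_avg N x0 - m0) + 2 * n2p ?no"
        by (rule L2_add(2)[OF L2p_snd(1)[OF L2_const] no(1)])
      also have "2 * (2 * n2p (\<lambda>t \<omega>. mf_avg N x0 - m0) + 2 * n2p ?no) + 2 * n2p ?pk
         \<le> 2 * (2 * (T * w) + 2 * (Cn * w)) + 2 * (T\<^sup>2 * ((cB * (2 * Cu + 2)) * w))"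
      proof (intro add_mono mult_left_mono no(2))
        show "n2p (\<lambda>t \<omega>. mf_avg N x0 - m0) \<le> T * w"
          unfolding c0 using eN_props(3)[OF i(2)] ew(1) T_pos by (intro mult_left_mono) auto
        show "n2p ?pk \<le> T\<^sup>2 * ((cB * (2 * Cu + 2)) * w)"
          by (rule order_trans[OF pk(2) mult_left_mono[OF kb]]) simp
      qed simp_all
      also have "\<dots> = K * w" by (simp add: K_def algebra_simps)
      finally show ?thesis by simp
    qed
    have AE1: "AE \<omega> in \<Omega>. ie_sol ((*v) (A + G)) T (\<lambda>t. ?c t \<omega>) (\<lambda>t. avg_err N i z x t \<omega>)"
      using deviation_paths[OF dv] by eventually_elim blast
    have AE2: "AE \<omega> in \<Omega>. ie_sol ((*v) A) T (\<lambda>t. \<integral>s\<in>{0..t}. G *v avg_err N i z x s \<omega> \<partial>lborel) (\<lambda>t. own_err i v z x t \<omega>)"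
      using deviation_paths[OF dv] by eventually_elim blast
    note a = C1(2)[OF cl err_measurable(1)[OF dv] AE1]
    have a1: "L2p (avg_err N i z x)" using a by blast
    have a2: "n2p (avg_err N i z x) \<le> L * w"
      unfolding L_def mult.assoc
      by (rule order_trans[OF conjunct1[OF conjunct2[OF a]] mult_left_mono[OF cb]]) (use C1(1) in simp)
    have gl: "L2p (\<lambda>t \<omega>. G *v avg_err N i z x t \<omega>)" by (rule L2_linear'[OF lin(1) a1])
    have gb: "n2p (\<lambda>t \<omega>. G *v avg_err N i z x t \<omega>) \<le> cG * (L * w)"
      by (rule order_trans[OF cG(2)[OF a1] mult_left_mono[OF a2]]) (use cG(1) in simp)
    note pg = primitive_L2[OF gl]
    note b = C2(2)[OF pg(1) pg(3)[OF T_in(1)] err_measurable(2)[OF dv] AE2]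
    let ?pg = "\<lambda>t \<omega>. \<integral>s\<in>{0..t}. G *v avg_err N i z x s \<omega> \<partial>lborel"
    have p1: "n2p ?pg \<le> T\<^sup>2 * (cG * (L * w))" by (rule order_trans[OF pg(2) mult_left_mono[OF gb]]) simp
    have p2: "n2 \<Omega> (?pg T) \<le> T * (cG * (L * w))"
      by (rule order_trans[OF pg(4)[OF T_in(1)] mult_left_mono[OF gb]]) simp
    have p3: "C2 * (n2p ?pg + n2 \<Omega> (?pg T)) \<le> C * w"
    proof -
      have "C2 * (n2p ?pg + n2 \<Omega> (?pg T)) \<le> C2 * (T\<^sup>2 * (cG * (L * w)) + T * (cG * (L * w)))"
        using C2(1) p1 p2 by (intro mult_left_mono add_mono) auto
      also have "\<dots> = (C2 * (T\<^sup>2 + T) * cG * L) * w" by (simp add: algebra_simps)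
      also have "\<dots> \<le> C * w" by (rule mult_right_mono[OF CL(2) ew(3)])
      finally show ?thesis .
    qed
    have "C2 * n2p ?pg \<le> C2 * (n2p ?pg + n2 \<Omega> (?pg T))" using C2(1) by (intro mult_left_mono) auto
    then have b1: "n2p (own_err i v z x) \<le> C * w" using b p3 by linarith
    have b2: "n2 \<Omega> (own_err i v z x T) \<le> C * w" using b p3 by linarith
    have a3: "n2p (avg_err N i z x) \<le> C * w" using a2 mult_right_mono[OF CL(1) ew(3)] by linarith
    show "L2p (avg_err N i z x) \<and> n2p (avg_err N i z x) \<le> C * ((eN N)\<^sup>2 * (1 + n2p (udev i v))) \<and>
      L2p (own_err i v z x) \<and> n2p (own_err i v z x) \<le> C * ((eN N)\<^sup>2 * (1 + n2p (udev i v))) \<and>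
      L2 \<Omega> (own_err i v z x T) \<and> n2 \<Omega> (own_err i v z x T) \<le> C * ((eN N)\<^sup>2 * (1 + n2p (udev i v)))"
      using a1 a3 b b1 b2 unfolding w_def[symmetric] by blast
  qed
qed

end

section \<open>Second-order expansion of the cost\<close>

lemma qf_L2_add:
  fixes S :: "real^'n^'n"
  assumes S: "sym_mat S" and f: "L2 \<mu> f" and h: "L2 \<mu> h"
  shows "(\<integral>x. qf S (f x + h x) \<partial>\<mu>) = (\<integral>x. qf S (f x) \<partial>\<mu>) + 2 * (\<integral>x. (S *v f x) \<bullet> h x \<partial>\<mu>) + (\<integral>x. qf S (h x) \<partial>\<mu>)"
proof -
  note i = qf_L2[OF f, of S] L2_inner(1)[OF L2_linear'[OF matrix_vector_mul_linear[of S] f] h] qf_L2[OF h, of S]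
  have "(\<integral>x. qf S (f x + h x) \<partial>\<mu>) = (\<integral>x. (qf S (f x) + 2 * ((S *v f x) \<bullet> h x)) + qf S (h x) \<partial>\<mu>)"
    unfolding qf_add[OF S] ..
  also have "\<dots> = (\<integral>x. qf S (f x) + 2 * ((S *v f x) \<bullet> h x) \<partial>\<mu>) + (\<integral>x. qf S (h x) \<partial>\<mu>)"
    by (intro bint_add bi_add i integrable_mult_right)
  also have "(\<integral>x. qf S (f x) + 2 * ((S *v f x) \<bullet> h x) \<partial>\<mu>) = (\<integral>x. qf S (f x) \<partial>\<mu>) + (\<integral>x. 2 * ((S *v f x) \<bullet> h x) \<partial>\<mu>)"
    by (intro bint_add i integrable_mult_right)
  finally show ?thesis by simp
qed

lemma qf_remainder_bound:
  fixes S :: "real^'n^'n"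
  obtains c where "c > 0"
    "\<And>\<mu> f h. L2 (\<mu> :: 'x measure) f \<Longrightarrow> L2 \<mu> h \<Longrightarrow>
      \<bar>2 * (\<integral>x. (S *v f x) \<bullet> h x \<partial>\<mu>) + (\<integral>x. qf S (h x) \<partial>\<mu>)\<bar> \<le> c * (sqrt (n2 \<mu> f) * sqrt (n2 \<mu> h) + n2 \<mu> h)"
proof -
  obtain c1 where c1: "c1 > 0" "\<And>N f. L2 N f \<Longrightarrow> n2 (N :: 'x measure) (\<lambda>x. S *v f x) \<le> c1 * n2 N f"
    using matrix_L2_bound by blast
  obtain c2 where c2: "c2 > 0" "\<And>N f. L2 N f \<Longrightarrow> \<bar>\<integral>x. qf S (f x) \<partial>(N :: 'x measure)\<bar> \<le> c2 * n2 N f"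
    using qf_L2_bound by blast
  have "\<bar>2 * (\<integral>x. (S *v f x) \<bullet> h x \<partial>\<mu>) + (\<integral>x. qf S (h x) \<partial>\<mu>)\<bar>
      \<le> (2 * sqrt c1 + c2) * (sqrt (n2 \<mu> f) * sqrt (n2 \<mu> h) + n2 \<mu> h)"
    if f: "L2 \<mu> f" and h: "L2 \<mu> h" for \<mu> :: "'x measure" and f h
  proof -
    let ?s = "sqrt (n2 \<mu> f) * sqrt (n2 \<mu> h)"
    have "\<bar>\<integral>x. (S *v f x) \<bullet> h x \<partial>\<mu>\<bar> \<le> sqrt (n2 \<mu> (\<lambda>x. S *v f x)) * sqrt (n2 \<mu> h)"
      by (rule L2_inner(2)[OF L2_linear'[OF matrix_vector_mul_linear f] h])
    also have "\<dots> \<le> sqrt (c1 * n2 \<mu> f) * sqrt (n2 \<mu> h)"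
      by (intro mult_right_mono real_sqrt_le_mono c1(2)[OF f]) simp
    also have "\<dots> = sqrt c1 * ?s" by (simp add: real_sqrt_mult)
    finally have 1: "\<bar>\<integral>x. (S *v f x) \<bullet> h x \<partial>\<mu>\<bar> \<le> sqrt c1 * ?s" .
    have "0 \<le> c2 * ?s" "0 \<le> sqrt c1 * n2 \<mu> h" using c1(1) c2(1) by simp_all
    moreover have "(2 * sqrt c1 + c2) * (?s + n2 \<mu> h) = 2 * (sqrt c1 * ?s) + 2 * (sqrt c1 * n2 \<mu> h) + c2 * ?s + c2 * n2 \<mu> h"
      by (simp add: algebra_simps)
    ultimately show ?thesis using 1 c2(2)[OF h] by linarith
  qed
  moreover have "2 * sqrt c1 + c2 > 0" using c1(1) c2(1) by (intro add_pos_pos) auto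
  ultimately show ?thesis using that by blast
qed

text \<open>F is the squared leading part and h the squared error. From 1 + n + g \<le> (1 + n)(1 +
  g) the mixed term is linear in e and contains g only under a root, and h itself loses one factor e
  to its upper bound E. This sublinear growth in g is what a coercive term in g can absorb.\<close>

lemma remainder_estimate:
  fixes n g e E K F h :: real
  assumes "0 \<le> n" "0 \<le> g" "0 < e" "e \<le> E" "0 \<le> K" "0 \<le> F" "0 \<le> h"
    and F: "F \<le> K * (1 + n + g)" and h: "h \<le> K * (e\<^sup>2 * (1 + n))"
  shows "sqrt F * sqrt h + h \<le> (K * (1 + E)) * (e * (1 + n) * sqrt (1 + g))"
proof -
  have "F * h \<le> (K * (1 + n + g)) * (K * (e\<^sup>2 * (1 + n)))"
    using assms by (intro mult_mono) auto
  also have "\<dots> \<le> (K * ((1 + n) * (1 + g))) * (K * (e\<^sup>2 * (1 + n)))"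
    using assms by (intro mult_right_mono mult_left_mono) (auto simp: algebra_simps)
  also have "\<dots> = (K * (e * (1 + n)))\<^sup>2 * (1 + g)" by (simp add: power2_eq_square algebra_simps)
  finally have "sqrt (F * h) \<le> sqrt ((K * (e * (1 + n)))\<^sup>2 * (1 + g))" by (rule real_sqrt_le_mono)
  also have "\<dots> = K * (e * (1 + n)) * sqrt (1 + g)" using assms by (simp add: real_sqrt_mult)
  finally have 1: "sqrt F * sqrt h \<le> K * (e * (1 + n)) * sqrt (1 + g)" by (simp add: real_sqrt_mult)
  have "h \<le> (K * (e * (1 + n))) * e" using h by (simp add: power2_eq_square algebra_simps)
  also have "\<dots> \<le> (K * (e * (1 + n))) * (E * sqrt (1 + g))"
  proof (rule mult_left_mono)
    have "e * 1 \<le> E * sqrt (1 + g)" using assms by (intro mult_mono) auto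
    then show "e \<le> E * sqrt (1 + g)" by simp
  qed (use assms in simp)
  finally have "h \<le> (K * (e * (1 + n))) * (E * sqrt (1 + g))" .
  with 1 have "sqrt F * sqrt h + h \<le> K * (e * (1 + n)) * sqrt (1 + g) + (K * (e * (1 + n))) * (E * sqrt (1 + g))" by linarith
  also have "\<dots> = (K * (1 + E)) * (e * (1 + n) * sqrt (1 + g))" by (simp add: algebra_simps)
  finally show ?thesis .
qed

context lq_game
begin

definition adev :: "nat \<Rightarrow> real \<Rightarrow> 'w \<Rightarrow> real^'n" where
  "adev i t \<omega> = X i t \<omega> - (\<Gamma> *v M i t + \<eta>)"

text \<open>The variation of the tracking error \<open>adev\<close>: the own state moves by the
  response plus z, and the average by z, whence z - \<Gamma> z. What is left of the true tracking
  error is \<open>rem_err\<close>.\<close>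

definition bdev :: "nat \<Rightarrow> (real \<Rightarrow> 'w \<Rightarrow> real^'k) \<Rightarrow> (real \<Rightarrow> real^'n) \<Rightarrow> real \<Rightarrow> 'w \<Rightarrow> real^'n" where
  "bdev i v z t \<omega> = xdev i v t \<omega> + (z t - \<Gamma> *v z t)"

definition rem_err :: "nat \<Rightarrow> nat \<Rightarrow> (real \<Rightarrow> 'w \<Rightarrow> real^'k) \<Rightarrow> (real \<Rightarrow> real^'n) \<Rightarrow> (nat \<Rightarrow> real \<Rightarrow> 'w \<Rightarrow> real^'n) \<Rightarrow> real \<Rightarrow> 'w \<Rightarrow> real^'n" where
  "rem_err N i v z x t \<omega> = own_err i v z x t \<omega> - \<Gamma> *v avg_err N i z x t \<omega>"

text \<open>The cost of player \<open>i\<close> in the limiting problem, and its second variation.\<close>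
definition Jlim :: "nat \<Rightarrow> real" where
  "Jlim i = (\<integral>p. qf Q (adev i (fst p) (snd p)) \<partial>PP) + (\<integral>p. qf R (Fb (Y i (fst p) (snd p))) \<partial>PP)
     - \<gamma> * n2 (leb T) (P i) + (\<integral>\<omega>. qf H (X i T \<omega>) \<partial>\<Omega>)"

definition quad :: "nat \<Rightarrow> (real \<Rightarrow> 'w \<Rightarrow> real^'k) \<Rightarrow> (real \<Rightarrow> real^'n) \<Rightarrow> (real \<Rightarrow> real^'n) \<Rightarrow> real" where
  "quad i v g z = (\<integral>p. qf Q (bdev i v z (fst p) (snd p)) \<partial>PP) + (\<integral>p. qf R (udev i v (fst p) (snd p)) \<partial>PP)
     - (1 / \<gamma>) * n2 (leb T) g + (\<integral>\<omega>. qf H (xdev i v T \<omega> + z T) \<partial>\<Omega>)"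

lemma game_cost_eq:
  assumes v: "L2p (u i)" and f: "L2 (leb T) f" and e: "L2p (\<lambda>t \<omega>. x i t \<omega> - (\<Gamma> *v mf_avg N (\<lambda>l. x l t \<omega>) + \<eta>))"
    and xT: "L2 \<Omega> (x i T)"
  shows "game_cost \<Gamma> \<eta> Q R H \<gamma> T \<Omega> N i u f x =
     (\<integral>p. qf Q (x i (fst p) (snd p) - (\<Gamma> *v mf_avg N (\<lambda>l. x l (fst p) (snd p)) + \<eta>)) \<partial>PP)
     + (\<integral>p. qf R (u i (fst p) (snd p)) \<partial>PP) - (1 / \<gamma>) * n2 (leb T) f + (\<integral>\<omega>. qf H (x i T \<omega>) \<partial>\<Omega>)"
proof -
  let ?q = "\<lambda>t \<omega>. qf Q (x i t \<omega> - (\<Gamma> *v mf_avg N (\<lambda>l. x l t \<omega>) + \<eta>))"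
  let ?F = "\<lambda>t \<omega>. ?q t \<omega> + qf R (u i t \<omega>) - (1 / \<gamma>) * (norm (f t))\<^sup>2"
  note q = qf_L2[OF e, of Q] and r = qf_L2[OF v, of R]
  have n: "integrable PP (\<lambda>p. (1 / \<gamma>) * (norm (f (fst p)))\<^sup>2)"
    using L2p_fst(1)[OF f] by (simp add: L2_def)
  have Fi: "integrable PP (\<lambda>p. ?F (fst p) (snd p))"
    by (intro bi_diff bi_add q r n)
  have Fi': "integrable PP (\<lambda>(t, \<omega>). ?F t \<omega>)" using Fi by (simp add: split_beta')
  have "game_cost \<Gamma> \<eta> Q R H \<gamma> T \<Omega> N i u f x = (\<integral>\<omega>. (\<integral>t. ?F t \<omega> \<partial>leb T) + qf H (x i T \<omega>) \<partial>\<Omega>)"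
    unfolding game_cost_def set_integral_leb' ..
  also have "\<dots> = (\<integral>\<omega>. (\<integral>t. ?F t \<omega> \<partial>leb T) \<partial>\<Omega>) + (\<integral>\<omega>. qf H (x i T \<omega>) \<partial>\<Omega>)"
    by (intro bint_add P.integrable_snd[OF Fi'] qf_L2[OF xT])
  also have "(\<integral>\<omega>. (\<integral>t. ?F t \<omega> \<partial>leb T) \<partial>\<Omega>) = (\<integral>p. ?F (fst p) (snd p) \<partial>PP)"
    unfolding P.integral_snd[OF Fi'] by (simp add: split_beta')
  also have "\<dots> = (\<integral>p. ?q (fst p) (snd p) + qf R (u i (fst p) (snd p)) \<partial>PP) - (\<integral>p. (1 / \<gamma>) * (norm (f (fst p)))\<^sup>2 \<partial>PP)"
    by (intro bint_diff bi_add q r n)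
  also have "(\<integral>p. ?q (fst p) (snd p) + qf R (u i (fst p) (snd p)) \<partial>PP)
      = (\<integral>p. ?q (fst p) (snd p) \<partial>PP) + (\<integral>p. qf R (u i (fst p) (snd p)) \<partial>PP)"
    by (intro bint_add q r)
  also have "(\<integral>p. (1 / \<gamma>) * (norm (f (fst p)))\<^sup>2 \<partial>PP) = (1 / \<gamma>) * n2 (leb T) f"
    using L2p_fst(2)[OF f] by (simp add: n2_def)
  finally show ?thesis .
qed

lemma adev_L2:
  assumes i: "1 \<le> i" shows "L2p (adev i)" "L2 (leb T) (\<lambda>t. \<Gamma> *v M i t + \<eta>)"
proof -
  show m: "L2 (leb T) (\<lambda>t. \<Gamma> *v M i t + \<eta>)"
    by (intro L2_add(1) L2_linear'[OF lin(1)] MP_L2(1)[OF i] leb.L2_const)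
  show "L2p (adev i)" unfolding adev_def by (intro L2_diff(1) fbsde(3)[OF i] L2p_fst(1)[OF m])
qed

lemma bdev_L2:
  assumes i: "1 \<le> i" "L2p v" and z: "continuous_on {0..T} z"
  shows "L2p (bdev i v z)" "L2 (leb T) (\<lambda>t. z t - \<Gamma> *v z t)" "L2 \<Omega> (\<lambda>\<omega>. xdev i v T \<omega> + z T)"
proof -
  show m: "L2 (leb T) (\<lambda>t. z t - \<Gamma> *v z t)"
    by (intro L2_diff(1) L2_linear'[OF lin(1)] L2_leb_continuous z)
  show "L2p (bdev i v z)" unfolding bdev_def by (intro L2_add(1) xdev_L2[OF i] L2p_fst(1)[OF m])
  show "L2 \<Omega> (\<lambda>\<omega>. xdev i v T \<omega> + z T)" by (intro L2_add(1) xdev_L2[OF i] L2_const)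
qed

lemma deviation_split:
  "x i t \<omega> - (\<Gamma> *v mf_avg N (\<lambda>l. x l t \<omega>) + \<eta>) = (adev i t \<omega> + bdev i v z t \<omega>) + rem_err N i v z x t \<omega>"
  "x i T = (\<lambda>\<omega>. (X i T \<omega> + (xdev i v T \<omega> + z T)) + own_err i v z x T \<omega>)"
  by (auto simp: adev_def bdev_def rem_err_def own_err_def avg_err_def matrix_vector_mult_diff_distrib)

lemma shift_bound:
  obtains C where "C > 0"
    "\<And>g z. L2 (leb T) g \<Longrightarrow> continuous_on {0..T} z \<Longrightarrow>
      (\<And>t. t \<in> {0..T} \<Longrightarrow> ((\<lambda>s. (A + G) *v z s + g s) has_integral z t) {0..t}) \<Longrightarrow>
      n2 (leb T) z \<le> C * n2 (leb T) g \<and> (norm (z T))\<^sup>2 \<le> C * n2 (leb T) g"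
proof -
  obtain C where C: "C > 0"
    "\<And>b. L2p b \<Longrightarrow> L2p (resp ((*v) (A + G)) b) \<and> n2p (resp ((*v) (A + G)) b) \<le> C * n2p b
       \<and> L2 \<Omega> (resp ((*v) (A + G)) b T) \<and> n2 \<Omega> (resp ((*v) (A + G)) b T) \<le> C * n2p b"
    using resp_bound[OF lin(1)[of "A + G"]] by blast
  show ?thesis
  proof (rule that[OF C(1)])
    fix g z assume g: "L2 (leb T) g" and zc: "continuous_on {0..T} z"
      and z: "\<And>t. t \<in> {0..T} \<Longrightarrow> ((\<lambda>s. (A + G) *v z s + g s) has_integral z t) {0..t}"
    let ?r = "resp ((*v) (A + G)) (\<lambda>t \<omega>. g t)"
    note gi = leb.L2_integrable(1)[OF g]
    have "ie_sol ((*v) (A + G)) T (\<lambda>t. 0 + (prim g t)) z"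
      by (rule ie_sol_forced[OF lin(1) gi]) (use z in auto)
    then have zs: "ie_sol ((*v) (A + G)) T (\<lambda>t. \<integral>s\<in>{0..t}. g s \<partial>lborel) z" by simp
    have r: "?r t \<omega> = z t" if "t \<in> {0..T}" for t \<omega>
      using ie_sol_unique[OF lin(1) resp_sol[of "(*v) (A + G)" "\<lambda>t \<omega>. g t" \<omega>, OF lin(1) gi] zs that] .
    have 1: "n2p ?r = n2p (\<lambda>t \<omega>. z t)" unfolding n2_def
      by (intro bint_cong refl) (auto simp: r space_pair_measure)
    have 2: "n2 \<Omega> (?r T) = (norm (z T))\<^sup>2" unfolding n2_def r[OF T_in(1)] by (simp add: prob_space)
    show "n2 (leb T) z \<le> C * n2 (leb T) g \<and> (norm (z T))\<^sup>2 \<le> C * n2 (leb T) g"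
      using C(2)[OF L2p_fst(1)[OF g]] unfolding 1 2 L2p_fst(2)[OF g] L2p_fst(2)[OF L2_leb_continuous[OF zc]] by blast
  qed
qed

text \<open>An exact expansion around the strategy and the disturbance \<gamma> P_i. The terms
  linear in the deviation cancel by the first-order condition; those containing the prediction
  errors are left unexpanded as the remainder.\<close>

lemma cost_identity:
  assumes dv: "deviation N i v f g z x"
    and r: "L2p (rem_err N i v z x)" and o: "L2 \<Omega> (own_err i v z x T)"
  shows "game_cost \<Gamma> \<eta> Q R H \<gamma> T \<Omega> N i ((uhat B R Y)(i := v)) f x = Jlim i + quad i v g z
    + (2 * (\<integral>p. (Q *v (adev i (fst p) (snd p) + bdev i v z (fst p) (snd p))) \<bullet> rem_err N i v z x (fst p) (snd p) \<partial>PP)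
       + (\<integral>p. qf Q (rem_err N i v z x (fst p) (snd p)) \<partial>PP))
    + (2 * (\<integral>\<omega>. (H *v (X i T \<omega> + (xdev i v T \<omega> + z T))) \<bullet> own_err i v z x T \<omega> \<partial>\<Omega>)
       + (\<integral>\<omega>. qf H (own_err i v z x T \<omega>) \<partial>\<Omega>))"
proof -
  have i: "1 \<le> i" "i \<in> {1..N}" and v: "L2p v" and f: "L2 (leb T) f" and g: "L2 (leb T) g"
    and pv: "prog_meas \<Omega> W {1..N} T v" and zc: "continuous_on {0..T} z"
    and z: "\<And>t. t \<in> {0..T} \<Longrightarrow> ((\<lambda>s. (A + G) *v z s + g s) has_integral z t) {0..t}"
    using dv unfolding deviation_def by auto
  have fg: "f t = \<gamma> *\<^sub>R P i t + g t" if "t \<in> {0..T}" for t using dv that unfolding deviation_def by blast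
  note a = adev_L2(1)[OF i(1)] and b = bdev_L2[OF i(1) v zc] and nu = udev_L2[OF i(1) v]
  note ab = L2_add(1)[OF a b(1)] and XT = XT_L2(1)[OF i(1)] and FY = Fb_Y_L2[OF i(1)] and PL = MP_L2(2)[OF i(1)]
  note XTb = L2_add(1)[OF XT b(3)]
  have sub: "{1..N} \<subseteq> {1..}" by auto
  have pn: "prog_meas \<Omega> W {1..N} T (udev i v)"
    unfolding udev_def using i by (intro prog_diff pv prog_linear[OF lin(2)] prog_mono[OF fbsde(2)[OF i(1)]]) auto
  have fo: "(\<integral>p. (Q *v adev i (fst p) (snd p)) \<bullet> bdev i v z (fst p) (snd p) \<partial>PP)
     + (\<integral>p. (R *v Fb (Y i (fst p) (snd p))) \<bullet> udev i v (fst p) (snd p) \<partial>PP) - (\<integral>s. P i s \<bullet> g s \<partial>leb T)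
     + (\<integral>\<omega>. (H *v X i T \<omega>) \<bullet> (xdev i v T \<omega> + z T) \<partial>\<Omega>) = 0"
    using first_order_zero[OF i(2) sub pn nu g zc z] unfolding bdev_def adev_def xdev_def drift_def .
  have 1: "(\<integral>p. qf Q (x i (fst p) (snd p) - (\<Gamma> *v mf_avg N (\<lambda>l. x l (fst p) (snd p)) + \<eta>)) \<partial>PP)
      = (\<integral>p. qf Q (adev i (fst p) (snd p)) \<partial>PP) + 2 * (\<integral>p. (Q *v adev i (fst p) (snd p)) \<bullet> bdev i v z (fst p) (snd p) \<partial>PP)
        + (\<integral>p. qf Q (bdev i v z (fst p) (snd p)) \<partial>PP)
        + 2 * (\<integral>p. (Q *v (adev i (fst p) (snd p) + bdev i v z (fst p) (snd p))) \<bullet> rem_err N i v z x (fst p) (snd p) \<partial>PP)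
        + (\<integral>p. qf Q (rem_err N i v z x (fst p) (snd p)) \<partial>PP)"
    unfolding deviation_split(1)[where v = v and z = z] qf_L2_add[OF Qsym ab r] qf_L2_add[OF Qsym a b(1)] ..
  have 2: "(\<integral>\<omega>. qf H (x i T \<omega>) \<partial>\<Omega>) = (\<integral>\<omega>. qf H (X i T \<omega>) \<partial>\<Omega>) + 2 * (\<integral>\<omega>. (H *v X i T \<omega>) \<bullet> (xdev i v T \<omega> + z T) \<partial>\<Omega>)
        + (\<integral>\<omega>. qf H (xdev i v T \<omega> + z T) \<partial>\<Omega>)
        + 2 * (\<integral>\<omega>. (H *v (X i T \<omega> + (xdev i v T \<omega> + z T))) \<bullet> own_err i v z x T \<omega> \<partial>\<Omega>)
        + (\<integral>\<omega>. qf H (own_err i v z x T \<omega>) \<partial>\<Omega>)"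
    unfolding deviation_split(2)[where v = v and z = z and x = x and i = i] qf_L2_add[OF Hsym XTb o] qf_L2_add[OF Hsym XT b(3)] ..
  have "(\<lambda>p. qf R (((uhat B R Y)(i := v)) i (fst p) (snd p))) = (\<lambda>p. qf R (Fb (Y i (fst p) (snd p)) + udev i v (fst p) (snd p)))"
    by (simp add: udev_def)
  then have 3: "(\<integral>p. qf R (((uhat B R Y)(i := v)) i (fst p) (snd p)) \<partial>PP) = (\<integral>p. qf R (Fb (Y i (fst p) (snd p))) \<partial>PP)
      + 2 * (\<integral>p. (R *v Fb (Y i (fst p) (snd p))) \<bullet> udev i v (fst p) (snd p) \<partial>PP) + (\<integral>p. qf R (udev i v (fst p) (snd p)) \<partial>PP)"
    using qf_L2_add[OF Rsym FY nu] by simp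
  have "n2 (leb T) f = (\<integral>s. (\<gamma>\<^sup>2 * (norm (P i s))\<^sup>2 + (2 * \<gamma>) * (P i s \<bullet> g s)) + (norm (g s))\<^sup>2 \<partial>leb T)"
    unfolding n2_def
  proof (intro bint_cong refl)
    fix s assume "s \<in> space (leb T)"
    then have "f s = \<gamma> *\<^sub>R P i s + g s" by (intro fg) simp
    then show "(norm (f s))\<^sup>2 = \<gamma>\<^sup>2 * (norm (P i s))\<^sup>2 + (2 * \<gamma>) * (P i s \<bullet> g s) + (norm (g s))\<^sup>2"
      unfolding power2_norm_eq_inner
      by (simp add: inner_add_left inner_add_right inner_commute power2_eq_square[of \<gamma>])
  qed
  also have "\<dots> = \<gamma>\<^sup>2 * n2 (leb T) (P i) + (2 * \<gamma>) * (\<integral>s. P i s \<bullet> g s \<partial>leb T) + n2 (leb T) g"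
    using L2_inner(1)[OF PL g] PL g unfolding n2_def L2_def by simp
  finally have "(1 / \<gamma>) * n2 (leb T) f = (1 / \<gamma>) * (\<gamma>\<^sup>2 * n2 (leb T) (P i) + (2 * \<gamma>) * (\<integral>s. P i s \<bullet> g s \<partial>leb T) + n2 (leb T) g)" by simp
  \<comment> \<open>Expanding |\<gamma> P_i + g|^2 / \<gamma> separates the value at \<gamma> P_i,
    the cross term of the first-order condition and the quadratic term of the second
    variation.\<close>
  then have 4: "(1 / \<gamma>) * n2 (leb T) f = \<gamma> * n2 (leb T) (P i) + 2 * (\<integral>s. P i s \<bullet> g s \<partial>leb T) + (1 / \<gamma>) * n2 (leb T) g"
    using gam by (simp add: distrib_left power2_eq_square add_divide_distrib)
  have e: "L2p (\<lambda>t \<omega>. x i t \<omega> - (\<Gamma> *v mf_avg N (\<lambda>l. x l t \<omega>) + \<eta>))"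
    unfolding deviation_split(1)[where v = v and z = z] by (rule L2_add(1)[OF ab r])
  have xT: "L2 \<Omega> (x i T)" unfolding deviation_split(2)[where v = v and z = z and x = x and i = i] by (rule L2_add(1)[OF XTb o])
  have vv: "L2p (((uhat B R Y)(i := v)) i)" using v by simp
  show ?thesis
    unfolding game_cost_eq[where u = "(uhat B R Y)(i := v)" and i = i and f = f and x = x and N = N, OF vv f e xT] 1 2 3 4 Jlim_def quad_def
    using fo by linarith
qed

end

section \<open>Cost estimate and signs of the second variation\<close>

context lq_game
begin

lemma adev_bound:
  obtains K where "K > 0" "\<And>i. 1 \<le> i \<Longrightarrow> n2p (adev i) \<le> K \<and> n2 \<Omega> (X i T) \<le> K \<and> n2p (\<lambda>t \<omega>. Fb (Y i t \<omega>)) \<le> K"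
proof -
  obtain Ku where Ku: "Ku > 0"
    "\<And>i. 1 \<le> i \<Longrightarrow> n2p (X i) \<le> Ku \<and> n2 \<Omega> (X i T) \<le> Ku \<and> n2 (leb T) (M i) \<le> Ku \<and> n2 (leb T) (P i) \<le> Ku
      \<and> n2p (\<lambda>t \<omega>. Fb (Y i t \<omega>)) \<le> Ku"
    using uniform_bounds by blast
  obtain cG where cG: "cG > 0" "\<And>N f. L2 N f \<Longrightarrow> n2 (N :: real measure) (\<lambda>x. \<Gamma> *v f x) \<le> cG * n2 N f"
    using matrix_L2_bound by blast
  define k where "k = T * (norm \<eta>)\<^sup>2"
  have k0: "0 \<le> k" "0 \<le> cG * Ku" using T_pos Ku(1) cG(1) by (simp_all add: k_def)
  define K where "K = 2 * Ku + 4 * (cG * Ku) + 4 * k"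
  have "n2p (adev i) \<le> K \<and> n2 \<Omega> (X i T) \<le> K \<and> n2p (\<lambda>t \<omega>. Fb (Y i t \<omega>)) \<le> K" if i: "1 \<le> i" for i
  proof -
    have "n2p (adev i) \<le> 2 * n2p (X i) + 2 * n2p (\<lambda>t \<omega>. \<Gamma> *v M i t + \<eta>)"
      unfolding adev_def by (rule L2_diff(2)[OF fbsde(3)[OF i] L2p_fst(1)[OF adev_L2(2)[OF i]]])
    also have "n2p (\<lambda>t \<omega>. \<Gamma> *v M i t + \<eta>) = n2 (leb T) (\<lambda>t. \<Gamma> *v M i t + \<eta>)" by (rule L2p_fst(2)[OF adev_L2(2)[OF i]])
    also have "2 * n2p (X i) + 2 * n2 (leb T) (\<lambda>t. \<Gamma> *v M i t + \<eta>) \<le> 2 * Ku + 2 * (2 * (cG * Ku) + 2 * k)"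
    proof (intro add_mono mult_left_mono)
      have "n2 (leb T) (\<lambda>t. \<Gamma> *v M i t + \<eta>) \<le> 2 * n2 (leb T) (\<lambda>t. \<Gamma> *v M i t) + 2 * n2 (leb T) (\<lambda>t. \<eta>)"
        by (intro L2_add(2) L2_linear'[OF lin(1)] MP_L2(1)[OF i] leb.L2_const)
      also have "\<dots> \<le> 2 * (cG * Ku) + 2 * k"
      proof (intro add_mono mult_left_mono)
        show "n2 (leb T) (\<lambda>t. \<Gamma> *v M i t) \<le> cG * Ku"
          by (rule order_trans[OF cG(2)[OF MP_L2(1)[OF i]] mult_left_mono]) (use Ku(2)[OF i] cG(1) in auto)
        show "n2 (leb T) (\<lambda>t. \<eta>) \<le> k" using measure_leb[of T] by (simp add: n2_def k_def)
      qed simp_all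
      finally show "n2 (leb T) (\<lambda>t. \<Gamma> *v M i t + \<eta>) \<le> 2 * (cG * Ku) + 2 * k" .
    qed (use Ku(2)[OF i] in auto)
    finally have "n2p (adev i) \<le> K" by (simp add: K_def)
    moreover have "Ku \<le> K" unfolding K_def using k0 Ku(1) by linarith
    ultimately show ?thesis using Ku(2)[OF i] by (meson order_trans)
  qed
  moreover have "K > 0" unfolding K_def using Ku(1) k0 by linarith
  ultimately show ?thesis using that by blast
qed

lemma Jlim_bound:
  obtains K where "\<And>i. 1 \<le> i \<Longrightarrow> Jlim i \<le> K"
proof -
  obtain Ka where Ka: "Ka > 0" "\<And>i. 1 \<le> i \<Longrightarrow> n2p (adev i) \<le> Ka \<and> n2 \<Omega> (X i T) \<le> Ka \<and> n2p (\<lambda>t \<omega>. Fb (Y i t \<omega>)) \<le> Ka"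
    using adev_bound by blast
  obtain cQ where cQ: "cQ > 0" "\<And>N f. L2 N f \<Longrightarrow> \<bar>\<integral>x. qf Q (f x) \<partial>(N :: (real \<times> 'w) measure)\<bar> \<le> cQ * n2 N f"
    using qf_L2_bound by blast
  obtain cR where cR: "cR > 0" "\<And>N f. L2 N f \<Longrightarrow> \<bar>\<integral>x. qf R (f x) \<partial>(N :: (real \<times> 'w) measure)\<bar> \<le> cR * n2 N f"
    using qf_L2_bound by blast
  obtain cH where cH: "cH > 0" "\<And>N f. L2 N f \<Longrightarrow> \<bar>\<integral>x. qf H (f x) \<partial>(N :: 'w measure)\<bar> \<le> cH * n2 N f"
    using qf_L2_bound by blast
  have "Jlim i \<le> cQ * Ka + cR * Ka + cH * Ka" if i: "1 \<le> i" for i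
  proof -
    have 1: "cQ * n2p (adev i) \<le> cQ * Ka" "cR * n2p (\<lambda>t \<omega>. Fb (Y i t \<omega>)) \<le> cR * Ka" "cH * n2 \<Omega> (X i T) \<le> cH * Ka"
      using Ka(2)[OF i] cQ(1) cR(1) cH(1) by auto
    have "0 \<le> \<gamma> * n2 (leb T) (P i)" using gam by simp
    then show ?thesis unfolding Jlim_def
      using 1 cQ(2)[OF adev_L2(1)[OF i]] cR(2)[OF Fb_Y_L2[OF i]] cH(2)[OF XT_L2(1)[OF i]] by linarith
  qed
  then show ?thesis by (rule that)
qed

lemma cost_estimate:
  obtains C where "C > 0"
    "\<And>N i v f g z x. deviation N i v f g z x \<Longrightarrow>
      \<bar>game_cost \<Gamma> \<eta> Q R H \<gamma> T \<Omega> N i ((uhat B R Y)(i := v)) f x - (Jlim i + quad i v g z)\<bar>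
       \<le> C * (eN N * (1 + n2p (udev i v)) * sqrt (1 + n2 (leb T) g))"
proof -
  obtain Ka where Ka: "Ka > 0" "\<And>i. 1 \<le> i \<Longrightarrow> n2p (adev i) \<le> Ka \<and> n2 \<Omega> (X i T) \<le> Ka \<and> n2p (\<lambda>t \<omega>. Fb (Y i t \<omega>)) \<le> Ka"
    using adev_bound by blast
  obtain Cp where Cp: "Cp > 0"
    "\<And>N i v f g z x. deviation N i v f g z x \<Longrightarrow>
      L2p (avg_err N i z x) \<and> n2p (avg_err N i z x) \<le> Cp * ((eN N)\<^sup>2 * (1 + n2p (udev i v))) \<and>
      L2p (own_err i v z x) \<and> n2p (own_err i v z x) \<le> Cp * ((eN N)\<^sup>2 * (1 + n2p (udev i v))) \<and>
      L2 \<Omega> (own_err i v z x T) \<and> n2 \<Omega> (own_err i v z x T) \<le> Cp * ((eN N)\<^sup>2 * (1 + n2p (udev i v)))"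
    by (fact perturbation)
  obtain Cz where Cz: "Cz > 0"
    "\<And>g z. L2 (leb T) g \<Longrightarrow> continuous_on {0..T} z \<Longrightarrow>
      (\<And>t. t \<in> {0..T} \<Longrightarrow> ((\<lambda>s. (A + G) *v z s + g s) has_integral z t) {0..t}) \<Longrightarrow>
      n2 (leb T) z \<le> Cz * n2 (leb T) g \<and> (norm (z T))\<^sup>2 \<le> Cz * n2 (leb T) g"
    by (fact shift_bound)
  obtain Cr where Cr: "Cr > 0"
    "\<And>b. L2p b \<Longrightarrow> L2p (resp ((*v) A) b) \<and> n2p (resp ((*v) A) b) \<le> Cr * n2p b
       \<and> L2 \<Omega> (resp ((*v) A) b T) \<and> n2 \<Omega> (resp ((*v) A) b T) \<le> Cr * n2p b"
    using resp_bound[OF lin(1)[of A]] by blast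
  obtain cB where cB: "cB > 0"
    "\<And>N f. L2 N f \<Longrightarrow> n2 (N :: (real \<times> 'w) measure) (\<lambda>x. B *v f x) \<le> cB * n2 N f"
    using matrix_L2_bound by blast
  obtain cG where cG: "cG > 0" "\<And>N f. L2 N f \<Longrightarrow> n2 (N :: real measure) (\<lambda>x. \<Gamma> *v f x) \<le> cG * n2 N f"
    using matrix_L2_bound by blast
  obtain cG2 where cG2: "cG2 > 0" "\<And>N f. L2 N f \<Longrightarrow> n2 (N :: (real \<times> 'w) measure) (\<lambda>x. \<Gamma> *v f x) \<le> cG2 * n2 N f"
    using matrix_L2_bound by blast
  obtain c1 where c1: "c1 > 0"
    "\<And>\<mu> f h. L2 (\<mu> :: (real \<times> 'w) measure) f \<Longrightarrow> L2 \<mu> h \<Longrightarrow>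
      \<bar>2 * (\<integral>x. (Q *v f x) \<bullet> h x \<partial>\<mu>) + (\<integral>x. qf Q (h x) \<partial>\<mu>)\<bar> \<le> c1 * (sqrt (n2 \<mu> f) * sqrt (n2 \<mu> h) + n2 \<mu> h)"
    using qf_remainder_bound by blast
  obtain c2 where c2: "c2 > 0"
    "\<And>\<mu> f h. L2 (\<mu> :: 'w measure) f \<Longrightarrow> L2 \<mu> h \<Longrightarrow>
      \<bar>2 * (\<integral>x. (H *v f x) \<bullet> h x \<partial>\<mu>) + (\<integral>x. qf H (h x) \<partial>\<mu>)\<bar> \<le> c2 * (sqrt (n2 \<mu> f) * sqrt (n2 \<mu> h) + n2 \<mu> h)"
    using qf_remainder_bound by blast
  define E where "E = 1 + M0 + norm m0"
  have E: "0 < E" unfolding E_def using M0_nonneg by (intro add_pos_nonneg add_nonneg_nonneg) auto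
  define a1 where "a1 = Cr * cB"
  define a2 where "a2 = cG * Cz"
  define a3 where "a3 = cG2 * Cp"
  have pos: "0 \<le> a1" "0 \<le> a2" "0 \<le> a3" "0 \<le> Cz" "0 \<le> Cp" "0 \<le> Ka"
    using Cr(1) cB(1) cG(1) Cz(1) cG2(1) Cp(1) Ka(1) by (simp_all add: a1_def a2_def a3_def)
  \<comment> \<open>One constant for four purposes: it bounds the two leading parts, running and
    terminal, relative to 1 + n + g, and the two errors relative to w, so that a single remainder
    estimate serves both cost terms.\<close>
  define K where "K = 2 * Ka + 4 * a1 + 8 * Cz + 8 * a2 + 2 * Cp + 2 * a3"
  have K: "0 \<le> K" unfolding K_def using pos by linarith
  define C where "C = (c1 + c2) * (K * (1 + E)) + 1"
  have C: "C > 0" unfolding C_def using c1(1) c2(1) K E by (intro add_nonneg_pos) auto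
  show ?thesis
  proof (rule that[OF C])
    fix N i v f g z x assume dv: "deviation N i v f g z x"
    have i: "1 \<le> i" "1 \<le> N" and v: "L2p v" and g: "L2 (leb T) g" and zc: "continuous_on {0..T} z"
      and z: "\<And>t. t \<in> {0..T} \<Longrightarrow> ((\<lambda>s. (A + G) *v z s + g s) has_integral z t) {0..t}"
      using dv unfolding deviation_def by auto
    define n where "n = n2p (udev i v)"
    define gg where "gg = n2 (leb T) g"
    define w where "w = (eN N)\<^sup>2 * (1 + n)"
    have n0: "0 \<le> n" "0 \<le> gg" "0 \<le> w" by (simp_all add: n_def gg_def w_def)
    note a = adev_L2(1)[OF i(1)] and b = bdev_L2[OF i(1) v zc] and nu = udev_L2[OF i(1) v]
    note p = Cp(2)[OF dv, folded n_def, folded w_def]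
    have pa: "L2p (avg_err N i z x)" "n2p (avg_err N i z x) \<le> Cp * w" "L2p (own_err i v z x)" "n2p (own_err i v z x) \<le> Cp * w"
      "L2 \<Omega> (own_err i v z x T)" "n2 \<Omega> (own_err i v z x T) \<le> Cp * w" using p by auto
    have zb: "n2 (leb T) z \<le> Cz * gg" "(norm (z T))\<^sup>2 \<le> Cz * gg"
      using Cz(2)[OF g zc z] unfolding gg_def by auto
    have xb: "n2p (xdev i v) \<le> a1 * n" "n2 \<Omega> (xdev i v T) \<le> a1 * n"
    proof -
      have "Cr * n2p (\<lambda>t \<omega>. B *v udev i v t \<omega>) \<le> Cr * (cB * n)"
        using cB(2)[OF nu] Cr(1) unfolding n_def by (intro mult_left_mono) auto
      then show "n2p (xdev i v) \<le> a1 * n" "n2 \<Omega> (xdev i v T) \<le> a1 * n"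
        using Cr(2)[OF L2_linear'[OF lin(1) nu]] unfolding xdev_def a1_def mult.assoc by (meson order_trans)+
    qed
    have gz: "n2 (leb T) (\<lambda>t. z t - \<Gamma> *v z t) \<le> 2 * (Cz * gg) + 2 * (a2 * gg)"
    proof -
      have zL: "L2 (leb T) z" by (rule L2_leb_continuous[OF zc])
      have "n2 (leb T) (\<lambda>t. z t - \<Gamma> *v z t) \<le> 2 * n2 (leb T) z + 2 * n2 (leb T) (\<lambda>t. \<Gamma> *v z t)"
        by (rule L2_diff(2)[OF zL L2_linear'[OF lin(1) zL]])
      moreover have "n2 (leb T) (\<lambda>t. \<Gamma> *v z t) \<le> a2 * gg" unfolding a2_def mult.assoc
        by (rule order_trans[OF cG(2)[OF zL] mult_left_mono[OF zb(1)]]) (use cG(1) in simp)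
      ultimately show ?thesis using zb(1) by linarith
    qed
    have bb: "n2p (bdev i v z) \<le> 2 * (a1 * n) + 4 * (Cz * gg) + 4 * (a2 * gg)"
    proof -
      have "n2p (bdev i v z) \<le> 2 * n2p (xdev i v) + 2 * n2p (\<lambda>t \<omega>. z t - \<Gamma> *v z t)"
        unfolding bdev_def by (rule L2_add(2)[OF xdev_L2(1)[OF i(1) v] L2p_fst(1)[OF b(2)]])
      then show ?thesis using xb(1) gz unfolding L2p_fst(2)[OF b(2)] by linarith
    qed
    have Ksum: "K * (1 + n + gg) = 2 * Ka + 4 * a1 + 8 * Cz + 8 * a2 + 2 * Cp + 2 * a3
        + 2 * (Ka * n) + 4 * (a1 * n) + 8 * (Cz * n) + 8 * (a2 * n) + 2 * (Cp * n) + 2 * (a3 * n)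
        + 2 * (Ka * gg) + 4 * (a1 * gg) + 8 * (Cz * gg) + 8 * (a2 * gg) + 2 * (Cp * gg) + 2 * (a3 * gg)"
      by (simp add: K_def algebra_simps)
    have pp: "0 \<le> Ka * n" "0 \<le> a1 * n" "0 \<le> Cz * n" "0 \<le> a2 * n" "0 \<le> Cp * n" "0 \<le> a3 * n"
      "0 \<le> Ka * gg" "0 \<le> a1 * gg" "0 \<le> Cz * gg" "0 \<le> a2 * gg" "0 \<le> Cp * gg" "0 \<le> a3 * gg"
      using pos n0 by simp_all
    have F1: "n2p (\<lambda>t \<omega>. adev i t \<omega> + bdev i v z t \<omega>) \<le> K * (1 + n + gg)"
    proof -
      have "n2p (\<lambda>t \<omega>. adev i t \<omega> + bdev i v z t \<omega>) \<le> 2 * n2p (adev i) + 2 * n2p (bdev i v z)"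
        by (rule L2_add(2)[OF a b(1)])
      moreover have "n2p (adev i) \<le> Ka" using Ka(2)[OF i(1)] by blast
      ultimately show ?thesis unfolding Ksum using bb pp pos by linarith
    qed
    have F2: "n2 \<Omega> (\<lambda>\<omega>. X i T \<omega> + (xdev i v T \<omega> + z T)) \<le> K * (1 + n + gg)"
    proof -
      have "n2 \<Omega> (\<lambda>\<omega>. X i T \<omega> + (xdev i v T \<omega> + z T)) \<le> 2 * n2 \<Omega> (X i T) + 2 * n2 \<Omega> (\<lambda>\<omega>. xdev i v T \<omega> + z T)"
        by (rule L2_add(2)[OF XT_L2(1)[OF i(1)] b(3)])
      moreover have "n2 \<Omega> (\<lambda>\<omega>. xdev i v T \<omega> + z T) \<le> 2 * n2 \<Omega> (xdev i v T) + 2 * n2 \<Omega> (\<lambda>\<omega>. z T)"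
        by (rule L2_add(2)[OF xdev_L2(2)[OF i(1) v] L2_const])
      moreover have "n2 \<Omega> (\<lambda>\<omega>. z T) = (norm (z T))\<^sup>2" by (simp add: n2_def prob_space)
      moreover have "n2 \<Omega> (X i T) \<le> Ka" using Ka(2)[OF i(1)] by blast
      ultimately show ?thesis unfolding Ksum using xb(2) zb(2) pp pos by linarith
    qed
    have G1: "L2p (\<lambda>t \<omega>. \<Gamma> *v avg_err N i z x t \<omega>)" by (rule L2_linear'[OF lin(1) pa(1)])
    have rL: "L2p (rem_err N i v z x)" unfolding rem_err_def by (rule L2_diff(1)[OF pa(3) G1])
    have Kw: "K * w = 2 * (Ka * w) + 4 * (a1 * w) + 8 * (Cz * w) + 8 * (a2 * w) + 2 * (Cp * w) + 2 * (a3 * w)"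
      by (simp add: K_def algebra_simps)
    have pw: "0 \<le> Ka * w" "0 \<le> a1 * w" "0 \<le> Cz * w" "0 \<le> a2 * w" "0 \<le> Cp * w" "0 \<le> a3 * w"
      using pos n0 by simp_all
    have h1: "n2p (rem_err N i v z x) \<le> K * w"
    proof -
      have "n2p (rem_err N i v z x) \<le> 2 * n2p (own_err i v z x) + 2 * n2p (\<lambda>t \<omega>. \<Gamma> *v avg_err N i z x t \<omega>)"
        unfolding rem_err_def by (rule L2_diff(2)[OF pa(3) G1])
      moreover have "n2p (\<lambda>t \<omega>. \<Gamma> *v avg_err N i z x t \<omega>) \<le> a3 * w" unfolding a3_def mult.assoc
        by (rule order_trans[OF cG2(2)[OF pa(1)] mult_left_mono[OF pa(2)]]) (use cG2(1) in simp)
      ultimately show ?thesis unfolding Kw using pa(4) pw by linarith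
    qed
    have h2: "n2 \<Omega> (own_err i v z x T) \<le> K * w" unfolding Kw using pa(6) pw by linarith
    let ?t = "eN N * (1 + n) * sqrt (1 + gg)"
    have t0: "0 \<le> ?t" using eN_props(1)[OF i(2)] n0 by simp
    have est: "sqrt F * sqrt h + h \<le> (K * (1 + E)) * ?t" if "0 \<le> F" "0 \<le> h" "F \<le> K * (1 + n + gg)" "h \<le> K * w" for F h
      using remainder_estimate[OF n0(1,2) eN_props(1)[OF i(2)] eN_props(5)[OF i(2), folded E_def] K that(1,2,3)] that(4)
      unfolding w_def by blast
    have e1: "\<bar>2 * (\<integral>p. (Q *v (adev i (fst p) (snd p) + bdev i v z (fst p) (snd p))) \<bullet> rem_err N i v z x (fst p) (snd p) \<partial>PP)
       + (\<integral>p. qf Q (rem_err N i v z x (fst p) (snd p)) \<partial>PP)\<bar> \<le> c1 * ((K * (1 + E)) * ?t)"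
      by (rule order_trans[OF c1(2)[OF L2_add(1)[OF a b(1)] rL] mult_left_mono[OF est[OF _ _ F1 h1]]]) (use c1(1) in auto)
    have e2: "\<bar>2 * (\<integral>\<omega>. (H *v (X i T \<omega> + (xdev i v T \<omega> + z T))) \<bullet> own_err i v z x T \<omega> \<partial>\<Omega>)
       + (\<integral>\<omega>. qf H (own_err i v z x T \<omega>) \<partial>\<Omega>)\<bar> \<le> c2 * ((K * (1 + E)) * ?t)"
      by (rule order_trans[OF c2(2)[OF L2_add(1)[OF XT_L2(1)[OF i(1)] b(3)] pa(5)] mult_left_mono[OF est[OF _ _ F2 h2]]])
        (use c2(1) in auto)
    have "C * ?t = c1 * ((K * (1 + E)) * ?t) + c2 * ((K * (1 + E)) * ?t) + ?t" by (simp add: C_def algebra_simps)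
    then show "\<bar>game_cost \<Gamma> \<eta> Q R H \<gamma> T \<Omega> N i ((uhat B R Y)(i := v)) f x - (Jlim i + quad i v g z)\<bar>
       \<le> C * (eN N * (1 + n2p (udev i v)) * sqrt (1 + n2 (leb T) g))"
      unfolding cost_identity[OF dv rL pa(5)] n_def[symmetric] gg_def[symmetric] using e1 e2 t0 by linarith
  qed
qed

text \<open>Expanding around the mean, the linear term integrates to zero and the quadratic form of
  the centred part is nonnegative.\<close>

lemma qf_jensen:
  fixes S :: "real^'q^'q"
  assumes S: "psd S" and f: "L2 \<Omega> f"
  shows "qf S (expectation f) \<le> (\<integral>\<omega>. qf S (f \<omega>) \<partial>\<Omega>)"
proof -
  let ?m = "expectation f"
  have sS: "sym_mat S" using S by (simp add: psd_def)
  have h: "L2 \<Omega> (\<lambda>\<omega>. f \<omega> - ?m)" by (intro L2_diff(1) f L2_const)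
  have "(\<integral>\<omega>. qf S (f \<omega>) \<partial>\<Omega>) = (\<integral>\<omega>. qf S (?m + (f \<omega> - ?m)) \<partial>\<Omega>)" by simp
  also have "\<dots> = qf S ?m + 2 * (\<integral>\<omega>. (S *v ?m) \<bullet> (f \<omega> - ?m) \<partial>\<Omega>) + (\<integral>\<omega>. qf S (f \<omega> - ?m) \<partial>\<Omega>)"
    unfolding qf_L2_add[OF sS L2_const h] by (simp add: prob_space)
  also have "(\<integral>\<omega>. (S *v ?m) \<bullet> (f \<omega> - ?m) \<partial>\<Omega>) = 0"
    using L2_integrable(1)[OF f] by (simp add: prob_space)
  finally have "(\<integral>\<omega>. qf S (f \<omega>) \<partial>\<Omega>) = qf S ?m + (\<integral>\<omega>. qf S (f \<omega> - ?m) \<partial>\<Omega>)" by simp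
  moreover have "(\<integral>\<omega>. qf S (f \<omega> - ?m) \<partial>\<Omega>) \<ge> 0" using S by (intro Bochner_Integration.integral_nonneg) (simp add: psd_def)
  ultimately show ?thesis by simp
qed

lemma qf_jensen_paths:
  fixes S :: "real^'q^'q"
  assumes S: "psd S" and u: "L2p u"
  shows "(\<integral>s. qf S (expectation (u s)) \<partial>leb T) \<le> (\<integral>p. qf S (u (fst p) (snd p)) \<partial>PP)"
proof -
  have i: "integrable PP (\<lambda>(s, \<omega>). qf S (u s \<omega>))" using qf_L2[OF u, of S] by (simp add: split_beta')
  have "(\<integral>s. qf S (expectation (u s)) \<partial>leb T) \<le> (\<integral>s. (\<integral>\<omega>. qf S (u s \<omega>) \<partial>\<Omega>) \<partial>leb T)"
  proof (rule integral_mono_AE)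
    show "integrable (leb T) (\<lambda>s. qf S (expectation (u s)))" by (rule qf_L2[OF mean_L2(1)[OF u]])
    show "integrable (leb T) (\<lambda>s. \<integral>\<omega>. qf S (u s \<omega>) \<partial>\<Omega>)" by (rule P.integrable_fst[OF i])
    show "AE s in leb T. qf S (expectation (u s)) \<le> (\<integral>\<omega>. qf S (u s \<omega>) \<partial>\<Omega>)"
      using sections(1)[OF u] by eventually_elim (rule qf_jensen[OF S])
  qed
  also have "\<dots> = (\<integral>p. qf S (u (fst p) (snd p)) \<partial>PP)"
    unfolding P.integral_fst[OF i] by (simp add: split_beta')
  finally show ?thesis .
qed

text \<open>The disturbance must be deterministic, so it can answer only the mean of the deviation.
  Jensen reduces the random deviation to that mean, and for a deterministic control with g =
  \<gamma> q the second variation is the functional of (H2).\<close>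

lemma quad_nonneg:
  obtains C where "C > 0"
    "\<And>i v. 1 \<le> i \<Longrightarrow> L2p v \<Longrightarrow> \<exists>g z. L2 (leb T) g \<and> g \<in> borel_measurable (leb T) \<and> continuous_on {0..T} z \<and>
      (\<forall>t\<in>{0..T}. ((\<lambda>s. (A + G) *v z s + g s) has_integral z t) {0..t}) \<and>
      n2 (leb T) g \<le> C * n2p (udev i v) \<and> 0 \<le> quad i v g z"
proof -
  obtain C where C: "C > 0"
    "\<And>\<nu>. L2 (leb T) \<nu> \<Longrightarrow> \<exists>zi z q. continuous_on {0..T} zi \<and> continuous_on {0..T} z \<and> continuous_on {0..T} q \<and>
      (\<forall>t\<in>{0..T}. ((\<lambda>s. A *v zi s + B *v \<nu> s + G *v z s + \<gamma> *\<^sub>R q s) has_integral zi t) {0..t}) \<and>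
      (\<forall>t\<in>{0..T}. ((\<lambda>s. (A + G) *v z s + \<gamma> *\<^sub>R q s) has_integral z t) {0..t}) \<and>
      n2 (leb T) q \<le> C * n2 (leb T) \<nu> \<and>
      (\<integral>t. qf Q (zi t - \<Gamma> *v z t) + qf R (\<nu> t) - \<gamma> * (norm (q t))\<^sup>2 \<partial>leb T) + qf H (zi T) \<ge> 0"
    by (fact H2_response)
  have "\<exists>g z. L2 (leb T) g \<and> g \<in> borel_measurable (leb T) \<and> continuous_on {0..T} z \<and>
      (\<forall>t\<in>{0..T}. ((\<lambda>s. (A + G) *v z s + g s) has_integral z t) {0..t}) \<and>
      n2 (leb T) g \<le> (\<gamma>\<^sup>2 * C) * n2p (udev i v) \<and> 0 \<le> quad i v g z" if i: "1 \<le> i" and v: "L2p v" for i v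
  proof -
    note nu = udev_L2[OF i v]
    let ?\<nu> = "\<lambda>s. expectation (udev i v s)"
    note mn = mean_L2[OF nu]
    obtain zi z q where zi: "continuous_on {0..T} zi" and zc: "continuous_on {0..T} z" and qc: "continuous_on {0..T} q"
      and e1: "\<forall>t\<in>{0..T}. ((\<lambda>s. A *v zi s + B *v ?\<nu> s + G *v z s + \<gamma> *\<^sub>R q s) has_integral zi t) {0..t}"
      and e2: "\<forall>t\<in>{0..T}. ((\<lambda>s. (A + G) *v z s + \<gamma> *\<^sub>R q s) has_integral z t) {0..t}"
      and qb: "n2 (leb T) q \<le> C * n2 (leb T) ?\<nu>"
      and pos: "0 \<le> (\<integral>t. qf Q (zi t - \<Gamma> *v z t) + qf R (?\<nu> t) - \<gamma> * (norm (q t))\<^sup>2 \<partial>leb T) + qf H (zi T)"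
      using C(2)[OF mn(1)] by (elim exE conjE) (rule that)
    note qL = L2_leb_continuous[OF qc]
    have gL: "L2 (leb T) (\<lambda>t. \<gamma> *\<^sub>R q t)" by (rule L2_scaleR[OF qL])
    have "n2 (leb T) q \<le> C * n2p (udev i v)"
      by (rule order_trans[OF qb mult_left_mono[OF mn(2)]]) (use C(1) in simp)
    then have gb: "n2 (leb T) (\<lambda>t. \<gamma> *\<^sub>R q t) \<le> (\<gamma>\<^sup>2 * C) * n2p (udev i v)"
      unfolding n2_scaleR mult.assoc by (rule mult_left_mono) simp
    have Bn: "L2p (\<lambda>t \<omega>. B *v udev i v t \<omega>)" by (rule L2_linear'[OF lin(1) nu])
    have BnL: "L2 (leb T) (\<lambda>s. B *v ?\<nu> s)" by (rule L2_linear'[OF lin(1) mn(1)])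
    have s1: "ie_sol ((*v) A) T (\<lambda>t. \<integral>s\<in>{0..t}. expectation (\<lambda>\<omega>. B *v udev i v s \<omega>) \<partial>lborel) (\<lambda>t. expectation (xdev i v t))"
      unfolding xdev_def by (rule mean_resp[OF lin(1) Bn])
    have "ie_sol ((*v) A) T (\<lambda>t. 0 + (prim (\<lambda>s. B *v ?\<nu> s) t)) (\<lambda>t. zi t - z t)"
    proof (rule ie_sol_forced[OF lin(1) leb.L2_integrable(1)[OF BnL]])
      fix t assume t: "t \<in> {0..T}"
      have "((\<lambda>s. (A *v zi s + B *v ?\<nu> s + G *v z s + \<gamma> *\<^sub>R q s) - ((A + G) *v z s + \<gamma> *\<^sub>R q s)) has_integral (zi t - z t)) {0..t}"
        by (intro has_integral_diff e1[rule_format] e2[rule_format] t)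
      moreover have "(A *v zi s + B *v ?\<nu> s + G *v z s + \<gamma> *\<^sub>R q s) - ((A + G) *v z s + \<gamma> *\<^sub>R q s) = A *v (zi s - z s) + B *v ?\<nu> s" for s
        unfolding matrix_vector_mult_add_rdistrib matrix_vector_mult_diff_distrib by simp
      ultimately show "((\<lambda>s. A *v (zi s - z s) + B *v ?\<nu> s) has_integral zi t - z t - 0) {0..t}"
        by (simp only: diff_0_right)
    qed simp
    then have s2: "ie_sol ((*v) A) T (\<lambda>t. \<integral>s\<in>{0..t}. B *v ?\<nu> s \<partial>lborel) (\<lambda>t. zi t - z t)" by simp
    have "(prim (\<lambda>s. expectation (\<lambda>\<omega>. B *v udev i v s \<omega>)) t) = (prim (\<lambda>s. B *v ?\<nu> s) t)" if t: "t \<in> {0..T}" for t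
    proof -
      have st: "0 \<le> (0::real)" "t \<le> T" using t by auto
      have ind: "indicat_real {0..t} \<in> borel_measurable (leb T)"
        using sets_leb[OF st] by (intro borel_measurable_indicator)
      show ?thesis unfolding set_integral_leb[OF st]
      proof (rule integral_cong_AE)
        show "(\<lambda>s. indicat_real {0..t} s *\<^sub>R expectation (\<lambda>\<omega>. B *v udev i v s \<omega>)) \<in> borel_measurable (leb T)"
          by (intro borel_measurable_scaleR ind L2_measurable[OF mean_L2(1)[OF Bn]])
        show "(\<lambda>s. indicat_real {0..t} s *\<^sub>R (B *v ?\<nu> s)) \<in> borel_measurable (leb T)"
          by (intro borel_measurable_scaleR ind L2_measurable[OF BnL])
        show "AE s in leb T. indicat_real {0..t} s *\<^sub>R expectation (\<lambda>\<omega>. B *v udev i v s \<omega>) = indicat_real {0..t} s *\<^sub>R (B *v ?\<nu> s)"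
          using L2p_integrable_section[OF nu] by eventually_elim (simp add: mean_linear(1)[OF lin(1)])
      qed
    qed
    \<comment> \<open>The mean response and z_i - z solve the same equation driven by B times the
      mean deviation. Hence the mean of \<open>bdev\<close> is z_i - \<Gamma> z, the tracking error
      in (H2).\<close>
    then have th: "expectation (xdev i v t) = zi t - z t" if "t \<in> {0..T}" for t
      by (intro ie_sol_unique[OF lin(1) ie_sol_cong[OF s1] s2 that]) blast
    note b = bdev_L2[OF i v zc]
    have Rpsd: "psd R"
    proof -
      have "0 \<le> qf R w" for w using Rpd by (cases "w = 0") (auto simp: pd_def qf_def intro: less_imp_le)
      then show ?thesis using Rpd by (simp add: psd_def pd_def)
    qed
    have zd: "L2 (leb T) (\<lambda>t. zi t - \<Gamma> *v z t)"
      by (intro L2_diff(1) L2_linear'[OF lin(1)] L2_leb_continuous zi zc)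
    have mb: "(\<integral>s. qf Q (expectation (bdev i v z s)) \<partial>leb T) = (\<integral>s. qf Q (zi s - \<Gamma> *v z s) \<partial>leb T)"
    proof (rule integral_cong_AE)
      show "(\<lambda>s. qf Q (expectation (bdev i v z s))) \<in> borel_measurable (leb T)"
        using qf_L2[OF mean_L2(1)[OF b(1)], of Q] by auto
      show "(\<lambda>s. qf Q (zi s - \<Gamma> *v z s)) \<in> borel_measurable (leb T)" using qf_L2[OF zd, of Q] by auto
      have sp: "AE s in leb T. s \<in> {0..T}" by (rule AE_I2) simp
      show "AE s in leb T. qf Q (expectation (bdev i v z s)) = qf Q (zi s - \<Gamma> *v z s)"
        using L2p_integrable_section[OF xdev_L2(1)[OF i v]] sp
      proof eventually_elim
        case (elim s)
        then have "expectation (bdev i v z s) = expectation (xdev i v s) + (z s - \<Gamma> *v z s)"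
          unfolding bdev_def by (simp add: prob_space)
        then show ?case using th elim by simp
      qed
    qed
    have mT: "expectation (\<lambda>\<omega>. xdev i v T \<omega> + z T) = zi T"
      using L2_integrable(1)[OF xdev_L2(2)[OF i v]] th[OF T_in(1)] by (simp add: prob_space)
    have split: "(\<integral>t. qf Q (zi t - \<Gamma> *v z t) + qf R (?\<nu> t) - \<gamma> * (norm (q t))\<^sup>2 \<partial>leb T)
        = (\<integral>t. qf Q (zi t - \<Gamma> *v z t) \<partial>leb T) + (\<integral>t. qf R (?\<nu> t) \<partial>leb T) - \<gamma> * n2 (leb T) q"
      using qf_L2[OF zd, of Q] qf_L2[OF mn(1), of R] qL unfolding n2_def L2_def by simp
    have "(1 / \<gamma>) * n2 (leb T) (\<lambda>t. \<gamma> *\<^sub>R q t) = \<gamma> * n2 (leb T) q"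
      unfolding n2_scaleR using gam by (simp add: power2_eq_square)
    then have "0 \<le> quad i v (\<lambda>t. \<gamma> *\<^sub>R q t) z"
      unfolding quad_def using pos qf_jensen_paths[OF Qpsd b(1)] qf_jensen_paths[OF Rpsd nu] qf_jensen[OF Hpsd b(3)]
      unfolding split mb mT by linarith
    with gL gb zc e2 show ?thesis using L2_measurable[OF gL] by blast
  qed
  moreover have "\<gamma>\<^sup>2 * C > 0" using gam C(1) by simp
  ultimately show ?thesis using that by blast
qed

text \<open>Without a deviation the response vanishes, and the second variation becomes minus the
  functional of (H1); its coercivity constant is the one returned.\<close>

lemma quad_uhat_upper:
  obtains \<epsilon> where "\<epsilon> > 0"
    "\<And>i g z. 1 \<le> i \<Longrightarrow> L2 (leb T) g \<Longrightarrow> continuous_on {0..T} z \<Longrightarrow>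
      (\<And>t. t \<in> {0..T} \<Longrightarrow> ((\<lambda>s. (A + G) *v z s + g s) has_integral z t) {0..t}) \<Longrightarrow>
      quad i (uhat B R Y i) g z \<le> - (\<epsilon> * n2 (leb T) g)"
proof -
  obtain e where e: "e > 0"
    "\<And>g z. g \<in> L2fun T \<Longrightarrow> (\<And>t. t \<in> {0..T} \<Longrightarrow> ((\<lambda>s. (A + G) *v z s + g s) has_integral z t) {0..t}) \<Longrightarrow>
      e * L2sq T g \<le> (prim (\<lambda>t. - qf (transpose (mat 1 - \<Gamma>) ** Q ** (mat 1 - \<Gamma>)) (z t)
                   + (1 / \<gamma>) * (norm (g t))\<^sup>2) T) - qf H (z T)"
    by (fact H1E[OF hyp1])
  show ?thesis
  proof (rule that[OF e(1)])
    fix i :: nat and g z :: "real \<Rightarrow> real^'n"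
    assume i: "1 \<le> i" and g: "L2 (leb T) g" and zc: "continuous_on {0..T} z"
      and z: "\<And>t. t \<in> {0..T} \<Longrightarrow> ((\<lambda>s. (A + G) *v z s + g s) has_integral z t) {0..t}"
    let ?g = "\<lambda>s. indicator {0..T} s *\<^sub>R g s"
    have zg: "((\<lambda>s. (A + G) *v z s + ?g s) has_integral z t) {0..t}" if "t \<in> {0..T}" for t
      using z[OF that] by (rule has_integral_eq[rotated]) (use that in auto)
    have u0: "udev i (uhat B R Y i) = (\<lambda>t \<omega>. 0)" by (intro ext) (simp add: udev_def uhat_def)
    have x0': "xdev i (uhat B R Y i) t \<omega> = 0" if t: "t \<in> {0..T}" for t \<omega>
    proof -
      have "ie_sol ((*v) A) T (\<lambda>t. 0) (\<lambda>t. resp ((*v) A) (\<lambda>t \<omega>. B *v udev i (uhat B R Y i) t \<omega>) t \<omega>)"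
        using resp_sol[of "(*v) A" "\<lambda>t \<omega>. B *v udev i (uhat B R Y i) t \<omega>" \<omega>, OF lin(1)] unfolding u0 by simp
      from ie_sol_zero[OF lin(1) this t] show ?thesis by (simp add: xdev_def)
    qed
    have zL: "L2 (leb T) (\<lambda>t. z t - \<Gamma> *v z t)" by (intro L2_diff(1) L2_linear'[OF lin(1)] L2_leb_continuous zc)
    have q1: "(\<integral>p. qf Q (bdev i (uhat B R Y i) z (fst p) (snd p)) \<partial>PP) = (\<integral>s. qf Q (z s - \<Gamma> *v z s) \<partial>leb T)"
    proof -
      have "(\<integral>p. qf Q (bdev i (uhat B R Y i) z (fst p) (snd p)) \<partial>PP) = (\<integral>p. qf Q (z (fst p) - \<Gamma> *v z (fst p)) \<partial>PP)"
        by (intro bint_cong refl) (auto simp: bdev_def x0' space_pair_measure)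
      also have "\<dots> = (\<integral>s. qf Q (z s - \<Gamma> *v z s) \<partial>leb T)"
        by (rule integrable_fst_PP(2)[OF qf_L2[OF zL]])
      finally show ?thesis .
    qed
    have q2: "(\<integral>\<omega>. qf H (xdev i (uhat B R Y i) T \<omega> + z T) \<partial>\<Omega>) = qf H (z T)" by (simp add: x0' prob_space)
    have q3: "(\<integral>p. qf R (udev i (uhat B R Y i) (fst p) (snd p)) \<partial>PP) = 0" by (simp add: u0 qf_def)
    have "(prim (\<lambda>t. - qf (transpose (mat 1 - \<Gamma>) ** Q ** (mat 1 - \<Gamma>)) (z t) + (1 / \<gamma>) * (norm (?g t))\<^sup>2) T)
        = (\<integral>s. - qf Q (z s - \<Gamma> *v z s) + (1 / \<gamma>) * (norm (g s))\<^sup>2 \<partial>leb T)"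
      unfolding set_integral_leb'
    proof (intro bint_cong refl)
      fix s assume "s \<in> space (leb T)"
      moreover have "qf (transpose (mat 1 - \<Gamma>) ** Q ** (mat 1 - \<Gamma>)) (z s) = (transpose (mat 1 - \<Gamma>) *v (Q *v (z s - \<Gamma> *v z s))) \<bullet> z s"
        by (simp add: qf_def matrix_vector_mul_assoc[symmetric] matrix_vector_mult_diff_rdistrib inner_commute)
      moreover have "\<dots> = qf Q (z s - \<Gamma> *v z s)"
        unfolding inner_transpose by (simp add: qf_def matrix_vector_mult_diff_rdistrib inner_commute)
      ultimately show "- qf (transpose (mat 1 - \<Gamma>) ** Q ** (mat 1 - \<Gamma>)) (z s) + (1 / \<gamma>) * (norm (?g s))\<^sup>2
        = - qf Q (z s - \<Gamma> *v z s) + (1 / \<gamma>) * (norm (g s))\<^sup>2" by simp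
    qed
    also have "\<dots> = - (\<integral>s. qf Q (z s - \<Gamma> *v z s) \<partial>leb T) + (1 / \<gamma>) * n2 (leb T) g"
      using qf_L2[OF zL, of Q] g unfolding n2_def L2_def by simp
    finally have "e * n2 (leb T) g \<le> - (\<integral>s. qf Q (z s - \<Gamma> *v z s) \<partial>leb T) + (1 / \<gamma>) * n2 (leb T) g - qf H (z T)"
      using e(2)[OF indicator_L2fun(1)[OF g] zg] unfolding indicator_L2fun(2)[OF g] by simp
    then show "quad i (uhat B R Y i) g z \<le> - (e * n2 (leb T) g)"
      unfolding quad_def q1 q2 q3 by linarith
  qed
qed

end

text \<open>With s = sqrt g and sqrt(1 + g) \<le> 1 + s, completing the square gives C e s -
  \<epsilon> s^2 \<le> (C e)^2 / (4 \<epsilon>); the square of e is then reduced to E e.\<close>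

lemma absorb_linear_term:
  fixes C e E \<epsilon> g :: real
  assumes "0 < \<epsilon>" "0 \<le> C" "0 \<le> e" "e \<le> E" "0 \<le> g"
  shows "C * (e * sqrt (1 + g)) - \<epsilon> * g \<le> (C + C\<^sup>2 * E / (4 * \<epsilon>)) * e"
proof -
  define s where "s = sqrt g"
  have s: "0 \<le> s" "g = s\<^sup>2" using assms by (simp_all add: s_def)
  have "sqrt (1 + g) \<le> 1 + s"
    by (rule real_le_lsqrt) (use s in \<open>simp_all add: power2_eq_square algebra_simps\<close>)
  then have "C * (e * sqrt (1 + g)) \<le> C * (e * (1 + s))" using assms by (intro mult_left_mono) auto
  moreover have "0 \<le> (C * e - 2 * \<epsilon> * s)\<^sup>2" by simp
  then have "4 * \<epsilon> * (C * e * s - \<epsilon> * s\<^sup>2) \<le> (C * e)\<^sup>2" by (simp add: power2_eq_square algebra_simps)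
  then have "C * e * s - \<epsilon> * s\<^sup>2 \<le> (C * e)\<^sup>2 / (4 * \<epsilon>)"
    using assms(1) by (simp add: pos_le_divide_eq mult.commute)
  moreover have "(C * e)\<^sup>2 / (4 * \<epsilon>) \<le> C\<^sup>2 * E / (4 * \<epsilon>) * e"
  proof -
    have "e * e \<le> E * e" using assms by (intro mult_right_mono) auto
    then have "C\<^sup>2 * (e * e) \<le> C\<^sup>2 * (E * e)" by (intro mult_left_mono) auto
    then have "(C * e)\<^sup>2 \<le> C\<^sup>2 * E * e" by (simp add: power2_eq_square algebra_simps)
    then have "(C * e)\<^sup>2 / (4 * \<epsilon>) \<le> (C\<^sup>2 * E * e) / (4 * \<epsilon>)" using assms(1) by (intro divide_right_mono) auto
    then show ?thesis by simp
  qed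
  ultimately show ?thesis unfolding s(2) by (simp add: algebra_simps)
qed

section \<open>Worst-case bounds and the equilibrium property\<close>

context lq_game
begin

abbreviation Jdev :: "nat \<Rightarrow> nat \<Rightarrow> (real \<Rightarrow> 'w \<Rightarrow> real^'k) \<Rightarrow> (real \<Rightarrow> real^'n) \<Rightarrow> real" where
  "Jdev N i v f \<equiv> J_cost A B G D \<Gamma> \<eta> Q R H \<gamma> T \<Omega> W x0 N i ((uhat B R Y)(i := v)) f"

lemma adm_controls_L2: "v \<in> adm_controls \<Omega> W T N \<Longrightarrow> prog_meas \<Omega> W {1..N} T v \<and> L2p v"
  using prog_L2p[of "{1..N}" v] by (auto simp: adm_controls_def)

lemma sq_integrable_if_L2p:
  fixes u :: "real \<Rightarrow> 'w \<Rightarrow> 'v::euclidean_space"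
  assumes u: "L2p u"
  shows "sq_integrable \<Omega> T u"
proof -
  have [measurable]: "(\<lambda>p. u (fst p) (snd p)) \<in> borel_measurable PP" by (rule L2_measurable[OF u])
  have "(\<integral>\<^sup>+ \<omega>. (\<integral>\<^sup>+ t\<in>{0..T}. ennreal ((norm (u t \<omega>))\<^sup>2) \<partial>lborel) \<partial>\<Omega>)
      = (\<integral>\<^sup>+ \<omega>. (\<integral>\<^sup>+ t. ennreal ((norm (u t \<omega>))\<^sup>2) \<partial>leb T) \<partial>\<Omega>)"
    by (intro nn_integral_cong, subst nn_integral_restrict_space) simp_all
  also have "\<dots> = (\<integral>\<^sup>+ p. ennreal ((norm (u (fst p) (snd p)))\<^sup>2) \<partial>PP)"
    using P.nn_integral_snd[of "\<lambda>p. ennreal ((norm (u (fst p) (snd p)))\<^sup>2)"] by simp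
  also have "\<dots> < \<infinity>" using u unfolding L2_def integrable_iff_bounded by simp
  finally show ?thesis unfolding sq_integrable_def .
qed

lemma uhat_adm:
  assumes i: "i \<in> {1..N}"
  shows "uhat B R Y i \<in> adm_controls \<Omega> W T N"
proof -
  have i1: "1 \<le> i" using i by simp
  have e: "uhat B R Y i = (\<lambda>t \<omega>. Fb (Y i t \<omega>))" by (intro ext) (simp add: uhat_def)
  have p: "prog_meas \<Omega> W {1..N} T (uhat B R Y i)"
    unfolding e using i by (intro prog_linear[OF lin(2)] prog_mono[OF fbsde(2)[OF i1]]) auto
  have "sq_integrable \<Omega> T (uhat B R Y i)" by (rule sq_integrable_if_L2p[OF uhat_L2[OF i1]])
  with p show ?thesis by (simp add: adm_controls_def)
qed

lemma shift_exists:
  assumes g: "L2 (leb T) g"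
  obtains z where "continuous_on {0..T} z"
    "\<And>t. t \<in> {0..T} \<Longrightarrow> ((\<lambda>s. (A + G) *v z s + g s) has_integral z t) {0..t}"
proof -
  note gi = leb.L2_integrable(1)[OF g]
  have s: "ie_sol ((*v) (A + G)) T (\<lambda>t. \<integral>s\<in>{0..t}. g s \<partial>lborel) (ie_formula ((*v) (A + G)) (\<lambda>t. \<integral>s\<in>{0..t}. g s \<partial>lborel))"
    (is "ie_sol _ _ _ ?z")
    by (rule ie_formula_sol[OF lin(1) continuous_on_int_leb[OF gi]])
  note p = ie_sol_primitive[OF lin(1) gi s]
  have "((\<lambda>s. (A + G) *v ?z s + g s) has_integral ?z t) {0..t}" if t: "t \<in> {0..T}" for t
    unfolding p(2)[OF t] using t by (intro has_integral_leb[OF p(1)]) auto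
  with ie_sol_continuous[OF s] show ?thesis by (rule that)
qed

text \<open>The estimates hold for every state of the game. Once existence is known, the state
  chosen in the definition of the cost is one of them.\<close>

lemma J_deviation:
  fixes v :: "real \<Rightarrow> 'w \<Rightarrow> real^'k"
  assumes i: "i \<in> {1..N}" and v: "v \<in> adm_controls \<Omega> W T N" and f: "L2 (leb T) f" and g: "L2 (leb T) g"
    and fg: "\<And>t. t \<in> {0..T} \<Longrightarrow> f t = \<gamma> *\<^sub>R P i t + g t" and zc: "continuous_on {0..T} z"
    and z: "\<And>t. t \<in> {0..T} \<Longrightarrow> ((\<lambda>s. (A + G) *v z s + g s) has_integral z t) {0..t}"
  obtains x where "deviation N i v f g z x"
    "Jdev N i v f = game_cost \<Gamma> \<eta> Q R H \<gamma> T \<Omega> N i ((uhat B R Y)(i := v)) f x"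
proof -
  have N: "1 \<le> N" using i by auto
  note v2 = adm_controls_L2[OF v]
  have "\<exists>x. game_state A B G D T \<Omega> W x0 N ((uhat B R Y)(i := v)) f x"
    by (rule game_state_exists[OF N _ f]) (use v2 uhat_L2 in auto)
  from someI_ex[OF this] have "deviation N i v f g z (SOME x. game_state A B G D T \<Omega> W x0 N ((uhat B R Y)(i := v)) f x)"
    unfolding deviation_def using assms v2 by blast
  then show ?thesis by (rule that) (simp add: J_cost_def)
qed

text \<open>An arbitrary disturbance f is written as \<gamma> P_i + g with g = f - \<gamma> P_i.
  However large g is, the coercive loss \<epsilon> |g|^2 dominates the error of the cost estimate,
  so the bound is uniform in f.\<close>

lemma J_uhat_upper:
  obtains C where "C > 0"
    "\<And>N i f. i \<in> {1..N} \<Longrightarrow> f \<in> L2fun T \<Longrightarrow> Jdev N i (uhat B R Y i) f \<le> Jlim i + C * eN N"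
proof -
  obtain C where C: "C > 0"
    "\<And>N i v f g z x. deviation N i v f g z x \<Longrightarrow>
      \<bar>game_cost \<Gamma> \<eta> Q R H \<gamma> T \<Omega> N i ((uhat B R Y)(i := v)) f x - (Jlim i + quad i v g z)\<bar>
       \<le> C * (eN N * (1 + n2p (udev i v)) * sqrt (1 + n2 (leb T) g))"
    by (fact cost_estimate)
  obtain \<epsilon> where \<epsilon>: "\<epsilon> > 0"
    "\<And>i g z. 1 \<le> i \<Longrightarrow> L2 (leb T) g \<Longrightarrow> continuous_on {0..T} z \<Longrightarrow>
      (\<And>t. t \<in> {0..T} \<Longrightarrow> ((\<lambda>s. (A + G) *v z s + g s) has_integral z t) {0..t}) \<Longrightarrow>
      quad i (uhat B R Y i) g z \<le> - (\<epsilon> * n2 (leb T) g)"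
    by (fact quad_uhat_upper)
  let ?C = "C + C\<^sup>2 * (1 + M0 + norm m0) / (4 * \<epsilon>)"
  have main: "Jdev N i (uhat B R Y i) f \<le> Jlim i + ?C * eN N" if i: "i \<in> {1..N}" and f: "f \<in> L2fun T" for N i f
  proof -
    have i1: "1 \<le> i" "1 \<le> N" using i by auto
    have fL: "L2 (leb T) f" using f L2_leb_iff_L2fun[of f T] by (simp add: L2fun_def)
    have gL: "L2 (leb T) (\<lambda>s. f s - \<gamma> *\<^sub>R P i s)" by (intro L2_diff(1) fL L2_scaleR MP_L2(2)[OF i1(1)])
    obtain z where z: "continuous_on {0..T} z"
      "\<And>t. t \<in> {0..T} \<Longrightarrow> ((\<lambda>s. (A + G) *v z s + (f s - \<gamma> *\<^sub>R P i s)) has_integral z t) {0..t}"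
      using shift_exists[OF gL] by blast
    let ?gg = "n2 (leb T) (\<lambda>s. f s - \<gamma> *\<^sub>R P i s)"
    have u0: "n2p (udev i (uhat B R Y i)) = 0" by (simp add: udev_def uhat_def n2_def)
    obtain x where x: "deviation N i (uhat B R Y i) f (\<lambda>s. f s - \<gamma> *\<^sub>R P i s) z x"
      "Jdev N i (uhat B R Y i) f = game_cost \<Gamma> \<eta> Q R H \<gamma> T \<Omega> N i ((uhat B R Y)(i := uhat B R Y i)) f x"
      by (rule J_deviation[OF i uhat_adm[OF i] fL gL _ z]) simp_all
    from C(2)[OF x(1), folded x(2)] have "Jdev N i (uhat B R Y i) f \<le> Jlim i + quad i (uhat B R Y i) (\<lambda>s. f s - \<gamma> *\<^sub>R P i s) z + C * (eN N * sqrt (1 + ?gg))"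
      unfolding u0 by simp
    moreover have "quad i (uhat B R Y i) (\<lambda>s. f s - \<gamma> *\<^sub>R P i s) z \<le> - (\<epsilon> * ?gg)" by (rule \<epsilon>(2)[OF i1(1) gL z])
    moreover have "C * (eN N * sqrt (1 + ?gg)) - \<epsilon> * ?gg \<le> ?C * eN N"
      by (rule absorb_linear_term[OF \<epsilon>(1) _ _ eN_props(5)[OF i1(2)]]) (use C(1) eN_props(1)[OF i1(2)] in auto)
    ultimately show ?thesis by linarith
  qed
  have "?C > 0" using C(1) \<epsilon>(1) M0_nonneg by (intro add_pos_nonneg divide_nonneg_pos mult_nonneg_nonneg add_nonneg_nonneg) auto
  from this main show ?thesis by (rule that)
qed

text \<open>The squared size of the answering g is bounded by that of the deviation, hence by
  \<kappa>, and the error of the cost estimate becomes a constant depending on \<kappa> times the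
  rate.\<close>

lemma J_deviation_lower:
  assumes \<kappa>: "0 \<le> \<kappa>"
  obtains C where "C > 0"
    "\<And>N i v. i \<in> {1..N} \<Longrightarrow> v \<in> adm_controls \<Omega> W T N \<Longrightarrow> n2p (udev i v) \<le> \<kappa> \<Longrightarrow>
      \<exists>f\<in>L2fun T. Jlim i - C * eN N \<le> Jdev N i v f"
proof -
  obtain C where C: "C > 0"
    "\<And>N i v f g z x. deviation N i v f g z x \<Longrightarrow>
      \<bar>game_cost \<Gamma> \<eta> Q R H \<gamma> T \<Omega> N i ((uhat B R Y)(i := v)) f x - (Jlim i + quad i v g z)\<bar>
       \<le> C * (eN N * (1 + n2p (udev i v)) * sqrt (1 + n2 (leb T) g))"
    by (fact cost_estimate)
  obtain Cq where Cq: "Cq > 0"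
    "\<And>i v. 1 \<le> i \<Longrightarrow> L2p v \<Longrightarrow> \<exists>g z. L2 (leb T) g \<and> g \<in> borel_measurable (leb T) \<and> continuous_on {0..T} z \<and>
      (\<forall>t\<in>{0..T}. ((\<lambda>s. (A + G) *v z s + g s) has_integral z t) {0..t}) \<and>
      n2 (leb T) g \<le> Cq * n2p (udev i v) \<and> 0 \<le> quad i v g z"
    by (fact quad_nonneg)
  let ?C = "C * ((1 + \<kappa>) * sqrt (1 + Cq * \<kappa>))"
  have main: "\<exists>f\<in>L2fun T. Jlim i - ?C * eN N \<le> Jdev N i v f"
    if i: "i \<in> {1..N}" and v: "v \<in> adm_controls \<Omega> W T N" and n: "n2p (udev i v) \<le> \<kappa>" for N i v
  proof -
    have i1: "1 \<le> i" "1 \<le> N" using i by auto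
    obtain g z where g: "L2 (leb T) g" and zc: "continuous_on {0..T} z"
      and z: "\<forall>t\<in>{0..T}. ((\<lambda>s. (A + G) *v z s + g s) has_integral z t) {0..t}"
      and gb: "n2 (leb T) g \<le> Cq * n2p (udev i v)" and q: "0 \<le> quad i v g z"
      using Cq(2)[OF i1(1) conjunct2[OF adm_controls_L2[OF v]]] by (elim exE conjE) (rule that)
    let ?f = "\<lambda>s. indicator {0..T} s *\<^sub>R (\<gamma> *\<^sub>R P i s + g s)"
    have L: "L2 (leb T) (\<lambda>s. \<gamma> *\<^sub>R P i s + g s)" by (intro L2_add(1) L2_scaleR MP_L2(2)[OF i1(1)] g)
    note fF = indicator_L2fun(1)[OF L]
    have fL: "L2 (leb T) ?f" using fF L2_leb_iff_L2fun[of ?f T] by (simp add: L2fun_def)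
    obtain x where x: "deviation N i v ?f g z x"
      "Jdev N i v ?f = game_cost \<Gamma> \<eta> Q R H \<gamma> T \<Omega> N i ((uhat B R Y)(i := v)) ?f x"
      by (rule J_deviation[OF i v fL g _ zc z[rule_format]]) simp_all
    note C(2)[OF x(1), folded x(2)]
    moreover have "C * (eN N * (1 + n2p (udev i v)) * sqrt (1 + n2 (leb T) g)) \<le> C * (eN N * (1 + \<kappa>) * sqrt (1 + Cq * \<kappa>))"
    proof (rule mult_left_mono)
      have "Cq * n2p (udev i v) \<le> Cq * \<kappa>" using n Cq(1) by (intro mult_left_mono) auto
      then have "sqrt (1 + n2 (leb T) g) \<le> sqrt (1 + Cq * \<kappa>)" using gb by simp
      then show "eN N * (1 + n2p (udev i v)) * sqrt (1 + n2 (leb T) g) \<le> eN N * (1 + \<kappa>) * sqrt (1 + Cq * \<kappa>)"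
        using n eN_props(1)[OF i1(2)] \<kappa> by (intro mult_mono) auto
    qed (use C(1) in simp)
    moreover have "C * (eN N * (1 + \<kappa>) * sqrt (1 + Cq * \<kappa>)) = ?C * eN N" by (simp add: mult.assoc mult.left_commute mult.commute)
    ultimately have "Jlim i - ?C * eN N \<le> Jdev N i v ?f" using q by linarith
    with fF show ?thesis by blast
  qed
  have "?C > 0" using C(1) Cq(1) \<kappa> by (intro mult_pos_pos) (auto intro!: add_pos_nonneg)
  from this main show ?thesis by (rule that)
qed

text \<open>With f = 0 the disturbance penalty is absent and the state costs are nonnegative, so the
  control cost alone bounds J from below. In the deviation format this is g = -\<gamma> P_i, which
  provides the integrability needed to split the cost.\<close>

lemma J_coercive:
  obtains c where "c > 0"
    "\<And>N i v. i \<in> {1..N} \<Longrightarrow> v \<in> adm_controls \<Omega> W T N \<Longrightarrow> \<exists>f\<in>L2fun T. c * n2p v \<le> Jdev N i v f"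
proof -
  obtain c where c: "c > 0" "\<And>N f. L2 N f \<Longrightarrow> c * n2 N f \<le> (\<integral>x. qf R (f x) \<partial>(N :: (real \<times> 'w) measure))"
    using pd_L2_coercive[OF Rpd] by blast
  have main: "\<exists>f\<in>L2fun T. c * n2p v \<le> Jdev N i v f" if i: "i \<in> {1..N}" and v: "v \<in> adm_controls \<Omega> W T N" for N i v
  proof -
    have i1: "1 \<le> i" using i by auto
    have vL: "L2p v" using adm_controls_L2[OF v] by blast
    let ?f = "\<lambda>_. 0 :: real^'n"
    have fF: "?f \<in> L2fun T" by (simp add: L2fun_def)
    have gL: "L2 (leb T) (\<lambda>s. - (\<gamma> *\<^sub>R P i s))" by (intro L2_uminus L2_scaleR MP_L2(2)[OF i1])
    obtain z where z: "continuous_on {0..T} z"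
      "\<And>t. t \<in> {0..T} \<Longrightarrow> ((\<lambda>s. (A + G) *v z s + - (\<gamma> *\<^sub>R P i s)) has_integral z t) {0..t}"
      using shift_exists[OF gL] by blast
    obtain x where x: "deviation N i v ?f (\<lambda>s. - (\<gamma> *\<^sub>R P i s)) z x"
      "Jdev N i v ?f = game_cost \<Gamma> \<eta> Q R H \<gamma> T \<Omega> N i ((uhat B R Y)(i := v)) ?f x"
      by (rule J_deviation[OF i v L2_0 gL _ z]) simp_all
    have pa: "L2p (avg_err N i z x) \<and> L2p (own_err i v z x) \<and> L2 \<Omega> (own_err i v z x T)"
      apply (rule perturbation)
      subgoal premises prems for c using prems(2)[OF x(1)] by blast
      done
    note b = bdev_L2[OF i1 vL z(1)]
    have r: "L2p (rem_err N i v z x)"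
      unfolding rem_err_def using pa by (intro L2_diff(1) L2_linear'[OF lin(1)]) blast+
    have e: "L2p (\<lambda>t \<omega>. x i t \<omega> - (\<Gamma> *v mf_avg N (\<lambda>l. x l t \<omega>) + \<eta>))"
      unfolding deviation_split(1)[where v = v and z = z] by (rule L2_add(1)[OF L2_add(1)[OF adev_L2(1)[OF i1] b(1)] r])
    have xT: "L2 \<Omega> (x i T)" unfolding deviation_split(2)[where v = v and z = z and x = x and i = i]
      using pa by (intro L2_add(1)[OF L2_add(1)[OF XT_L2(1)[OF i1] b(3)]]) blast
    have vv: "L2p (((uhat B R Y)(i := v)) i)" using vL by simp
    have "0 \<le> (\<integral>p. qf Q (x i (fst p) (snd p) - (\<Gamma> *v mf_avg N (\<lambda>l. x l (fst p) (snd p)) + \<eta>)) \<partial>PP)"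
      "0 \<le> (\<integral>\<omega>. qf H (x i T \<omega>) \<partial>\<Omega>)"
      using Qpsd Hpsd by (auto simp: psd_def intro!: Bochner_Integration.integral_nonneg)
    moreover have "n2 (leb T) ?f = 0" by (simp add: n2_def)
    moreover have "c * n2p v \<le> (\<integral>p. qf R (((uhat B R Y)(i := v)) i (fst p) (snd p)) \<partial>PP)" using c(2)[OF vL] by simp
    ultimately have "c * n2p v \<le> Jdev N i v ?f"
      unfolding x(2) game_cost_eq[where u = "(uhat B R Y)(i := v)" and i = i and f = ?f and x = x and N = N, OF vv L2_0 e xT] by simp
    with fF show ?thesis by blast
  qed
  show ?thesis by (rule that[OF c(1) main])
qed

lemma robust_nash:
  "\<exists>C. \<forall>N\<ge>1. \<forall>i\<in>{1..N}.
     (let \<epsilon> = C * (1 / sqrt (real N) + norm (mf_avg N x0 - m0));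
          Jhat = J_wo A B G D \<Gamma> \<eta> Q R H \<gamma> T \<Omega> W x0 N i (uhat B R Y);
          Jinf = (INF v\<in>adm_controls \<Omega> W T N. J_wo A B G D \<Gamma> \<eta> Q R H \<gamma> T \<Omega> W x0 N i ((uhat B R Y)(i := v)))
      in 0 \<le> \<epsilon> \<and> Jhat - ereal \<epsilon> \<le> Jinf \<and> Jinf \<le> Jhat)"
proof -
  let ?wo = "\<lambda>N i u. J_wo A B G D \<Gamma> \<eta> Q R H \<gamma> T \<Omega> W x0 N i u"
  obtain Cu where Cu: "Cu > 0"
    "\<And>N i f. i \<in> {1..N} \<Longrightarrow> f \<in> L2fun T \<Longrightarrow> Jdev N i (uhat B R Y i) f \<le> Jlim i + Cu * eN N"
    by (fact J_uhat_upper)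
  obtain c where c: "c > 0"
    "\<And>N i v. i \<in> {1..N} \<Longrightarrow> v \<in> adm_controls \<Omega> W T N \<Longrightarrow> \<exists>f\<in>L2fun T. c * n2p v \<le> Jdev N i v f"
    by (fact J_coercive)
  obtain Ka where Ka: "Ka > 0" "\<And>i. 1 \<le> i \<Longrightarrow> n2p (adev i) \<le> Ka \<and> n2 \<Omega> (X i T) \<le> Ka \<and> n2p (\<lambda>t \<omega>. Fb (Y i t \<omega>)) \<le> Ka"
    using adev_bound by blast
  obtain KJ where KJ: "\<And>i. 1 \<le> i \<Longrightarrow> Jlim i \<le> KJ" using Jlim_bound by blast
  \<comment> \<open>K0 is nonnegative and dominates every \<open>Jlim i\<close>; the absolute value
    is taken because KJ may be negative. A control with c |v|^2 \<ge> K0 therefore already costs too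
    much at f = 0.\<close>
  define K0 where "K0 = \<bar>KJ\<bar> + Cu * (1 + M0 + norm m0)"
  have K0: "0 \<le> K0" unfolding K0_def using Cu(1) M0_nonneg by (intro add_nonneg_nonneg mult_nonneg_nonneg) auto
  \<comment> \<open>For the remaining controls |v|^2 \<le> K0/c, and the deviation v minus the own
    strategy has squared norm at most 2 K0/c + 2 Ka. This must be fixed beforehand, as the constant
    of the lower bound depends on it.\<close>
  define \<kappa> where "\<kappa> = 2 * (K0 / c) + 2 * Ka"
  have \<kappa>: "0 \<le> \<kappa>" using K0 c(1) Ka(1) by (simp add: \<kappa>_def)
  obtain Cl where Cl: "Cl > 0"
    "\<And>N i v. i \<in> {1..N} \<Longrightarrow> v \<in> adm_controls \<Omega> W T N \<Longrightarrow> n2p (udev i v) \<le> \<kappa> \<Longrightarrow>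
      \<exists>f\<in>L2fun T. Jlim i - Cl * eN N \<le> Jdev N i v f"
    by (fact J_deviation_lower[OF \<kappa>])
  have sup: "ereal r \<le> ?wo N i ((uhat B R Y)(i := v))" if "\<exists>f\<in>L2fun T. r \<le> Jdev N i v f" for r N i and v :: "real \<Rightarrow> 'w \<Rightarrow> real^'k"
  proof -
    obtain f where f: "f \<in> L2fun T" "r \<le> Jdev N i v f" using \<open>\<exists>f\<in>L2fun T. r \<le> Jdev N i v f\<close> by blast
    then show ?thesis unfolding J_wo_def by (intro SUP_upper2[OF f(1)]) simp
  qed
  have "0 \<le> (Cu + Cl) * eN N \<and> ?wo N i (uhat B R Y) - ereal ((Cu + Cl) * eN N)
      \<le> (INF v\<in>adm_controls \<Omega> W T N. ?wo N i ((uhat B R Y)(i := v))) \<and>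
      (INF v\<in>adm_controls \<Omega> W T N. ?wo N i ((uhat B R Y)(i := v))) \<le> ?wo N i (uhat B R Y)"
    if i: "i \<in> {1..N}" for N i
  proof (intro conjI)
    have i1: "1 \<le> i" "1 \<le> N" using i by auto
    note e = eN_props(1)[OF i1(2)] eN_props(5)[OF i1(2)]
    show "0 \<le> (Cu + Cl) * eN N" using Cu(1) Cl(1) e by simp
    \<comment> \<open>The player's own strategy is an admissible deviation, and updating the profile
      with it changes nothing.\<close>
    show "(INF v\<in>adm_controls \<Omega> W T N. ?wo N i ((uhat B R Y)(i := v))) \<le> ?wo N i (uhat B R Y)"
      using INF_lower[OF uhat_adm[OF i], of "\<lambda>v. ?wo N i ((uhat B R Y)(i := v))"] by simp
    have "?wo N i (uhat B R Y) \<le> ereal (Jlim i + Cu * eN N)"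
      unfolding J_wo_def using Cu(2)[OF i] by (intro SUP_least) simp
    then have "?wo N i (uhat B R Y) - ereal ((Cu + Cl) * eN N) \<le> ereal (Jlim i + Cu * eN N) - ereal ((Cu + Cl) * eN N)"
      by (intro ereal_minus_mono) auto
    also have "\<dots> = ereal (Jlim i - Cl * eN N)" by (simp add: distrib_right)
    also have "\<dots> \<le> (INF v\<in>adm_controls \<Omega> W T N. ?wo N i ((uhat B R Y)(i := v)))"
    proof (rule INF_greatest)
      fix v :: "real \<Rightarrow> 'w \<Rightarrow> real^'k"
      assume v: "v \<in> adm_controls \<Omega> W T N"
      have vL: "L2p v" using adm_controls_L2[OF v] by blast
      show "ereal (Jlim i - Cl * eN N) \<le> ?wo N i ((uhat B R Y)(i := v))"
      proof (cases "K0 \<le> c * n2p v")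
        case True
        have "0 \<le> Cl * eN N" "0 \<le> Cu * (1 + M0 + norm m0)" using Cl(1) Cu(1) e by (auto simp: less_imp_le order_trans[OF less_imp_le])
        then have le: "Jlim i - Cl * eN N \<le> c * n2p v" using True KJ[OF i1(1)] unfolding K0_def by linarith
        show ?thesis using c(2)[OF i v] le by (intro sup) (meson order_trans)
      next
        case False
        then have "n2p v \<le> K0 / c" using c(1) by (simp add: pos_le_divide_eq mult.commute)
        moreover have "n2p (udev i v) \<le> 2 * n2p v + 2 * n2p (\<lambda>t \<omega>. Fb (Y i t \<omega>))"
          unfolding udev_def by (rule L2_diff(2)[OF vL Fb_Y_L2[OF i1(1)]])
        moreover have "n2p (\<lambda>t \<omega>. Fb (Y i t \<omega>)) \<le> Ka" using Ka(2)[OF i1(1)] by blast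
        ultimately have "n2p (udev i v) \<le> \<kappa>" unfolding \<kappa>_def by linarith
        then show ?thesis by (intro sup Cl(2)[OF i v])
      qed
    qed
    finally show "?wo N i (uhat B R Y) - ereal ((Cu + Cl) * eN N)
      \<le> (INF v\<in>adm_controls \<Omega> W T N. ?wo N i ((uhat B R Y)(i := v)))" .
  qed
  then show ?thesis unfolding Let_def eN_def[symmetric] by blast
qed

end

theorem theorem22:
  fixes A G \<Gamma> Q H :: "real^'n^'n" and B :: "real^'k^'n" and D :: "real^'d^'n"
    and R :: "real^'k^'k" and \<eta> m0 :: "real^'n" and \<gamma> T M0 :: real
    and \<Omega> :: "'w measure" and W :: "nat \<Rightarrow> real \<Rightarrow> 'w \<Rightarrow> real^'d" and x0 :: "nat \<Rightarrow> real^'n"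
    and m p y :: "real \<Rightarrow> real^'n"
    and X Y :: "nat \<Rightarrow> real \<Rightarrow> 'w \<Rightarrow> real^'n" and M P :: "nat \<Rightarrow> real \<Rightarrow> real^'n"
  assumes T: "T > 0" and gam: "\<gamma> > 0"
    and Qpsd: "psd Q" and Hpsd: "psd H" and Rpd: "pd R"
    and prob: "prob_space \<Omega>" and BM: "brownian_family \<Omega> W"
    and hyp1: "H1 A G \<Gamma> Q H \<gamma> T" and hyp2: "H2 A B G \<Gamma> Q R H \<gamma> T"
    and init: "\<forall>i\<ge>1. norm (x0 i) \<le> M0"
    and mf: "MF_sol A B G \<Gamma> \<eta> Q R H \<gamma> T m0 m p y"
    and mf_unique: "\<forall>m' p' y'. MF_sol A B G \<Gamma> \<eta> Q R H \<gamma> T m0 m' p' y' \<longrightarrow>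
                       (\<forall>t\<in>{0..T}. m' t = m t \<and> p' t = p t \<and> y' t = y t)"
    and strat: "\<forall>i\<ge>1. FBSDE_sol A B G D \<Gamma> \<eta> Q R H \<gamma> T \<Omega> W x0 m0 y i (X i) (M i) (P i) (Y i)"
  shows "\<exists>C. \<forall>N\<ge>1. \<forall>i\<in>{1..N}.
     (let \<epsilon> = C * (1 / sqrt (real N) + norm (mf_avg N x0 - m0));
          Jhat = J_wo A B G D \<Gamma> \<eta> Q R H \<gamma> T \<Omega> W x0 N i (uhat B R Y);
          Jinf = (INF v\<in>adm_controls \<Omega> W T N. J_wo A B G D \<Gamma> \<eta> Q R H \<gamma> T \<Omega> W x0 N i ((uhat B R Y)(i := v)))
      in 0 \<le> \<epsilon> \<and> Jhat - ereal \<epsilon> \<le> Jinf \<and> Jinf \<le> Jhat)"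
proof -
  interpret prob_space \<Omega> by (rule prob)
  interpret lq_game \<Omega> T W A G \<Gamma> Q H B D R \<eta> m0 \<gamma> M0 x0 m p y X Y M P
    by unfold_locales (fact T BM gam Qpsd Hpsd Rpd hyp1 hyp2 init mf strat)+
  show ?thesis by (rule robust_nash)
qed

end
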